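(* Let $\xi_1,\xi_2,\xi_3,\xi_4\in\mathbb{S}^2$ be the vertices of a regular tetrahedron inscribed in the unit sphere $\mathbb{S}^2\subset\mathbb{R}^3$, and let $T_d\subset O(3,\mathbb{R})$ be its symmetry group. There exists $\epsilon_0>0$ small enough such that for each $\epsilon\in(0,\epsilon_0)$, with $\rho=32\pi+\epsilon$, there exist $\lambda=\lambda(\epsilon)>0$ and a solution $u_\lambda$ of $$\Delta_g u+\rho\left(\frac{e^u}{\int_{\mathbb{S}^2}e^u}-\frac{1}{4\pi}\right)=0\quad\text{on }\mathbb{S}^2$$ such that, as $\epsilon\to 0$, $$\epsilon=(384\pi+o(1))\,\lambda^2\ln\frac1\lambda,$$ $$u_\lambda(\xi_j)\to\infty\quad\text{for } j=1,2,3,4,$$ $$u_\lambda(x)\to-\infty\quad\text{for all }x\in\mathbb{S}^2\setminus\{\xi_1,\xi_2,\xi_3,\xi_4\}.$$ Moreover, $u_\lambda$ has tetrahedral symmetry, i.e. $u_\lambda(y)=u_\lambda(Ty)$ for all $T\in T_d$ and all $y\in\mathbb{S}^2$, and $$\frac{\rho}{\int_{\mathbb{S}^2}e^{u_\lambda}}\,e^{u_\lambda}\to 8\pi\sum_{j=1}^4\delta_{\xi_j}\quad\text{in the sense of measures, as }\epsilon\to0.$$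
   Context: $\Delta_g$ is the Laplace–Beltrami operator on the unit sphere $\mathbb{S}^2\subset\mathbb{R}^3$ with the metric $g$ induced by the Euclidean metric; integrals are with respect to the area measure. $T_d$ is the full group of symmetries (including reflections) of the regular tetrahedron with vertices $\xi_1,\dots,\xi_4$, a subgroup of order $24$ of $O(3,\mathbb{R})$ isomorphic to $S_4$. $\delta_\xi$ is the Dirac mass at $\xi$. *)

theory Defs
  imports "HOL-Probability.Probability"
begin

definition pderiv_at :: "'n \<Rightarrow> (real^'n \<Rightarrow> 'b::real_normed_vector) \<Rightarrow> real^'n \<Rightarrow> 'b" where
  "pderiv_at i f y = frechet_derivative f (at y) (axis i 1)"

primrec C_class :: "nat \<Rightarrow> (real^'n \<Rightarrow> real) \<Rightarrow> bool" where
  "C_class 0 f \<longleftrightarrow> continuous_on UNIV f"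
| "C_class (Suc k) f \<longleftrightarrow> (\<forall>y. f differentiable (at y)) \<and> (\<forall>i. C_class k (pderiv_at i f))"

text \<open>In what follows \<open>\<phi>\<close> is a local parametrization of a submanifold of Euclidean space.
  The matrix below is the first fundamental form, that is, the metric induced by the Euclidean
  inner product, in the coordinates given by \<open>\<phi>\<close>.\<close>

definition induced_metric :: "(real^'m \<Rightarrow> real^'n) \<Rightarrow> real^'m \<Rightarrow> real^'m^'m" where
  "induced_metric \<phi> y = (\<chi> i j. pderiv_at i \<phi> y \<bullet> pderiv_at j \<phi> y)"

definition volume_density :: "(real^'m \<Rightarrow> real^'n) \<Rightarrow> real^'m \<Rightarrow> real" where
  "volume_density \<phi> y = sqrt (det (induced_metric \<phi> y))"

text \<open>The coordinate formula
  \<open>(1 / sqrt (det g)) * (\<Sum>i j. \<partial>\<^sub>i (sqrt (det g) * g\<^sup>i\<^sup>j * \<partial>\<^sub>j (u \<circ> \<phi>)))\<close>.\<close>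

definition laplace_beltrami_coord ::
    "(real^'m \<Rightarrow> real^'n) \<Rightarrow> (real^'n \<Rightarrow> real) \<Rightarrow> real^'m \<Rightarrow> real" where
  "laplace_beltrami_coord \<phi> u y =
     (1 / volume_density \<phi> y) *
     (\<Sum>i\<in>UNIV. pderiv_at i
        (\<lambda>z. \<Sum>j\<in>UNIV. volume_density \<phi> z * matrix_inv (induced_metric \<phi> z) $ i $ j
                       * pderiv_at j (u \<circ> \<phi>) z) y)"

text \<open>Functions on the sphere are represented by functions on the whole space \<open>real^3\<close>; no notion
  below depends on their values off the sphere.\<close>

abbreviation S2 :: "(real^3) set" where
  "S2 \<equiv> sphere 0 1"

text \<open>For \<open>s = 1\<close> (\<open>s = -1\<close>), the inverse stereographic projection from the north (south) pole
  \<open>(0, 0, s)\<close>, which parametrizes the sphere without that pole, and the stereographic projection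
  itself.\<close>

definition stereo_param :: "real \<Rightarrow> real^2 \<Rightarrow> real^3" where
  "stereo_param s y =
     (1 / (1 + (norm y)\<^sup>2)) *\<^sub>R vector [2 * y$1, 2 * y$2, s * ((norm y)\<^sup>2 - 1)]"

definition stereo_proj :: "real \<Rightarrow> real^3 \<Rightarrow> real^2" where
  "stereo_proj s x = (1 / (1 - s * x$3)) *\<^sub>R vector [x$1, x$2]"

definition C2_on_sphere :: "(real^3 \<Rightarrow> real) \<Rightarrow> bool" where
  "C2_on_sphere u \<longleftrightarrow> (\<forall>s\<in>{1, -1}. C_class 2 (u \<circ> stereo_param s))"

text \<open>The Laplace--Beltrami operator does not depend on the coordinates, so any choice of a chart
  around the given point is admissible.\<close>

definition laplace_beltrami :: "(real^3 \<Rightarrow> real) \<Rightarrow> real^3 \<Rightarrow> real" where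
  "laplace_beltrami u x =
     (let s = (if x$3 \<le> 0 then 1 else -1)
      in laplace_beltrami_coord (stereo_param s) u (stereo_proj s x))"

text \<open>The Riemannian measure \<open>sqrt (det g) dy\<close>; the one point not covered by the chart
  is a null set.\<close>

definition area_measure :: "(real^3) measure" where
  "area_measure =
     distr (density lborel (\<lambda>y. ennreal (volume_density (stereo_param 1) y)))
           (restrict_space borel S2) (stereo_param 1)"

definition mean_field_solution :: "real \<Rightarrow> (real^3 \<Rightarrow> real) \<Rightarrow> bool" where
  "mean_field_solution \<rho> u \<longleftrightarrow>
     C2_on_sphere u \<and>
     (\<forall>x\<in>S2. laplace_beltrami u x
             + \<rho> * (exp (u x) / (\<integral>y. exp (u y) \<partial>area_measure) - 1 / (4 * pi)) = 0)"

definition mean_field_measure :: "real \<Rightarrow> (real^3 \<Rightarrow> real) \<Rightarrow> (real^3) measure" where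
  "mean_field_measure \<rho> u =
     density area_measure
       (\<lambda>x. ennreal (\<rho> / (\<integral>y. exp (u y) \<partial>area_measure) * exp (u x)))"

text \<open>Four distinct, pairwise equidistant points of \<open>\<real>\<^sup>3\<close> are the vertices of a regular tetrahedron.\<close>

definition inscribed_regular_tetrahedron :: "(4 \<Rightarrow> real^3) \<Rightarrow> bool" where
  "inscribed_regular_tetrahedron \<xi> \<longleftrightarrow>
     (\<forall>j. \<xi> j \<in> S2) \<and> (\<exists>l>0. \<forall>i j. i \<noteq> j \<longrightarrow> dist (\<xi> i) (\<xi> j) = l)"

definition tetrahedral_group :: "(4 \<Rightarrow> real^3) \<Rightarrow> (real^3 \<Rightarrow> real^3) set" where
  "tetrahedral_group \<xi> =
     {T. orthogonal_transformation T \<and>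
         T ` (convex hull (range \<xi>)) = convex hull (range \<xi>)}"

text \<open>The measure \<open>c * (\<Sum>j. \<delta>\<^bsub>\<xi> j\<^esub>)\<close>, where \<open>return S x\<close> is the Dirac mass at \<open>x\<close>.\<close>

definition dirac_sum :: "real \<Rightarrow> ('i::finite \<Rightarrow> real^3) \<Rightarrow> (real^3) measure" where
  "dirac_sum c \<xi> =
     (let S = restrict_space borel S2
      in measure_of (space S) (sets S)
           (\<lambda>A. ennreal c * (\<Sum>j\<in>UNIV. emeasure (return S (\<xi> j)) A)))"

definition measures_tendsto ::
    "('a \<Rightarrow> (real^3) measure) \<Rightarrow> (real^3) measure \<Rightarrow> 'a filter \<Rightarrow> bool" where
  "measures_tendsto \<mu> \<nu> F \<longleftrightarrow>
     (\<forall>f::real^3 \<Rightarrow> real. continuous_on S2 f \<longrightarrow>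
        ((\<lambda>a. \<integral>x. f x \<partial>\<mu> a) \<longlongrightarrow> (\<integral>x. f x \<partial>\<nu>)) F)"

end

theory Submission
  imports Defs "HOL-Real_Asymp.Real_Asymp"
begin

text \<open>The four bubbles are glued exactly: \<open>exp u\<close> is a sum of four conformal factors
  concentrated at the vertices, multiplied by a symmetric function that equals 1 at the vertices
  and by a symmetric correction \<open>exp \<phi>\<close>. The equation is used in integral form, with the kernel
  \<open>ln (1 - x \<bullet> y)\<close>. After the conformal map that blows up the first vertex at scale \<open>s\<close> it
  becomes a fixed point equation for one function \<open>\<chi>\<close>, whose linear part is \<open>\<Delta> + 2\<close>.
  The kernel of \<open>\<Delta> + 2\<close> consists of the linear functions: the stabilizer of the vertex excludes those
  orthogonal to it, and a multiplier \<open>\<mu> s\<close> deals with the remaining one. The multiplier need not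
  vanish, because the term that it multiplies is the blown-up uniform density, so it only changes
  the total mass: each \<open>s\<close> gives a solution for \<open>\<rho> = 32 \<pi> + 8 \<mu> s\<close>. Finally \<open>\<mu>\<close> is continuous, tends to 0
  and is positive, since the symmetric factor has a strict minimum at the vertex
  and its quadratic growth there contributes a positive multiple of \<open>s\<^sup>2 ln (1/s)\<close>.\<close>

text \<open>The obstacle is the interaction of the bubbles. In blown-up coordinates everything that
  happens far from the first vertex is seen near - \<xi> 1, and there neither the symmetric factor
  minus 1 nor the influence of the other bubbles is small. Both are small against the weight (1 + x
  \<bullet> \<xi> 1) powr (-5/8). The exponent has to exceed 1/2, so that the symmetric factor
  contributes o(s) and the multiplier term, of weighted size s powr (-3/4), loses less than the
  factor s that its coefficient gains; it has to stay below 3/4, because the logarithmic kernel is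
  bounded by the power -1/4 and only powers above -1 are integrable. The influence of another bubble
  gains its factor s from the modulus of continuity alone, hence the 1/2-Hoelder norm. No elliptic
  theory is invoked: under conformal maps 1 - x \<bullet> y is multiplied by conformal factors,
  which makes the potentials of bubbles explicit, and only the final solution is differentiated, in
  the plane.\<close>

abbreviation area :: "(real^3) measure" where
  "area \<equiv> area_measure"

section \<open>Stereographic coordinates and the area measure\<close>

lemma norm_sq_2: "(norm (y::real^2))\<^sup>2 = (y$1)\<^sup>2 + (y$2)\<^sup>2"
  unfolding power2_norm_eq_inner by (simp add: inner_vec_def sum_2 power2_eq_square)

lemma norm_sq_3: "(norm (y::real^3))\<^sup>2 = (y$1)\<^sup>2 + (y$2)\<^sup>2 + (y$3)\<^sup>2"
  unfolding power2_norm_eq_inner by (simp add: inner_vec_def sum_3 power2_eq_square)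

lemma stereo_param_nth:
  "stereo_param s y $ 1 = 2 * y$1 / (1 + (norm y)\<^sup>2)"
  "stereo_param s y $ 2 = 2 * y$2 / (1 + (norm y)\<^sup>2)"
  "stereo_param s y $ 3 = s * ((norm y)\<^sup>2 - 1) / (1 + (norm y)\<^sup>2)"
  by (simp_all add: stereo_param_def)

lemma one_plus_norm_sq_pos [simp]: "1 + (norm y)\<^sup>2 > (0::real)"
  by (simp add: add_pos_nonneg)

lemma one_plus_norm_sq_nz [simp]: "1 + (norm y)\<^sup>2 \<noteq> (0::real)"
  using one_plus_norm_sq_pos[of y] by linarith

text \<open>The chordal distance formula. It replaces differentiation: the metric of the chart and
  the Jacobians of conformal maps are read off from exact formulas for distances between two
  points.\<close>

lemma norm_stereo_diff:
  assumes "s\<^sup>2 = 1"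
  shows "(norm (stereo_param s y - stereo_param s z))\<^sup>2
    = 4 * (norm (y - z))\<^sup>2 / ((1 + (norm y)\<^sup>2) * (1 + (norm z)\<^sup>2))"
proof -
  have key: "(2*y1/p - 2*z1/q)\<^sup>2 + (2*y2/p - 2*z2/q)\<^sup>2 + (s*(p-2)/p - s*(q-2)/q)\<^sup>2
      = 4 * ((y1-z1)\<^sup>2 + (y2-z2)\<^sup>2) / (p*q)"
    if "p > 0" "q > 0" "p = 1 + (y1\<^sup>2+y2\<^sup>2)" "q = 1 + (z1\<^sup>2+z2\<^sup>2)" for y1 y2 z1 z2 p q :: real
  proof -
    have "(2*y1/p - 2*z1/q)\<^sup>2 + (2*y2/p - 2*z2/q)\<^sup>2 + (s*(p-2)/p - s*(q-2)/q)\<^sup>2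
       = ((2*y1*q - 2*z1*p)\<^sup>2 + (2*y2*q - 2*z2*p)\<^sup>2 + s\<^sup>2 * (2*p - 2*q)\<^sup>2) / (p*q)\<^sup>2"
      using that(1,2) by (simp add: field_simps power2_eq_square)
    also have "(2*y1*q - 2*z1*p)\<^sup>2 + (2*y2*q - 2*z2*p)\<^sup>2 + s\<^sup>2 * (2*p - 2*q)\<^sup>2
       = 4 * ((y1-z1)\<^sup>2 + (y2-z2)\<^sup>2) * (p*q)"
      unfolding assms using that(3,4) by algebra
    finally show ?thesis using that(1,2) by (simp add: power2_eq_square)
  qed
  have e: "s * ((norm x)\<^sup>2 - 1) = s * ((1 + (norm x)\<^sup>2) - 2)" for x :: "real^2" by simp
  show ?thesis
    unfolding norm_sq_3 vector_minus_component stereo_param_nth e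
    unfolding norm_sq_2[of "y - z"] vector_minus_component
    by (rule key) (simp_all add: norm_sq_2 add_pos_nonneg)
qed

lemma stereo_param_in_S2 [simp]: "s\<^sup>2 = 1 \<Longrightarrow> norm (stereo_param s y) = 1"
proof -
  assume s: "s\<^sup>2 = 1"
  have key: "(2*y1/p)\<^sup>2 + (2*y2/p)\<^sup>2 + (s*(p-2)/p)\<^sup>2 = 1"
    if "p > 0" "p = 1 + (y1\<^sup>2+y2\<^sup>2)" for y1 y2 p :: real
  proof -
    have "(2*y1/p)\<^sup>2 + (2*y2/p)\<^sup>2 + (s*(p-2)/p)\<^sup>2 = ((2*y1)\<^sup>2 + (2*y2)\<^sup>2 + s\<^sup>2*(p-2)\<^sup>2)/p\<^sup>2"
      using that(1) by (simp add: field_simps power2_eq_square)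
    also have "(2*y1)\<^sup>2 + (2*y2)\<^sup>2 + s\<^sup>2*(p-2)\<^sup>2 = p\<^sup>2" unfolding s using that(2) by algebra
    finally show ?thesis using that(1) by simp
  qed
  have e: "s * ((norm x)\<^sup>2 - 1) = s * ((1 + (norm x)\<^sup>2) - 2)" for x :: "real^2" by simp
  have "(norm (stereo_param s y))\<^sup>2 = 1"
    unfolding norm_sq_3 stereo_param_nth e
    by (rule key) (simp_all add: norm_sq_2 add_pos_nonneg)
  then show ?thesis by (metis norm_ge_zero power2_eq_imp_eq power_one zero_le_one)
qed

lemma stereo_proj_param [simp]: "s\<^sup>2 = 1 \<Longrightarrow> stereo_proj s (stereo_param s y) = y"
proof -
  assume s: "s\<^sup>2 = 1"
  have "s * (stereo_param s y $ 3) = s\<^sup>2 * ((norm y)\<^sup>2 - 1) / (1 + (norm y)\<^sup>2)"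
    unfolding stereo_param_nth by (simp add: power2_eq_square)
  then have "1 - s * (stereo_param s y $ 3) = 2 / (1 + (norm y)\<^sup>2)"
    unfolding s by (simp add: field_simps)
  then show ?thesis
    unfolding stereo_proj_def
    by (simp add: vec_eq_iff forall_2 stereo_param_nth)
qed

lemma stereo_param_proj:
  assumes s: "s\<^sup>2 = 1" and x: "norm x = 1" "s * x$3 \<noteq> 1"
  shows "stereo_param s (stereo_proj s x) = x"
proof -
  have n: "(x$1)\<^sup>2 + (x$2)\<^sup>2 + (x$3)\<^sup>2 = 1" using x norm_sq_3[of x] by simp
  define d where "d = 1 - s * x$3"
  have d: "d \<noteq> 0" using x d_def by simp
  have p: "stereo_proj s x $ 1 = x$1 / d" "stereo_proj s x $ 2 = x$2 / d"
    by (simp_all add: stereo_proj_def d_def)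
  have sq: "(norm (stereo_proj s x))\<^sup>2 = ((x$1)\<^sup>2 + (x$2)\<^sup>2) / d\<^sup>2"
    unfolding norm_sq_2 p by (simp add: power_divide add_divide_distrib)
  have e: "1 + ((x$1)\<^sup>2 + (x$2)\<^sup>2) / d\<^sup>2 = 2 / d"
  proof -
    have "d\<^sup>2 + ((x$1)\<^sup>2 + (x$2)\<^sup>2) = 2 * d" using n s unfolding d_def by algebra
    then show ?thesis using d by (simp add: field_simps power2_eq_square)
  qed
  have e2: "((x$1)\<^sup>2 + (x$2)\<^sup>2) / d\<^sup>2 = 2 / d - 1" using e by simp
  have e3: "s * (2 - 2 * d) = 2 * x$3" using s unfolding d_def by algebra
  have "s * (2 / d - 1 - 1) / (1 + (2 / d - 1)) = s * (2 - 2 * d) / 2"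
    using d by (simp add: field_simps)
  then have e4: "s * (2 / d - 1 - 1) / (1 + (2 / d - 1)) = x$3" using e3 by simp
  show ?thesis
    unfolding vec_eq_iff forall_3 stereo_param_nth sq e2 p
  proof (intro conjI e4)
    show "2 * (x $ 1 / d) / (1 + (2 / d - 1)) = x $ 1" "2 * (x $ 2 / d) / (1 + (2 / d - 1)) = x $ 2"
      using d by simp_all
  qed
qed

lemma stereo_proj_inj:
  "s\<^sup>2 = 1 \<Longrightarrow> stereo_param s y = stereo_param s z \<Longrightarrow> y = z"
  by (metis stereo_proj_param)

lemma stereo_third: "stereo_param s y $ 3 = s * (1 - 2 / (1 + (norm y)\<^sup>2))"
  by (simp add: stereo_param_nth field_simps)

lemma stereo_ne_pole: "s\<^sup>2 = 1 \<Longrightarrow> s * (stereo_param s y $ 3) \<noteq> 1"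
proof -
  assume s: "s\<^sup>2 = 1"
  have "s * (stereo_param s y $ 3) = 1 - 2 / (1 + (norm y)\<^sup>2)"
    unfolding stereo_third using s by (simp add: power2_eq_square mult.assoc[symmetric])
  then show ?thesis by simp
qed

lemma differentiable_nth: "(\<lambda>y::real^'n. y $ k) differentiable (at y)"
  by (rule bounded_linear_imp_differentiable) (rule bounded_linear_vec_nth)

lemma differentiable_one_plus_norm_sq: "(\<lambda>y::real^2. 1 + (norm y)\<^sup>2) differentiable (at y)"
proof -
  have "(\<lambda>y::real^2. 1 + (norm y)\<^sup>2) = (\<lambda>y. 1 + ((y$1)*(y$1) + (y$2)*(y$2)))"
    using norm_sq_2 by (simp add: fun_eq_iff flip: power2_eq_square)
  moreover have "(\<lambda>y::real^2. 1 + ((y$1)*(y$1) + (y$2)*(y$2))) differentiable (at y)"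
    by (intro differentiable_add differentiable_mult differentiable_const differentiable_nth)
  ultimately show ?thesis by (simp only:)
qed

lemma stereo_differentiable:
  "stereo_param s differentiable (at y)"
proof -
  note ds = differentiable_divide differentiable_mult differentiable_diff differentiable_const
    differentiable_nth differentiable_one_plus_norm_sq
  have 1: "(\<lambda>y. 2 * y$1 / (1 + (norm (y::real^2))\<^sup>2)) differentiable (at y)"
    by (intro ds) (rule one_plus_norm_sq_nz)
  have 2: "(\<lambda>y. 2 * y$2 / (1 + (norm (y::real^2))\<^sup>2)) differentiable (at y)"
    by (intro ds) (rule one_plus_norm_sq_nz)
  have 3: "(\<lambda>y. s * (1 - 2 / (1 + (norm (y::real^2))\<^sup>2))) differentiable (at y)"
    by (intro ds) (rule one_plus_norm_sq_nz)
  have "\<forall>i. (\<lambda>y. stereo_param s y $ i) differentiable (at y)"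
    using 1 2 3 by (simp only: forall_3 stereo_param_nth(1,2) stereo_third simp_thms)
  then show ?thesis
    by (subst differentiable_componentwise_within) (auto simp: Basis_vec_def inner_axis)
qed

lemma continuous_stereo [continuous_intros]: "continuous_on A (stereo_param s)"
  by (rule continuous_at_imp_continuous_on, rule ballI, rule differentiable_imp_continuous_within, rule stereo_differentiable)

text \<open>A derivative is the limit of difference quotients along lines, so the exact dilation
  formula gives \<open>norm (g' h) = k y * norm h\<close>; polarization turns this into inner
  products. The factor \<open>k z\<close> involves both points, but only its value at
  \<open>y\<close> survives in the limit.\<close>

lemma conformal_deriv_inner:
  fixes g :: "'a::euclidean_space \<Rightarrow> 'b::euclidean_space"
  assumes d: "(g has_derivative g') (at y)" and S: "open S" "y \<in> S"
    and e: "\<And>z. z \<in> S \<Longrightarrow> norm (g z - g y) = k z * norm (z - y)"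
    and k: "isCont k y" and k0: "k y \<ge> 0"
  shows "g' u \<bullet> g' v = (k y)\<^sup>2 * (u \<bullet> v)"
proof -
  have lin: "linear g'" using d has_derivative_linear by blast
  have n: "norm (g' h) = k y * norm h" for h
  proof -
    have l0: "((\<lambda>t::real. y + t *\<^sub>R h) \<longlongrightarrow> y) (at 0)"
      by (auto intro!: tendsto_eq_intros)
    have "((\<lambda>t. (g (y + t *\<^sub>R h) - g y) /\<^sub>R t) \<longlongrightarrow> g' h) (at 0)"
    proof -
      have "((\<lambda>t. g (y + t *\<^sub>R h)) has_derivative (\<lambda>t. g' (t *\<^sub>R h))) (at 0)"
        by (rule has_derivative_compose[where f="\<lambda>t. y + t *\<^sub>R h" and g=g, simplified])
           (auto intro!: derivative_eq_intros d)
      then have "((\<lambda>t. g (y + t *\<^sub>R h)) has_vector_derivative g' h) (at 0)"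
      by (simp add: has_vector_derivative_def linear_scale[OF lin])
    then have "((\<lambda>t. norm (g (y + t *\<^sub>R h) - g y - t *\<^sub>R g' h) / norm t) \<longlongrightarrow> 0) (at 0)"
      unfolding has_vector_derivative_def has_derivative_at by simp
    moreover have "\<forall>\<^sub>F t in at 0. norm (g (y + t *\<^sub>R h) - g y - t *\<^sub>R g' h) / norm t
        = norm ((g (y + t *\<^sub>R h) - g y) /\<^sub>R t - g' h)"
      unfolding eventually_at_filter
    proof (intro always_eventually allI impI)
      fix t :: real assume t: "t \<noteq> 0"
      have "(g (y + t *\<^sub>R h) - g y) /\<^sub>R t - g' h = (g (y + t *\<^sub>R h) - g y - t *\<^sub>R g' h) /\<^sub>R t"
        using t by (simp add: scaleR_diff_right)
      then show "norm (g (y + t *\<^sub>R h) - g y - t *\<^sub>R g' h) / norm t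
        = norm ((g (y + t *\<^sub>R h) - g y) /\<^sub>R t - g' h)" by (simp only: norm_scaleR abs_inverse divide_inverse real_norm_def mult.commute)
    qed
    ultimately have "((\<lambda>t. norm ((g (y + t *\<^sub>R h) - g y) /\<^sub>R t - g' h)) \<longlongrightarrow> 0) (at 0)"
      by (rule Lim_transform_eventually)
    then show ?thesis by (simp add: tendsto_norm_zero_iff LIM_zero_iff)
    qed
    then have "((\<lambda>t. norm ((g (y + t *\<^sub>R h) - g y) /\<^sub>R t)) \<longlongrightarrow> norm (g' h)) (at 0)"
      by (rule tendsto_norm)
    moreover have "\<forall>\<^sub>F t in at 0. norm ((g (y + t *\<^sub>R h) - g y) /\<^sub>R t) = k (y + t *\<^sub>R h) * norm h"
    proof -
      have "\<forall>\<^sub>F t in at (0::real). y + t *\<^sub>R h \<in> S"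
        using l0 S by (rule topological_tendstoD)
      moreover have "\<forall>\<^sub>F t in at (0::real). t \<noteq> 0" by (simp add: eventually_at_filter)
      ultimately show ?thesis
      proof eventually_elim
        case (elim t)
        then show ?case by (simp add: e divide_simps)
      qed
    qed
    ultimately have "((\<lambda>t. k (y + t *\<^sub>R h) * norm h) \<longlongrightarrow> norm (g' h)) (at 0)"
      by (rule Lim_transform_eventually)
    moreover have "((\<lambda>t. k (y + t *\<^sub>R h) * norm h) \<longlongrightarrow> k y * norm h) (at 0)"
      by (rule tendsto_mult[OF isCont_tendsto_compose[OF k l0] tendsto_const])
    ultimately show ?thesis by (rule tendsto_unique[rotated]) simp
  qed
  have sq: "g' h \<bullet> g' h = (k y)\<^sup>2 * (h \<bullet> h)" for h
    using n[of h] by (simp add: power2_norm_eq_inner[symmetric] power_mult_distrib)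
  have "g' (u+v) \<bullet> g' (u+v) = (k y)\<^sup>2 * ((u+v) \<bullet> (u+v))" by (rule sq)
  then show ?thesis using sq[of u] sq[of v]
    by (simp add: linear_add[OF lin] inner_add inner_commute algebra_simps)
qed

text \<open>By Lagrange's identity the squared determinant is the Gram determinant of the two
  columns, which is c * c - 0.\<close>

lemma conformal_det:
  fixes g' :: "real^2 \<Rightarrow> real^2"
  assumes "linear g'" and "\<And>u v. g' u \<bullet> g' v = c * (u \<bullet> v)" "c \<ge> 0"
  shows "\<bar>det (matrix g')\<bar> = c"
proof -
  have lagrange: "(a * d - b * c')\<^sup>2 = (a * a + c' * c') * (b * b + d * d) - (a * b + c' * d)\<^sup>2" for a b c' d :: real
    by (simp add: power2_eq_square algebra_simps)
  define u where "u = g' (axis 1 1)"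
  define v where "v = g' (axis 2 1)"
  have uu: "u \<bullet> u = c" "v \<bullet> v = c" "u \<bullet> v = 0"
    unfolding u_def v_def assms(2) by (simp_all add: inner_axis_axis)
  have "det (matrix g') = u$1 * v$2 - v$1 * u$2"
    by (simp add: det_2 matrix_def u_def v_def)
  then have "(det (matrix g'))\<^sup>2 = (u$1 * u$1 + u$2 * u$2) * (v$1 * v$1 + v$2 * v$2) - (u$1 * v$1 + u$2 * v$2)\<^sup>2"
    using lagrange[of "u$1" "v$2" "v$1" "u$2"] by (simp only:)
  then have "(det (matrix g'))\<^sup>2 = (u \<bullet> u) * (v \<bullet> v) - (u \<bullet> v)\<^sup>2"
    by (simp only: inner_vec_def sum_2 inner_real_def)
  then have "\<bar>det (matrix g')\<bar>\<^sup>2 = c\<^sup>2" unfolding uu power2_abs by (simp add: power2_eq_square)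
  then show ?thesis using assms(3) power2_eq_imp_eq abs_ge_zero by blast
qed

lemma norm_stereo_diff':
  assumes "s\<^sup>2 = 1"
  shows "norm (stereo_param s y - stereo_param s z)
    = 2 * norm (y - z) / (sqrt (1 + (norm y)\<^sup>2) * sqrt (1 + (norm z)\<^sup>2))"
proof -
  have "norm (stereo_param s y - stereo_param s z) = sqrt ((norm (stereo_param s y - stereo_param s z))\<^sup>2)"
    by simp
  also have "\<dots> = sqrt (4 * (norm (y - z))\<^sup>2 / ((1 + (norm y)\<^sup>2) * (1 + (norm z)\<^sup>2)))"
    unfolding norm_stereo_diff[OF assms] ..
  also have "\<dots> = 2 * norm (y - z) / (sqrt (1 + (norm y)\<^sup>2) * sqrt (1 + (norm z)\<^sup>2))"
    by (simp add: real_sqrt_divide real_sqrt_mult)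
  finally show ?thesis .
qed

lemma induced_metric_stereo:
  assumes "s\<^sup>2 = 1"
  shows "induced_metric (stereo_param s) y $ i $ j = (if i = j then 4 / (1 + (norm y)\<^sup>2)\<^sup>2 else 0)"
proof -
  let ?D = "frechet_derivative (stereo_param s) (at y)"
  let ?k = "\<lambda>z. 2 / (sqrt (1 + (norm z)\<^sup>2) * sqrt (1 + (norm y)\<^sup>2))"
  have d: "(stereo_param s has_derivative ?D) (at y)"
    using stereo_differentiable frechet_derivative_works by blast
  have "?D u \<bullet> ?D v = (?k y)\<^sup>2 * (u \<bullet> v)" for u v
  proof (rule conformal_deriv_inner[OF d, where S=UNIV and k="?k"])
    show "isCont ?k y"
      by (intro continuous_intros) (simp_all add: real_sqrt_eq_zero_cancel_iff)
    show "norm (stereo_param s z - stereo_param s y) = ?k z * norm (z - y)" for z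
      unfolding norm_stereo_diff'[OF assms] by simp
    show "0 \<le> ?k y" by simp
  qed simp_all
  moreover have "(?k y)\<^sup>2 = 4 / (1 + (norm y)\<^sup>2)\<^sup>2"
    by (simp add: power_divide)
  ultimately show ?thesis
    by (simp add: induced_metric_def pderiv_at_def inner_axis_axis)
qed

lemma volume_density_stereo:
  assumes "s\<^sup>2 = 1"
  shows "volume_density (stereo_param s) y = 4 / (1 + (norm y)\<^sup>2)\<^sup>2"
proof -
  define c where "c = 4 / (1 + (norm y)\<^sup>2)\<^sup>2"
  have "c \<ge> 0" by (simp add: c_def)
  then show ?thesis
    unfolding volume_density_def det_2 induced_metric_stereo[OF assms] c_def[symmetric] by simp
qed

section \<open>Integration over the sphere in the stereographic chart\<close>

lemma sets_area [measurable_cong, simp]: "sets area = sets (restrict_space borel S2)"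
  by (simp add: area_measure_def)

lemma space_area [simp]: "space area = S2"
  by (simp add: area_measure_def space_restrict_space)

lemma measurable_stereo [measurable]: "stereo_param s \<in> borel_measurable borel"
  by (intro borel_measurable_continuous_onI continuous_stereo)

lemma measurable_stereo_S2: "s\<^sup>2 = 1 \<Longrightarrow> stereo_param s \<in> borel \<rightarrow>\<^sub>M restrict_space borel S2"
  by (intro measurable_restrict_space2) auto

lemma measurable_stereo_1 [measurable]: "stereo_param 1 \<in> borel \<rightarrow>\<^sub>M restrict_space borel S2"
  by (rule measurable_stereo_S2) simp

lemma measurable_areaI:
  "continuous_on S2 f \<Longrightarrow> f \<in> borel_measurable (restrict_space borel S2)"
  for f :: "real^3 \<Rightarrow> 'b::topological_space"
  by (rule borel_measurable_continuous_on_restrict)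

definition conf :: "real^2 \<Rightarrow> real" where
  "conf y = 4 / (1 + (norm y)\<^sup>2)\<^sup>2"

lemma conf_pos: "conf y > 0"
  by (simp add: conf_def)

lemma conf_measurable [measurable]: "conf \<in> borel_measurable borel"
  unfolding conf_def by measurable

lemma area_measure_eq:
  "area = distr (density lborel (\<lambda>y. ennreal (conf y))) (restrict_space borel S2) (stereo_param 1)"
proof -
  have "volume_density (stereo_param 1) = conf"
    by (rule ext) (simp only: conf_def volume_density_stereo one_power2)
  then show ?thesis by (simp only: area_measure_def)
qed

lemma nn_integral_area:
  assumes "f \<in> borel_measurable (restrict_space borel S2)"
  shows "(\<integral>\<^sup>+x. f x \<partial>area) = (\<integral>\<^sup>+y. ennreal (conf y) * f (stereo_param 1 y) \<partial>lborel)"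
proof -
  have 1: "(\<lambda>y. f (stereo_param 1 y)) \<in> borel_measurable borel"
    by (rule measurable_compose[OF measurable_stereo_1 assms])
  have "(\<integral>\<^sup>+x. f x \<partial>area)
      = (\<integral>\<^sup>+y. f (stereo_param 1 y) \<partial>density lborel (\<lambda>y. ennreal (conf y)))"
    unfolding area_measure_eq using assms by (intro nn_integral_distr) simp_all
  also have "\<dots> = (\<integral>\<^sup>+y. ennreal (conf y) * f (stereo_param 1 y) \<partial>lborel)"
    using 1 by (intro nn_integral_density) simp_all
  finally show ?thesis .
qed

text \<open>A disc of squared radius r has area pi * r, so the squared norm, unlike the norm, has
  constant density on the half-line.\<close>

lemma distr_norm_sq_plane:
  "distr lborel borel (\<lambda>y::real^2. (norm y)\<^sup>2) = density lborel (\<lambda>v. ennreal pi * indicator {0..} v)"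
    (is "?M = ?N")
proof (rule measure_eqI_generator_eq[where \<Omega>=UNIV and E="range (\<lambda>a::real. {..a})" and A="\<lambda>n. {..real n}"])
  have M: "emeasure ?M {..r} = ennreal (pi * max 0 r)" for r
  proof -
    have "emeasure ?M {..r} = emeasure lborel ((\<lambda>y::real^2. (norm y)\<^sup>2) -` {..r})"
      by (subst emeasure_distr) simp_all
    also have "\<dots> = ennreal (pi * max 0 r)"
    proof (cases "r \<ge> 0")
      case True
      have "(\<lambda>y::real^2. (norm y)\<^sup>2) -` {..r} = cball 0 (sqrt r)"
        using True by (auto simp: real_le_rsqrt sqrt_ge_absD intro: real_le_rsqrt dest: sqrt_ge_absD)
      then show ?thesis using True by (simp add: emeasure_cball unit_ball_vol_2)
    next
      case False
      have "\<not> (norm y)\<^sup>2 \<le> r" for y :: "real^2"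
        using zero_le_power2[of "norm y"] False by linarith
      then have "(\<lambda>y::real^2. (norm y)\<^sup>2) -` {..r} = {}" by auto
      then show ?thesis using False by simp
    qed
    finally show ?thesis .
  qed
  have N: "emeasure ?N {..r} = ennreal (pi * max 0 r)" for r
  proof -
    have "emeasure ?N {..r} = (\<integral>\<^sup>+v. ennreal pi * indicator {0..r} v \<partial>lborel)"
      by (subst emeasure_density) (auto intro!: nn_integral_cong simp: indicator_def)
    also have "\<dots> = ennreal pi * emeasure lborel {0..r}"
      by (simp add: nn_integral_cmult)
    also have "\<dots> = ennreal (pi * max 0 r)"
      by (cases "r \<ge> 0") (simp_all add: ennreal_mult'')
    finally show ?thesis .
  qed
  show "emeasure ?M X = emeasure ?N X" if "X \<in> range (\<lambda>a::real. {..a})" for X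
    using that M N by auto
  show "Int_stable (range (\<lambda>a::real. {..a}))"
    by (auto simp: Int_stable_def)
  show "sets ?M = sigma_sets UNIV (range (\<lambda>a::real. {..a}))" "sets ?N = sigma_sets UNIV (range (\<lambda>a::real. {..a}))"
    by (simp_all add: borel_eq_atMost)
  show "(\<Union>i. {..real i}) = UNIV"
    using real_arch_simple by auto
  show "emeasure ?M {..real i} \<noteq> \<infinity>" for i by (simp add: M)
qed auto

lemma nn_integral_radial_plane:
  assumes [measurable]: "f \<in> borel_measurable borel"
  shows "(\<integral>\<^sup>+y. f ((norm (y::real^2))\<^sup>2) \<partial>lborel) = (\<integral>\<^sup>+v. (ennreal pi * indicator {0..} v) * f v \<partial>lborel)"
proof -
  have "(\<integral>\<^sup>+y. f ((norm (y::real^2))\<^sup>2) \<partial>lborel) = (\<integral>\<^sup>+v. f v \<partial>distr lborel borel (\<lambda>y::real^2. (norm y)\<^sup>2))"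
    by (subst nn_integral_distr) simp_all
  also have "\<dots> = (\<integral>\<^sup>+v. (ennreal pi * indicator {0..} v) * f v \<partial>lborel)"
    unfolding distr_norm_sq_plane by (rule nn_integral_density) simp_all
  finally show ?thesis .
qed

lemma nth3_measurable [measurable]: "(\<lambda>x::real^3. x $ i) \<in> borel_measurable borel"
  by (intro borel_measurable_continuous_onI continuous_intros)

lemma stereo_one_third: "stereo_param 1 y $ 3 = 1 - 2 / (1 + (norm y)\<^sup>2)"
  by (simp add: stereo_third)

text \<open>Archimedes: a cap of the sphere has area proportional to its height. In the chart the
  cap below height c is a disc, and \<open>conf\<close> as a function of the squared radius has an
  elementary primitive.\<close>

lemma distr_area_third:
  "distr area borel (\<lambda>x. x $ 3) = density lborel (\<lambda>t. ennreal (2 * pi) * indicator {-1..1} t)"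
    (is "?M = ?N")
proof (rule measure_eqI_generator_eq[where \<Omega>=UNIV and E="range (\<lambda>a::real. {..a})" and A="\<lambda>n. {..real n}"])
  have m3: "(\<lambda>x::real^3. x $ 3) \<in> borel_measurable (restrict_space borel S2)"
    by (rule measurable_restrict_space1) simp
  have M: "emeasure ?M {..c} = ennreal (2 * pi * (max (-1) (min c 1) + 1))" for c
  proof -
    have "emeasure ?M {..c} = (\<integral>\<^sup>+x. indicator {..c} (x $ 3) \<partial>area)"
      using m3 by (subst nn_integral_indicator[symmetric], simp, subst nn_integral_distr)
        (simp_all cong: measurable_cong_sets)
    also have "\<dots> = (\<integral>\<^sup>+y. ennreal (conf y) * indicator {..c} (stereo_param 1 y $ 3) \<partial>lborel)"
      by (rule nn_integral_area) (use m3 in measurable)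
    also have "\<dots> = (\<integral>\<^sup>+y. (\<lambda>v. ennreal (4 / (1 + v)\<^sup>2) * indicator {..c} (1 - 2 / (1 + v))) ((norm (y::real^2))\<^sup>2) \<partial>lborel)"
      by (simp add: conf_def stereo_one_third)
    also have "\<dots> = (\<integral>\<^sup>+v. (ennreal pi * indicator {0..} v) * (ennreal (4 / (1 + v)\<^sup>2) * indicator {..c} (1 - 2 / (1 + v))) \<partial>lborel)"
      by (rule nn_integral_radial_plane) measurable
    also have "\<dots> = (\<integral>\<^sup>+v. ennreal pi * (ennreal (4 / (1 + v)\<^sup>2) * indicator {v. 0 \<le> v \<and> 1 - 2 / (1 + v) \<le> c} v) \<partial>lborel)"
      by (intro nn_integral_cong) (auto simp: indicator_def)
    also have "\<dots> = ennreal pi * (\<integral>\<^sup>+v. ennreal (4 / (1 + v)\<^sup>2) * indicator {v. 0 \<le> v \<and> 1 - 2 / (1 + v) \<le> c} v \<partial>lborel)"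
      by (rule nn_integral_cmult) measurable
    also have "(\<integral>\<^sup>+v. ennreal (4 / (1 + v)\<^sup>2) * indicator {v. 0 \<le> v \<and> 1 - 2 / (1 + v) \<le> c} v \<partial>lborel)
        = ennreal (2 * (max (-1) (min c 1) + 1))"
    proof -
      consider "c < -1" | "-1 \<le> c" "c < 1" | "c \<ge> 1" by linarith
      then show ?thesis
      proof cases
        case 1
        have "{v. 0 \<le> v \<and> 1 - 2 / (1 + v) \<le> c} = {}"
        proof -
          have "1 - 2 / (1 + v) \<ge> -1" if "v \<ge> 0" for v :: real using that by (simp add: field_simps)
          then show ?thesis using 1 by force
        qed
        then show ?thesis using 1 by simp
      next
        case 2
        \<comment> \<open>The squared radius of the disc that is mapped onto the cap, from solving 1
          - 2 / (1 + v) = c.\<close>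
        define V where "V = (1 + c) / (1 - c)"
        have V: "V \<ge> 0" "1 + V = 2 / (1 - c)" using 2 by (simp_all add: V_def field_simps)
        have e: "{v. 0 \<le> v \<and> 1 - 2 / (1 + v) \<le> c} = {0..V}"
        proof -
          have "1 - 2 / (1 + v) \<le> c \<longleftrightarrow> v \<le> V" if "v \<ge> 0" for v
            using that 2 by (simp add: V_def field_simps)
          then show ?thesis by auto
        qed
        have "(\<integral>\<^sup>+v. ennreal (4 / (1 + v)\<^sup>2) * indicator {0..V} v \<partial>lborel) = ennreal ((-4 / (1 + V)) - (-4 / (1 + 0)))"
        proof (rule nn_integral_FTC_Icc)
          show "((\<lambda>v. -4 / (1 + v)) has_real_derivative 4 / (1 + v)\<^sup>2) (at v)" if "v \<in> {0..V}" for v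
            using that by (auto intro!: derivative_eq_intros simp: power2_eq_square field_simps)
        qed (use V in \<open>auto\<close>)
        also have "(-4 / (1 + V)) - (-4 / (1 + 0)) = 2 * (c + 1)" unfolding V(2) using 2 by (simp add: field_simps)
        finally show ?thesis using 2 unfolding e by simp
      next
        case 3
        have e: "{v. 0 \<le> v \<and> 1 - 2 / (1 + v) \<le> c} = {0..}"
        proof -
          have "1 - 2 / (1 + v) \<le> c" if "v \<ge> 0" for v :: real
          proof -
            have "0 \<le> 2 / (1 + v)" using that by simp
            then show ?thesis using 3 by linarith
          qed
          then show ?thesis by auto
        qed
        have "(\<integral>\<^sup>+v. ennreal (4 / (1 + v)\<^sup>2) * indicator {0..} v \<partial>lborel) = ennreal (0 - (-4 / (1 + 0)))"
        proof (rule nn_integral_FTC_atLeast)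
          show "((\<lambda>v. -4 / (1 + v)) has_real_derivative 4 / (1 + v)\<^sup>2) (at v)" if "0 \<le> v" for v
            using that by (auto intro!: derivative_eq_intros simp: power2_eq_square field_simps)
          show "((\<lambda>v::real. -4 / (1 + v)) \<longlongrightarrow> 0) at_top" by real_asymp
        qed (auto)
        then show ?thesis using 3 unfolding e by simp
      qed
    qed
    also have "ennreal pi * ennreal (2 * (max (-1) (min c 1) + 1)) = ennreal (2 * pi * (max (-1) (min c 1) + 1))"
      by (subst ennreal_mult[symmetric]) (auto simp: algebra_simps)
    finally show ?thesis .
  qed
  have N: "emeasure ?N {..c} = ennreal (2 * pi * (max (-1) (min c 1) + 1))" for c
  proof -
    have "emeasure ?N {..c} = (\<integral>\<^sup>+v. ennreal (2 * pi) * indicator {-1..min c 1} v \<partial>lborel)"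
      by (subst emeasure_density) (auto intro!: nn_integral_cong simp: indicator_def)
    also have "\<dots> = ennreal (2 * pi) * emeasure lborel {-1..min c 1}"
      by (simp add: nn_integral_cmult)
    also have "\<dots> = ennreal (2 * pi * (max (-1) (min c 1) + 1))"
      by (cases "c \<ge> -1") (auto simp: ennreal_mult''[symmetric] max_def min_def)
    finally show ?thesis .
  qed
  show "emeasure ?M X = emeasure ?N X" if "X \<in> range (\<lambda>a::real. {..a})" for X
    using that M N by auto
  show "Int_stable (range (\<lambda>a::real. {..a}))"
    by (auto simp: Int_stable_def)
  show "sets ?M = sigma_sets UNIV (range (\<lambda>a::real. {..a}))" "sets ?N = sigma_sets UNIV (range (\<lambda>a::real. {..a}))"
    by (simp_all add: borel_eq_atMost)
  show "(\<Union>i. {..real i}) = UNIV"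
    using real_arch_simple by auto
  show "emeasure ?M {..real i} \<noteq> \<infinity>" for i by (simp add: M)
qed auto

lemma nn_integral_area_third:
  assumes [measurable]: "f \<in> borel_measurable borel"
  shows "(\<integral>\<^sup>+x. f (x $ 3) \<partial>area) = (\<integral>\<^sup>+t. (ennreal (2 * pi) * indicator {-1..1} t) * f t \<partial>lborel)"
proof -
  have m3: "(\<lambda>x::real^3. x $ 3) \<in> borel_measurable area"
    using measurable_restrict_space1[OF nth3_measurable[of 3], of S2] by (simp cong: measurable_cong_sets)
  have "(\<integral>\<^sup>+x. f (x $ 3) \<partial>area) = (\<integral>\<^sup>+t. f t \<partial>distr area borel (\<lambda>x. x $ 3))"
    using m3 by (subst nn_integral_distr) simp_all
  also have "\<dots> = (\<integral>\<^sup>+t. (ennreal (2 * pi) * indicator {-1..1} t) * f t \<partial>lborel)"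
    unfolding distr_area_third by (rule nn_integral_density) simp_all
  finally show ?thesis .
qed

lemma emeasure_area: "emeasure area S2 = ennreal (4 * pi)"
proof -
  have "emeasure area S2 = (\<integral>\<^sup>+x. 1 \<partial>area)"
    by simp
  also have "\<dots> = (\<integral>\<^sup>+t. (ennreal (2 * pi) * indicator {-1..1::real} t) * 1 \<partial>lborel)"
    by (rule nn_integral_area_third[of "\<lambda>_. 1"]) simp
  also have "\<dots> = ennreal (2 * pi) * 2"
    by (simp add: nn_integral_cmult)
  also have "\<dots> = ennreal (4 * pi)"
    using ennreal_mult[of "2 * pi" 2] by simp
  finally show ?thesis .
qed

lemma finite_area: "finite_measure area"
  by (rule finite_measureI) (simp add: emeasure_area)

section \<open>Area integrals under conformal maps of the sphere\<close>

lemma change_of_variables_real: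
  fixes f :: "real^'m::{finite,wellorder} \<Rightarrow> real" and g :: "real^'m::_ \<Rightarrow> real^'m::_"
  assumes S: "S \<in> sets lebesgue"
    and der_g: "\<And>x. x \<in> S \<Longrightarrow> (g has_derivative g' x) (at x within S)"
    and inj: "inj_on g S"
  shows "(\<lambda>x. \<bar>det (matrix (g' x))\<bar> * f(g x)) absolutely_integrable_on S \<and>
           integral S (\<lambda>x. \<bar>det (matrix (g' x))\<bar> * f (g x)) = b
     \<longleftrightarrow> f absolutely_integrable_on (g ` S) \<and> integral (g ` S) f = b"
proof -
  have "(\<lambda>x. \<bar>det (matrix (g' x))\<bar> *\<^sub>R vec (f(g x)) :: real ^ 1) absolutely_integrable_on S \<and>
           integral S (\<lambda>x. \<bar>det (matrix (g' x))\<bar> *\<^sub>R vec (f(g x))) = (vec b :: real ^ 1)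
         \<longleftrightarrow> (\<lambda>x. vec (f x) :: real ^ 1) absolutely_integrable_on (g ` S) \<and>
           integral (g ` S) (\<lambda>x. vec (f x)) = (vec b :: real ^ 1)"
    by (intro has_absolute_integral_change_of_variables assms) auto
  thus ?thesis
    by (simp add: absolutely_integrable_on_1_iff integral_on_1_eq)
qed


lemma stereo_proj_nth: "stereo_proj s x $ 1 = x$1 / (1 - s * x$3)" "stereo_proj s x $ 2 = x$2 / (1 - s * x$3)"
  by (simp_all add: stereo_proj_def)

lemma stereo_proj_differentiable:
  assumes "s * x$3 \<noteq> 1"
  shows "stereo_proj s differentiable (at x)"
proof -
  note ds = differentiable_divide differentiable_mult differentiable_diff differentiable_const differentiable_nth
  have 1: "(\<lambda>x. x$1 / (1 - s * (x::real^3)$3)) differentiable (at x)"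
    by (intro ds) (use assms in simp)
  have 2: "(\<lambda>x. x$2 / (1 - s * (x::real^3)$3)) differentiable (at x)"
    by (intro ds) (use assms in simp)
  have "\<forall>i. (\<lambda>x. stereo_proj s x $ i) differentiable (at x)"
    using 1 2 by (simp only: forall_2 stereo_proj_nth simp_thms)
  then show ?thesis
    by (subst differentiable_componentwise_within) (auto simp: Basis_vec_def inner_axis)
qed

lemma S2_third_eq_1: "norm x = 1 \<Longrightarrow> x$3 = 1 \<longleftrightarrow> x = axis 3 (1::real)" for x :: "real^3"
proof
  assume n: "norm x = 1" and "x$3 = 1"
  then have "(x$1)\<^sup>2 + (x$2)\<^sup>2 = 0" using norm_sq_3[of x] by simp
  then show "x = axis 3 1" using \<open>x$3 = 1\<close>
    by (simp add: vec_eq_iff forall_3 axis_def sum_power2_eq_zero_iff)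
qed (simp add: axis_def)

lemma AE_lborel_notin_subsingleton:
  fixes A :: "'a::euclidean_space set"
  assumes "\<And>x y. x \<in> A \<Longrightarrow> y \<in> A \<Longrightarrow> x = y"
  shows "AE x in lborel. x \<notin> A"
proof -
  have "finite A"
  proof (cases "A = {}")
    case False
    then obtain a where "a \<in> A" by blast
    then have "A \<subseteq> {a}" using assms by blast
    then show ?thesis using finite_subset by blast
  qed simp
  then have "A \<in> null_sets lborel" by (rule finite_imp_null_set_lborel)
  then show ?thesis by (rule AE_not_in)
qed

lemma nn_integral_conf: "(\<integral>\<^sup>+y. ennreal (conf y) \<partial>lborel) = ennreal (4 * pi)"
proof -
  have "(\<integral>\<^sup>+y. ennreal (conf y) \<partial>lborel) = (\<integral>\<^sup>+x. 1 \<partial>area)"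
    by (subst nn_integral_area) simp_all
  then show ?thesis by (simp add: emeasure_area)
qed

text \<open>Read in the stereographic chart, \<open>A\<close> is a planar map \<open>g\<close> whose
  distances are known exactly, hence a conformal one, and its Jacobian is the quotient of the
  densities. At most one point of the plane is sent to the pole and at most one is missed; these are
  null sets. Rotations have j = 1, and the conformal dilations \<open>bub\<close> are the other
  use.\<close>

theorem distr_area_conformal:
  fixes A :: "real^3 \<Rightarrow> real^3" and j :: "real^3 \<Rightarrow> real"
  assumes im: "A ` S2 = S2"
    and dist: "\<And>x y. norm x = 1 \<Longrightarrow> norm y = 1 \<Longrightarrow> (norm (A x - A y))\<^sup>2 = j x * j y * (norm (x - y))\<^sup>2"
    and jp: "\<And>x. norm x = 1 \<Longrightarrow> j x > 0"
    and jc: "continuous_on S2 j"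
    and diff: "\<And>x. norm x = 1 \<Longrightarrow> A differentiable (at x)"
  shows "distr (density area (\<lambda>x. ennreal ((j x)\<^sup>2))) (restrict_space borel S2) A = area"
    and "A \<in> restrict_space borel S2 \<rightarrow>\<^sub>M restrict_space borel S2"
proof -
  let ?\<phi> = "stereo_param 1"
  let ?R = "restrict_space borel S2 :: (real^3) measure"
  have AS: "norm (A x) = 1" if "norm x = 1" for x using im that by (metis image_eqI mem_sphere_0)
  have inj: "x = y" if "norm x = 1" "norm y = 1" "A x = A y" for x y
  proof -
    have "j x * j y * (norm (x - y))\<^sup>2 = 0" using dist[OF that(1,2)] that(3) by simp
    then show ?thesis using jp[OF that(1)] jp[OF that(2)] by simp
  qed
  have cA: "continuous_on S2 A"
    using diff by (intro continuous_at_imp_continuous_on ballI differentiable_imp_continuous_within) auto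
  have Am: "A \<in> ?R \<rightarrow>\<^sub>M ?R"
    by (rule measurable_restrict_space2) (use AS cA in \<open>auto intro: measurable_areaI simp: space_restrict_space\<close>)
  have jm: "j \<in> borel_measurable ?R" by (rule measurable_areaI[OF jc])
  define S where "S = {y. A (?\<phi> y) $ 3 \<noteq> 1}"
  have c3: "continuous_on UNIV (\<lambda>y. A (?\<phi> y))"
    by (rule continuous_on_compose2[OF cA continuous_stereo]) auto
  then have c3': "continuous_on UNIV (\<lambda>y. A (?\<phi> y) $ 3)" by (intro continuous_intros)
  have oS: "open S" unfolding S_def by (rule open_Collect_neq[OF c3' continuous_on_const])
  define g where "g y = stereo_proj 1 (A (?\<phi> y))" for y
  have pg: "?\<phi> (g y) = A (?\<phi> y)" if "y \<in> S" for y
    unfolding g_def by (rule stereo_param_proj) (use that AS in \<open>auto simp: S_def\<close>)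
  have gd: "g differentiable (at y)" if "y \<in> S" for y
    unfolding g_def
    by (rule differentiable_compose[where f="stereo_proj 1", unfolded o_def], rule stereo_proj_differentiable)
       (use that in \<open>auto simp: S_def intro!: differentiable_compose[where f=A] diff stereo_differentiable\<close>)
  have gi: "inj_on g S"
  proof (rule inj_onI)
    fix y z assume "y \<in> S" "z \<in> S" "g y = g z"
    then have "A (?\<phi> y) = A (?\<phi> z)" using pg by metis
    then have "?\<phi> y = ?\<phi> z" using inj[of "?\<phi> y" "?\<phi> z"] by simp
    then show "y = z" by (rule stereo_proj_inj[rotated]) simp
  qed
  have gim: "g ` S = {w. ?\<phi> w \<noteq> A (axis 3 1)}"
  proof (intro set_eqI iffI)
    fix w assume "w \<in> g ` S"
    then obtain y where y: "y \<in> S" "w = g y" by blast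
    have "?\<phi> y \<noteq> axis 3 1" using stereo_ne_pole[of 1 y] by (auto simp: axis_def)
    then have "A (?\<phi> y) \<noteq> A (axis 3 1)" using inj[of "?\<phi> y" "axis 3 1"] by auto
    then show "w \<in> {w. ?\<phi> w \<noteq> A (axis 3 1)}" using pg[OF y(1)] y by simp
  next
    fix w assume "w \<in> {w. ?\<phi> w \<noteq> A (axis 3 1)}"
    then have w: "?\<phi> w \<noteq> A (axis 3 1)" by simp
    have "?\<phi> w \<in> A ` S2" using im by simp
    then obtain x where x: "norm x = 1" "?\<phi> w = A x" by auto
    have "x \<noteq> axis 3 1" using w x by auto
    then have x3: "x$3 \<noteq> 1" using S2_third_eq_1[OF x(1)] by simp
    define y where "y = stereo_proj 1 x"
    have y: "?\<phi> y = x" unfolding y_def by (rule stereo_param_proj) (use x x3 in auto)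
    have "y \<in> S" unfolding S_def using stereo_ne_pole[of 1 w] by (simp add: y x(2)[symmetric])
    moreover have "g y = w" unfolding g_def y x(2)[symmetric] by simp
    ultimately show "w \<in> g ` S" by blast
  qed
  define g' where "g' y = frechet_derivative g (at y)" for y
  have gd': "(g has_derivative g' y) (at y)" if "y \<in> S" for y
    using gd[OF that] frechet_derivative_works unfolding g'_def by blast
  have det: "\<bar>det (matrix (g' y))\<bar> * conf (g y) = (j (?\<phi> y))\<^sup>2 * conf y" if y: "y \<in> S" for y
  proof -
    \<comment> \<open>The two-point dilation factor of \<open>g\<close>, obtained by solving the
      chordal distance formulas before and after \<open>A\<close> for norm (g z - g y). It is exact
      on \<open>S\<close>, not only infinitesimally.\<close>
    define k where "k z = sqrt (j (?\<phi> z) * j (?\<phi> y) * (1 + (norm (g z))\<^sup>2) * (1 + (norm (g y))\<^sup>2)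
       / ((1 + (norm z)\<^sup>2) * (1 + (norm y)\<^sup>2)))" for z
    have jpp: "j (?\<phi> z) > 0" for z by (rule jp) simp
    have kk: "k y = j (?\<phi> y) * (1 + (norm (g y))\<^sup>2) / (1 + (norm y)\<^sup>2)"
    proof -
      have "k y = sqrt ((j (?\<phi> y) * (1 + (norm (g y))\<^sup>2) / (1 + (norm y)\<^sup>2))\<^sup>2)"
        unfolding k_def by (simp add: power2_eq_square mult_ac)
      then show ?thesis using jpp[of y] by simp
    qed
    have "g' y u \<bullet> g' y v = (k y)\<^sup>2 * (u \<bullet> v)" for u v
    proof (rule conformal_deriv_inner[OF gd'[OF y] oS y])
      fix z assume z: "z \<in> S"
      have "4 * (norm (g z - g y))\<^sup>2 / ((1 + (norm (g z))\<^sup>2) * (1 + (norm (g y))\<^sup>2)) = (norm (A (?\<phi> z) - A (?\<phi> y)))\<^sup>2"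
        using norm_stereo_diff[of 1 "g z" "g y"] by (simp add: pg y z)
      also have "\<dots> = j (?\<phi> z) * j (?\<phi> y) * (4 * (norm (z - y))\<^sup>2 / ((1 + (norm z)\<^sup>2) * (1 + (norm y)\<^sup>2)))"
        by (subst dist) (simp_all add: norm_stereo_diff)
      finally have e: "4 * (norm (g z - g y))\<^sup>2 / ((1 + (norm (g z))\<^sup>2) * (1 + (norm (g y))\<^sup>2))
          = j (?\<phi> z) * j (?\<phi> y) * (4 * (norm (z - y))\<^sup>2 / ((1 + (norm z)\<^sup>2) * (1 + (norm y)\<^sup>2)))" .
      have gen: "n = j1 * p * q / r * m" if "4 * n / (p * q) = j1 * (4 * m / r)" "p > 0" "q > 0" for n p q j1 m r :: real
      proof -
        have "n = 4 * n / (p * q) * (p * q / 4)" using that(2,3) by simp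
        also have "\<dots> = j1 * (4 * m / r) * (p * q / 4)" by (simp only: that(1))
        also have "\<dots> = j1 * p * q / r * m" by simp
        finally show ?thesis .
      qed
      have "(norm (g z - g y))\<^sup>2 = j (?\<phi> z) * j (?\<phi> y) * (1 + (norm (g z))\<^sup>2) * (1 + (norm (g y))\<^sup>2)
       / ((1 + (norm z)\<^sup>2) * (1 + (norm y)\<^sup>2)) * (norm (z - y))\<^sup>2"
        by (rule gen[OF e]) simp_all
      then have "sqrt ((norm (g z - g y))\<^sup>2) = k z * sqrt ((norm (z - y))\<^sup>2)"
        unfolding k_def by (simp only: real_sqrt_mult)
      then show "norm (g z - g y) = k z * norm (z - y)" by simp
    next
      have "isCont g y" using gd[OF y] differentiable_imp_continuous_within by blast
      moreover have "continuous_on UNIV (\<lambda>z. j (?\<phi> z))"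
        by (rule continuous_on_compose2[OF jc continuous_stereo]) auto
      then have "isCont (\<lambda>z. j (?\<phi> z)) y"
        by (simp add: continuous_on_eq_continuous_at)
      ultimately show "isCont k y" unfolding k_def by (intro continuous_intros) simp_all
    qed (use jpp[of y] in \<open>simp add: kk\<close>)
    then have "\<bar>det (matrix (g' y))\<bar> = (k y)\<^sup>2"
      by (intro conformal_det) (use gd'[OF y] has_derivative_linear in auto)
    then show ?thesis unfolding kk conf_def by (simp add: power_mult_distrib power_divide)
  qed
  have sing1: "AE y in lborel. y \<in> S"
  proof -
    have "AE y in lborel. y \<notin> - S"
    proof (rule AE_lborel_notin_subsingleton)
      fix y z assume "y \<in> - S" "z \<in> - S"
      then have "A (?\<phi> y) = axis 3 1" "A (?\<phi> z) = axis 3 1" unfolding S_def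
        by (simp_all add: S2_third_eq_1 AS)
      then have "?\<phi> y = ?\<phi> z" using inj[of "?\<phi> y" "?\<phi> z"] by simp
      then show "y = z" by (rule stereo_proj_inj[rotated]) simp
    qed
    then show ?thesis by simp
  qed
  have sing2: "AE y in lborel. y \<in> g ` S"
  proof -
    have "AE y in lborel. y \<notin> - (g ` S)"
    proof (rule AE_lborel_notin_subsingleton)
      fix y z assume "y \<in> - (g ` S)" "z \<in> - (g ` S)"
      then have "?\<phi> y = ?\<phi> z" unfolding gim by simp
      then show "y = z" by (rule stereo_proj_inj[rotated]) simp
    qed
    then show ?thesis by simp
  qed
  have gSm: "g ` S \<in> sets lborel"
  proof -
    have "open (g ` S)" unfolding gim
      by (rule open_Collect_neq) (auto intro!: continuous_intros)
    then show ?thesis by simp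
  qed
  show "A \<in> ?R \<rightarrow>\<^sub>M ?R" by (rule Am)
  show "distr (density area (\<lambda>x. ennreal ((j x)\<^sup>2))) ?R A = area"
  proof (rule measure_eqI)
    show "sets (distr (density area (\<lambda>x. ennreal ((j x)\<^sup>2))) ?R A) = sets area" by simp
    fix B assume "B \<in> sets (distr (density area (\<lambda>x. ennreal ((j x)\<^sup>2))) ?R A)"
    then have B: "B \<in> sets ?R" by simp
    have ind: "(\<lambda>x. indicator B x :: real) \<in> borel_measurable ?R" using B by simp
    define F where "F w = conf w * indicator B (?\<phi> w)" for w
    have Fm: "F \<in> borel_measurable borel" unfolding F_def
      using measurable_compose[OF measurable_stereo_1 ind] by simp
    have F0: "0 \<le> F w" "F w \<le> conf w" for w using conf_pos[of w] by (auto simp: F_def indicator_def)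
    have "integrable lborel F"
    proof (rule integrableI_nonneg)
      have "(\<integral>\<^sup>+ x. ennreal (F x) \<partial>lborel) \<le> (\<integral>\<^sup>+ x. ennreal (conf x) \<partial>lborel)"
        by (intro nn_integral_mono ennreal_leI F0)
      also have "\<dots> < \<infinity>" unfolding nn_integral_conf by simp
      finally show "(\<integral>\<^sup>+ x. ennreal (F x) \<partial>lborel) < \<infinity>" .
    qed (use Fm F0 in auto)
    then have "integrable lebesgue F" using Fm by (subst integrable_completion) simp_all
    then have "F absolutely_integrable_on UNIV" by (simp add: set_integrable_def)
    then have Fi: "F absolutely_integrable_on (g ` S)"
      by (rule set_integrable_subset) (use gSm in auto)
    define b where "b = integral (g ` S) F"
    have "(\<lambda>y. \<bar>det (matrix (g' y))\<bar> * F (g y)) absolutely_integrable_on S \<and>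
           integral S (\<lambda>y. \<bar>det (matrix (g' y))\<bar> * F (g y)) = b"
      using change_of_variables_real[of S g g' F b] gd' gi oS Fi b_def
      by (simp add: has_derivative_at_withinI lebesgue_openin)
    then have "((\<lambda>y. \<bar>det (matrix (g' y))\<bar> * F (g y)) has_integral b) S"
      by (simp add: has_integral_iff set_lebesgue_integral_eq_integral(1))
    then have "(\<integral>\<^sup>+y. ennreal (\<bar>det (matrix (g' y))\<bar> * F (g y)) * indicator S y \<partial>lborel) = ennreal b"
      by (intro nn_integral_has_integral_lebesgue') (use F0 in auto)
    moreover have "(F has_integral b) (g ` S)"
      using Fi b_def by (simp add: has_integral_iff set_lebesgue_integral_eq_integral(1))
    then have "(\<integral>\<^sup>+y. ennreal (F y) * indicator (g ` S) y \<partial>lborel) = ennreal b"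
      by (intro nn_integral_has_integral_lebesgue') (use F0 in auto)
    ultimately have eq: "(\<integral>\<^sup>+y. ennreal (\<bar>det (matrix (g' y))\<bar> * F (g y)) * indicator S y \<partial>lborel)
        = (\<integral>\<^sup>+y. ennreal (F y) * indicator (g ` S) y \<partial>lborel)" by simp
    have mB: "(\<lambda>x. ennreal ((j x)\<^sup>2) * indicator B (A x)) \<in> borel_measurable ?R"
      using jm measurable_compose[OF Am, of "indicator B" "borel :: ennreal measure"] B by simp
    have "emeasure (distr (density area (\<lambda>x. ennreal ((j x)\<^sup>2))) ?R A) B
       = (\<integral>\<^sup>+x. indicator B x \<partial>distr (density area (\<lambda>x. ennreal ((j x)\<^sup>2))) ?R A)"
      using B by simp
    also have "\<dots> = (\<integral>\<^sup>+x. indicator B (A x) \<partial>density area (\<lambda>x. ennreal ((j x)\<^sup>2)))"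
      using Am B by (intro nn_integral_distr) (simp_all cong: measurable_cong_sets)
    also have "\<dots> = (\<integral>\<^sup>+x. ennreal ((j x)\<^sup>2) * indicator B (A x) \<partial>area)"
      using jm measurable_compose[OF Am, of "indicator B" "borel :: ennreal measure"] B
      by (intro nn_integral_density) (simp_all cong: measurable_cong_sets)
    also have "\<dots> = (\<integral>\<^sup>+y. ennreal (conf y) * (ennreal ((j (?\<phi> y))\<^sup>2) * indicator B (A (?\<phi> y))) \<partial>lborel)"
      by (rule nn_integral_area[OF mB])
    also have "\<dots> = (\<integral>\<^sup>+y. ennreal (\<bar>det (matrix (g' y))\<bar> * F (g y)) * indicator S y \<partial>lborel)"
    proof (rule nn_integral_cong_AE, use sing1 in eventually_elim)
      fix y assume y: "y \<in> S"
      have "\<bar>det (matrix (g' y))\<bar> * F (g y) = (j (?\<phi> y))\<^sup>2 * conf y * indicator B (A (?\<phi> y))"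
        unfolding F_def mult.assoc[symmetric] det[OF y] pg[OF y] ..
      then show "ennreal (conf y) * (ennreal ((j (?\<phi> y))\<^sup>2) * indicator B (A (?\<phi> y)))
        = ennreal (\<bar>det (matrix (g' y))\<bar> * F (g y)) * indicator S y"
        using y conf_pos[of y] by (auto simp: indicator_def ennreal_mult mult.commute)
    qed
    also have "\<dots> = (\<integral>\<^sup>+y. ennreal (F y) * indicator (g ` S) y \<partial>lborel)" by (rule eq)
    also have "\<dots> = (\<integral>\<^sup>+y. ennreal (conf y) * indicator B (?\<phi> y) \<partial>lborel)"
    proof (rule nn_integral_cong_AE, use sing2 in eventually_elim)
      fix y assume y: "y \<in> g ` S"
      then show "ennreal (F y) * indicator (g ` S) y = ennreal (conf y) * indicator B (?\<phi> y)"
        unfolding F_def by (auto simp: indicator_def)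
    qed
    also have "\<dots> = (\<integral>\<^sup>+x. indicator B x \<partial>area)"
      by (rule nn_integral_area[symmetric]) (use B in simp)
    also have "\<dots> = emeasure area B" using B by simp
    finally show "emeasure (distr (density area (\<lambda>x. ennreal ((j x)\<^sup>2))) ?R A) B = emeasure area B" .
  qed
qed

lemma measurable_area_eq: "measurable area N = measurable (restrict_space borel S2) N"
  by (rule measurable_cong_sets) simp_all

lemma measurable_density_area_eq:
  "measurable (density area f) N = measurable (restrict_space borel S2) N"
  by (rule measurable_cong_sets) simp_all

lemma borel_measurable_areaI: "continuous_on S2 f \<Longrightarrow> f \<in> borel_measurable area"
  for f :: "real^3 \<Rightarrow> 'b::topological_space"
  using measurable_areaI[of f] by (simp only: measurable_area_eq measurable_density_area_eq)

interpretation area: finite_measure area by (rule finite_area)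

lemma measure_area: "measure area S2 = 4 * pi"
  by (simp add: measure_def emeasure_area)

lemma integrable_area_cont:
  fixes f :: "real^3 \<Rightarrow> 'b::{banach, second_countable_topology}"
  assumes "continuous_on S2 f"
  shows "integrable area f"
proof -
  have "bounded (f ` S2)" by (intro compact_imp_bounded compact_continuous_image assms compact_sphere)
  then obtain B where "\<forall>y \<in> f ` S2. norm y \<le> B" unfolding bounded_iff by blast
  then have "\<And>x. x \<in> S2 \<Longrightarrow> norm (f x) \<le> B" by blast
  then show ?thesis
    by (intro area.integrable_const_bound[where B=B] borel_measurable_areaI assms AE_I2) simp
qed

lemma orth_norm: "orthogonal_transformation T \<Longrightarrow> norm (T x) = norm x"
  by (simp add: orthogonal_transformation)

lemma orth_S2: "T ` S2 = S2" if T: "orthogonal_transformation T" for T :: "real^3 \<Rightarrow> real^3"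
proof
  show "T ` S2 \<subseteq> S2" using orth_norm[OF T] by auto
  show "S2 \<subseteq> T ` S2"
  proof
    fix x :: "real^3" assume x: "x \<in> S2"
    obtain y where "x = T y" using orthogonal_transformation_surj[OF T] by blast
    then show "x \<in> T ` S2" using x orth_norm[OF T, of y] by simp
  qed
qed

lemma orth_inner: "orthogonal_transformation T \<Longrightarrow> T x \<bullet> T y = x \<bullet> y"
  by (simp add: orthogonal_transformation_def)

lemma orth_differentiable: "orthogonal_transformation T \<Longrightarrow> T differentiable (at x)"
  for T :: "'a::euclidean_space \<Rightarrow> 'a"
  using orthogonal_transformation_linear linear_imp_differentiable by blast

lemma distr_area_orth:
  assumes T: "orthogonal_transformation T"
  shows "distr area (restrict_space borel S2) T = area"
    and "T \<in> restrict_space borel S2 \<rightarrow>\<^sub>M restrict_space borel S2"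
proof -
  have d: "(norm (T x - T y))\<^sup>2 = 1 * 1 * (norm (x - y))\<^sup>2" for x y
    using orth_norm[OF T, of "x - y"] linear_diff[OF orthogonal_transformation_linear[OF T], of x y] by simp
  note c = distr_area_conformal[of T "\<lambda>_. 1", OF orth_S2[OF T] d]
  show "distr area (restrict_space borel S2) T = area"
    using c(1) orth_differentiable[OF T] by (simp add: density_1)
  show "T \<in> restrict_space borel S2 \<rightarrow>\<^sub>M restrict_space borel S2"
    using c(2) orth_differentiable[OF T] by simp
qed

lemma integral_area_orth:
  fixes f :: "real^3 \<Rightarrow> 'b::{banach, second_countable_topology}"
  assumes "orthogonal_transformation T" "f \<in> borel_measurable area"
  shows "(\<integral>x. f (T x) \<partial>area) = (\<integral>x. f x \<partial>area)"
proof -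
  have f: "f \<in> borel_measurable (restrict_space borel S2)" using assms(2) by (simp only: measurable_area_eq measurable_density_area_eq)
  have T: "T \<in> measurable area (restrict_space borel S2)"
    using distr_area_orth(2)[OF assms(1)] by (simp only: measurable_area_eq measurable_density_area_eq)
  show ?thesis using integral_distr[OF T f] unfolding distr_area_orth(1)[OF assms(1)] ..
qed

lemma integral_area_conformal:
  fixes f :: "real^3 \<Rightarrow> real"
  assumes c: "distr (density area (\<lambda>x. ennreal ((j x)\<^sup>2))) (restrict_space borel S2) A = area"
    and A: "A \<in> restrict_space borel S2 \<rightarrow>\<^sub>M restrict_space borel S2"
    and j: "continuous_on S2 j" and f: "f \<in> borel_measurable area"
  shows "(\<integral>x. (j x)\<^sup>2 * f (A x) \<partial>area) = (\<integral>x. f x \<partial>area)"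
    and "integrable area (\<lambda>x. (j x)\<^sup>2 * f (A x)) \<longleftrightarrow> integrable area f"
proof -
  have f': "f \<in> borel_measurable (restrict_space borel S2)" using f by (simp only: measurable_area_eq measurable_density_area_eq)
  have fA: "(\<lambda>x. f (A x)) \<in> borel_measurable area"
    using measurable_compose[OF A f'] by (simp only: measurable_area_eq measurable_density_area_eq)
  have jm: "(\<lambda>x. (j x)\<^sup>2) \<in> borel_measurable area"
    by (intro borel_measurable_areaI continuous_intros j)
  have A': "A \<in> measurable (density area (\<lambda>x. ennreal ((j x)\<^sup>2))) (restrict_space borel S2)"
    using A by (simp only: measurable_area_eq measurable_density_area_eq)
  have "(\<integral>x. f x \<partial>area) = (\<integral>x. f (A x) \<partial>density area (\<lambda>x. ennreal ((j x)\<^sup>2)))"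
    using integral_distr[OF A' f'] unfolding c .
  also have "\<dots> = (\<integral>x. (j x)\<^sup>2 * f (A x) \<partial>area)"
    using integral_density[OF fA jm] by simp
  finally show "(\<integral>x. (j x)\<^sup>2 * f (A x) \<partial>area) = (\<integral>x. f x \<partial>area)" ..
  have "integrable area f \<longleftrightarrow> integrable (density area (\<lambda>x. ennreal ((j x)\<^sup>2))) (\<lambda>x. f (A x))"
    using integrable_distr_eq[OF A' f'] unfolding c .
  also have "\<dots> \<longleftrightarrow> integrable area (\<lambda>x. (j x)\<^sup>2 * f (A x))"
    using integrable_density[OF fA jm] by simp
  finally show "integrable area (\<lambda>x. (j x)\<^sup>2 * f (A x)) \<longleftrightarrow> integrable area f" ..
qed

section \<open>Functions of the distance to a fixed point\<close>

definition zonal_measure :: "real measure" where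
  "zonal_measure = density lborel (\<lambda>v. ennreal (2 * pi) * indicator {0..2} v)"

lemma sets_zonal [simp, measurable_cong]: "sets zonal_measure = sets borel"
  by (simp add: zonal_measure_def)

text \<open>A rotation takes \<open>p\<close> to the third axis, where Archimedes' theorem applies.
  The variable 1 - x \<bullet> p is half the squared chordal distance to \<open>p\<close>, so
  kernels that depend on the distance are integrated against 2 * pi times Lebesgue measure on
  [0, 2].\<close>

lemma distr_area_zonal:
  assumes p: "norm p = 1"
  shows "distr area borel (\<lambda>x. 1 - x \<bullet> p) = zonal_measure"
proof (rule measure_eqI)
  fix B assume "B \<in> sets (distr area borel (\<lambda>x. 1 - x \<bullet> p))"
  then have B [measurable]: "B \<in> sets borel" by simp
  obtain T :: "real^3 \<Rightarrow> real^3" where T: "orthogonal_transformation T" "T p = axis 3 1"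
    by (rule orthogonal_transformation_exists_1[OF p norm_axis_1])
  have third: "x \<bullet> p = T x $ 3" for x
    using orth_inner[OF T(1), of x p] T(2) by (simp add: inner_axis)
  have m3: "(\<lambda>x::real^3. 1 - x $ 3) \<in> borel_measurable borel" by simp
  have m4: "(\<lambda>x. 1 - x \<bullet> p) \<in> borel_measurable area"
    by (intro borel_measurable_areaI continuous_intros)
  have i3: "(\<lambda>x::real^3. indicator B (1 - x $ 3) :: ennreal) \<in> borel_measurable (restrict_space borel S2)"
    by (rule measurable_restrict_space1) measurable
  have Tm: "T \<in> measurable area (restrict_space borel S2)"
    using distr_area_orth(2)[OF T(1)] by (simp only: measurable_area_eq measurable_density_area_eq)
  have "emeasure (distr area borel (\<lambda>x. 1 - x \<bullet> p)) B = (\<integral>\<^sup>+v. indicator B v \<partial>distr area borel (\<lambda>x. 1 - x \<bullet> p))"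
    by simp
  also have "\<dots> = (\<integral>\<^sup>+x. indicator B (1 - x \<bullet> p) \<partial>area)"
    using m4 by (rule nn_integral_distr) simp
  also have "\<dots> = (\<integral>\<^sup>+x. indicator B (1 - T x $ 3) \<partial>area)"
    unfolding third ..
  also have "\<dots> = (\<integral>\<^sup>+x. indicator B (1 - x $ 3) \<partial>distr area (restrict_space borel S2) T)"
    using i3 by (subst nn_integral_distr[OF Tm]) simp_all
  also have "\<dots> = (\<integral>\<^sup>+x. indicator B (1 - x $ 3) \<partial>area)"
    unfolding distr_area_orth(1)[OF T(1)] ..
  also have "\<dots> = (\<integral>\<^sup>+t. (ennreal (2 * pi) * indicator {-1..1} t) * indicator B (1 - t) \<partial>lborel)"
    by (rule nn_integral_area_third[of "\<lambda>t. indicator B (1 - t)"]) measurable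
  also have "\<dots> = ennreal \<bar>-1\<bar> * (\<integral>\<^sup>+v. (ennreal (2 * pi) * indicator {-1..1} (1 + (-1) * v)) * indicator B (1 - (1 + (-1) * v)) \<partial>lborel)"
    by (rule nn_integral_real_affine) simp_all
  also have "\<dots> = (\<integral>\<^sup>+v. (ennreal (2 * pi) * indicator {0..2} v) * indicator B v \<partial>lborel)"
    by (simp, intro nn_integral_cong) (auto simp: indicator_def)
  also have "\<dots> = emeasure zonal_measure B"
    unfolding zonal_measure_def by (rule emeasure_density[symmetric]) simp_all
  finally show "emeasure (distr area borel (\<lambda>x. 1 - x \<bullet> p)) B = emeasure zonal_measure B" .
qed simp

lemma zonal_measurable: "(\<lambda>x::real^3. 1 - x \<bullet> p) \<in> borel_measurable area"
  by (intro borel_measurable_areaI continuous_intros)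

lemma integral_zonal:
  fixes k :: "real \<Rightarrow> real"
  assumes p: "norm p = 1" and k: "k \<in> borel_measurable borel"
  shows "(\<integral>x. k (1 - x \<bullet> p) \<partial>area) = (\<integral>v. k v \<partial>zonal_measure)"
    and "integrable area (\<lambda>x. k (1 - x \<bullet> p)) \<longleftrightarrow> integrable zonal_measure k"
  using integral_distr[OF zonal_measurable[of p] k] integrable_distr_eq[OF zonal_measurable[of p] k]
  unfolding distr_area_zonal[OF p] by simp_all

lemma zonal_has_integral:
  fixes k :: "real \<Rightarrow> real"
  assumes k: "k \<in> borel_measurable borel" and i: "k absolutely_integrable_on {0..2}"
  shows "integrable zonal_measure k" and "(\<integral>v. k v \<partial>zonal_measure) = 2 * pi * integral {0..2} k"
proof -
  have eq: "zonal_measure = density lborel (\<lambda>v. ennreal (2 * pi * indicator {0..2} v))"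
    unfolding zonal_measure_def by (intro density_cong AE_I2) (auto simp: indicator_def)
  have "integrable lborel (\<lambda>v. indicator {0..2} v *\<^sub>R k v)"
    using i k unfolding set_integrable_def by (subst (asm) integrable_completion) simp_all
  then have il: "integrable lborel (\<lambda>v. indicator {0..2} v * k v)" by simp
  then have "integrable lborel (\<lambda>v. 2 * pi * (indicator {0..2} v * k v))" by (rule integrable_mult_right)
  then have il2: "integrable lborel (\<lambda>v. (2 * pi * indicator {0..2} v) * k v)" by (simp add: mult.assoc)
  then show "integrable zonal_measure k"
    unfolding eq using k by (subst integrable_density) (auto intro!: AE_I2 simp: indicator_def)
  have "(\<integral>v. k v \<partial>zonal_measure) = (\<integral>v. (2 * pi * indicator {0..2} v) * k v \<partial>lborel)"
    unfolding eq using k by (subst integral_density) (auto intro!: AE_I2 simp: indicator_def)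
  also have "\<dots> = 2 * pi * (\<integral>v. indicator {0..2} v * k v \<partial>lborel)"
    by (simp add: mult.assoc)
  also have "(\<integral>v. indicator {0..2} v * k v \<partial>lborel) = integral UNIV (\<lambda>v. indicator {0..2} v * k v)"
    using il by (rule integral_lborel[symmetric])
  also have "\<dots> = integral {0..2} k"
    by (subst integral_restrict_UNIV[symmetric]) (auto intro!: integral_cong simp: indicator_def)
  finally show "(\<integral>v. k v \<partial>zonal_measure) = 2 * pi * integral {0..2} k" .
qed


text \<open>-7/8 is -1/4 - 5/8: the power that bounds the logarithm plus the power of the weight in
  \<open>wbd\<close>. It is above -1, hence integrable, and \<open>sing_const\<close> enters all
  later bounds for potentials.\<close>

lemma singular_integral:
  shows "integrable zonal_measure (\<lambda>v. v powr (-7/8))"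
proof -
  have hi: "((\<lambda>v::real. v powr (-7/8)) has_integral (2 powr (-7/8 + 1) / (-7/8 + 1))) {0..2}"
    by (rule has_integral_powr_from_0) simp_all
  then have "(\<lambda>v::real. v powr (-7/8)) absolutely_integrable_on {0..2}"
    by (intro nonnegative_absolutely_integrable_1) (auto simp: has_integral_integrable)
  then show ?thesis by (intro zonal_has_integral(1)) simp_all
qed

definition sing_const :: real where "sing_const = (\<integral>v. v powr (-7/8) \<partial>zonal_measure)"

lemma sing_const_nonneg: "sing_const \<ge> 0"
  unfolding sing_const_def by (rule integral_nonneg_AE) simp

lemma integrable_sing:
  assumes "norm p = 1"
  shows "integrable area (\<lambda>x. (1 - x \<bullet> p) powr (-7/8))"
    and "(\<integral>x. (1 - x \<bullet> p) powr (-7/8) \<partial>area) = sing_const"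
  using integral_zonal[OF assms, of "\<lambda>v. v powr (-7/8)"] singular_integral by (simp_all add: sing_const_def)

lemma AE_area_ne:
  assumes "norm p = 1"
  shows "AE x in area. 1 - x \<bullet> p > 0"
proof -
  have "AE v in zonal_measure. v > 0"
  proof -
    have "AE v in lborel. v \<noteq> (0::real)" by (rule AE_lborel_singleton)
    then show ?thesis unfolding zonal_measure_def
      by (subst AE_density) (auto simp: indicator_def elim!: eventually_mono)
  qed
  then have "AE v in distr area borel (\<lambda>x. 1 - x \<bullet> p). v > 0"
    unfolding distr_area_zonal[OF assms] .
  then show ?thesis
    by (subst (asm) AE_distr_iff[OF zonal_measurable]) simp_all
qed

lemma one_minus_inner: "norm x = 1 \<Longrightarrow> norm y = 1 \<Longrightarrow> (norm (x - y))\<^sup>2 = 2 * (1 - x \<bullet> y)"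
  for x y :: "'a::real_inner"
proof -
  assume "norm x = 1" "norm y = 1"
  then have "x \<bullet> x = 1" "y \<bullet> y = 1" by (simp_all add: norm_eq_1)
  then show ?thesis unfolding power2_norm_eq_inner by (simp add: inner_diff inner_commute)
qed

lemma one_minus_inner_ge: "norm x = 1 \<Longrightarrow> norm y = 1 \<Longrightarrow> 0 \<le> 1 - x \<bullet> y"
  for x y :: "'a::real_inner"
proof -
  assume "norm x = 1" "norm y = 1"
  then have "2 * (1 - x \<bullet> y) = (norm (x - y))\<^sup>2" by (simp add: one_minus_inner)
  then have "0 \<le> 2 * (1 - x \<bullet> y)" by (simp only: zero_le_power2)
  then show ?thesis by simp
qed

lemma one_minus_inner_le: "norm x = 1 \<Longrightarrow> norm y = 1 \<Longrightarrow> 1 - x \<bullet> y \<le> 2"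
  for x y :: "'a::real_inner"
  using one_minus_inner_ge[of x "- y"] by simp

lemma one_minus_inner_pos: "norm x = 1 \<Longrightarrow> norm y = 1 \<Longrightarrow> x \<noteq> y \<Longrightarrow> 0 < 1 - x \<bullet> y"
  for x y :: "'a::real_inner"
  using one_minus_inner[of x y] zero_less_power2[of "norm (x - y)"] by simp

text \<open>For small v this is ln t \<le> t - 1 at t = v powr (-1/4); for v up to 2 the logarithm
  is at most 1 and the right-hand side at least 2.\<close>

lemma abs_ln_le:
  fixes v :: real
  assumes "0 < v" "v \<le> 2"
  shows "\<bar>ln v\<bar> \<le> 4 * v powr (-1/4)"
proof -
  have "ln (v powr (-1/4)) \<le> v powr (-1/4) - 1" using assms by (intro ln_le_minus_one) simp
  then have 1: "- ln v \<le> 4 * v powr (-1/4)" using assms by (simp add: ln_powr)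
  have "ln v \<le> v - 1" using assms by (intro ln_le_minus_one) simp
  then have "ln v \<le> 1" using assms by simp
  moreover have "2 powr (-1/4) \<le> v powr (-1/4)" using assms by (intro powr_mono2') simp_all
  moreover have "2 powr (-1/4::real) \<ge> 2 powr (-1)" by (intro powr_mono) simp_all
  then have "2 powr (-1/4::real) \<ge> 1/2" by (simp add: powr_minus)
  ultimately have "ln v \<le> 4 * v powr (-1/4)" by linarith
  then show ?thesis using 1 by linarith
qed

lemma one_le_powr_quarter:
  fixes v :: real
  assumes "0 < v" "v \<le> 2"
  shows "1 \<le> 2 * v powr (-1/4)"
proof -
  have "2 powr (-1/4) \<le> v powr (-1/4)" using assms by (intro powr_mono2') simp_all
  moreover have "2 powr (-1/4::real) \<ge> 2 powr (-1)" by (intro powr_mono) simp_all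
  then have "2 powr (-1/4::real) \<ge> 1/2" by (simp add: powr_minus)
  ultimately show ?thesis by linarith
qed

text \<open>Writing ln (1 + r) as 2 * ln (sqrt (1 + r)) gives the bound 2 * sqrt r. The Hoelder
  exponent 1/2 costs the power -1/2 of the distance, that is the power -1/4 of 1 - x \<bullet> y,
  which is no worse than the bound for the kernel itself.\<close>

lemma ln_diff_sqrt:
  fixes p q :: real
  assumes "0 < p" "0 < q"
  shows "\<bar>ln p - ln q\<bar> \<le> 2 * sqrt \<bar>p - q\<bar> * (p powr (-1/2) + q powr (-1/2))"
proof -
  have main: "ln p - ln q \<le> 2 * sqrt (p - q) * q powr (-1/2)" if "0 < q" "q \<le> p" for p q :: real
  proof -
    define r where "r = (p - q) / q"
    have r: "r \<ge> 0" using that by (simp add: r_def)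
    have "1 + r = p / q" using that by (simp add: r_def field_simps)
    then have "ln p - ln q = ln (1 + r)" using that by (simp add: ln_div)
    also have "\<dots> = 2 * ln (sqrt (1 + r))" using r by (simp add: ln_sqrt)
    also have "\<dots> \<le> 2 * (sqrt (1 + r) - 1)" using r ln_le_minus_one[of "sqrt (1 + r)"] by simp
    also have "sqrt (1 + r) \<le> 1 + sqrt r" using r sqrt_add_le_add_sqrt[of 1 r] by simp
    also have "2 * ((1 + sqrt r) - 1) = 2 * (sqrt (p - q) / sqrt q)" by (simp add: r_def real_sqrt_divide)
    also have "2 * (sqrt (p - q) / sqrt q) = 2 * sqrt (p - q) * q powr (-1/2)"
    proof -
      have "q powr (-(1/2)) = 1 / sqrt q" using powr_minus_divide[of q "1/2"] that by (simp add: powr_half_sqrt)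
      then show ?thesis by simp
    qed
    finally show ?thesis by simp
  qed
  show ?thesis
  proof (cases "q \<le> p")
    case True
    have "ln p - ln q \<le> 2 * sqrt (p - q) * q powr (-1/2)" using main True assms by simp
    also have "\<dots> \<le> 2 * sqrt (p - q) * (p powr (-1/2) + q powr (-1/2))"
      using True by (intro mult_left_mono) auto
    finally show ?thesis using True assms by simp
  next
    case False
    have "ln q - ln p \<le> 2 * sqrt (q - p) * p powr (-1/2)" using main False assms by simp
    also have "\<dots> \<le> 2 * sqrt (q - p) * (p powr (-1/2) + q powr (-1/2))"
      using False by (intro mult_left_mono) auto
    finally show ?thesis using False assms by (simp add: abs_if)
  qed
qed

text \<open>Replacing the larger of the two bases by the smaller one increases a negative power. The
  sum on the right separates the singularity of the kernel from that of the weight, so later bounds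
  do not depend on their relative position.\<close>

lemma powr_mix:
  fixes v e :: real
  assumes "0 < v" "0 < e"
  shows "v powr (-1/4) * e powr (-5/8) \<le> v powr (-7/8) + e powr (-7/8)"
proof (cases "v \<le> e")
  case True
  have "v powr (-1/4) * e powr (-5/8) \<le> v powr (-1/4) * v powr (-5/8)"
    using assms True by (intro mult_left_mono powr_mono2') auto
  also have "\<dots> = v powr (-7/8)" by (simp add: powr_add[symmetric])
  finally show ?thesis by (smt (verit) powr_ge_zero)
next
  case False
  have "v powr (-1/4) * e powr (-5/8) \<le> e powr (-1/4) * e powr (-5/8)"
    using assms False by (intro mult_right_mono powr_mono2') auto
  also have "\<dots> = e powr (-7/8)" by (simp add: powr_add[symmetric])
  finally show ?thesis by (smt (verit) powr_ge_zero)
qed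

lemma id_area [measurable]: "(\<lambda>x. x) \<in> borel_measurable area"
  by (intro borel_measurable_areaI continuous_intros)

interpretation area_pair: pair_sigma_finite area area
  by unfold_locales

section \<open>The logarithmic kernel and conformal maps\<close>

definition logk :: "real^3 \<Rightarrow> real^3 \<Rightarrow> real" where
  "logk x y = ln (1 - x \<bullet> y)"

text \<open>Up to linear functions, the fundamental solution of \<open>\<Delta> + 2\<close> on the sphere.\<close>

definition greenk :: "real^3 \<Rightarrow> real^3 \<Rightarrow> real" where
  "greenk x y = - (1 / (4 * pi)) * ((x \<bullet> y) * logk x y + 1)"

lemma logk_commute: "logk x y = logk y x" by (simp add: logk_def inner_commute)

lemma logk_measurable [measurable]: "logk x \<in> borel_measurable area"
  unfolding logk_def by measurable

lemma logk_measurable_pair [measurable]: "(\<lambda>z. logk (fst z) (snd z)) \<in> borel_measurable (area \<Otimes>\<^sub>M area)"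
  unfolding logk_def by measurable

lemma greenk_measurable [measurable]: "greenk x \<in> borel_measurable area"
  unfolding greenk_def by measurable

lemma greenk_measurable_pair [measurable]: "(\<lambda>z. greenk (fst z) (snd z)) \<in> borel_measurable (area \<Otimes>\<^sub>M area)"
  unfolding greenk_def by measurable

lemma abs_logk_le:
  assumes "norm x = 1" "norm y = 1" "0 < 1 - x \<bullet> y"
  shows "\<bar>logk x y\<bar> \<le> 4 * (1 - x \<bullet> y) powr (-1/4)"
  unfolding logk_def by (rule abs_ln_le[OF assms(3) one_minus_inner_le[OF assms(1,2)]])

lemma abs_inner_le_1: "norm x = 1 \<Longrightarrow> norm y = 1 \<Longrightarrow> \<bar>x \<bullet> y\<bar> \<le> 1"
  for x y :: "'a::real_inner"
  using Cauchy_Schwarz_ineq2[of x y] by simp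

lemma abs_greenk_le:
  assumes "norm x = 1" "norm y = 1" "0 < 1 - x \<bullet> y"
  shows "\<bar>greenk x y\<bar> \<le> (1/2) * (1 - x \<bullet> y) powr (-1/4)"
proof -
  let ?v = "(1 - x \<bullet> y) powr (-1/4)"
  have "\<bar>(x \<bullet> y) * logk x y + 1\<bar> \<le> \<bar>x \<bullet> y\<bar> * \<bar>logk x y\<bar> + 1"
    by (simp add: abs_mult[symmetric] abs_triangle_ineq[THEN order_trans])
  moreover have "\<bar>x \<bullet> y\<bar> * \<bar>logk x y\<bar> \<le> 1 * (4 * ?v)"
    by (intro mult_mono abs_logk_le abs_inner_le_1 assms) auto
  moreover have "(1::real) \<le> 2 * ?v"
    by (rule one_le_powr_quarter[OF assms(3) one_minus_inner_le[OF assms(1,2)]])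
  ultimately have 1: "\<bar>(x \<bullet> y) * logk x y + 1\<bar> \<le> 6 * ?v" by linarith
  have "\<bar>greenk x y\<bar> = (1 / (4 * pi)) * \<bar>(x \<bullet> y) * logk x y + 1\<bar>"
    unfolding greenk_def by (simp add: abs_mult)
  also have "\<dots> \<le> (1 / (4 * 3)) * (6 * ?v)"
    using pi_gt3 by (intro mult_mono 1 divide_left_mono) auto
  finally show ?thesis by simp
qed

text \<open>Up to a constant the kernel is twice the logarithm of the distance, and for distances
  the reverse triangle inequality bounds the change by norm (x - x').\<close>

lemma logk_holder:
  assumes "norm x = 1" "norm x' = 1" "norm y = 1" "0 < 1 - x \<bullet> y" "0 < 1 - x' \<bullet> y"
  shows "\<bar>logk x y - logk x' y\<bar> \<le> 4 * sqrt (norm (x - x')) * ((1 - x \<bullet> y) powr (-1/4) + (1 - x' \<bullet> y) powr (-1/4))"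
proof -
  have *: "logk z y = 2 * ln (norm (z - y)) - ln 2 \<and> norm (z - y) > 0 \<and> norm (z - y) powr (-1/2) \<le> (1 - z \<bullet> y) powr (-1/4)"
    if z: "norm z = 1" "0 < 1 - z \<bullet> y" for z
  proof -
    have sq: "(norm (z - y))\<^sup>2 = 2 * (1 - z \<bullet> y)" by (rule one_minus_inner) (use z assms in auto)
    then have pos: "norm (z - y) > 0" using z by (metis mult_pos_pos norm_ge_zero order_le_less power2_eq_square mult_zero_left less_irrefl zero_less_numeral)
    have "ln ((norm (z - y))\<^sup>2) = ln 2 + ln (1 - z \<bullet> y)" unfolding sq by (rule ln_mult_pos) (use z in auto)
    then have l: "2 * ln (norm (z - y)) = ln 2 + ln (1 - z \<bullet> y)" using pos by (simp add: ln_realpow)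
    have "norm (z - y) powr (-1/2) = ((norm (z - y))\<^sup>2) powr (-1/4)"
      using pos by (simp add: powr_powr flip: powr_numeral)
    also have "\<dots> = (2 * (1 - z \<bullet> y)) powr (-1/4)" unfolding sq ..
    also have "\<dots> \<le> (1 - z \<bullet> y) powr (-1/4)" using z by (intro powr_mono2') auto
    finally show ?thesis using l pos by (simp add: logk_def)
  qed
  let ?p = "norm (x - y)" let ?q = "norm (x' - y)"
  have X: "logk x y = 2 * ln ?p - ln 2" "?p > 0" "?p powr (-1/2) \<le> (1 - x \<bullet> y) powr (-1/4)"
    using *[OF assms(1,4)] by auto
  have X': "logk x' y = 2 * ln ?q - ln 2" "?q > 0" "?q powr (-1/2) \<le> (1 - x' \<bullet> y) powr (-1/4)"
    using *[OF assms(2,5)] by auto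
  have "\<bar>logk x y - logk x' y\<bar> = 2 * \<bar>ln ?p - ln ?q\<bar>"
  proof -
    have gen: "\<bar>(2 * p - l) - (2 * q - l)\<bar> = 2 * \<bar>p - q\<bar>" for p q l :: real by (auto simp: abs_if)
    show ?thesis unfolding X(1) X'(1) by (rule gen)
  qed
  also have "\<dots> \<le> 2 * (2 * sqrt \<bar>?p - ?q\<bar> * (?p powr (-1/2) + ?q powr (-1/2)))"
    using X X' by (intro mult_left_mono ln_diff_sqrt) auto
  also have "\<dots> \<le> 2 * (2 * sqrt (norm (x - x')) * ((1 - x \<bullet> y) powr (-1/4) + (1 - x' \<bullet> y) powr (-1/4)))"
  proof (intro mult_left_mono mult_mono add_mono)
    have "\<bar>?p - ?q\<bar> \<le> norm ((x - y) - (x' - y))" by (rule norm_triangle_ineq3)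
    then show "sqrt \<bar>?p - ?q\<bar> \<le> sqrt (norm (x - x'))" by simp
  qed (use X X' in auto)
  finally show ?thesis by simp
qed

lemma greenk_holder:
  assumes "norm x = 1" "norm x' = 1" "norm y = 1" "0 < 1 - x \<bullet> y" "0 < 1 - x' \<bullet> y"
  shows "\<bar>greenk x y - greenk x' y\<bar> \<le> sqrt (norm (x - x')) * ((1 - x \<bullet> y) powr (-1/4) + (1 - x' \<bullet> y) powr (-1/4))"
proof -
  let ?v = "(1 - x \<bullet> y) powr (-1/4)" let ?w = "(1 - x' \<bullet> y) powr (-1/4)"
  let ?d = "norm (x - x')"
  have "(x \<bullet> y) * logk x y - (x' \<bullet> y) * logk x' y = ((x - x') \<bullet> y) * logk x y + (x' \<bullet> y) * (logk x y - logk x' y)"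
    by (simp add: inner_diff_left algebra_simps)
  then have "\<bar>(x \<bullet> y) * logk x y - (x' \<bullet> y) * logk x' y\<bar> \<le> \<bar>(x - x') \<bullet> y\<bar> * \<bar>logk x y\<bar> + \<bar>x' \<bullet> y\<bar> * \<bar>logk x y - logk x' y\<bar>"
    by (simp add: abs_mult[symmetric] abs_triangle_ineq)
  also have "\<dots> \<le> ?d * (4 * ?v) + 1 * (4 * sqrt ?d * (?v + ?w))"
    using Cauchy_Schwarz_ineq2[of "x - x'" y] assms
    by (intro add_mono mult_mono abs_logk_le logk_holder abs_inner_le_1) auto
  also have "?d \<le> 2 * sqrt ?d"
  proof -
    have "?d \<le> 2" using norm_triangle_ineq4[of x x'] assms by simp
    then have "sqrt ?d \<le> sqrt 4" by (intro real_sqrt_le_mono) simp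
    then have "sqrt ?d * sqrt ?d \<le> 2 * sqrt ?d" by (intro mult_right_mono) auto
    then show ?thesis by simp
  qed
  then have "?d * (4 * ?v) \<le> (2 * sqrt ?d) * (4 * (?v + ?w))" by (intro mult_mono) auto
  also have "(2 * sqrt ?d) * (4 * (?v + ?w)) + 1 * (4 * sqrt ?d * (?v + ?w)) = 12 * (sqrt ?d * (?v + ?w))" by algebra
  finally have 1: "\<bar>(x \<bullet> y) * logk x y - (x' \<bullet> y) * logk x' y\<bar> \<le> 12 * (sqrt ?d * (?v + ?w))" by simp
  have "greenk x y - greenk x' y = - (1 / (4 * pi)) * ((x \<bullet> y) * logk x y - (x' \<bullet> y) * logk x' y)"
    unfolding greenk_def by algebra
  then have "\<bar>greenk x y - greenk x' y\<bar> = (1 / (4 * pi)) * \<bar>(x \<bullet> y) * logk x y - (x' \<bullet> y) * logk x' y\<bar>"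
    by (simp add: abs_mult)
  also have "\<dots> \<le> (1 / (4 * 3)) * (12 * (sqrt ?d * (?v + ?w)))"
    using pi_gt3 by (intro mult_mono 1 divide_left_mono) auto
  finally show ?thesis by simp
qed

text \<open>The weight is singular at \<open>p\<close>, which will be the antipode of the first
  vertex, where the error terms of the blown-up equation are of order 1. The value at
  \<open>p\<close> itself is left free.\<close>

definition wbd :: "real^3 \<Rightarrow> real \<Rightarrow> (real^3 \<Rightarrow> real) \<Rightarrow> bool" where
  "wbd p m g \<longleftrightarrow> norm p = 1 \<and> 0 \<le> m \<and> g \<in> borel_measurable area \<and>
    (\<forall>y. norm y = 1 \<longrightarrow> 0 < 1 - y \<bullet> p \<longrightarrow> \<bar>g y\<bar> \<le> m * (1 - y \<bullet> p) powr (-5/8))"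

text \<open>By \<open>powr_mix\<close> the product of the two singularities is at most the sum of
  single ones with exponent -7/8, and each of these integrates to \<open>sing_const\<close> wherever
  its centre lies.\<close>

lemma wbd_kernel:
  assumes g: "wbd p m g" and x: "norm x = 1" and c: "0 \<le> c"
    and k: "k \<in> borel_measurable area"
    and kb: "\<And>y. norm y = 1 \<Longrightarrow> 0 < 1 - x \<bullet> y \<Longrightarrow> 0 < 1 - y \<bullet> p \<Longrightarrow> \<bar>k y\<bar> \<le> c * (1 - x \<bullet> y) powr (-1/4)"
  shows "integrable area (\<lambda>y. k y * g y)"
    and "(\<integral>y. \<bar>k y * g y\<bar> \<partial>area) \<le> 2 * c * m * sing_const"
    and "\<bar>\<integral>y. k y * g y \<partial>area\<bar> \<le> 2 * c * m * sing_const"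
proof -
  have p: "norm p = 1" and m: "0 \<le> m" and gm: "g \<in> borel_measurable area"
    and gb: "\<And>y. norm y = 1 \<Longrightarrow> 0 < 1 - y \<bullet> p \<Longrightarrow> \<bar>g y\<bar> \<le> m * (1 - y \<bullet> p) powr (-5/8)"
    using g by (auto simp: wbd_def)
  let ?h = "\<lambda>y. c * m * ((1 - y \<bullet> x) powr (-7/8) + (1 - y \<bullet> p) powr (-7/8))"
  have hi: "integrable area ?h"
    by (intro integrable_mult_right Bochner_Integration.integrable_add integrable_sing(1) x p)
  have hv: "(\<integral>y. ?h y \<partial>area) = 2 * c * m * sing_const"
    using integrable_sing[OF x] integrable_sing[OF p] by simp
  have AEb: "AE y in area. \<bar>k y * g y\<bar> \<le> ?h y"
    using AE_area_ne[OF x] AE_area_ne[OF p] AE_space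
  proof eventually_elim
    case (elim y)
    then have y: "norm y = 1" and 1: "0 < 1 - x \<bullet> y" by (simp_all add: inner_commute)
    have "\<bar>k y * g y\<bar> \<le> (c * (1 - x \<bullet> y) powr (-1/4)) * (m * (1 - y \<bullet> p) powr (-5/8))"
      unfolding abs_mult using elim y 1 c by (intro mult_mono kb gb) auto
    also have "\<dots> = c * m * ((1 - x \<bullet> y) powr (-1/4) * (1 - y \<bullet> p) powr (-5/8))" by simp
    also have "\<dots> \<le> c * m * ((1 - x \<bullet> y) powr (-7/8) + (1 - y \<bullet> p) powr (-7/8))"
      using c m elim 1 by (intro mult_left_mono powr_mix) auto
    finally show ?case by (simp add: inner_commute)
  qed
  have mm: "(\<lambda>y. k y * g y) \<in> borel_measurable area" using k gm by simp
  show i: "integrable area (\<lambda>y. k y * g y)"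
    by (rule Bochner_Integration.integrable_bound[OF hi mm]) (use AEb in \<open>auto elim!: eventually_mono\<close>)
  show 1: "(\<integral>y. \<bar>k y * g y\<bar> \<partial>area) \<le> 2 * c * m * sing_const"
    unfolding hv[symmetric] by (rule integral_mono_AE[OF _ hi AEb]) (use i in \<open>rule integrable_abs\<close>)
  show "\<bar>\<integral>y. k y * g y \<partial>area\<bar> \<le> 2 * c * m * sing_const"
    using integral_abs_bound[of area "\<lambda>y. k y * g y"] 1 by linarith
qed

text \<open>A bounded kernel counts as one with a mild singularity at \<open>p\<close>, by
  \<open>one_le_powr_quarter\<close>.\<close>

lemma wbd_integrable:
  assumes g: "wbd p m g" and k: "k \<in> borel_measurable area" "\<And>y. norm y = 1 \<Longrightarrow> \<bar>k y\<bar> \<le> c" and c: "0 \<le> c"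
  shows "integrable area (\<lambda>y. k y * g y)"
    and "\<bar>\<integral>y. k y * g y \<partial>area\<bar> \<le> 4 * c * m * sing_const"
proof -
  have p: "norm p = 1" using g by (simp add: wbd_def)
  have b: "\<bar>k y\<bar> \<le> (2 * c) * (1 - p \<bullet> y) powr (-1/4)" if y: "norm y = 1" "0 < 1 - p \<bullet> y" for y
  proof -
    have "1 \<le> 2 * (1 - p \<bullet> y) powr (-1/4)"
      by (rule one_le_powr_quarter[OF y(2) one_minus_inner_le[OF p y(1)]])
    then have "c * 1 \<le> c * (2 * (1 - p \<bullet> y) powr (-1/4))" using c by (intro mult_left_mono) auto
    then show ?thesis using k(2)[OF y(1)] by simp
  qed
  show "integrable area (\<lambda>y. k y * g y)"
    by (rule wbd_kernel(1)[OF g p _ k(1) b]) (use c in auto)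
  show "\<bar>\<integral>y. k y * g y \<partial>area\<bar> \<le> 4 * c * m * sing_const"
    using wbd_kernel(3)[OF g p _ k(1) b] c by auto
qed

definition gpot :: "(real^3 \<Rightarrow> real) \<Rightarrow> real^3 \<Rightarrow> real" where
  "gpot g x = 2 * (\<integral>y. greenk x y * g y \<partial>area)"

lemma greenk_integrable:
  assumes "wbd p m g" "norm x = 1"
  shows "integrable area (\<lambda>y. greenk x y * g y)"
  by (rule wbd_kernel(1)[OF assms, where c="1/2"]) (auto intro: abs_greenk_le[OF assms(2), simplified] assms)

lemma gpot_bound:
  assumes "wbd p m g" "norm x = 1"
  shows "\<bar>gpot g x\<bar> \<le> 2 * m * sing_const"
  using wbd_kernel(3)[OF assms, where c="1/2" and k="greenk x"] abs_greenk_le[OF assms(2)]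
  by (simp add: gpot_def abs_mult)

lemma gpot_holder:
  assumes g: "wbd p m g" and x: "norm x = 1" "norm x' = 1"
  shows "\<bar>gpot g x - gpot g x'\<bar> \<le> 8 * m * sing_const * sqrt (norm (x - x'))"
proof -
  let ?d = "sqrt (norm (x - x'))"
  note i = greenk_integrable[OF g x(1)] greenk_integrable[OF g x(2)]
  let ?k = "\<lambda>z y. (1 - z \<bullet> y) powr (-1/4)"
  have km: "?k z \<in> borel_measurable area" for z by measurable
  have w: "integrable area (\<lambda>y. ?k z y * g y)" "(\<integral>y. \<bar>?k z y * g y\<bar> \<partial>area) \<le> 2 * 1 * m * sing_const"
    if "norm z = 1" for z
    using wbd_kernel(1,2)[OF g that, where c=1 and k="?k z"] km by simp_all
  have "gpot g x - gpot g x' = 2 * (\<integral>y. greenk x y * g y - greenk x' y * g y \<partial>area)"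
    unfolding gpot_def using i by simp
  then have "\<bar>gpot g x - gpot g x'\<bar> = 2 * \<bar>\<integral>y. greenk x y * g y - greenk x' y * g y \<partial>area\<bar>" by simp
  also have "\<bar>\<integral>y. greenk x y * g y - greenk x' y * g y \<partial>area\<bar> \<le> (\<integral>y. \<bar>greenk x y * g y - greenk x' y * g y\<bar> \<partial>area)"
    by (rule integral_abs_bound)
  also have "\<dots> \<le> (\<integral>y. ?d * (\<bar>?k x y * g y\<bar> + \<bar>?k x' y * g y\<bar>) \<partial>area)"
  proof (rule integral_mono_AE)
    show "integrable area (\<lambda>y. \<bar>greenk x y * g y - greenk x' y * g y\<bar>)"
      by (intro integrable_abs Bochner_Integration.integrable_diff i)
    show "integrable area (\<lambda>y. ?d * (\<bar>?k x y * g y\<bar> + \<bar>?k x' y * g y\<bar>))"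
      by (intro integrable_mult_right Bochner_Integration.integrable_add integrable_abs w x)
    show "AE y in area. \<bar>greenk x y * g y - greenk x' y * g y\<bar> \<le> ?d * (\<bar>?k x y * g y\<bar> + \<bar>?k x' y * g y\<bar>)"
      using AE_area_ne[OF x(1)] AE_area_ne[OF x(2)] AE_space
    proof eventually_elim
      case (elim y)
      have "\<bar>greenk x y * g y - greenk x' y * g y\<bar> = \<bar>greenk x y - greenk x' y\<bar> * \<bar>g y\<bar>"
        by (simp add: abs_mult[symmetric] left_diff_distrib)
      also have "\<dots> \<le> (?d * (?k x y + ?k x' y)) * \<bar>g y\<bar>"
        using elim by (intro mult_right_mono greenk_holder x) (auto simp: inner_commute)
      finally show ?case by (simp add: abs_mult algebra_simps)
    qed
  qed
  also have "\<dots> = ?d * ((\<integral>y. \<bar>?k x y * g y\<bar> \<partial>area) + (\<integral>y. \<bar>?k x' y * g y\<bar> \<partial>area))"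
    by (subst integral_mult_right_zero, subst Bochner_Integration.integral_add) (intro integrable_abs w x refl)+
  also have "\<dots> \<le> ?d * (2 * 1 * m * sing_const + 2 * 1 * m * sing_const)"
    by (intro mult_left_mono add_mono w x) simp
  finally show ?thesis by (simp add: algebra_simps)
qed

section \<open>Conformal dilations of the sphere\<close>

definition bub :: "real \<Rightarrow> real^3 \<Rightarrow> real^3 \<Rightarrow> real^3" where
  "bub a p x = (1 / (a - x \<bullet> p)) *\<^sub>R (sqrt (a\<^sup>2 - 1) *\<^sub>R (x - (x \<bullet> p) *\<^sub>R p) + (a * (x \<bullet> p) - 1) *\<^sub>R p)"

definition jf :: "real \<Rightarrow> real^3 \<Rightarrow> real^3 \<Rightarrow> real" where
  "jf a p x = sqrt (a\<^sup>2 - 1) / (a - x \<bullet> p)"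

lemma a_minus_pos: "a > 1 \<Longrightarrow> norm p = 1 \<Longrightarrow> norm x = 1 \<Longrightarrow> 0 < a - x \<bullet> p"
  for x :: "'a::real_inner"
  using one_minus_inner_ge[of x p] by linarith

lemma sqrt_a_pos: "a > 1 \<Longrightarrow> sqrt (a\<^sup>2 - 1) > 0"
  by (simp add: power2_eq_square less_1_mult)

lemma sqrt_a_sq: "a > 1 \<Longrightarrow> sqrt (a\<^sup>2 - 1) * sqrt (a\<^sup>2 - 1) = a\<^sup>2 - 1"
  by (simp add: power2_eq_square less_1_mult order_less_imp_le)

lemma jf_pos: "a > 1 \<Longrightarrow> norm p = 1 \<Longrightarrow> norm x = 1 \<Longrightarrow> 0 < jf a p x"
  unfolding jf_def by (intro divide_pos_pos a_minus_pos sqrt_a_pos)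

lemma jf_cont: "a > 1 \<Longrightarrow> norm p = 1 \<Longrightarrow> continuous_on S2 (jf a p)"
  unfolding jf_def using a_minus_pos[of a p] by (intro continuous_intros) fastforce

text \<open>\<open>bub\<close> is a Lorentz boost of velocity 1 / a acting on light rays: (1, x) is
  sent to a multiple of (1, bub a p x), and 1 / jf a p x is the new time component. The Lorentz
  product of (1, x) and (1, y) is 1 - x \<bullet> y and is invariant, whence the formula.\<close>

lemma bub_inner:
  assumes a: "a > 1" and p: "norm p = 1" and x: "norm x = 1" "norm y = 1"
  shows "1 - bub a p x \<bullet> bub a p y = jf a p x * jf a p y * (1 - x \<bullet> y)"
proof -
  define s where "s = sqrt (a\<^sup>2 - 1)"
  have ss: "s * s = a\<^sup>2 - 1" unfolding s_def by (rule sqrt_a_sq[OF a])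
  have pp: "p \<bullet> p = 1" using p by (simp add: norm_eq_1)
  define t where "t = x \<bullet> p"
  define u where "u = y \<bullet> p"
  define w where "w = x \<bullet> y"
  have n: "(s *\<^sub>R (x - t *\<^sub>R p) + (a * t - 1) *\<^sub>R p) \<bullet> (s *\<^sub>R (y - u *\<^sub>R p) + (a * u - 1) *\<^sub>R p)
     = (s * s) * (w - t * u) + (a * t - 1) * (a * u - 1)"
  proof -
    have e: "p \<bullet> y = u" "x \<bullet> p = t" "x \<bullet> y = w"
      unfolding t_def u_def w_def by (simp_all add: inner_commute)
    show ?thesis
      by (simp only: inner_add_left inner_add_right inner_diff_left inner_diff_right inner_scaleR_left inner_scaleR_right e pp) algebra
  qed
  have d: "a - t > 0" "a - u > 0" unfolding t_def u_def using a_minus_pos a p x by auto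
  have b: "bub a p x \<bullet> bub a p y = (1 / (a - u)) * ((1 / (a - t)) * ((s * s) * (w - t * u) + (a * t - 1) * (a * u - 1)))"
    unfolding bub_def t_def[symmetric] u_def[symmetric] s_def[symmetric] inner_scaleR_left inner_scaleR_right n ..
  have "1 - bub a p x \<bullet> bub a p y = 1 - ((a\<^sup>2 - 1) * (w - t * u) + (a * t - 1) * (a * u - 1)) / ((a - t) * (a - u))"
    unfolding b ss by simp
  also have "\<dots> = ((a - t) * (a - u) - ((a\<^sup>2 - 1) * (w - t * u) + (a * t - 1) * (a * u - 1))) / ((a - t) * (a - u))"
    using d by (simp add: diff_divide_distrib)
  also have "(a - t) * (a - u) - ((a\<^sup>2 - 1) * (w - t * u) + (a * t - 1) * (a * u - 1)) = (s * s) * (1 - w)"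
    unfolding ss by algebra
  finally show ?thesis unfolding jf_def t_def[symmetric] u_def[symmetric] s_def[symmetric] w_def by simp
qed

lemma bub_norm:
  assumes "a > 1" "norm p = 1" "norm x = 1"
  shows "norm (bub a p x) = 1"
proof -
  have "x \<bullet> x = 1" using assms(3) by (simp add: norm_eq_1)
  then have "bub a p x \<bullet> bub a p x = 1" using bub_inner[OF assms assms(3)] by simp
  then show ?thesis by (simp add: norm_eq_1)
qed

lemma bub_p:
  assumes "a > 1" "norm p = 1" "norm x = 1"
  shows "bub a p x \<bullet> p = (a * (x \<bullet> p) - 1) / (a - x \<bullet> p)"
proof -
  have pp: "p \<bullet> p = 1" using assms by (simp add: norm_eq_1)
  show ?thesis unfolding bub_def by (simp add: inner_add inner_diff pp)
qed

lemma bub_inverse: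
  assumes a: "a > 1" and p: "norm p = 1" and x: "norm x = 1"
  shows "bub a (- p) (bub a p x) = x"
proof -
  define s where "s = sqrt (a\<^sup>2 - 1)"
  have ss: "s * s = a\<^sup>2 - 1" unfolding s_def by (rule sqrt_a_sq[OF a])
  have s0: "s > 0" unfolding s_def by (rule sqrt_a_pos[OF a])
  define t where "t = x \<bullet> p"
  have d: "a - t > 0" unfolding t_def using a_minus_pos a p x by auto
  define u where "u = bub a p x"
  have up: "u \<bullet> p = (a * t - 1) / (a - t)" unfolding u_def t_def by (rule bub_p[OF assms])
  have uu: "u - (u \<bullet> p) *\<^sub>R p = (s / (a - t)) *\<^sub>R (x - t *\<^sub>R p)"
    unfolding up unfolding u_def bub_def s_def t_def by (simp add: scaleR_add_right divide_inverse mult.commute)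
  have e1: "a + u \<bullet> p = s * s / (a - t)" unfolding up ss using d by (simp add: field_simps power2_eq_square)
  have e2: "a * (u \<bullet> p) + 1 = s * s * t / (a - t)" unfolding up ss using d by (simp add: field_simps power2_eq_square)
  have "bub a (- p) u = (1 / (a + u \<bullet> p)) *\<^sub>R (s *\<^sub>R (u - (u \<bullet> p) *\<^sub>R p) + (a * (u \<bullet> p) + 1) *\<^sub>R p)"
    unfolding bub_def s_def by (simp add: algebra_simps)
  also have "\<dots> = (1 / (s * s / (a - t))) *\<^sub>R ((s * s / (a - t)) *\<^sub>R (x - t *\<^sub>R p) + (s * s / (a - t)) *\<^sub>R (t *\<^sub>R p))"
    unfolding uu e1 e2 by simp
  also have "\<dots> = (1 / (s * s / (a - t)) * (s * s / (a - t))) *\<^sub>R (x - t *\<^sub>R p + t *\<^sub>R p)"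
    by (simp only: scaleR_add_right scaleR_scaleR mult.assoc)
  also have "1 / (s * s / (a - t)) * (s * s / (a - t)) = 1" using s0 d by simp
  finally show ?thesis unfolding u_def by simp
qed

lemma bub_S2:
  assumes a: "a > 1" and p: "norm p = 1"
  shows "bub a p ` S2 = S2"
proof
  show "bub a p ` S2 \<subseteq> S2" using bub_norm[OF a p] by auto
  show "S2 \<subseteq> bub a p ` S2"
  proof
    fix x :: "real^3" assume "x \<in> S2"
    then have x: "norm x = 1" by simp
    have "bub a p (bub a (- p) x) = x" using bub_inverse[OF a, of "- p" x] p x by simp
    moreover have "bub a (- p) x \<in> S2" using bub_norm[OF a, of "- p" x] p x by simp
    ultimately show "x \<in> bub a p ` S2" by (metis image_eqI)
  qed
qed

lemma bub_dist:
  assumes a: "a > 1" and p: "norm p = 1" and x: "norm x = 1" "norm y = 1"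
  shows "(norm (bub a p x - bub a p y))\<^sup>2 = jf a p x * jf a p y * (norm (x - y))\<^sup>2"
  using bub_inner[OF assms] one_minus_inner[OF bub_norm[OF a p x(1)] bub_norm[OF a p x(2)]] one_minus_inner[OF x] by simp

lemma bub_differentiable:
  assumes "a > 1" "norm p = 1" "norm x = 1"
  shows "bub a p differentiable (at x)"
proof -
  have i: "(\<lambda>x. x \<bullet> p) differentiable (at x)"
    by (rule bounded_linear_imp_differentiable) (rule bounded_linear_inner_left)
  have "a - x \<bullet> p \<noteq> 0" using a_minus_pos[OF assms] by simp
  then show ?thesis unfolding bub_def
    by (intro differentiable_scaleR differentiable_divide differentiable_add differentiable_diff differentiable_mult
        differentiable_const differentiable_ident i)
qed

lemma bub_cont:
  assumes "a > 1" "norm p = 1"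
  shows "continuous_on S2 (bub a p)"
proof (rule continuous_at_imp_continuous_on, rule ballI)
  fix x :: "real^3" assume "x \<in> S2"
  then have "bub a p differentiable (at x)" by (intro bub_differentiable[OF assms]) simp
  then show "isCont (bub a p) x" by (rule differentiable_imp_continuous_within)
qed

lemma integral_bub:
  fixes f :: "real^3 \<Rightarrow> real"
  assumes a: "a > 1" and p: "norm p = 1" and f: "f \<in> borel_measurable area"
  shows "(\<integral>x. (jf a p x)\<^sup>2 * f (bub a p x) \<partial>area) = (\<integral>x. f x \<partial>area)"
    and "integrable area (\<lambda>x. (jf a p x)\<^sup>2 * f (bub a p x)) \<longleftrightarrow> integrable area f"
proof -
  have c: "distr (density area (\<lambda>x. ennreal ((jf a p x)\<^sup>2))) (restrict_space borel S2) (bub a p) = area"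
    "bub a p \<in> restrict_space borel S2 \<rightarrow>\<^sub>M restrict_space borel S2"
    by (rule distr_area_conformal[where j="jf a p", OF bub_S2[OF a p]];
        fact bub_dist[OF a p] jf_pos[OF a p] jf_cont[OF a p] bub_differentiable[OF a p])+
  show "(\<integral>x. (jf a p x)\<^sup>2 * f (bub a p x) \<partial>area) = (\<integral>x. f x \<partial>area)"
    by (rule integral_area_conformal(1)[OF c jf_cont[OF a p] f])
  show "integrable area (\<lambda>x. (jf a p x)\<^sup>2 * f (bub a p x)) \<longleftrightarrow> integrable area f"
    by (rule integral_area_conformal(2)[OF c jf_cont[OF a p] f])
qed

lemma bub_orth:
  assumes "orthogonal_transformation T"
  shows "T (bub a p x) = bub a (T p) (T x)"
  unfolding bub_def orth_inner[OF assms]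
  using orthogonal_transformation_linear[OF assms]
  by (simp add: linear_add linear_diff linear_scale)

lemma logk_bub:
  assumes "a > 1" "norm p = 1" "norm x = 1" "norm y = 1" "0 < 1 - x \<bullet> y"
  shows "logk (bub a p x) (bub a p y) = ln (jf a p x) + ln (jf a p y) + logk x y"
  unfolding logk_def bub_inner[OF assms(1-4)]
  using jf_pos[OF assms(1-3)] jf_pos[OF assms(1,2,4)] assms(5) by (simp add: ln_mult)

lemma logk_integrable:
  assumes x: "norm x = 1"
  shows "integrable area (logk x)"
    and "(\<integral>y. logk x y \<partial>area) = (\<integral>v. ln v \<partial>zonal_measure)"
proof -
  have w: "wbd x 2 (\<lambda>_. 1)" unfolding wbd_def
  proof (intro conjI allI impI x)
    fix y :: "real^3" assume y: "norm y = 1" "0 < 1 - y \<bullet> x"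
    have "2 powr (-5/8) \<le> (1 - y \<bullet> x) powr (-5/8)" using y one_minus_inner_le[OF y(1) x] by (intro powr_mono2') simp_all
    moreover have "2 powr (-5/8::real) \<ge> 2 powr (-1)" by (intro powr_mono) simp_all
    then have "2 powr (-5/8::real) \<ge> 1/2" by (simp add: powr_minus)
    ultimately show "\<bar>1::real\<bar> \<le> 2 * (1 - y \<bullet> x) powr (-5/8)" by simp
  qed simp_all
  have "integrable area (\<lambda>y. logk x y * 1)"
    by (rule wbd_kernel(1)[OF w x, where c=4]) (use abs_logk_le[OF x] in auto)
  then show "integrable area (logk x)" by simp
  have "(\<integral>y. ln (1 - y \<bullet> x) \<partial>area) = (\<integral>v. ln v \<partial>zonal_measure)"
    by (rule integral_zonal(1)[OF x]) simp
  then show "(\<integral>y. logk x y \<partial>area) = (\<integral>v. ln v \<partial>zonal_measure)"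
    by (simp add: logk_def inner_commute)
qed

text \<open>Rotation invariance makes the logarithmic potential of the uniform measure constant.
  Substituting \<open>bub\<close> in it and splitting the kernel by \<open>logk_bub\<close> gives
  the potential of the density (jf a p z)^2. The constant \<open>C\<close> depends on
  \<open>a\<close> and disappears in differences of potentials.\<close>

lemma bubble_potential:
  assumes a: "a > 1" and p: "norm p = 1"
  obtains C where "\<And>x. norm x = 1 \<Longrightarrow> integrable area (\<lambda>z. (jf a p z)\<^sup>2 * logk x z)"
    "\<And>x. norm x = 1 \<Longrightarrow> (\<integral>z. (jf a p z)\<^sup>2 * logk x z \<partial>area) = 4 * pi * ln (a - x \<bullet> p) + C"
proof -
  define c0 where "c0 = (\<integral>v. ln v \<partial>zonal_measure)"
  define D where "D = (\<integral>z. (jf a p z)\<^sup>2 * ln (jf a p z) \<partial>area)"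
  have jne: "jf a p z \<noteq> 0" if "norm z = 1" for z using jf_pos[OF a p that] by simp
  have i1: "integrable area (\<lambda>z. (jf a p z)\<^sup>2)"
    by (intro integrable_area_cont continuous_intros jf_cont a p)
  have v1: "(\<integral>z. (jf a p z)\<^sup>2 \<partial>area) = 4 * pi"
    using integral_bub(1)[OF a p, of "\<lambda>_. 1"] by (simp add: measure_area)
  have i2: "integrable area (\<lambda>z. (jf a p z)\<^sup>2 * ln (jf a p z))"
    by (intro integrable_area_cont continuous_intros jf_cont a p) (use jne in auto)
  have main: "integrable area (\<lambda>z. (jf a p z)\<^sup>2 * logk x z) \<and>
     (\<integral>z. (jf a p z)\<^sup>2 * logk x z \<partial>area) = c0 - ln (jf a p x) * (4 * pi) - D"
    if x: "norm x = 1" for x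
  proof -
    have bx: "norm (bub a p x) = 1" by (rule bub_norm[OF a p x])
    let ?f = "\<lambda>z. (jf a p z)\<^sup>2 * logk (bub a p x) (bub a p z)"
    let ?g = "\<lambda>z. ?f z - ln (jf a p x) * (jf a p z)\<^sup>2 - (jf a p z)\<^sup>2 * ln (jf a p z)"
    have fi: "integrable area ?f"
      using integral_bub(2)[OF a p, of "logk (bub a p x)"] logk_integrable(1)[OF bx] by simp
    have fv: "(\<integral>z. ?f z \<partial>area) = c0"
      using integral_bub(1)[OF a p, of "logk (bub a p x)"] logk_integrable(2)[OF bx] by (simp add: c0_def)
    have gi: "integrable area ?g"
      by (intro Bochner_Integration.integrable_diff fi i2 integrable_mult_right i1)
    have gv: "(\<integral>z. ?g z \<partial>area) = c0 - ln (jf a p x) * (4 * pi) - D"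
      unfolding D_def fv[symmetric] v1[symmetric]
      by (subst Bochner_Integration.integral_diff, (intro Bochner_Integration.integrable_diff fi i2 integrable_mult_right i1)+,
          subst Bochner_Integration.integral_diff, (intro fi integrable_mult_right i1)+, simp)
    have AEe: "AE z in area. (jf a p z)\<^sup>2 * logk x z = ?g z"
      using AE_area_ne[OF x] AE_space
    proof eventually_elim
      case (elim z)
      then have "logk (bub a p x) (bub a p z) = ln (jf a p x) + ln (jf a p z) + logk x z"
        by (intro logk_bub a p x) (auto simp: inner_commute)
      then show ?case by (simp add: algebra_simps)
    qed
    have jm: "(\<lambda>z. (jf a p z)\<^sup>2) \<in> borel_measurable area" using i1 by simp
    have m: "(\<lambda>z. (jf a p z)\<^sup>2 * logk x z) \<in> borel_measurable area"
      using jm by simp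
    have "integrable area (\<lambda>z. (jf a p z)\<^sup>2 * logk x z)"
      using integrable_cong_AE[OF m borel_measurable_integrable[OF gi] AEe] gi by simp
    moreover have "(\<integral>z. (jf a p z)\<^sup>2 * logk x z \<partial>area) = (\<integral>z. ?g z \<partial>area)"
      by (rule integral_cong_AE[OF m borel_measurable_integrable[OF gi] AEe])
    ultimately show ?thesis using gv by simp
  qed
  show thesis
  proof (rule that[of "c0 - D - 4 * pi * ln (sqrt (a\<^sup>2 - 1))"])
    fix x :: "real^3" assume x: "norm x = 1"
    show "integrable area (\<lambda>z. (jf a p z)\<^sup>2 * logk x z)" using main[OF x] by simp
    have e: "ln (jf a p x) = ln (sqrt (a\<^sup>2 - 1)) - ln (a - x \<bullet> p)"
      unfolding jf_def using sqrt_a_pos[OF a] a_minus_pos[OF a p x] by (simp add: ln_div)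
    show "(\<integral>z. (jf a p z)\<^sup>2 * logk x z \<partial>area) = 4 * pi * ln (a - x \<bullet> p) + (c0 - D - 4 * pi * ln (sqrt (a\<^sup>2 - 1)))"
      unfolding conjunct2[OF main[OF x]] e by (simp add: algebra_simps)
  qed
qed

section \<open>The Green potential of the operator \<open>\<Delta> + 2\<close>\<close>

lemma integrable_mult_cont:
  fixes f k :: "real^3 \<Rightarrow> real"
  assumes f: "integrable area f" and k: "continuous_on S2 k"
  shows "integrable area (\<lambda>z. f z * k z)"
proof -
  have "bounded (k ` S2)" by (intro compact_imp_bounded compact_continuous_image k compact_sphere)
  then obtain B where "\<forall>y \<in> k ` S2. norm y \<le> B" unfolding bounded_iff by blast
  then have B: "\<bar>k x\<bar> \<le> B" if "x \<in> S2" for x using that by auto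
  have m: "(\<lambda>z. f z * k z) \<in> borel_measurable area"
    using borel_measurable_areaI[OF k] f by simp
  show ?thesis
  proof (rule Bochner_Integration.integrable_bound[OF _ m])
    show "integrable area (\<lambda>z. f z * B)" using f by simp
    show "AE z in area. norm (f z * k z) \<le> norm (f z * B)"
      using AE_space
    proof eventually_elim
      case (elim z)
      then have "\<bar>k z\<bar> \<le> B" by (intro B) simp
      then show ?case by (simp add: abs_mult mult_left_mono)
    qed
  qed
qed

interpretation area_line: pair_sigma_finite area "lborel :: real measure"
  by unfold_locales

section \<open>Composition of the logarithmic kernel with the Green kernel\<close>

lemma logk_wbd:
  assumes p: "norm p = 1"
  shows "wbd p 8 (\<lambda>z. logk z p)"
  unfolding wbd_def
proof (intro conjI allI impI p)
  show "(\<lambda>z. logk z p) \<in> borel_measurable area"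
    using logk_measurable[of p] by (simp add: logk_commute[of _ p])
  fix y :: "real^3" assume y: "norm y = 1" "0 < 1 - y \<bullet> p"
  have "(1 - y \<bullet> p) powr (3/8) \<le> 2 powr (3/8)" using y one_minus_inner_le[OF y(1) p] by (intro powr_mono2) auto
  also have "2 powr (3/8) \<le> 2 powr (1::real)" by (intro powr_mono) auto
  finally have 1: "(1 - y \<bullet> p) powr (3/8) \<le> 2" by simp
  have "\<bar>logk y p\<bar> \<le> 4 * (1 - y \<bullet> p) powr (-1/4)" by (rule abs_logk_le[OF y(1) p y(2)])
  also have "(1 - y \<bullet> p) powr (-1/4) = (1 - y \<bullet> p) powr (3/8) * (1 - y \<bullet> p) powr (-5/8)" by (simp add: powr_add[symmetric])
  also have "\<dots> \<le> 2 * (1 - y \<bullet> p) powr (-5/8)" using 1 by (intro mult_right_mono) auto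
  finally show "\<bar>logk y p\<bar> \<le> 8 * (1 - y \<bullet> p) powr (-5/8)" by simp
qed simp

text \<open>The integral of the bubble density (a^2 - 1) / (a - t)^2 over a from 1 to A. Its term t
  * ln (1 - t) is what links potentials of bubbles with \<open>greenk\<close>.\<close>

definition Bfun :: "real \<Rightarrow> real \<Rightarrow> real" where
  "Bfun A t = (A - 1) + 2 * t * ln (A - t) - 2 * t * ln (1 - t) - (1 + t) + (1 - t\<^sup>2) / (A - t)"

lemma Bfun_integral:
  assumes A: "A \<ge> 2" and t: "t < 1"
  shows "has_bochner_integral lborel (\<lambda>a. (a\<^sup>2 - 1) / (a - t)\<^sup>2 * indicator {1..A} a) (Bfun A t)"
proof -
  let ?F = "\<lambda>a. a + 2 * t * ln (a - t) + (1 - t\<^sup>2) / (a - t)"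
  have "has_bochner_integral lborel (\<lambda>a. (a\<^sup>2 - 1) / (a - t)\<^sup>2 * indicator {1..A} a) (?F A - ?F 1)"
  proof (rule has_bochner_integral_FTC_Icc_real)
    fix a :: real assume a: "1 \<le> a" "a \<le> A"
    define u where "u = a - t"
    have u: "u > 0" using a t by (simp add: u_def)
    have "(?F has_real_derivative (1 + 2 * t * (1 / (a - t)) + (0 - (1 - t\<^sup>2) * 1) / ((a - t) * (a - t)))) (at a)"
      using u unfolding u_def by (auto intro!: derivative_eq_intros)
    moreover have "1 + 2 * t * (1 / u) + (0 - (1 - t\<^sup>2) * 1) / (u * u) = (a\<^sup>2 - 1) / u\<^sup>2"
    proof -
      have "1 + 2 * t * (1 / u) + (0 - (1 - t\<^sup>2) * 1) / (u * u) = (u\<^sup>2 + 2 * t * u - (1 - t\<^sup>2)) / u\<^sup>2"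
        using u by (simp add: field_simps power2_eq_square)
      also have "u\<^sup>2 + 2 * t * u - (1 - t\<^sup>2) = a\<^sup>2 - 1" unfolding u_def by algebra
      finally show ?thesis .
    qed
    ultimately show "(?F has_real_derivative (a\<^sup>2 - 1) / (a - t)\<^sup>2) (at a)" unfolding u_def by simp
    show "isCont (\<lambda>a. (a\<^sup>2 - 1) / (a - t)\<^sup>2) a" using u unfolding u_def by (intro continuous_intros) auto
  qed (use A in simp)
  moreover have "?F A - ?F 1 = Bfun A t"
  proof -
    have "(1 - t\<^sup>2) / (1 - t) = 1 + t" using t by (simp add: field_simps power2_eq_square)
    then show ?thesis unfolding Bfun_def by simp
  qed
  ultimately show ?thesis by simp
qed

lemma ln_prim_integral:
  fixes A t :: real
  assumes A: "A \<ge> 2" and t: "t < 1"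
  shows "has_bochner_integral lborel (\<lambda>a. ln (a - t) * indicator {1..A} a)
     (((A - t) * ln (A - t) - A) - ((1 - t) * ln (1 - t) - 1))"
proof (rule has_bochner_integral_FTC_Icc_real[where F="\<lambda>a::real. (a - t) * ln (a - t) - a"])
  fix a :: real assume a: "1 \<le> a" "a \<le> A"
  then show "((\<lambda>a. (a - t) * ln (a - t) - a) has_real_derivative ln (a - t)) (at a)"
    using t by (auto intro!: derivative_eq_intros)
  show "isCont (\<lambda>a. ln (a - t)) a" using a t by (intro continuous_intros) auto
qed (use A in simp)

text \<open>The bubble densities are integrated over a from 1 to A and tested against a difference
  of two logarithmic kernels. By Fubini one side contains the wanted integral through
  \<open>Bfun\<close>, and the other is explicit by \<open>bubble_potential\<close>. As A tends to
  infinity, the coefficient of ln A and the constant term are compared separately; the former yields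
  the first moment \<open>V\<close>, the latter the claim.\<close>

lemma logk_product_difference:
  assumes p: "norm p = 1" and x: "norm x = 1" and x': "norm x' = 1"
    and xp: "x \<bullet> p < 1" "x' \<bullet> p < 1"
  shows "integrable area (\<lambda>z. (logk x z - logk x' z) * ((z \<bullet> p) * logk z p))"
    and "(\<integral>z. (logk x z - logk x' z) * ((z \<bullet> p) * logk z p) \<partial>area)
      = 2 * pi * ((1 - x \<bullet> p) * ln (1 - x \<bullet> p) - (1 - x' \<bullet> p) * ln (1 - x' \<bullet> p)) + 3 * pi * (x \<bullet> p - x' \<bullet> p)"
proof -
  define dl where "dl z = logk x z - logk x' z" for z
  have dli: "integrable area dl" unfolding dl_def by (intro Bochner_Integration.integrable_diff logk_integrable x x')
  have dlm [measurable]: "dl \<in> borel_measurable area" using dli by simp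
  have dl0: "(\<integral>z. dl z \<partial>area) = 0" unfolding dl_def
    by (subst Bochner_Integration.integral_diff) (simp_all add: logk_integrable x x')
  have ltm [measurable]: "(\<lambda>z. (z \<bullet> p) * logk z p) \<in> borel_measurable area"
    using logk_measurable[of p] by (simp add: logk_commute[of _ p])
  have lt1: "integrable area (\<lambda>z. logk w z * ((z \<bullet> p) * logk z p))" if w: "norm w = 1" for w
  proof -
    have "wbd p 8 (\<lambda>z. (z \<bullet> p) * logk z p)"
      unfolding wbd_def
    proof (intro conjI allI impI p ltm)
      fix y :: "real^3" assume y: "norm y = 1" "0 < 1 - y \<bullet> p"
      have "\<bar>(y \<bullet> p) * logk y p\<bar> \<le> 1 * \<bar>logk y p\<bar>"
        unfolding abs_mult using abs_inner_le_1[OF y(1) p] by (intro mult_right_mono) auto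
      also have "\<dots> \<le> 8 * (1 - y \<bullet> p) powr (-5/8)" using logk_wbd[OF p] y by (auto simp: wbd_def)
      finally show "\<bar>(y \<bullet> p) * logk y p\<bar> \<le> 8 * (1 - y \<bullet> p) powr (-5/8)" .
    qed simp
    then show ?thesis
      by (rule wbd_kernel(1)[OF _ w, where c=4]) (auto intro: abs_logk_le[OF w, simplified])
  qed
  have lti: "integrable area (\<lambda>z. dl z * ((z \<bullet> p) * logk z p))"
    unfolding dl_def left_diff_distrib by (intro Bochner_Integration.integrable_diff lt1 x x')
  then show "integrable area (\<lambda>z. (logk x z - logk x' z) * ((z \<bullet> p) * logk z p))" by (simp add: dl_def)
  define L where "L = (\<integral>z. dl z * ((z \<bullet> p) * logk z p) \<partial>area)"
  define V where "V = (\<integral>z. dl z * (z \<bullet> p) \<partial>area)"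
  have Vi: "integrable area (\<lambda>z. dl z * (z \<bullet> p))"
    by (intro integrable_mult_cont dli continuous_intros)
  define dt where "dt = x \<bullet> p - x' \<bullet> p"
  define Psi where "Psi = (1 - x \<bullet> p) * ln (1 - x \<bullet> p) - (1 - x' \<bullet> p) * ln (1 - x' \<bullet> p)"
  \<comment> \<open>What is left of \<open>Bfun\<close> after the terms A - 2, (2 * ln A - 1) * t
    and - 2 * t * ln (1 - t). It is at most 8 / A for \<bar>t\<bar> \<le> 1.\<close>
  define R where "R A t = 2 * t * (ln (A - t) - ln A) + (1 - t\<^sup>2) / (A - t)" for A t :: real
  have tle: "\<bar>z \<bullet> p\<bar> \<le> 1" if "norm z = 1" for z using abs_inner_le_1[OF that p] .
  have Rc: "continuous_on S2 (\<lambda>z. R A (z \<bullet> p))" if "A \<ge> 2" for A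
    unfolding R_def using tle that by (intro continuous_intros) (auto simp: abs_le_iff, fastforce+)
  have Ri: "integrable area (\<lambda>z. dl z * R A (z \<bullet> p))" if "A \<ge> 2" for A
    by (rule integrable_mult_cont[OF dli Rc[OF that]])
  define err where "err A = (\<integral>z. dl z * R A (z \<bullet> p) \<partial>area)" for A
  have Beq: "dl z * Bfun A (z \<bullet> p) = (A - 2) * dl z + (2 * ln A - 1) * (dl z * (z \<bullet> p)) - 2 * (dl z * ((z \<bullet> p) * logk z p)) + dl z * R A (z \<bullet> p)"
    for A z unfolding Bfun_def R_def logk_def by (simp add: algebra_simps)
  have Bi: "integrable area (\<lambda>z. dl z * Bfun A (z \<bullet> p))" if "A \<ge> 2" for A
    unfolding Beq by (intro Bochner_Integration.integrable_add Bochner_Integration.integrable_diff integrable_mult_right dli Vi lti Ri that)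
  have Bv: "(\<integral>z. dl z * Bfun A (z \<bullet> p) \<partial>area) = (2 * ln A - 1) * V - 2 * L + err A" if "A \<ge> 2" for A
  proof -
    have "(\<integral>z. dl z * Bfun A (z \<bullet> p) \<partial>area) =
      (\<integral>z. (A - 2) * dl z \<partial>area) + (\<integral>z. (2 * ln A - 1) * (dl z * (z \<bullet> p)) \<partial>area)
       - (\<integral>z. 2 * (dl z * ((z \<bullet> p) * logk z p)) \<partial>area) + (\<integral>z. dl z * R A (z \<bullet> p) \<partial>area)"
      unfolding Beq
      using integrable_mult_right[OF dli, of "A - 2"] integrable_mult_right[OF Vi, of "2 * ln A - 1"] integrable_mult_right[OF lti, of 2] Ri[OF that]
      by (simp only: Bochner_Integration.integral_add Bochner_Integration.integral_diff Bochner_Integration.integrable_add Bochner_Integration.integrable_diff)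
    then show ?thesis by (simp only: integral_mult_right_zero dl0 V_def[symmetric] L_def[symmetric] err_def[symmetric])
  qed
  have B0: "Bfun A t \<ge> 0" if "A \<ge> 2" "t < 1" for A t
  proof -
    have "Bfun A t = (\<integral>a. (a\<^sup>2 - 1) / (a - t)\<^sup>2 * indicator {1..A} a \<partial>lborel)"
      using Bfun_integral[OF that] by (simp add: has_bochner_integral_integral_eq)
    also have "\<dots> \<ge> 0" by (rule integral_nonneg_AE) (auto simp: indicator_def)
    finally show ?thesis .
  qed
  have main: "(\<integral>z. dl z * Bfun A (z \<bullet> p) \<partial>area) =
     4 * pi * (((A - x \<bullet> p) * ln (A - x \<bullet> p) - (A - x' \<bullet> p) * ln (A - x' \<bullet> p)) - Psi)" if A: "A \<ge> 2" for A
  proof -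
    let ?b = "\<lambda>z a. (a\<^sup>2 - 1) / (a - z \<bullet> p)\<^sup>2 * indicator {1..A} a"
    have fm: "(\<lambda>(z, a). dl z * ?b z a) \<in> borel_measurable (area \<Otimes>\<^sub>M lborel)"
      by measurable
    have AEt: "AE z in area. z \<bullet> p < 1" using AE_area_ne[OF p] by eventually_elim simp
    have inner1: "AE z in area. (\<integral>a. dl z * ?b z a \<partial>lborel) = dl z * Bfun A (z \<bullet> p)"
      using AEt by eventually_elim (simp only: integral_mult_right_zero Bfun_integral[OF A, THEN has_bochner_integral_integral_eq])
    have inner2: "AE z in area. (\<integral>a. norm (dl z * ?b z a) \<partial>lborel) = \<bar>dl z * Bfun A (z \<bullet> p)\<bar>"
      using AEt
    proof eventually_elim
      case (elim z)
      have "norm (dl z * ?b z a) = \<bar>dl z\<bar> * ?b z a" for a by (auto simp: abs_mult indicator_def)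
      then have "(\<integral>a. norm (dl z * ?b z a) \<partial>lborel) = \<bar>dl z\<bar> * Bfun A (z \<bullet> p)"
        by (simp only: integral_mult_right_zero Bfun_integral[OF A elim, THEN has_bochner_integral_integral_eq])
      then show ?case using B0[OF A elim] by (simp add: abs_mult)
    qed
    have "integrable (area \<Otimes>\<^sub>M lborel) (\<lambda>(z, a). dl z * ?b z a)"
    proof (rule area_line.Fubini_integrable[OF fm])
      have m: "(\<lambda>z. \<integral>a. norm (case (z, a) of (z, a) \<Rightarrow> dl z * ?b z a) \<partial>lborel) \<in> borel_measurable area"
        using fm by (intro lborel.borel_measurable_lebesgue_integral) (simp add: split_beta')
      show "integrable area (\<lambda>z. \<integral>a. norm (case (z, a) of (z, a) \<Rightarrow> dl z * ?b z a) \<partial>lborel)"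
        by (rule integrable_cong_AE_imp[OF integrable_abs[OF Bi[OF A]] m]) (use inner2 in \<open>auto elim!: eventually_mono\<close>)
      show "AE z in area. integrable lborel (\<lambda>a. case (z, a) of (z, a) \<Rightarrow> dl z * ?b z a)"
        using AEt
      proof eventually_elim
        case (elim z)
        have "integrable lborel (?b z)" using Bfun_integral[OF A elim] by (rule integrable.intros)
        then show ?case unfolding split_conv by (rule integrable_mult_right)
      qed
    qed
    from area_line.Fubini_integral[OF this]
    have "(\<integral>a. (\<integral>z. dl z * ?b z a \<partial>area) \<partial>lborel) = (\<integral>z. (\<integral>a. dl z * ?b z a \<partial>lborel) \<partial>area)" .
    also have "\<dots> = (\<integral>z. dl z * Bfun A (z \<bullet> p) \<partial>area)"
    proof (rule integral_cong_AE[OF _ _ inner1])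
      show "(\<lambda>z. \<integral>a. dl z * ?b z a \<partial>lborel) \<in> borel_measurable area"
        using fm by (intro lborel.borel_measurable_lebesgue_integral)
      show "(\<lambda>z. dl z * Bfun A (z \<bullet> p)) \<in> borel_measurable area" using Bi[OF A] by simp
    qed
    finally have e1: "(\<integral>z. dl z * Bfun A (z \<bullet> p) \<partial>area) = (\<integral>a. (\<integral>z. dl z * ?b z a \<partial>area) \<partial>lborel)" ..
    \<comment> \<open>For fixed a the integral is a difference of two bubble potentials. At a = 1
      there is no bubble, but this is a single point of the outer integration.\<close>
    have inner3: "(\<integral>z. dl z * ?b z a \<partial>area) = 4 * pi * (ln (a - x \<bullet> p) * indicator {1..A} a - ln (a - x' \<bullet> p) * indicator {1..A} a)"
      if "a \<noteq> 1" for a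
    proof (cases "a \<in> {1..A}")
      case True
      then have a: "a > 1" using that by simp
      obtain C where C: "\<And>x. norm x = 1 \<Longrightarrow> integrable area (\<lambda>z. (jf a p z)\<^sup>2 * logk x z)"
        "\<And>x. norm x = 1 \<Longrightarrow> (\<integral>z. (jf a p z)\<^sup>2 * logk x z \<partial>area) = 4 * pi * ln (a - x \<bullet> p) + C"
        using bubble_potential[OF a p] by blast
      have j: "(jf a p z)\<^sup>2 = (a\<^sup>2 - 1) / (a - z \<bullet> p)\<^sup>2" for z
        unfolding jf_def using sqrt_a_sq[OF a] by (simp add: power2_eq_square)
      have "(\<integral>z. dl z * ?b z a \<partial>area) = (\<integral>z. (jf a p z)\<^sup>2 * logk x z - (jf a p z)\<^sup>2 * logk x' z \<partial>area)"
      proof (intro Bochner_Integration.integral_cong refl)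
        fix z
        have ind: "indicator {1..A} a = (1::real)" using True by simp
        show "dl z * ?b z a = (jf a p z)\<^sup>2 * logk x z - (jf a p z)\<^sup>2 * logk x' z"
          unfolding dl_def j ind by (simp only: mult_1_right left_diff_distrib mult.commute)
      qed
      also have "\<dots> = 4 * pi * ln (a - x \<bullet> p) - 4 * pi * ln (a - x' \<bullet> p)"
        by (subst Bochner_Integration.integral_diff) (simp_all add: C x x')
      finally show ?thesis using True by (simp add: algebra_simps)
    qed simp
    have AE1: "AE a in lborel. a \<noteq> (1::real)" by (rule AE_lborel_singleton)
    have i1: "has_bochner_integral lborel (\<lambda>a. 4 * pi * (ln (a - x \<bullet> p) * indicator {1..A} a - ln (a - x' \<bullet> p) * indicator {1..A} a))
      (4 * pi * ((((A - x \<bullet> p) * ln (A - x \<bullet> p) - A) - ((1 - x \<bullet> p) * ln (1 - x \<bullet> p) - 1))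
       - (((A - x' \<bullet> p) * ln (A - x' \<bullet> p) - A) - ((1 - x' \<bullet> p) * ln (1 - x' \<bullet> p) - 1))))"
      by (intro has_bochner_integral_mult_right has_bochner_integral_diff ln_prim_integral A xp)
    have "(\<integral>a. (\<integral>z. dl z * ?b z a \<partial>area) \<partial>lborel) =
       (\<integral>a. 4 * pi * (ln (a - x \<bullet> p) * indicator {1..A} a - ln (a - x' \<bullet> p) * indicator {1..A} a) \<partial>lborel)"
    proof (rule integral_cong_AE)
      show "(\<lambda>a. \<integral>z. dl z * ?b z a \<partial>area) \<in> borel_measurable lborel"
      proof (rule area.borel_measurable_lebesgue_integral)
        show "(\<lambda>(a, z). dl z * ?b z a) \<in> borel_measurable (lborel \<Otimes>\<^sub>M area)" by measurable
      qed
    qed (use AE1 inner3 in \<open>auto elim!: eventually_mono\<close>)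
    also have "\<dots> = 4 * pi * (((A - x \<bullet> p) * ln (A - x \<bullet> p) - (A - x' \<bullet> p) * ln (A - x' \<bullet> p)) - Psi)"
      using has_bochner_integral_integral_eq[OF i1] unfolding Psi_def by (simp add: algebra_simps)
    finally show ?thesis unfolding e1 .
  qed
  have errb: "\<bar>err A\<bar> \<le> 8 / A * (\<integral>z. \<bar>dl z\<bar> \<partial>area)" if A: "A \<ge> 2" for A
  proof -
    have Rb: "\<bar>R A t\<bar> \<le> 8 / A" if t: "\<bar>t\<bar> \<le> 1" for t
    proof -
      have tt: "-1 \<le> t" "t \<le> 1" using t by auto
      have At: "A - t \<ge> A / 2" using A tt by simp
      have pos: "A - t > 0" "A > 0" using A tt by auto
      have "ln (A - t) - ln A = ln ((A - t) / A)" using pos by (simp add: ln_div)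
      also have "\<dots> \<le> (A - t) / A - 1" using pos by (intro ln_le_minus_one) simp
      also have "\<dots> = - t / A" using pos by (simp add: field_simps)
      also have "\<dots> \<le> 1 / A" using tt pos by (intro divide_right_mono) auto
      finally have u: "ln (A - t) - ln A \<le> 1 / A" .
      have "ln A - ln (A - t) = ln (A / (A - t))" using pos by (simp add: ln_div)
      also have "\<dots> \<le> A / (A - t) - 1" using pos by (intro ln_le_minus_one) simp
      also have "\<dots> = t / (A - t)" using pos by (simp add: field_simps)
      also have "\<dots> \<le> 1 / (A - t)" using tt pos by (intro divide_right_mono) auto
      also have "\<dots> \<le> 1 / (A / 2)" using At pos by (intro divide_left_mono) auto
      finally have l: "ln A - ln (A - t) \<le> 2 / A" by simp
      have "1 / A \<le> 2 / A" using pos by (intro divide_right_mono) auto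
      then have ab: "\<bar>ln (A - t) - ln A\<bar> \<le> 2 / A" using u l by linarith
      have "\<bar>2 * t * (ln (A - t) - ln A)\<bar> = 2 * (\<bar>t\<bar> * \<bar>ln (A - t) - ln A\<bar>)" by (simp add: abs_mult)
      also have "\<dots> \<le> 2 * (1 * (2 / A))" using ab t by (intro mult_left_mono mult_mono) auto
      finally have 1: "\<bar>2 * t * (ln (A - t) - ln A)\<bar> \<le> 4 / A" by simp
      have "t\<^sup>2 \<le> 1" using t by (simp add: abs_square_le_1)
      then have "\<bar>(1 - t\<^sup>2) / (A - t)\<bar> = (1 - t\<^sup>2) / (A - t)" using pos by simp
      also have "\<dots> \<le> 1 / (A / 2)" using At pos by (intro frac_le) auto
      finally have 2: "\<bar>(1 - t\<^sup>2) / (A - t)\<bar> \<le> 2 / A" by simp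
      have "\<bar>R A t\<bar> \<le> 4 / A + 2 / A" unfolding R_def using 1 2 by linarith
      also have "\<dots> \<le> 8 / A" using pos by (simp add: add_divide_distrib[symmetric] divide_right_mono)
      finally show ?thesis .
    qed
    have "\<bar>err A\<bar> \<le> (\<integral>z. \<bar>dl z * R A (z \<bullet> p)\<bar> \<partial>area)" unfolding err_def by (rule integral_abs_bound)
    also have "\<dots> \<le> (\<integral>z. 8 / A * \<bar>dl z\<bar> \<partial>area)"
    proof (rule integral_mono)
      show "integrable area (\<lambda>z. \<bar>dl z * R A (z \<bullet> p)\<bar>)" using Ri[OF A] by (rule integrable_abs)
      show "integrable area (\<lambda>z. 8 / A * \<bar>dl z\<bar>)" using dli by (intro integrable_mult_right integrable_abs)
      fix z assume "z \<in> space area"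
      then have "\<bar>R A (z \<bullet> p)\<bar> \<le> 8 / A" by (intro Rb tle) simp
      then have "\<bar>dl z\<bar> * \<bar>R A (z \<bullet> p)\<bar> \<le> \<bar>dl z\<bar> * (8 / A)" by (intro mult_left_mono) auto
      then show "\<bar>dl z * R A (z \<bullet> p)\<bar> \<le> 8 / A * \<bar>dl z\<bar>" by (simp add: abs_mult mult.commute)
    qed
    also have "\<dots> = 8 / A * (\<integral>z. \<bar>dl z\<bar> \<partial>area)" by simp
    finally show ?thesis .
  qed
  have err0: "(err \<longlongrightarrow> 0) at_top"
  proof (rule Lim_null_comparison)
    show "\<forall>\<^sub>F A in at_top. norm (err A) \<le> 8 / A * (\<integral>z. \<bar>dl z\<bar> \<partial>area)"
      using eventually_ge_at_top[of "2::real"] by eventually_elim (use errb in simp)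
    have "((\<lambda>A::real. 8 / A) \<longlongrightarrow> 0) at_top" by real_asymp
    then show "((\<lambda>A. 8 / A * (\<integral>z. \<bar>dl z\<bar> \<partial>area)) \<longlongrightarrow> 0) at_top"
      by (rule tendsto_mult_left_zero)
  qed
  define h where "h A = ((A - x \<bullet> p) * ln (A - x \<bullet> p) - (A - x' \<bullet> p) * ln (A - x' \<bullet> p)) + (x \<bullet> p - x' \<bullet> p) * ln A" for A
  have hlim: "(h \<longlongrightarrow> - dt) at_top"
  proof -
    have "((\<lambda>A::real. (A - u) * (ln (A - u) - ln A)) \<longlongrightarrow> - u) at_top" for u by real_asymp
    from tendsto_diff[OF this[of "x \<bullet> p"] this[of "x' \<bullet> p"]]
    have "((\<lambda>A. (A - x \<bullet> p) * (ln (A - x \<bullet> p) - ln A) - (A - x' \<bullet> p) * (ln (A - x' \<bullet> p) - ln A)) \<longlongrightarrow> - dt) at_top"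
      by (simp add: dt_def)
    moreover have "(\<lambda>A. (A - x \<bullet> p) * (ln (A - x \<bullet> p) - ln A) - (A - x' \<bullet> p) * (ln (A - x' \<bullet> p) - ln A)) = h"
      unfolding h_def by (rule ext) (simp add: algebra_simps)
    ultimately show ?thesis by simp
  qed
  have eqA: "(2 * V + 4 * pi * dt) * ln A = 4 * pi * h A - 4 * pi * Psi + 2 * L + V - err A" if "A \<ge> 2" for A
    using main[OF that] Bv[OF that] unfolding h_def dt_def by (simp add: algebra_simps)
  define K where "K = 4 * pi * (- dt) - 4 * pi * Psi + 2 * L + V - 0"
  have lim: "((\<lambda>A. 4 * pi * h A - 4 * pi * Psi + 2 * L + V - err A) \<longlongrightarrow> K) at_top"
    unfolding K_def by (intro tendsto_intros hlim err0)
  \<comment> \<open>Divided by ln A, the right-hand side of \<open>eqA\<close> tends to 0, so the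
    constant coefficient on the left vanishes.\<close>
  have c0: "2 * V + 4 * pi * dt = 0"
  proof -
    have "((\<lambda>A. (4 * pi * h A - 4 * pi * Psi + 2 * L + V - err A) * (1 / ln A)) \<longlongrightarrow> K * 0) at_top"
    proof (rule tendsto_mult[OF lim])
      show "((\<lambda>A::real. 1 / ln A) \<longlongrightarrow> 0) at_top" by real_asymp
    qed
    moreover have "\<forall>\<^sub>F A in at_top. (4 * pi * h A - 4 * pi * Psi + 2 * L + V - err A) * (1 / ln A) = 2 * V + 4 * pi * dt"
      using eventually_ge_at_top[of "2::real"]
    proof eventually_elim
      case (elim A)
      then show ?case using eqA[OF elim, symmetric] by simp
    qed
    ultimately have "((\<lambda>A::real. 2 * V + 4 * pi * dt) \<longlongrightarrow> K * 0) at_top" by (rule Lim_transform_eventually)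
    then show ?thesis by (simp add: tendsto_const_iff)
  qed
  have "K = 0"
  proof -
    have "\<forall>\<^sub>F A in at_top. 4 * pi * h A - 4 * pi * Psi + 2 * L + V - err A = 0"
      using eventually_ge_at_top[of "2::real"] by eventually_elim (use eqA c0 in simp)
    then have "((\<lambda>A::real. 0) \<longlongrightarrow> K) at_top" using lim by (rule Lim_transform_eventually[rotated])
    then show ?thesis by (simp add: tendsto_const_iff)
  qed
  then have "2 * L = 4 * pi * Psi + 4 * pi * dt - V" unfolding K_def by simp
  moreover have "V = - 2 * pi * dt" using c0 by simp
  ultimately have "L = 2 * pi * Psi + 3 * pi * dt" by simp
  then show "(\<integral>z. (logk x z - logk x' z) * ((z \<bullet> p) * logk z p) \<partial>area)
      = 2 * pi * ((1 - x \<bullet> p) * ln (1 - x \<bullet> p) - (1 - x' \<bullet> p) * ln (1 - x' \<bullet> p)) + 3 * pi * (x \<bullet> p - x' \<bullet> p)"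
    unfolding L_def Psi_def dt_def dl_def .
qed

lemma greenk_pair_integrable:
  assumes g: "wbd p m g" and k: "integrable area k"
  shows "integrable (area \<Otimes>\<^sub>M area) (\<lambda>(z, y). k z * (greenk z y * g y))"
proof (rule area_pair.Fubini_integrable)
  have gm [measurable]: "g \<in> borel_measurable area" using g by (simp add: wbd_def)
  have km [measurable]: "k \<in> borel_measurable area" using k by simp
  show fm: "(\<lambda>(z, y). k z * (greenk z y * g y)) \<in> borel_measurable (area \<Otimes>\<^sub>M area)"
    by (simp add: split_beta')
  have b: "(\<integral>y. \<bar>greenk z y * g y\<bar> \<partial>area) \<le> m * sing_const" if "norm z = 1" for z
    using wbd_kernel(2)[OF g that, where c="1/2" and k="greenk z"] abs_greenk_le[OF that] by simp
  have m: "(\<lambda>z. \<integral>y. norm (case (z, y) of (z, y) \<Rightarrow> k z * (greenk z y * g y)) \<partial>area) \<in> borel_measurable area"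
    using fm by (intro area.borel_measurable_lebesgue_integral) (simp add: split_beta')
  show "integrable area (\<lambda>z. \<integral>y. norm (case (z, y) of (z, y) \<Rightarrow> k z * (greenk z y * g y)) \<partial>area)"
  proof (rule Bochner_Integration.integrable_bound[OF _ m])
    show "integrable area (\<lambda>z. k z * (m * sing_const))" using k by simp
    show "AE z in area. norm (\<integral>y. norm (case (z, y) of (z, y) \<Rightarrow> k z * (greenk z y * g y)) \<partial>area)
        \<le> norm (k z * (m * sing_const))"
      using AE_space
    proof eventually_elim
      case (elim z)
      have "(\<integral>y. norm (case (z, y) of (z, y) \<Rightarrow> k z * (greenk z y * g y)) \<partial>area) = \<bar>k z\<bar> * (\<integral>y. \<bar>greenk z y * g y\<bar> \<partial>area)"
        by (simp only: split_conv real_norm_def abs_mult[of "k z"] integral_mult_right_zero)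
      moreover have "\<dots> \<le> \<bar>k z\<bar> * (m * sing_const)" using elim by (intro mult_left_mono b) auto
      moreover have "0 \<le> (\<integral>y. \<bar>greenk z y * g y\<bar> \<partial>area)" by (rule integral_nonneg_AE) simp
      moreover have "0 \<le> m" using g by (simp add: wbd_def)
      ultimately show ?case using sing_const_nonneg by (simp add: abs_mult)
    qed
  qed
  show "AE z in area. integrable area (\<lambda>y. case (z, y) of (z, y) \<Rightarrow> k z * (greenk z y * g y))"
    using AE_space
  proof eventually_elim
    case (elim z)
    then have "integrable area (\<lambda>y. greenk z y * g y)" by (intro greenk_integrable[OF g]) simp
    then show ?case unfolding split_conv by (rule integrable_mult_right)
  qed
qed

lemma gpot_integral_swap:
  assumes g: "wbd p m g" and k: "integrable area k"
  shows "integrable area (\<lambda>z. k z * gpot g z)"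
    and "integrable area (\<lambda>y. g y * (\<integral>z. k z * greenk z y \<partial>area))"
    and "(\<integral>z. k z * gpot g z \<partial>area) = 2 * (\<integral>y. g y * (\<integral>z. k z * greenk z y \<partial>area) \<partial>area)"
proof -
  note i = greenk_pair_integrable[OF g k]
  have e1: "(\<integral>y. k z * (greenk z y * g y) \<partial>area) = k z * gpot g z / 2" for z
    unfolding gpot_def by simp
  have e2: "(\<integral>z. k z * (greenk z y * g y) \<partial>area) = g y * (\<integral>z. k z * greenk z y \<partial>area)" for y
  proof -
    have "(\<integral>z. k z * (greenk z y * g y) \<partial>area) = (\<integral>z. g y * (k z * greenk z y) \<partial>area)"
      by (rule Bochner_Integration.integral_cong) simp_all
    then show ?thesis by simp
  qed
  have "integrable area (\<lambda>z. k z * gpot g z / 2)"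
    using area_pair.integrable_fst[OF i] unfolding e1 .
  then have "integrable area (\<lambda>z. 2 * (k z * gpot g z / 2))" by (rule integrable_mult_right)
  then show "integrable area (\<lambda>z. k z * gpot g z)" by simp
  show "integrable area (\<lambda>y. g y * (\<integral>z. k z * greenk z y \<partial>area))"
    using area_pair.integrable_snd[OF i] unfolding e2 .
  have "(\<integral>y. g y * (\<integral>z. k z * greenk z y \<partial>area) \<partial>area) = (\<integral>z. k z * gpot g z / 2 \<partial>area)"
    using area_pair.Fubini_integral[OF i] unfolding e1 e2 .
  then show "(\<integral>z. k z * gpot g z \<partial>area) = 2 * (\<integral>y. g y * (\<integral>z. k z * greenk z y \<partial>area) \<partial>area)"
    by simp
qed

section \<open>Means of the kernels and the equation for the potential\<close>

lemma log_moment: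
  shows "integrable zonal_measure (\<lambda>v. (1 - v) * ln v)" "(\<integral>v. (1 - v) * ln v \<partial>zonal_measure) = - (2 * pi)"
proof -
  have cont0: "continuous_on {0..2} (\<lambda>v::real. v * ln v)"
  proof (rule continuous_on_eq_continuous_within[THEN iffD2], rule ballI)
    fix v :: real assume v: "v \<in> {0..2}"
    show "continuous (at v within {0..2}) (\<lambda>v. v * ln v)"
    proof (cases "v = 0")
      case True
      have "((\<lambda>v::real. v * ln v) \<longlongrightarrow> 0) (at_right 0)" by real_asymp
      then show ?thesis unfolding True continuous_within by (simp add: at_within_Icc_at_right)
    next
      case False
      then show ?thesis by (intro continuous_intros) auto
    qed
  qed
  let ?F = "\<lambda>v::real. v * ln v - v - (v / 2) * (v * ln v) + v\<^sup>2 / 4"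
  have "((\<lambda>v. (1 - v) * ln v) has_integral (?F 2 - ?F 0)) {0..2}"
  proof (rule fundamental_theorem_of_calculus_interior)
    show "continuous_on {0..2} ?F" by (intro continuous_intros cont0) auto
    fix v :: real assume v: "v \<in> {0<..<2}"
    then show "(?F has_vector_derivative (1 - v) * ln v) (at v)"
      unfolding has_real_derivative_iff_has_vector_derivative[symmetric]
      by (auto intro!: derivative_eq_intros simp: field_simps power2_eq_square)
  qed simp
  then have hi: "((\<lambda>v::real. (1 - v) * ln v) has_integral (-1)) {0..2}" by simp
  have "(\<lambda>v::real. (1 - v) * ln v) absolutely_integrable_on {0..2}"
  proof (rule measurable_bounded_by_integrable_imp_absolutely_integrable)
    show "(\<lambda>v::real. (1 - v) * ln v) \<in> borel_measurable (lebesgue_on {0..2})"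
      by (rule measurable_restrict_space1) (rule measurable_completion, simp)
    have "((\<lambda>v::real. v powr (-1/4)) has_integral (2 powr (-1/4 + 1) / (-1/4 + 1))) {0..2}"
      by (rule has_integral_powr_from_0) simp_all
    then have "(\<lambda>v::real. v powr (-1/4)) integrable_on {0..2}" by blast
    then show "(\<lambda>v::real. 4 * v powr (-1/4)) integrable_on {0..2}" using integrable_cmul[of _ _ 4] by fastforce
    fix v :: real assume v: "v \<in> {0..2}"
    show "norm ((1 - v) * ln v) \<le> 4 * v powr (-1/4)"
    proof (cases "v = 0")
      case False
      have "\<bar>1 - v\<bar> * \<bar>ln v\<bar> \<le> 1 * (4 * v powr (-1/4))"
        using v False by (intro mult_mono abs_ln_le) auto
      then show ?thesis by (simp add: abs_mult)
    qed simp
  qed simp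
  from zonal_has_integral[OF _ this]
  show "integrable zonal_measure (\<lambda>v. (1 - v) * ln v)" "(\<integral>v. (1 - v) * ln v \<partial>zonal_measure) = - (2 * pi)"
    using integral_unique[OF hi] by simp_all
qed

lemma zonal_total: "integrable zonal_measure (\<lambda>_. c)" "(\<integral>v. c \<partial>zonal_measure) = 4 * pi * c" for c :: real
proof -
  have p: "norm (axis 3 1 :: real^3) = 1" by (rule norm_axis_1)
  show "integrable zonal_measure (\<lambda>_. c)"
    using integral_zonal(2)[OF p, of "\<lambda>_. c"] by simp
  show "(\<integral>v. c \<partial>zonal_measure) = 4 * pi * c"
  proof -
    have "(\<integral>x. c \<partial>area) = (\<integral>v. c \<partial>zonal_measure)"
      by (rule integral_zonal(1)[OF p, of "\<lambda>_. c"]) simp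
    moreover have "(\<integral>x. c \<partial>area) = 4 * pi * c" by (simp add: measure_area)
    ultimately show ?thesis by (simp only:)
  qed
qed

text \<open>This mean fixes the summand 1 in \<open>greenk\<close>: \<Delta> + 2 acts on constants
  as multiplication by 2, so a potential for the right-hand side - 2 * g must have minus the mean of
  \<open>g\<close>. Then the density \<open>gpot g + g\<close> in \<open>gpot_equation\<close> has
  total mass 0.\<close>

lemma greenk_mean:
  assumes "norm y = 1"
  shows "integrable area (\<lambda>z. greenk z y)" "(\<integral>z. greenk z y \<partial>area) = - (1/2)"
proof -
  let ?k = "\<lambda>v. - (1 / (4 * pi)) * ((1 - v) * ln v + 1)"
  have ki: "integrable zonal_measure ?k"
    by (intro integrable_mult_right Bochner_Integration.integrable_add log_moment(1) zonal_total(1))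
  have kv: "(\<integral>v. ?k v \<partial>zonal_measure) = - (1 / (4 * pi)) * (- (2 * pi) + 4 * pi * 1)"
    unfolding log_moment(2)[symmetric] zonal_total(2)[symmetric]
    by (subst integral_mult_right_zero, subst Bochner_Integration.integral_add) (simp_all add: log_moment(1) zonal_total(1))
  have e: "greenk z y = ?k (1 - z \<bullet> y)" for z by (simp add: greenk_def logk_def)
  show "integrable area (\<lambda>z. greenk z y)" unfolding e
    by (subst integral_zonal(2)[OF assms, of ?k]) (use ki in simp_all)
  show "(\<integral>z. greenk z y \<partial>area) = - (1/2)" unfolding e
    by (subst integral_zonal(1)[OF assms, of ?k]) (simp, subst kv, simp)
qed

lemma gpot_mean:
  assumes g: "wbd p m g"
  shows "integrable area (gpot g)" "(\<integral>z. gpot g z \<partial>area) = - (\<integral>y. g y \<partial>area)"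
proof -
  have one: "integrable area (\<lambda>_. 1 :: real)" by simp
  note sw = gpot_integral_swap[OF g one, simplified]
  show "integrable area (gpot g)" using sw(1) by simp
  have gi: "integrable area g" using wbd_integrable(1)[OF g, of "\<lambda>_. 1" 1] by simp
  have "(\<integral>y. g y * (\<integral>z. greenk z y \<partial>area) \<partial>area) = (\<integral>y. g y * (- (1/2)) \<partial>area)"
    by (rule Bochner_Integration.integral_cong) (simp_all add: greenk_mean)
  then show "(\<integral>z. gpot g z \<partial>area) = - (\<integral>y. g y \<partial>area)"
    using sw(3) by simp
qed

text \<open>The integral form of \<Delta> \<chi> + 2 * (\<chi> + g) = 0 for the potential \<chi>. By
  \<open>logk_product_difference\<close>, composing the logarithmic kernel with
  \<open>greenk\<close> returns the two kernels and a multiple of the linear function (x - x')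
  \<bullet> y, which the orthogonality of \<open>g\<close> to linear functions removes.\<close>

theorem gpot_equation:
  assumes g: "wbd p m g" and orth: "\<And>q. (\<integral>y. g y * (q \<bullet> y) \<partial>area) = 0"
    and x: "norm x = 1" and x': "norm x' = 1"
  shows "gpot g x - gpot g x' = - (1 / (2 * pi)) * (\<integral>z. (logk x z - logk x' z) * (gpot g z + g z) \<partial>area)"
    and "integrable area (\<lambda>z. logk x z * (gpot g z + g z))"
proof -
  have gm [measurable]: "g \<in> borel_measurable area" using g by (simp add: wbd_def)
  have lg: "integrable area (\<lambda>y. logk w y * g y)" if "norm w = 1" for w
    by (rule wbd_kernel(1)[OF g that, where c=4]) (auto intro: abs_logk_le[OF that, simplified])
  have lgp: "integrable area (\<lambda>z. logk w z * gpot g z)" if "norm w = 1" for w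
    by (rule gpot_integral_swap(1)[OF g logk_integrable(1)[OF that]])
  show "integrable area (\<lambda>z. logk x z * (gpot g z + g z))"
    unfolding distrib_left by (intro Bochner_Integration.integrable_add lg lgp x)
  define dl where "dl z = logk x z - logk x' z" for z
  have dli: "integrable area dl" unfolding dl_def by (intro Bochner_Integration.integrable_diff logk_integrable x x')
  have dl0: "(\<integral>z. dl z \<partial>area) = 0" unfolding dl_def
    by (subst Bochner_Integration.integral_diff) (simp_all add: logk_integrable x x')
  have dlg: "integrable area (\<lambda>y. dl y * g y)" unfolding dl_def left_diff_distrib
    by (intro Bochner_Integration.integrable_diff lg x x')
  define T where "T y = (x \<bullet> y) * logk x y - (x' \<bullet> y) * logk x' y" for y
  have gre: "(w \<bullet> y) * logk w y = - (4 * pi) * greenk w y - 1" for w y unfolding greenk_def by simp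
  have Te: "T y = - (4 * pi) * (greenk x y - greenk x' y)" for y unfolding T_def gre by algebra
  have gTi: "integrable area (\<lambda>y. g y * T y)"
  proof -
    have "integrable area (\<lambda>y. - (4 * pi) * (greenk x y * g y - greenk x' y * g y))"
      by (intro integrable_mult_right Bochner_Integration.integrable_diff greenk_integrable[OF g] x x')
    moreover have "(\<lambda>y. - (4 * pi) * (greenk x y * g y - greenk x' y * g y)) = (\<lambda>y. g y * T y)"
      unfolding Te by (rule ext) algebra
    ultimately show ?thesis by (simp only:)
  qed
  have gT: "gpot g x - gpot g x' = - (1 / (2 * pi)) * (\<integral>y. g y * T y \<partial>area)"
  proof -
    have "(\<integral>y. g y * T y \<partial>area) = (\<integral>y. - (4 * pi) * (greenk x y * g y - greenk x' y * g y) \<partial>area)"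
      unfolding Te by (rule Bochner_Integration.integral_cong) (simp_all add: algebra_simps)
    also have "\<dots> = - (4 * pi) * ((\<integral>y. greenk x y * g y \<partial>area) - (\<integral>y. greenk x' y * g y \<partial>area))"
      by (subst integral_mult_right_zero, subst Bochner_Integration.integral_diff) (simp_all add: greenk_integrable[OF g] x x')
    finally show ?thesis unfolding gpot_def by simp
  qed
  have inner: "AE y in area. (\<integral>z. dl z * greenk z y \<partial>area) =
      - (1/2) * (dl y - T y) - (3/4) * ((x - x') \<bullet> y)"
    using AE_area_ne[OF x] AE_area_ne[OF x'] AE_space
  proof eventually_elim
    case (elim y)
    then have y: "norm y = 1" "x \<bullet> y < 1" "x' \<bullet> y < 1" by (simp_all add: inner_commute)
    note lp = logk_product_difference[OF y(1) x x' y(2,3), folded dl_def]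
    have "(\<integral>z. dl z * greenk z y \<partial>area) = (\<integral>z. - (1 / (4 * pi)) * (dl z * ((z \<bullet> y) * logk z y) + dl z) \<partial>area)"
      unfolding greenk_def by (rule Bochner_Integration.integral_cong) (simp_all add: algebra_simps)
    also have "\<dots> = - (1 / (4 * pi)) * ((\<integral>z. dl z * ((z \<bullet> y) * logk z y) \<partial>area) + 0)"
      unfolding dl0[symmetric] by (subst integral_mult_right_zero, subst Bochner_Integration.integral_add) (simp_all add: lp(1) dli)
    also have "(\<integral>z. dl z * ((z \<bullet> y) * logk z y) \<partial>area) = 2 * pi * (dl y - T y) + 3 * pi * ((x - x') \<bullet> y)"
      unfolding lp(2) unfolding dl_def T_def logk_def by (simp add: inner_diff_left algebra_simps)
    also have "- (1 / (4 * pi)) * (2 * pi * (dl y - T y) + 3 * pi * ((x - x') \<bullet> y) + 0)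
        = - (1/2) * (dl y - T y) - (3/4) * ((x - x') \<bullet> y)"
    proof -
      have alg: "- (1 / (4 * pi)) * (2 * pi * u + 3 * pi * v + 0) = - (1/2) * u - (3/4) * v" for u v :: real
        by (simp add: field_simps)
      show ?thesis by (rule alg)
    qed
    finally show ?case .
  qed
  have mi: "(\<lambda>y. \<integral>z. dl z * greenk z y \<partial>area) \<in> borel_measurable area"
  proof (rule area.borel_measurable_lebesgue_integral)
    have [measurable]: "dl \<in> borel_measurable area" using dli by simp
    have "(\<lambda>z. greenk (fst z) (snd z)) = (\<lambda>z. greenk (snd z) (fst z))" by (rule ext) (simp add: greenk_def logk_def inner_commute)
    then have "(\<lambda>z. greenk (snd z) (fst z)) \<in> borel_measurable (area \<Otimes>\<^sub>M area)"
      using greenk_measurable_pair by simp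
    then show "(\<lambda>(y, z). dl z * greenk z y) \<in> borel_measurable (area \<Otimes>\<^sub>M area)"
      by (simp add: split_beta')
  qed
  have go: "integrable area (\<lambda>y. g y * ((x - x') \<bullet> y))"
  proof -
    have "\<bar>(x - x') \<bullet> y\<bar> \<le> norm (x - x')" if "norm y = 1" for y
      using Cauchy_Schwarz_ineq2[of "x - x'" y] unfolding that by simp
    then have "integrable area (\<lambda>y. ((x - x') \<bullet> y) * g y)"
      by (intro wbd_integrable(1)[OF g, where c="norm (x - x')"]) auto
    then show ?thesis by (simp only: mult.commute)
  qed
  have Tm: "T \<in> borel_measurable area" unfolding T_def by measurable
  have "(\<integral>y. g y * (\<integral>z. dl z * greenk z y \<partial>area) \<partial>area)
      = (\<integral>y. - (1/2) * (dl y * g y - g y * T y) - (3/4) * (g y * ((x - x') \<bullet> y)) \<partial>area)"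
  proof (rule integral_cong_AE)
    show "(\<lambda>y. g y * (\<integral>z. dl z * greenk z y \<partial>area)) \<in> borel_measurable area" using mi by simp
    show "(\<lambda>y. - (1/2) * (dl y * g y - g y * T y) - (3/4) * (g y * ((x - x') \<bullet> y))) \<in> borel_measurable area"
      using dli Tm by measurable
    show "AE y in area. g y * (\<integral>z. dl z * greenk z y \<partial>area) = - (1/2) * (dl y * g y - g y * T y) - (3/4) * (g y * ((x - x') \<bullet> y))"
    proof -
      have alg: "u * (- (1/2) * (d - T) - (3/4) * v) = - (1/2) * (d * u - u * T) - (3/4) * (u * v)" for u d T v :: real
        by (simp add: field_simps)
      show ?thesis using inner by eventually_elim (simp only: alg)
    qed
  qed
  also have "\<dots> = - (1/2) * ((\<integral>y. dl y * g y \<partial>area) - (\<integral>y. g y * T y \<partial>area)) - (3/4) * 0"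
    unfolding orth[of "x - x'", symmetric]
    using dlg gTi go
    by (simp only: Bochner_Integration.integral_diff integral_mult_right_zero Bochner_Integration.integrable_diff integrable_mult_right)
  finally have e1: "(\<integral>y. g y * (\<integral>z. dl z * greenk z y \<partial>area) \<partial>area)
     = - (1/2) * ((\<integral>y. dl y * g y \<partial>area) - (\<integral>y. g y * T y \<partial>area))" by simp
  have "(\<integral>z. dl z * (gpot g z + g z) \<partial>area) = (\<integral>z. dl z * gpot g z \<partial>area) + (\<integral>z. dl z * g z \<partial>area)"
    unfolding distrib_left by (rule Bochner_Integration.integral_add[OF gpot_integral_swap(1)[OF g dli] dlg])
  also have "\<dots> = (\<integral>y. g y * T y \<partial>area)"
    unfolding gpot_integral_swap(3)[OF g dli] e1 by (simp add: field_simps)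
  finally show "gpot g x - gpot g x' = - (1 / (2 * pi)) * (\<integral>z. (logk x z - logk x' z) * (gpot g z + g z) \<partial>area)"
    unfolding gT dl_def by simp
qed

section \<open>Symmetries of the tetrahedron\<close>

locale tetra =
  fixes \<xi> :: "4 \<Rightarrow> real^3"
  assumes tet: "inscribed_regular_tetrahedron \<xi>"
begin

lemma nrm [simp]: "norm (\<xi> k) = 1"
  using tet by (simp add: inscribed_regular_tetrahedron_def)

lemma self_inner [simp]: "\<xi> k \<bullet> \<xi> k = 1"
  using nrm[of k] by (simp only: norm_eq_1)

text \<open>Four vectors in space are linearly dependent. Pairing a relation with each vertex, where
  all mutual products are equal, shows that its coefficients are equal, and then 1 + 3 * c =
  0.\<close>

lemma inner_ne: "i \<noteq> j \<Longrightarrow> \<xi> i \<bullet> \<xi> j = - (1/3)"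
proof -
  assume ij: "i \<noteq> j"
  obtain l where l: "l > 0" "\<And>i j. i \<noteq> j \<Longrightarrow> dist (\<xi> i) (\<xi> j) = l"
    using tet by (auto simp: inscribed_regular_tetrahedron_def)
  define c where "c = 1 - l\<^sup>2 / 2"
  have c: "\<xi> i \<bullet> \<xi> j = c" if "i \<noteq> j" for i j
    using one_minus_inner[of "\<xi> i" "\<xi> j"] l(2)[OF that] unfolding c_def dist_norm by (simp add: field_simps)
  have c1: "1 - c > 0" using l(1) by (simp add: c_def)
  have inj: "inj \<xi>"
  proof (rule injI, rule ccontr)
    fix i j assume "\<xi> i = \<xi> j" "i \<noteq> j"
    then show False using l(2)[of i j] l(1) by simp
  qed
  have "card (range \<xi>) = 4" using card_image[OF inj] by simp
  then have "dependent (range \<xi>)" using independent_bound[of "range \<xi>"] by auto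
  then have "\<exists>u. (\<exists>v\<in>range \<xi>. u v \<noteq> 0) \<and> (\<Sum>v\<in>range \<xi>. u v *\<^sub>R v) = 0"
    using dependent_finite[of "range \<xi>"] by simp
  then obtain u v where u: "v \<in> range \<xi>" "u v \<noteq> 0" "(\<Sum>v\<in>range \<xi>. u v *\<^sub>R v) = 0"
    by blast
  define al where "al k = u (\<xi> k)" for k
  have s0: "(\<Sum>k\<in>UNIV. al k *\<^sub>R \<xi> k) = 0"
    using u(3) by (simp add: sum.reindex[OF inj] al_def)
  obtain k0 where k0: "al k0 \<noteq> 0" using u(1,2) by (auto simp: al_def)
  define S where "S = (\<Sum>k\<in>UNIV. al k)"
  have e: "(1 - c) * al j = - c * S" for j
  proof -
    have "0 = (\<Sum>k\<in>UNIV. al k *\<^sub>R \<xi> k) \<bullet> \<xi> j" by (simp add: s0)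
    also have "\<dots> = (\<Sum>k\<in>UNIV. al k * (\<xi> k \<bullet> \<xi> j))" by (simp add: inner_sum_left)
    also have "\<dots> = (\<Sum>k\<in>UNIV. c * al k + (if k = j then (1 - c) * al k else 0))"
      by (intro sum.cong refl) (auto simp: c algebra_simps)
    also have "\<dots> = c * S + (1 - c) * al j" by (simp add: sum.distrib sum_distrib_left S_def)
    finally show ?thesis by simp
  qed
  have alk: "al k = al k0" for k
  proof -
    have "(1 - c) * al k = (1 - c) * al k0" by (simp only: e)
    then show ?thesis using c1 by simp
  qed
  have "S = (\<Sum>k\<in>(UNIV::4 set). al k0)" unfolding S_def by (rule sum.cong[OF refl alk])
  then have "S = 4 * al k0" by simp
  then have "(1 - c) * al k0 = - c * (4 * al k0)" using e[of k0] by simp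
  then have "(1 + 3 * c) * al k0 = 0" by (simp add: algebra_simps)
  then have "1 + 3 * c = 0" using k0 by simp
  then have "c = - (1/3)" by simp
  then show ?thesis using c[OF ij] by simp
qed

lemma inj_xi: "\<xi> i = \<xi> j \<longleftrightarrow> i = j"
  using inner_ne[of i j] self_inner[of j] by fastforce

lemma four: "(\<Sum>k\<in>(UNIV::4 set). f k) = f 1 + f 2 + f 3 + f 4" for f :: "4 \<Rightarrow> 'a::comm_monoid_add"
  by (rule sum_4)

lemma ne4: "(1::4) \<noteq> 2" "(1::4) \<noteq> 3" "(1::4) \<noteq> 4" "(2::4) \<noteq> 3" "(2::4) \<noteq> 4" "(3::4) \<noteq> 4"
  "(2::4) \<noteq> 1" "(3::4) \<noteq> 1" "(4::4) \<noteq> 1" "(3::4) \<noteq> 2" "(4::4) \<noteq> 2" "(4::4) \<noteq> 3"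
  by simp_all

lemmas xi_inner = inner_ne[OF ne4(1)] inner_ne[OF ne4(2)] inner_ne[OF ne4(3)] inner_ne[OF ne4(4)] inner_ne[OF ne4(5)] inner_ne[OF ne4(6)]
  inner_ne[OF ne4(7)] inner_ne[OF ne4(8)] inner_ne[OF ne4(9)] inner_ne[OF ne4(10)] inner_ne[OF ne4(11)] inner_ne[OF ne4(12)]

lemma sum_zero: "\<xi> 1 + \<xi> 2 + \<xi> 3 + \<xi> 4 = 0"
proof -
  have "(\<xi> 1 + \<xi> 2 + \<xi> 3 + \<xi> 4) \<bullet> (\<xi> 1 + \<xi> 2 + \<xi> 3 + \<xi> 4) = 0"
    by (simp only: inner_add_left inner_add_right xi_inner self_inner)
  then show ?thesis by (simp only: inner_eq_zero_iff)
qed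

lemma span_xi: "y = 0" if y: "\<And>k. y \<bullet> \<xi> k = 0"
proof -
  let ?A = "{\<xi> 2, \<xi> 3, \<xi> 4}"
  have d: "\<xi> 2 \<noteq> \<xi> 3" "\<xi> 2 \<noteq> \<xi> 4" "\<xi> 3 \<noteq> \<xi> 4" by (simp_all add: inj_xi)
  have "independent ?A"
  proof (rule independent_if_scalars_zero)
    fix f :: "real^3 \<Rightarrow> real" and x assume s: "(\<Sum>x\<in>?A. f x *\<^sub>R x) = 0" and x: "x \<in> ?A"
    have s': "f (\<xi> 2) *\<^sub>R \<xi> 2 + (f (\<xi> 3) *\<^sub>R \<xi> 3 + f (\<xi> 4) *\<^sub>R \<xi> 4) = 0" using s d by simp
    have "f (\<xi> 2) * (\<xi> 2 \<bullet> \<xi> j) + (f (\<xi> 3) * (\<xi> 3 \<bullet> \<xi> j) + f (\<xi> 4) * (\<xi> 4 \<bullet> \<xi> j)) = 0" for j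
      using arg_cong[OF s', of "\<lambda>v. v \<bullet> \<xi> j"] by (simp only: inner_add_left inner_scaleR_left inner_zero_left)
    from this[of 2] this[of 3] this[of 4]
    have "f (\<xi> 2) = 0" "f (\<xi> 3) = 0" "f (\<xi> 4) = 0" unfolding xi_inner self_inner by linarith+
    then show "f x = 0" using x by auto
  qed simp
  moreover have "dim (UNIV :: (real^3) set) \<le> card ?A" using d by simp
  ultimately have "UNIV \<subseteq> span ?A" by (intro card_ge_dim_independent) auto
  then have "y \<in> span ?A" by auto
  moreover have "orthogonal y x" if "x \<in> ?A" for x using that y by (auto simp: orthogonal_def)
  ultimately have "orthogonal y y" using orthogonal_to_span by blast
  then show ?thesis by (simp add: orthogonal_def)
qed

text \<open>The vertices form a tight frame with bound 4/3. Both sides have the same products with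
  the four vertices, and these span the space.\<close>

lemma frame: "x = (3/4) *\<^sub>R ((x \<bullet> \<xi> 1) *\<^sub>R \<xi> 1 + (x \<bullet> \<xi> 2) *\<^sub>R \<xi> 2 + (x \<bullet> \<xi> 3) *\<^sub>R \<xi> 3 + (x \<bullet> \<xi> 4) *\<^sub>R \<xi> 4)"
    (is "x = ?r")
proof -
  have z: "x \<bullet> \<xi> 1 + x \<bullet> \<xi> 2 + x \<bullet> \<xi> 3 + x \<bullet> \<xi> 4 = 0"
    using arg_cong[OF sum_zero, of "\<lambda>v. x \<bullet> v"] by (simp add: inner_add_right)
  have "\<forall>k. (x - ?r) \<bullet> \<xi> k = 0"
    unfolding forall_4 by (simp only: inner_diff_left inner_scaleR_left inner_add_left xi_inner self_inner) (use z in simp)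
  then have "x - ?r = 0" by (intro span_xi) blast
  then show ?thesis by simp
qed

lemma coords_sum: "x \<bullet> \<xi> 1 + x \<bullet> \<xi> 2 + x \<bullet> \<xi> 3 + x \<bullet> \<xi> 4 = 0"
  using arg_cong[OF sum_zero, of "\<lambda>v. x \<bullet> v"] by (simp add: inner_add_right)

lemma coords_sq: "(x \<bullet> \<xi> 1)\<^sup>2 + (x \<bullet> \<xi> 2)\<^sup>2 + (x \<bullet> \<xi> 3)\<^sup>2 + (x \<bullet> \<xi> 4)\<^sup>2 = (4/3) * (norm x)\<^sup>2"
proof -
  have "x \<bullet> x = x \<bullet> ((3/4) *\<^sub>R ((x \<bullet> \<xi> 1) *\<^sub>R \<xi> 1 + (x \<bullet> \<xi> 2) *\<^sub>R \<xi> 2 + (x \<bullet> \<xi> 3) *\<^sub>R \<xi> 3 + (x \<bullet> \<xi> 4) *\<^sub>R \<xi> 4))"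
    using frame[of x] by simp
  then have "x \<bullet> x = (3/4) * ((x \<bullet> \<xi> 1)\<^sup>2 + (x \<bullet> \<xi> 2)\<^sup>2 + (x \<bullet> \<xi> 3)\<^sup>2 + (x \<bullet> \<xi> 4)\<^sup>2)"
    by (simp only: inner_scaleR_right inner_add_right power2_eq_square)
  then show ?thesis unfolding power2_norm_eq_inner by simp
qed

section \<open>Symmetries, the stabilizer of a vertex, and reflections\<close>

definition symm :: "(real^3 \<Rightarrow> real^3) \<Rightarrow> bool" where
  "symm T \<longleftrightarrow> orthogonal_transformation T \<and> (\<exists>\<pi>. bij \<pi> \<and> (\<forall>k. T (\<xi> k) = \<xi> (\<pi> k)))"

definition stab :: "(real^3 \<Rightarrow> real^3) \<Rightarrow> bool" where
  "stab T \<longleftrightarrow> symm T \<and> T (\<xi> 1) = \<xi> 1"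

lemma symm_of_orth:
  assumes T: "orthogonal_transformation T" and m: "\<And>k. T (\<xi> k) \<in> range \<xi>"
  shows "symm T"
proof -
  define pi where "pi k = (SOME j. T (\<xi> k) = \<xi> j)" for k
  have p: "T (\<xi> k) = \<xi> (pi k)" for k unfolding pi_def using m[of k] by (metis (mono_tags, lifting) rangeE someI)
  have "inj T" using orthogonal_transformation_inj[OF T] .
  then have "inj pi" by (metis injI inj_xi injD p)
  then have "bij pi" by (simp add: finite_UNIV_inj_surj bij_def)
  then show ?thesis unfolding symm_def using T p by blast
qed

text \<open>The vertices are exactly the points of norm 1 in the tetrahedron: a unit vector whose
  products with all vertices are below 1 is separated from the hull by an open half-space. An
  isometry that preserves the tetrahedron hence permutes them.\<close>

lemma symm_tetrahedral_group:
  assumes "T \<in> tetrahedral_group \<xi>"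
  shows "symm T"
proof -
  have T: "orthogonal_transformation T" and h: "T ` (convex hull (range \<xi>)) = convex hull (range \<xi>)"
    using assms by (auto simp: tetrahedral_group_def)
  have ext: "x \<in> range \<xi>" if x: "x \<in> convex hull (range \<xi>)" "norm x = 1" for x
  proof -
    have "\<exists>k. 1 \<le> x \<bullet> \<xi> k"
    proof (rule ccontr)
      assume "\<not> (\<exists>k. 1 \<le> x \<bullet> \<xi> k)"
      then have "range \<xi> \<subseteq> {y. x \<bullet> y < 1}" by (auto simp: not_le)
      then have "convex hull (range \<xi>) \<subseteq> {y. x \<bullet> y < 1}" by (rule hull_minimal) (rule convex_halfspace_lt)
      then show False using x by (auto simp: norm_eq_1)
    qed
    then obtain k where k: "1 \<le> x \<bullet> \<xi> k" by blast
    have "(norm (x - \<xi> k))\<^sup>2 \<le> 0" using one_minus_inner[OF x(2) nrm, of k] k by simp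
    then show ?thesis by simp
  qed
  show ?thesis
  proof (rule symm_of_orth[OF T])
    fix k
    have "\<xi> k \<in> convex hull (range \<xi>)" by (rule hull_inc) simp
    then have "T (\<xi> k) \<in> convex hull (range \<xi>)" using h by blast
    then show "T (\<xi> k) \<in> range \<xi>" by (rule ext) (simp add: orth_norm[OF T])
  qed
qed

text \<open>The reflection in the plane that bisects the edge between \<xi> k and \<xi> l; 3/4 is 2
  divided by the squared edge length 8/3. For k = l it is the identity, so \<open>refl 1 k\<close>
  makes sense for all four vertices.\<close>

definition refl :: "4 \<Rightarrow> 4 \<Rightarrow> real^3 \<Rightarrow> real^3" where
  "refl k l x = x - (3/4 * ((\<xi> k - \<xi> l) \<bullet> x)) *\<^sub>R (\<xi> k - \<xi> l)"

lemma refl_same [simp]: "refl k k x = x" by (simp add: refl_def)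

lemma refl_linear: "linear (refl k l)"
  unfolding refl_def
  by (rule linearI) (simp_all add: inner_add_right algebra_simps)

lemma refl_sq: "k \<noteq> l \<Longrightarrow> (\<xi> k - \<xi> l) \<bullet> (\<xi> k - \<xi> l) = 8/3"
  using inner_ne[of k l] inner_ne[of l k] by (simp add: inner_diff)

lemma refl_orth: "orthogonal_transformation (refl k l)"
proof (cases "k = l")
  case True
  then have "refl k l = (\<lambda>x. x)" by (auto simp: fun_eq_iff)
  then show ?thesis by (simp add: orthogonal_transformation_def linear_ident)
next
  case False
  define u where "u = \<xi> k - \<xi> l"
  have u: "u \<bullet> u = 8/3" unfolding u_def by (rule refl_sq[OF False])
  have "refl k l x \<bullet> refl k l y = x \<bullet> y" for x y
  proof -
    have "refl k l x \<bullet> refl k l y = x \<bullet> y - 3/4 * (u \<bullet> y) * (x \<bullet> u) - 3/4 * (u \<bullet> x) * (u \<bullet> y) + 3/4 * (u \<bullet> x) * (3/4 * (u \<bullet> y)) * (u \<bullet> u)"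
      unfolding refl_def u_def[symmetric]
      by (simp only: inner_diff_left inner_diff_right inner_scaleR_left inner_scaleR_right) algebra
    then show ?thesis unfolding u by (simp add: inner_commute[of x u])
  qed
  then show ?thesis using refl_linear by (simp add: orthogonal_transformation_def)
qed

lemma refl_xi:
  "refl k l (\<xi> k) = \<xi> l" "refl k l (\<xi> l) = \<xi> k" "j \<noteq> k \<Longrightarrow> j \<noteq> l \<Longrightarrow> refl k l (\<xi> j) = \<xi> j"
proof -
  show "refl k l (\<xi> k) = \<xi> l"
  proof (cases "k = l")
    case False
    then have e: "(\<xi> k - \<xi> l) \<bullet> \<xi> k = 4/3" using inner_ne[of l k] by (simp add: inner_diff_left)
    show ?thesis unfolding refl_def e by simp
  qed simp
  show "refl k l (\<xi> l) = \<xi> k"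
  proof (cases "k = l")
    case False
    then have e: "(\<xi> k - \<xi> l) \<bullet> \<xi> l = - (4/3)" using inner_ne[of k l] by (simp add: inner_diff_left)
    show ?thesis unfolding refl_def e by simp
  qed simp
  assume "j \<noteq> k" "j \<noteq> l"
  then have "(\<xi> k - \<xi> l) \<bullet> \<xi> j = 0" using inner_ne[of k j] inner_ne[of l j] by (simp add: inner_diff_left)
  then show "refl k l (\<xi> j) = \<xi> j" by (simp add: refl_def)
qed

lemma refl_symm: "symm (refl k l)"
proof (rule symm_of_orth[OF refl_orth])
  fix j
  show "refl k l (\<xi> j) \<in> range \<xi>"
  proof (cases "j = k \<or> j = l")
    case True then show ?thesis using refl_xi(1,2) by auto
  next
    case False then show ?thesis using refl_xi(3)[of j k l] by simp
  qed
qed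

lemma refl_stab: "k \<noteq> 1 \<Longrightarrow> l \<noteq> 1 \<Longrightarrow> stab (refl k l)"
  unfolding stab_def using refl_symm refl_xi(3)[of 1 k l] by simp

lemma symm_comp: "symm S \<Longrightarrow> symm T \<Longrightarrow> symm (\<lambda>x. S (T x))"
proof -
  assume S: "symm S" and T: "symm T"
  obtain p q where pq: "\<And>k. S (\<xi> k) = \<xi> (p k)" "\<And>k. T (\<xi> k) = \<xi> (q k)" using S T by (auto simp: symm_def)
  have "orthogonal_transformation (S \<circ> T)" using S T by (intro orthogonal_transformation_compose) (auto simp: symm_def)
  then show ?thesis by (intro symm_of_orth) (simp_all add: o_def pq)
qed

lemma symm_orth: "symm T \<Longrightarrow> orthogonal_transformation T" by (simp add: symm_def)
lemma stab_orth: "stab T \<Longrightarrow> orthogonal_transformation T" by (simp add: stab_def symm_def)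

lemma refl_refl: "refl k l (refl k l x) = x"
proof (cases "k = l")
  case False
  have "(\<xi> k - \<xi> l) \<bullet> refl k l x = - ((\<xi> k - \<xi> l) \<bullet> x)"
    unfolding refl_def by (simp add: inner_diff_right refl_sq[OF False] )
      (use refl_sq[OF False] in \<open>simp add: inner_diff_right inner_diff_left inner_commute\<close>)
  then show ?thesis by (simp add: refl_def[of k l "refl k l x"]) (simp add: refl_def)
qed simp

text \<open>A symmetry composed with a reflection onto the first vertex differs from another such
  reflection by an element of the stabilizer of the first vertex.\<close>

lemma symm_factor:
  assumes T: "symm T"
  obtains \<pi> where "bij \<pi>" "\<And>k. T (\<xi> k) = \<xi> (\<pi> k)"
    "\<And>j. \<exists>S. stab S \<and> (\<forall>x. refl 1 (\<pi> j) (T x) = S (refl 1 j x))"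
proof -
  obtain p where p: "bij p" "\<And>k. T (\<xi> k) = \<xi> (p k)" using T unfolding symm_def by blast
  have "\<exists>S. stab S \<and> (\<forall>x. refl 1 (p j) (T x) = S (refl 1 j x))" for j
  proof -
    let ?S = "\<lambda>x. refl 1 (p j) (T (refl 1 j x))"
    have "symm ?S" by (rule symm_comp[OF refl_symm symm_comp[OF T refl_symm]])
    moreover have "?S (\<xi> 1) = \<xi> 1" by (simp add: refl_xi p(2))
    ultimately have "stab ?S" by (simp add: stab_def)
    moreover have "\<forall>x. refl 1 (p j) (T x) = ?S (refl 1 j x)" by (simp add: refl_refl)
    ultimately show ?thesis by (intro exI[of _ ?S] conjI)
  qed
  then show thesis using that p by blast
qed

section \<open>The symmetric factor and its behaviour at a vertex\<close>

definition prd :: "real \<Rightarrow> real^3 \<Rightarrow> 4 \<Rightarrow> real" where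
  "prd a z k = (\<Prod>l\<in>UNIV - {k}. a - z \<bullet> \<xi> l)"

text \<open>The sum of 1 / (a - z \<bullet> \<xi> k)^2 over the vertices, times the square of the
  product of all four denominators. Dividing the sum of the bubbles by this polynomial leaves the
  reciprocal of a product, whose logarithm is a sum of single bubble potentials.\<close>

definition Pf :: "real \<Rightarrow> real^3 \<Rightarrow> real" where
  "Pf a z = (\<Sum>k\<in>UNIV. (prd a z k)\<^sup>2)"

lemma symm_inner: "symm T \<Longrightarrow> T x \<bullet> T y = x \<bullet> y" by (simp add: orth_inner symm_orth)

lemma Pf_symm:
  assumes T: "symm T"
  shows "Pf a (T z) = Pf a z"
proof -
  obtain p where p: "bij p" "\<And>k. T (\<xi> k) = \<xi> (p k)" using T unfolding symm_def by blast
  have c: "T z \<bullet> \<xi> (p k) = z \<bullet> \<xi> k" for k using symm_inner[OF T, of z "\<xi> k"] p(2) by simp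
  have pr: "prd a (T z) (p k) = prd a z k" for k
  proof -
    have "UNIV - {p k} = p ` (UNIV - {k})" using p(1) by (auto simp: bij_def image_set_diff)
    moreover have "inj_on p (UNIV - {k})" using p(1) by (auto simp: bij_def inj_on_def)
    ultimately show ?thesis unfolding prd_def by (simp add: prod.reindex c)
  qed
  have "Pf a (T z) = (\<Sum>k\<in>UNIV. (prd a (T z) (p k))\<^sup>2)"
    unfolding Pf_def using sum.reindex_bij_betw[of p UNIV UNIV "\<lambda>k. (prd a (T z) k)\<^sup>2"] p(1) by simp
  then show ?thesis by (simp add: pr Pf_def)
qed

lemma UNIV_minus: "UNIV - {1::4} = {2,3,4}" "UNIV - {2::4} = {1,3,4}" "UNIV - {3::4} = {1,2,4}" "UNIV - {4::4} = {1,2,3}"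
  using UNIV_4 by auto

lemma prd_expl:
  "prd a z 1 = (a - z \<bullet> \<xi> 2) * ((a - z \<bullet> \<xi> 3) * (a - z \<bullet> \<xi> 4))"
  "prd a z 2 = (a - z \<bullet> \<xi> 1) * ((a - z \<bullet> \<xi> 3) * (a - z \<bullet> \<xi> 4))"
  "prd a z 3 = (a - z \<bullet> \<xi> 1) * ((a - z \<bullet> \<xi> 2) * (a - z \<bullet> \<xi> 4))"
  "prd a z 4 = (a - z \<bullet> \<xi> 1) * ((a - z \<bullet> \<xi> 2) * (a - z \<bullet> \<xi> 3))"
  unfolding prd_def UNIV_minus by simp_all

text \<open>In the coordinates \<open>t = z \<bullet> \<xi> 1\<close> and \<open>h\<close>, the product of the three
  deviations \<open>z \<bullet> \<xi> l + t/3\<close>, the polynomial has no term linear in the distance to \<open>\<xi> 1\<close>.\<close>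

definition Pt :: "real \<Rightarrow> real \<Rightarrow> real \<Rightarrow> real" where
  "Pt a t h = ((a + t/3)^3 - (2/3) * (a + t/3) * (1 - t\<^sup>2) - h)\<^sup>2
     + (a - t)\<^sup>2 * (3 * (a + t/3)^4 + (4/9) * (1 - t\<^sup>2)\<^sup>2 + 6 * (a + t/3) * h)"

text \<open>The deviations of the other three coordinates from - t/3 have sum 0 and square sum 4/3 *
  (1 - t^2), so every symmetric polynomial in them depends only on t and their product
  \<open>h\<close>. Bounding each squared deviation by the square sum gives the estimate for
  \<open>h\<close>.\<close>

lemma Pf_Pt:
  assumes z: "norm z = 1"
  obtains h where "Pf a z = Pt a (z \<bullet> \<xi> 1) h" "h\<^sup>2 \<le> (4/3 * (1 - (z \<bullet> \<xi> 1)\<^sup>2))^3"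
proof -
  define t where "t = z \<bullet> \<xi> 1"
  define d2 where "d2 = z \<bullet> \<xi> 2 + t/3"
  define d3 where "d3 = z \<bullet> \<xi> 3 + t/3"
  define d4 where "d4 = z \<bullet> \<xi> 4 + t/3"
  have s: "d2 + d3 + d4 = 0" using coords_sum[of z] unfolding d2_def d3_def d4_def t_def by simp
  have q: "d2\<^sup>2 + d3\<^sup>2 + d4\<^sup>2 = 4/3 * (1 - t\<^sup>2)"
  proof -
    have "t\<^sup>2 + (d2 - t/3)\<^sup>2 + (d3 - t/3)\<^sup>2 + (d4 - t/3)\<^sup>2 = 4/3"
      using coords_sq[of z] z unfolding d2_def d3_def d4_def t_def by simp
    then have "d2\<^sup>2 + d3\<^sup>2 + d4\<^sup>2 - (2 * t / 3) * (d2 + d3 + d4) + t\<^sup>2 * (4/3) = 4/3"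
      by (simp add: power2_eq_square algebra_simps)
    then show ?thesis unfolding s by simp
  qed
  define b where "b = a + t/3"
  define h where "h = d2 * d3 * d4"
  have e: "a - z \<bullet> \<xi> 1 = a - t" "a - z \<bullet> \<xi> 2 = b - d2" "a - z \<bullet> \<xi> 3 = b - d3" "a - z \<bullet> \<xi> 4 = b - d4"
    by (simp_all add: b_def d2_def d3_def d4_def t_def)
  define v where "v = 1 - t\<^sup>2"
  have d4': "d4 = - d2 - d3" using s by simp
  have v': "v = (3/4) * (d2\<^sup>2 + d3\<^sup>2 + (- d2 - d3)\<^sup>2)" using q unfolding v_def d4' by simp
  have 1: "(b - d2) * ((b - d3) * (b - d4)) = b^3 - (2/3) * b * v - h"
    unfolding h_def d4' v' by (simp add: field_simps power2_eq_square power3_eq_cube)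
  have 2: "((b - d3) * (b - d4))\<^sup>2 + ((b - d2) * (b - d4))\<^sup>2 + ((b - d2) * (b - d3))\<^sup>2 = 3 * b^4 + (4/9) * v\<^sup>2 + 6 * b * h"
    unfolding h_def d4' v' by (simp add: field_simps power2_eq_square power4_eq_xxxx)
  have "Pf a z = ((b - d2) * ((b - d3) * (b - d4)))\<^sup>2 + (a - t)\<^sup>2 * (((b - d3) * (b - d4))\<^sup>2 + ((b - d2) * (b - d4))\<^sup>2 + ((b - d2) * (b - d3))\<^sup>2)"
    unfolding Pf_def four prd_expl e by (simp only: power_mult_distrib distrib_left add_ac)
  then have "Pf a z = (b^3 - (2/3) * b * v - h)\<^sup>2 + (a - t)\<^sup>2 * (3 * b^4 + (4/9) * v\<^sup>2 + 6 * b * h)"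
    unfolding 1 2 .
  then have "Pf a z = Pt a t h" unfolding Pt_def b_def v_def .
  moreover have "h\<^sup>2 \<le> (4/3 * (1 - t\<^sup>2))^3"
  proof -
    have "d2\<^sup>2 * d3\<^sup>2 * d4\<^sup>2 \<le> (4/3 * (1 - t\<^sup>2)) * (4/3 * (1 - t\<^sup>2)) * (4/3 * (1 - t\<^sup>2))"
      unfolding q[symmetric] by (intro mult_mono) auto
    then show ?thesis unfolding h_def by (simp add: power_mult_distrib power3_eq_cube)
  qed
  ultimately show thesis using that unfolding t_def by blast
qed

lemma Pf_vertex: "Pf a (\<xi> 1) = Pt a 1 0"
proof -
  obtain h where h: "Pf a (\<xi> 1) = Pt a (\<xi> 1 \<bullet> \<xi> 1) h" "h\<^sup>2 \<le> (4/3 * (1 - (\<xi> 1 \<bullet> \<xi> 1)\<^sup>2))^3"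
    using Pf_Pt[of "\<xi> 1" a] by (metis nrm)
  then have "h = 0" by simp
  then show ?thesis using h by simp
qed

text \<open>Take the vertex k nearest to z. The sum of two vertices has norm at most 6/5, so the
  other coordinates of z are at most 3/5 and each of the three factors of \<open>prd a z k\<close>
  is at least 2/5; (2/5)^6 exceeds 1/256.\<close>

lemma Pf_lower:
  assumes z: "norm z = 1" and a: "1 \<le> a"
  shows "Pf a z \<ge> 1/256"
proof -
  obtain k where k: "\<And>l. z \<bullet> \<xi> l \<le> z \<bullet> \<xi> k"
  proof -
    have "Max (range (\<lambda>l. z \<bullet> \<xi> l)) \<in> range (\<lambda>l. z \<bullet> \<xi> l)" by (rule Max_in) auto
    then obtain k where "Max (range (\<lambda>l. z \<bullet> \<xi> l)) = z \<bullet> \<xi> k" by (rule imageE)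
    then have "z \<bullet> \<xi> l \<le> z \<bullet> \<xi> k" for l using Max_ge[of "range (\<lambda>l. z \<bullet> \<xi> l)" "z \<bullet> \<xi> l"] by auto
    then show thesis by (rule that)
  qed
  have l: "2/5 \<le> a - z \<bullet> \<xi> l" if "l \<noteq> k" for l
  proof -
    have "(norm (\<xi> k + \<xi> l))\<^sup>2 = 4/3"
      unfolding power2_norm_eq_inner using inner_ne[OF that] inner_ne[of k l] that by (simp add: inner_add)
    have "z \<bullet> (\<xi> k + \<xi> l) \<le> norm z * norm (\<xi> k + \<xi> l)" by (rule norm_cauchy_schwarz)
    also have "\<dots> = norm (\<xi> k + \<xi> l)" using z by simp
    also have "\<dots> \<le> 6/5" by (rule power2_le_imp_le) (use \<open>(norm (\<xi> k + \<xi> l))\<^sup>2 = 4/3\<close> in \<open>simp_all add: power2_eq_square\<close>)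
    finally have "z \<bullet> \<xi> k + z \<bullet> \<xi> l \<le> 6/5" by (simp add: inner_add_right)
    then show ?thesis using k[of l] a by linarith
  qed
  have "(2/5)^3 \<le> prd a z k"
  proof -
    have "(\<Prod>l\<in>UNIV - {k}. (2/5::real)) \<le> (\<Prod>l\<in>UNIV - {k}. a - z \<bullet> \<xi> l)"
      by (rule prod_mono) (use l in auto)
    moreover have "card (UNIV - {k}) = 3" by (simp add: card_Diff_singleton)
    ultimately show ?thesis by (simp add: prd_def)
  qed
  then have "((2/5)^3)\<^sup>2 \<le> (prd a z k)\<^sup>2" by (intro power_mono) auto
  also have "\<dots> \<le> Pf a z" unfolding Pf_def by (rule member_le_sum) auto
  finally show ?thesis by (simp add: power_divide)
qed

end

section \<open>The scale, the weight, and elementary estimates\<close>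

definition aa :: "real \<Rightarrow> real" where "aa s = sqrt (1 + s\<^sup>2)"

lemma aa_facts:
  assumes s: "0 < s" "s \<le> 1"
  shows "1 < aa s" "aa s \<le> 3/2" "(aa s)\<^sup>2 - 1 = s\<^sup>2" "sqrt ((aa s)\<^sup>2 - 1) = s" "s\<^sup>2 / 3 \<le> aa s - 1" "aa s - 1 \<le> s\<^sup>2 / 2"
proof -
  have sq: "(aa s)\<^sup>2 = 1 + s\<^sup>2" unfolding aa_def by simp
  show 1: "1 < aa s" unfolding aa_def using s by simp
  have "s\<^sup>2 \<le> 1" using s by (simp add: power_le_one)
  show 2: "aa s \<le> 3/2"
  proof (rule power2_le_imp_le)
    show "(aa s)\<^sup>2 \<le> (3/2)\<^sup>2" unfolding sq using \<open>s\<^sup>2 \<le> 1\<close> by (simp add: power_divide)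
  qed simp
  show "(aa s)\<^sup>2 - 1 = s\<^sup>2" using sq by simp
  then show "sqrt ((aa s)\<^sup>2 - 1) = s" using s by simp
  have f: "(aa s - 1) * (aa s + 1) = s\<^sup>2" using sq by (simp add: power2_eq_square algebra_simps)
  have "(aa s - 1) * (aa s + 1) \<le> (aa s - 1) * 3" using 1 2 by (intro mult_left_mono) auto
  then show "s\<^sup>2 / 3 \<le> aa s - 1" using f by simp
  have "(aa s - 1) * 2 \<le> (aa s - 1) * (aa s + 1)" using 1 2 by (intro mult_left_mono) auto
  then show "aa s - 1 \<le> s\<^sup>2 / 2" using f by simp
qed

lemma abs_mult_le: "\<bar>x\<bar> \<le> u \<Longrightarrow> \<bar>y\<bar> \<le> v \<Longrightarrow> \<bar>x * y\<bar> \<le> u * v" for x y u v :: real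
  unfolding abs_mult by (intro mult_mono) auto

lemma exp_diff_bounds:
  fixes p q r :: real
  assumes p: "\<bar>p\<bar> \<le> r" and q: "\<bar>q\<bar> \<le> r" and r: "r \<le> 1"
  shows "\<bar>exp p - exp q - (p - q)\<bar> \<le> 2 * r * \<bar>p - q\<bar>" "\<bar>exp p - exp q\<bar> \<le> 3 * \<bar>p - q\<bar>"
proof -
  have main: "\<exists>z. \<bar>z\<bar> \<le> r \<and> exp p - exp q = (p - q) * exp z" if qp: "q < p" "\<bar>p\<bar> \<le> r" "\<bar>q\<bar> \<le> r" for p q :: real
  proof -
    obtain z where "q < z" "z < p" "exp p - exp q = (p - q) * exp z"
      using MVT2[OF qp(1), of exp exp] DERIV_exp by blast
    then show ?thesis using qp by (intro exI[of _ z]) auto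
  qed
  obtain z where z: "\<bar>z\<bar> \<le> r" "exp p - exp q = (p - q) * exp z"
  proof (cases rule: linorder_cases[of q p])
    case less then show ?thesis using main[OF less p q] that by blast
  next
    case equal then show ?thesis using that[of p] p by simp
  next
    case greater
    then obtain z where "\<bar>z\<bar> \<le> r" "exp q - exp p = (q - p) * exp z" using main[OF greater q p] by blast
    then show ?thesis using that[of z] by (simp add: algebra_simps)
  qed
  have ez: "\<bar>exp z - 1\<bar> \<le> 2 * r"
  proof (cases "z \<ge> 0")
    case True
    have "z * z \<le> 1 * z" using z(1) r True by (intro mult_right_mono) auto
    moreover have "exp z \<le> 1 + z + z\<^sup>2" using True z(1) r by (intro exp_bound) auto
    ultimately have "exp z \<le> 1 + 2 * z" by (simp add: power2_eq_square)
    moreover have "1 \<le> exp z" using True by simp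
    ultimately show ?thesis using z(1) by linarith
  next
    case False
    have "1 + z \<le> exp z" by (rule exp_ge_add_one_self)
    moreover have "exp z \<le> 1" using False by simp
    ultimately show ?thesis using z(1) False by linarith
  qed
  have "exp p - exp q - (p - q) = (p - q) * (exp z - 1)" using z(2) by (simp add: algebra_simps)
  then have "\<bar>exp p - exp q - (p - q)\<bar> = \<bar>exp z - 1\<bar> * \<bar>p - q\<bar>" by (simp add: abs_mult)
  also have "\<dots> \<le> 2 * r * \<bar>p - q\<bar>" using ez by (intro mult_right_mono) auto
  finally show "\<bar>exp p - exp q - (p - q)\<bar> \<le> 2 * r * \<bar>p - q\<bar>" .
  have "\<bar>exp p - exp q\<bar> = \<bar>exp z\<bar> * \<bar>p - q\<bar>" unfolding z(2) by (simp add: abs_mult)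
  also have "\<dots> \<le> 3 * \<bar>p - q\<bar>" using ez r by (intro mult_right_mono) auto
  finally show "\<bar>exp p - exp q\<bar> \<le> 3 * \<bar>p - q\<bar>" .
qed

text \<open>The last claim lets a bound without a small factor count as one of order s: for w < 4 *
  s^2 the weight is at least 1 / (3 * s).\<close>

lemma weight_facts:
  fixes w s :: real
  assumes w: "0 < w" "w \<le> 2"
  shows "1 \<le> 2 * w powr (-5/8)" "w powr (-1/4) \<le> 2 * w powr (-5/8)"
    and "0 < s \<Longrightarrow> s \<le> 1 \<Longrightarrow> w < 4 * s\<^sup>2 \<Longrightarrow> 1 \<le> 3 * s * w powr (-5/8)"
proof -
  have a: "w powr k \<le> 2" if "0 \<le> k" "k \<le> 1" for k
  proof -
    have "w powr k \<le> 2 powr k" using w that by (intro powr_mono2) auto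
    also have "\<dots> \<le> 2 powr 1" using that by (intro powr_mono) auto
    finally show ?thesis by simp
  qed
  have "1 = w powr (5/8) * w powr (-5/8)" using w by (simp add: powr_add[symmetric])
  also have "\<dots> \<le> 2 * w powr (-5/8)" by (intro mult_right_mono a) auto
  finally show "1 \<le> 2 * w powr (-5/8)" .
  have "w powr (-1/4) = w powr (3/8) * w powr (-5/8)" using w by (simp add: powr_add[symmetric])
  also have "\<dots> \<le> 2 * w powr (-5/8)" by (intro mult_right_mono a) auto
  finally show "w powr (-1/4) \<le> 2 * w powr (-5/8)" .
  assume s: "0 < s" "s \<le> 1" and ws: "w < 4 * s\<^sup>2"
  have "w powr (5/8) \<le> (4 * s\<^sup>2) powr (5/8)" using w ws by (intro powr_mono2) auto
  also have "\<dots> = 4 powr (5/8) * (s\<^sup>2) powr (5/8)" using s by (simp add: powr_mult)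
  also have "(s\<^sup>2) powr (5/8) = s powr (5/4)" using s by (simp add: powr_powr flip: powr_numeral)
  also have "s powr (5/4) \<le> s powr 1" using s by (intro powr_mono') auto
  also have "4 powr (5/8) \<le> (3::real)"
  proof -
    have "(4::real) powr (5/8) = (2 powr 2) powr (5/8)" by simp
    also have "\<dots> = 2 powr (5/4)" unfolding powr_powr by simp
    also have "\<dots> \<le> 2 powr (1 + 1/2)" by (intro powr_mono) auto
    also have "\<dots> = 2 * sqrt 2" unfolding powr_add by (simp add: powr_half_sqrt)
    also have "sqrt 2 \<le> 3/2" by (rule real_le_lsqrt) (simp_all add: power2_eq_square)
    finally show ?thesis by simp
  qed
  finally have "w powr (5/8) \<le> 3 * s" using s by simp
  then have "w powr (5/8) * w powr (-5/8) \<le> 3 * s * w powr (-5/8)" by (intro mult_right_mono) auto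
  then show "1 \<le> 3 * s * w powr (-5/8)" using w by (simp add: powr_add[symmetric])
qed

context tetra begin

lemma Pt_params:
  fixes a t h :: real
  assumes a: "1 \<le> a" "a \<le> 3/2" and t: "\<bar>t\<bar> \<le> 1" and h: "h\<^sup>2 \<le> (4/3 * (1 - t\<^sup>2))^3"
  defines "b \<equiv> a + t/3" and "Q \<equiv> 3 * (a + t/3)^4 + (4/9) * (1 - t\<^sup>2)\<^sup>2 + 6 * (a + t/3) * h"
  shows "0 \<le> 1 - t\<^sup>2" "1 - t\<^sup>2 \<le> 1" "1 - t\<^sup>2 \<le> 2 * (1 - t)" "2/3 \<le> b" "b \<le> 2" "\<bar>h\<bar> \<le> 2 * (1 - t\<^sup>2)" "\<bar>h\<bar> \<le> 4 * (1 - t)"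
    "\<bar>Q\<bar> \<le> 73" "\<bar>Q - 3 * (a + 1/3)^4\<bar> \<le> 81 * (1 - t)"
proof -
  define v where "v = 1 - t\<^sup>2"
  define b0 where "b0 = a + 1/3"
  define e where "e = 1 - t"
  have tt: "-1 \<le> t" "t \<le> 1" using t by auto
  have "t\<^sup>2 \<le> 1" using t by (simp add: abs_square_le_1)
  then have v0: "0 \<le> v" by (simp add: v_def)
  show "0 \<le> 1 - t\<^sup>2" using v0 by (simp add: v_def)
  have v1: "v \<le> 1" by (simp add: v_def)
  show "1 - t\<^sup>2 \<le> 1" by simp
  have e0: "0 \<le> e" "e \<le> 2" using tt by (auto simp: e_def)
  have "v = e * (1 + t)" unfolding v_def e_def by (simp add: power2_eq_square algebra_simps)
  also have "\<dots> \<le> e * 2" using tt e0 by (intro mult_left_mono) auto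
  finally have ve: "v \<le> 2 * e" by simp
  then show "1 - t\<^sup>2 \<le> 2 * (1 - t)" by (simp add: v_def e_def)
  show b: "2/3 \<le> b" "b \<le> 2" using a tt by (auto simp: b_def)
  have "v^3 \<le> v\<^sup>2" using v0 v1 by (intro power_decreasing) auto
  moreover have "0 \<le> v^3" using v0 by simp
  ultimately have v32: "(64/27) * v^3 \<le> 4 * v\<^sup>2" by linarith
  have "h\<^sup>2 \<le> (64/27) * v^3" using h unfolding v_def[symmetric] by (simp add: power_mult_distrib power_divide)
  also note v32
  finally have "h\<^sup>2 \<le> (2 * v)\<^sup>2" by (simp add: power_mult_distrib)
  then have hv: "\<bar>h\<bar> \<le> 2 * v" using v0 power2_le_imp_le[of "\<bar>h\<bar>" "2 * v"] by simp
  then show "\<bar>h\<bar> \<le> 2 * (1 - t\<^sup>2)" by (simp add: v_def)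
  have he: "\<bar>h\<bar> \<le> 4 * e" using hv ve by linarith
  then show "\<bar>h\<bar> \<le> 4 * (1 - t)" by (simp add: e_def)
  have b4: "b^4 \<le> 16" using power_mono[OF b(2), of 4] b by simp
  have bh: "\<bar>6 * b * h\<bar> \<le> 12 * \<bar>h\<bar>" using b by (simp add: abs_mult mult_right_mono)
  have vv: "v\<^sup>2 \<le> v" "0 \<le> v\<^sup>2" using v0 v1 by (simp_all add: power2_eq_square mult_left_le)
  have Qe: "Q = 3 * b^4 + (4/9) * v\<^sup>2 + 6 * b * h" by (simp add: Q_def b_def v_def)
  have b40: "0 \<le> b^4" using b by simp
  show "\<bar>Q\<bar> \<le> 73" unfolding Qe using b4 b40 bh hv vv v1 by linarith
  have "b0^4 - b^4 = (b0 - b) * ((b0 + b) * (b0\<^sup>2 + b\<^sup>2))" by algebra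
  also have "b0 - b = e / 3" by (simp add: b0_def b_def e_def field_simps)
  finally have d4: "b0^4 - b^4 = (e/3) * ((b0 + b) * (b0\<^sup>2 + b\<^sup>2))" .
  have b0: "0 \<le> b0" "b0 \<le> 2" using a by (auto simp: b0_def)
  have sq: "b0\<^sup>2 \<le> 4" "b\<^sup>2 \<le> 4" using power_mono[OF b0(2,1), of 2] power_mono[OF b(2), of 2] b by simp_all
  have "(b0 + b) * (b0\<^sup>2 + b\<^sup>2) \<le> 4 * 8" using b b0 sq by (intro mult_mono) auto
  then have "(e/3) * ((b0 + b) * (b0\<^sup>2 + b\<^sup>2)) \<le> (e/3) * 32" using e0 by (intro mult_left_mono) auto
  moreover have "0 \<le> (e/3) * ((b0 + b) * (b0\<^sup>2 + b\<^sup>2))" using e0 b b0 by (intro mult_nonneg_nonneg) auto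
  ultimately have d40: "0 \<le> b0^4 - b^4" "b0^4 - b^4 \<le> (e/3) * 32" unfolding d4 by blast+
  have "3 * (b0^4 - b^4) \<le> 3 * ((e/3) * 32)" by (rule mult_left_mono[OF d40(2)]) simp
  then have "3 * (b0^4 - b^4) \<le> 32 * e" by simp
  then show "\<bar>Q - 3 * (a + 1/3)^4\<bar> \<le> 81 * (1 - t)" unfolding Qe b0_def[symmetric] e_def[symmetric]
  proof -
    have gen: "\<bar>3 * B + (4/9) * V + H - 3 * B0\<bar> \<le> 81 * e'"
      if "0 \<le> B0 - B" "3 * (B0 - B) \<le> 32 * e'" "\<bar>H\<bar> \<le> 12 * k" "k \<le> 4 * e'" "V \<le> v'" "0 \<le> V" "v' \<le> 2 * e'"
      for B V H B0 e' k v' :: real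
    proof -
      have "H \<le> 12 * k" "- H \<le> 12 * k" using that(3) by (auto simp: abs_le_iff)
      moreover have "0 \<le> e'" using that(5-7) by linarith
      ultimately show ?thesis using that by (intro abs_leI) (simp_all add: field_simps)
    qed
    show "\<bar>3 * b^4 + (4/9) * v\<^sup>2 + 6 * b * h - 3 * b0^4\<bar> \<le> 81 * e"
      by (rule gen[OF d40(1) \<open>3 * (b0^4 - b^4) \<le> 32 * e\<close> bh he vv ve])
  qed
qed

text \<open>At the vertex \<open>Pt\<close> decreases linearly in 1 - t, that is, quadratically in
  the distance. The decrease comes from the leading square; in the range of the second claim the
  other summand is nearly constant, because (a - t)^2 is small, and \<open>h\<close> is of order (1
  - t) to the power 3/2.\<close>

lemma Pt_bound:
  assumes a: "1 \<le> a" "a \<le> 3/2" and t: "\<bar>t\<bar> \<le> 1" and h: "h\<^sup>2 \<le> (4/3 * (1 - t\<^sup>2))^3"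
  shows "\<bar>Pt a t h - Pt a 1 0\<bar> \<le> 700 * (1 - t)"
    and "a \<le> 1 + 1/1000 \<Longrightarrow> 1 - t \<le> 1/1000 \<Longrightarrow> Pt a t h + 2 * (1 - t) \<le> Pt a 1 0"
proof -
  define b where "b = a + t/3"
  define b0 where "b0 = a + 1/3"
  define e where "e = 1 - t"
  define v where "v = 1 - t\<^sup>2"
  define Q where "Q = 3 * b^4 + (4/9) * v\<^sup>2 + 6 * b * h"
  define X where "X = b^3 - (2/3) * b * v - h"
  note pr = Pt_params[OF a t h, folded b_def v_def, folded Q_def b0_def e_def]
  have e0: "0 \<le> e" "e \<le> 2" using t by (auto simp: e_def)
  have b0: "4/3 \<le> b0" "b0 \<le> 2" using a by (auto simp: b0_def)
  have bb0: "b = b0 - e/3" by (simp add: b_def b0_def e_def field_simps)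
  have P: "Pt a t h = X\<^sup>2 + (a - t)\<^sup>2 * Q" unfolding Pt_def X_def Q_def b_def v_def ..
  have P0: "Pt a 1 0 = (b0^3)\<^sup>2 + (a - 1)\<^sup>2 * (3 * b0^4)" unfolding Pt_def b0_def by simp
  have diff: "Pt a t h - Pt a 1 0 = (X - b0^3) * (X + b0^3) + (e * (2 * (a - 1) + e)) * Q + (a - 1)\<^sup>2 * (Q - 3 * b0^4)"
  proof -
    have at: "a - t = (a - 1) + e" by (simp add: e_def)
    show ?thesis unfolding P P0 at by algebra
  qed
  have sq: "b0\<^sup>2 \<le> 4" "b\<^sup>2 \<le> 4" using power_mono[of b0 2 2] power_mono[of b 2 2] b0 pr(4,5) by simp_all
  have "b0^3 - b^3 = (e/3) * (b0\<^sup>2 + b0 * b + b\<^sup>2)" unfolding bb0 by (simp add: field_simps power2_eq_square power3_eq_cube)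
  moreover have "b0 * b \<le> 2 * 2" using b0 pr(4,5) by (intro mult_mono) auto
  then have "(e/3) * (b0\<^sup>2 + b0 * b + b\<^sup>2) \<le> (e/3) * 12" using e0 sq by (intro mult_left_mono) auto
  moreover have "0 \<le> (e/3) * (b0\<^sup>2 + b0 * b + b\<^sup>2)" using e0 b0 pr(4,5) by (intro mult_nonneg_nonneg add_nonneg_nonneg) auto
  ultimately have b3: "0 \<le> b0^3 - b^3" "b0^3 - b^3 \<le> 4 * e" by linarith+
  have bv: "b * v \<le> 2 * (2 * e)" using pr(1,3,4,5) by (intro mult_mono) auto
  have bv0: "0 \<le> b * v" using pr(1,4) by (intro mult_nonneg_nonneg) auto
  have X1: "\<bar>X - b0^3\<bar> \<le> 11 * e" unfolding X_def using b3 bv bv0 pr(7) by linarith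
  have b03: "b0^3 \<le> 8" "0 \<le> b0^3" using power_mono[of b0 2 3] b0 by simp_all
  have X2: "\<bar>X + b0^3\<bar> \<le> 38" using X1 b03 e0 by linarith
  have a1: "0 \<le> a - 1" "(a - 1)\<^sup>2 \<le> 1/4" using a power_mono[of "a - 1" "1/2" 2] by (simp_all add: power2_eq_square)
  show "\<bar>Pt a t h - Pt a 1 0\<bar> \<le> 700 * (1 - t)"
  proof -
    have 1: "\<bar>(X - b0^3) * (X + b0^3)\<bar> \<le> (11 * e) * 38" by (rule abs_mult_le[OF X1 X2])
    have "e * (2 * (a - 1) + e) \<le> e * 3" using e0 a by (intro mult_left_mono) auto
    then have "\<bar>e * (2 * (a - 1) + e)\<bar> \<le> e * 3" using e0 a1 by (simp add: abs_mult)
    then have 2: "\<bar>(e * (2 * (a - 1) + e)) * Q\<bar> \<le> (e * 3) * 73" by (rule abs_mult_le[OF _ pr(8)])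
    have "\<bar>(a - 1)\<^sup>2\<bar> \<le> 1/4" using a1 by simp
    then have 3: "\<bar>(a - 1)\<^sup>2 * (Q - 3 * b0^4)\<bar> \<le> 1/4 * (81 * e)" by (rule abs_mult_le[OF _ pr(9)])
    show ?thesis unfolding diff e_def[symmetric] using 1 2 3 e0 by linarith
  qed
  assume as: "a \<le> 1 + 1/1000" and es': "1 - t \<le> 1/1000"
  then have es: "e \<le> 1/1000" by (simp add: e_def)
  \<comment> \<open>The bound for h^2 is cubic in e, so for e \<le> 1/1000 it is below a small
    multiple of e^2.\<close>
  have h4: "\<bar>h\<bar> \<le> e / 4"
  proof -
    have "h\<^sup>2 \<le> (4/3 * v)^3" using h by (simp add: v_def)
    also have "\<dots> \<le> (4/3 * (2 * e))^3" using pr(1,3) by (intro power_mono mult_left_mono) auto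
    also have "\<dots> = (512/27) * e * e\<^sup>2" by (simp add: power_mult_distrib power3_eq_cube power2_eq_square)
    also have "\<dots> \<le> (1/16) * e\<^sup>2" using es e0 by (intro mult_right_mono) auto
    finally have "h\<^sup>2 \<le> (e/4)\<^sup>2" by (simp add: power_divide)
    then show ?thesis using e0 power2_le_imp_le[of "\<bar>h\<bar>" "e / 4"] by simp
  qed
  have Xu: "X \<le> b0^3 - (19/10) * e"
  proof -
    have "b * b\<^sup>2 \<le> b * b0\<^sup>2" using pr(4) e0 bb0 by (intro mult_left_mono power_mono) auto
    moreover have "b * b0\<^sup>2 = b0^3 - (b0\<^sup>2/3) * e" unfolding bb0 by (simp add: field_simps power2_eq_square power3_eq_cube)
    moreover have "16/9 \<le> b0\<^sup>2" using power_mono[of "4/3" b0 2] b0 by (simp add: power2_eq_square)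
    then have "(16/27) * e \<le> (b0\<^sup>2/3) * e" using e0 by (intro mult_right_mono) auto
    ultimately have 1: "b^3 \<le> b0^3 - (16/27) * e" by (simp add: power3_eq_cube power2_eq_square)
    have "v = e * (2 - e)" unfolding v_def e_def by (simp add: power2_eq_square algebra_simps)
    moreover have "e * (19/10) \<le> e * (2 - e)" using es e0 by (intro mult_left_mono) auto
    ultimately have "(19/10) * e \<le> v" by simp
    then have "(13/10) * ((19/10) * e) \<le> b * v" using e0 es b0 bb0 by (intro mult_mono) auto
    then show ?thesis unfolding X_def using 1 h4 e0 by linarith
  qed
  have b02: "64/27 \<le> b0^3" using power_mono[of "4/3" b0 3] b0 by (simp add: power_divide)
  have X0: "0 \<le> X" using X1 b02 es by linarith
  have "(X - b0^3) * (X + b0^3) \<le> (- (19/10) * e) * (X + b0^3)" using Xu X0 b03 by (intro mult_right_mono) auto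
  also have "\<dots> \<le> (- (19/10) * e) * (64/27)" using X0 b02 e0 by (intro mult_left_mono_neg) auto
  finally have 1: "(X - b0^3) * (X + b0^3) \<le> - 4 * e" using e0 by linarith
  have "e * (2 * (a - 1) + e) \<le> e * (3/1000)" using e0 as es by (intro mult_left_mono) auto
  then have "\<bar>e * (2 * (a - 1) + e)\<bar> \<le> e * (3/1000)" using e0 a1 by (simp add: abs_mult)
  then have 2: "\<bar>(e * (2 * (a - 1) + e)) * Q\<bar> \<le> (e * (3/1000)) * 73" by (rule abs_mult_le[OF _ pr(8)])
  have "(a - 1)\<^sup>2 \<le> (1/1000)\<^sup>2" using as a1 by (intro power_mono) auto
  then have "\<bar>(a - 1)\<^sup>2\<bar> \<le> 1/1000" by (simp add: power2_eq_square)
  then have 3: "\<bar>(a - 1)\<^sup>2 * (Q - 3 * b0^4)\<bar> \<le> 1/1000 * (81 * e)" by (rule abs_mult_le[OF _ pr(9)])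
  show "Pt a t h + 2 * (1 - t) \<le> Pt a 1 0" using diff 1 2 3 e0 unfolding e_def[symmetric] by linarith
qed

definition Ef :: "real \<Rightarrow> real^3 \<Rightarrow> real" where "Ef a z = Pf a (\<xi> 1) / Pf a z"

text \<open>\<open>Th s\<close> contracts the sphere towards \<xi> 1, and \<open>Ph s\<close>, its
  inverse, blows that vertex up. The other three bubbles are reached by composing with
  \<open>refl 1 k\<close>.\<close>

abbreviation Th :: "real \<Rightarrow> real^3 \<Rightarrow> real^3" where "Th s \<equiv> bub (aa s) (- \<xi> 1)"
abbreviation Ph :: "real \<Rightarrow> real^3 \<Rightarrow> real^3" where "Ph s \<equiv> bub (aa s) (\<xi> 1)"

lemma Pf_vertex_bounds: "1 \<le> a \<Longrightarrow> a \<le> 3/2 \<Longrightarrow> Pf a (\<xi> 1) \<le> 100"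
proof -
  assume a: "1 \<le> a" "a \<le> 3/2"
  have 1: "(a + 1/3)^3 \<le> (19/10)^3" using a by (intro power_mono) auto
  have "((a + 1/3)^3)\<^sup>2 \<le> ((19/10)^3)\<^sup>2" using 1 a by (intro power_mono) auto
  moreover have "(a - 1)\<^sup>2 \<le> (1/2)\<^sup>2" using a by (intro power_mono) auto
  moreover have "(a + 1/3)^4 \<le> (19/10)^4" using a by (intro power_mono) auto
  then have "(a - 1)\<^sup>2 * (3 * (a + 1/3)^4) \<le> (1/2)\<^sup>2 * (3 * (19/10)^4)" using a \<open>(a - 1)\<^sup>2 \<le> (1/2)\<^sup>2\<close> by (intro mult_mono) auto
  moreover have "Pf a (\<xi> 1) = ((a + 1/3)^3)\<^sup>2 + (a - 1)\<^sup>2 * (3 * (a + 1/3)^4)" unfolding Pf_vertex Pt_def by simp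
  ultimately show ?thesis by (simp add: power_divide)
qed

text \<open>179200 is 700 * 256, from the lower bound 1/256 for \<open>Pf\<close>; the factor 1/50
  is 2/100, from its upper bound 100 near the vertex. The second estimate is what makes the
  multiplier positive.\<close>

lemma Ef_bounds:
  assumes a: "1 \<le> a" "a \<le> 3/2" and z: "norm z = 1"
  shows "\<bar>Ef a z - 1\<bar> \<le> 179200 * (1 - z \<bullet> \<xi> 1)"
    and "a \<le> 1 + 1/1000 \<Longrightarrow> 1 - z \<bullet> \<xi> 1 \<le> 1/1000 \<Longrightarrow> (1 - z \<bullet> \<xi> 1) / 50 \<le> Ef a z - 1"
proof -
  obtain h where h: "Pf a z = Pt a (z \<bullet> \<xi> 1) h" "h\<^sup>2 \<le> (4/3 * (1 - (z \<bullet> \<xi> 1)\<^sup>2))^3" using Pf_Pt[OF z] by metis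
  have t: "\<bar>z \<bullet> \<xi> 1\<bar> \<le> 1" by (rule abs_inner_le_1[OF z nrm])
  have low: "1/256 \<le> Pf a z" by (rule Pf_lower[OF z a(1)])
  have e: "Ef a z - 1 = (Pf a (\<xi> 1) - Pf a z) / Pf a z" unfolding Ef_def using low by (simp add: field_simps)
  have b: "\<bar>Pf a (\<xi> 1) - Pf a z\<bar> \<le> 700 * (1 - z \<bullet> \<xi> 1)"
    using Pt_bound(1)[OF a t h(2)] unfolding h(1) Pf_vertex by (simp add: abs_minus_commute)
  have "\<bar>Ef a z - 1\<bar> = \<bar>Pf a (\<xi> 1) - Pf a z\<bar> / Pf a z" unfolding e using low by simp
  also have "\<dots> \<le> (700 * (1 - z \<bullet> \<xi> 1)) / (1/256)" using b low by (intro frac_le) auto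
  finally show "\<bar>Ef a z - 1\<bar> \<le> 179200 * (1 - z \<bullet> \<xi> 1)" by simp
  assume as: "a \<le> 1 + 1/1000" "1 - z \<bullet> \<xi> 1 \<le> 1/1000"
  have t1: "0 \<le> 1 - z \<bullet> \<xi> 1" by (rule one_minus_inner_ge[OF z nrm])
  have g: "2 * (1 - z \<bullet> \<xi> 1) \<le> Pf a (\<xi> 1) - Pf a z" using Pt_bound(2)[OF a t h(2) as] unfolding h(1) Pf_vertex by simp
  have "0 \<le> 2 * (1 - z \<bullet> \<xi> 1)" using t1 by (rule mult_nonneg_nonneg[rotated]) simp
  from order_trans[OF this g] have "Pf a z \<le> 100" using Pf_vertex_bounds[OF a] by linarith
  then have "(2 * (1 - z \<bullet> \<xi> 1)) / 100 \<le> (Pf a (\<xi> 1) - Pf a z) / Pf a z" using g t1 low by (intro frac_le) auto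
  moreover have "(2 * u) / 100 = u / 50" for u :: real by simp
  ultimately show "(1 - z \<bullet> \<xi> 1) / 50 \<le> Ef a z - 1" unfolding e by (simp only:)
qed

lemma Ef_symm: "symm T \<Longrightarrow> Ef a (T z) = Ef a z" by (simp add: Ef_def Pf_symm)

lemma Pf_cont: "continuous_on A (Pf a)"
  unfolding Pf_def prd_def by (intro continuous_intros)

lemma Ef_cont: "1 \<le> a \<Longrightarrow> continuous_on S2 (Ef a)"
  unfolding Ef_def using Pf_lower[of _ a] by (intro continuous_intros Pf_cont) fastforce

text \<open>The point \<open>Th s x\<close> has squared distance at most 2 * s^2 / (aa s + x
  \<bullet> \<xi> 1) from the vertex, so an error quadratic in the distance becomes a multiple of
  s^2 / (aa s + x \<bullet> \<xi> 1).\<close>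

lemma Th_facts:
  assumes s: "0 < s" "s \<le> 1" and x: "norm x = 1"
  shows "norm (Th s x) = 1" "0 < aa s + x \<bullet> \<xi> 1" "s\<^sup>2 / 3 \<le> aa s + x \<bullet> \<xi> 1" "1 + x \<bullet> \<xi> 1 \<le> aa s + x \<bullet> \<xi> 1"
    "1 - Th s x \<bullet> \<xi> 1 = s\<^sup>2 * (1 - x \<bullet> \<xi> 1) / ((aa s + x \<bullet> \<xi> 1) * (aa s + 1))"
    "1 - Th s x \<bullet> \<xi> 1 \<le> s\<^sup>2 / (aa s + x \<bullet> \<xi> 1)" "1 - Th s x \<bullet> \<xi> 1 \<le> 2" "0 \<le> 1 - Th s x \<bullet> \<xi> 1"
    "\<And>k. k \<noteq> 1 \<Longrightarrow> (Th s x \<bullet> \<xi> k) * (aa s + x \<bullet> \<xi> 1) = s * (x \<bullet> \<xi> k + (x \<bullet> \<xi> 1)/3) - (aa s * (x \<bullet> \<xi> 1) + 1)/3"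
proof -
  note a = aa_facts[OF s]
  have mN: "norm (- \<xi> 1) = 1" by simp
  show n: "norm (Th s x) = 1" by (rule bub_norm[OF a(1) mN x])
  have t: "\<bar>x \<bullet> \<xi> 1\<bar> \<le> 1" by (rule abs_inner_le_1[OF x nrm])
  show p: "0 < aa s + x \<bullet> \<xi> 1" "s\<^sup>2 / 3 \<le> aa s + x \<bullet> \<xi> 1" "1 + x \<bullet> \<xi> 1 \<le> aa s + x \<bullet> \<xi> 1" using a t by auto
  have exp: "Th s x = (1 / (aa s + x \<bullet> \<xi> 1)) *\<^sub>R (s *\<^sub>R (x - (x \<bullet> \<xi> 1) *\<^sub>R \<xi> 1) + (aa s * (x \<bullet> \<xi> 1) + 1) *\<^sub>R \<xi> 1)"
    unfolding bub_def a(4) by (simp add: algebra_simps)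
  have ti: "(Th s x \<bullet> \<xi> 1) * (aa s + x \<bullet> \<xi> 1) = aa s * (x \<bullet> \<xi> 1) + 1"
    unfolding exp using p by (simp add: inner_add_left inner_diff_left)
  have "(1 - Th s x \<bullet> \<xi> 1) * ((aa s + x \<bullet> \<xi> 1) * (aa s + 1)) = (aa s + 1) * ((aa s + x \<bullet> \<xi> 1) - (Th s x \<bullet> \<xi> 1) * (aa s + x \<bullet> \<xi> 1))"
    by algebra
  also have "\<dots> = ((aa s)\<^sup>2 - 1) * (1 - x \<bullet> \<xi> 1)" unfolding ti by algebra
  finally have "(1 - Th s x \<bullet> \<xi> 1) * ((aa s + x \<bullet> \<xi> 1) * (aa s + 1)) = s\<^sup>2 * (1 - x \<bullet> \<xi> 1)" unfolding a(3) .
  then show e: "1 - Th s x \<bullet> \<xi> 1 = s\<^sup>2 * (1 - x \<bullet> \<xi> 1) / ((aa s + x \<bullet> \<xi> 1) * (aa s + 1))"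
    using p(1) a(1) by (intro eq_divide_imp) auto
  have "s\<^sup>2 * (1 - x \<bullet> \<xi> 1) / ((aa s + x \<bullet> \<xi> 1) * (aa s + 1)) = s\<^sup>2 / (aa s + x \<bullet> \<xi> 1) * ((1 - x \<bullet> \<xi> 1) / (aa s + 1))"
    by simp
  also have "\<dots> \<le> s\<^sup>2 / (aa s + x \<bullet> \<xi> 1) * 1" using p(1) a(1) t by (intro mult_left_mono) auto
  finally show "1 - Th s x \<bullet> \<xi> 1 \<le> s\<^sup>2 / (aa s + x \<bullet> \<xi> 1)" using e by simp
  show "1 - Th s x \<bullet> \<xi> 1 \<le> 2" "0 \<le> 1 - Th s x \<bullet> \<xi> 1"
    by (rule one_minus_inner_le[OF n nrm], rule one_minus_inner_ge[OF n nrm])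
  fix k :: 4 assume k: "k \<noteq> 1"
  then have "\<xi> 1 \<bullet> \<xi> k = - (1/3)" by (intro inner_ne) auto
  then show "(Th s x \<bullet> \<xi> k) * (aa s + x \<bullet> \<xi> 1) = s * (x \<bullet> \<xi> k + (x \<bullet> \<xi> 1)/3) - (aa s * (x \<bullet> \<xi> 1) + 1)/3"
    unfolding exp using p(1) by (simp add: inner_add_left inner_diff_left)
qed

text \<open>The coordinates along the other vertices deviate from - (x \<bullet> \<xi> 1) / 3 by at
  most the order of the distance to - \<xi> 1. In \<open>Dop_bound\<close> this controls the only
  term of indefinite sign.\<close>

lemma dev_le:
  assumes x: "norm x = 1" and k: "k \<noteq> 1"
  shows "(x \<bullet> \<xi> k + (x \<bullet> \<xi> 1)/3)\<^sup>2 \<le> (8/3) * (1 + x \<bullet> \<xi> 1)"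
proof -
  define t where "t = x \<bullet> \<xi> 1"
  define d where "d l = x \<bullet> \<xi> l + t/3" for l
  have s: "d 2 + d 3 + d 4 = 0" using coords_sum[of x] by (simp add: d_def t_def)
  have "t\<^sup>2 + (d 2 - t/3)\<^sup>2 + (d 3 - t/3)\<^sup>2 + (d 4 - t/3)\<^sup>2 = 4/3" using coords_sq[of x] x by (simp add: d_def t_def)
  then have "(d 2)\<^sup>2 + (d 3)\<^sup>2 + (d 4)\<^sup>2 - (2 * t / 3) * (d 2 + d 3 + d 4) + t\<^sup>2 * (4/3) = 4/3"
    by (simp add: power2_eq_square algebra_simps)
  then have q: "(d 2)\<^sup>2 + (d 3)\<^sup>2 + (d 4)\<^sup>2 = 4/3 * (1 - t\<^sup>2)" unfolding s by simp
  have "k = 2 \<or> k = 3 \<or> k = 4" using k exhaust_4[of k] by auto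
  then have "(d k)\<^sup>2 \<le> (d 2)\<^sup>2 + (d 3)\<^sup>2 + (d 4)\<^sup>2" by auto
  also have "\<dots> = 4/3 * ((1 + t) * (1 - t))" unfolding q by (simp add: power2_eq_square algebra_simps)
  also have "\<dots> \<le> 4/3 * ((1 + t) * 2)" using abs_inner_le_1[OF x nrm[of 1]] unfolding t_def by (intro mult_left_mono) auto
  finally show ?thesis unfolding d_def t_def by simp
qed

end

section \<open>The fixed point equation\<close>

text \<open>One constant bounds the supremum and the 1/2-Hoelder seminorm on the sphere, so a
  contraction is a statement about constants. The seminorm is what makes \<open>Dop\<close> small,
  because \<open>Dop\<close> compares values of one function at two nearby points.\<close>

definition hold :: "real \<Rightarrow> (real^3 \<Rightarrow> real) \<Rightarrow> bool" where
  "hold d f \<longleftrightarrow> 0 \<le> d \<and> (\<forall>x. norm x = 1 \<longrightarrow> \<bar>f x\<bar> \<le> d) \<and>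
     (\<forall>x y. norm x = 1 \<longrightarrow> norm y = 1 \<longrightarrow> \<bar>f x - f y\<bar> \<le> d * sqrt (norm (x - y)))"

lemma holdD:
  assumes "hold d f"
  shows "0 \<le> d" "\<And>x. norm x = 1 \<Longrightarrow> \<bar>f x\<bar> \<le> d"
    "\<And>x y. norm x = 1 \<Longrightarrow> norm y = 1 \<Longrightarrow> \<bar>f x - f y\<bar> \<le> d * sqrt (norm (x - y))"
  using assms by (auto simp: hold_def)

lemma hold_mono: "hold d f \<Longrightarrow> d \<le> d' \<Longrightarrow> hold d' f"
  unfolding hold_def by (meson mult_right_mono norm_ge_zero order_trans real_sqrt_ge_zero)

lemma hold_add:
  assumes "hold d f" "hold d' f'"
  shows "hold (d + d') (\<lambda>x. f x + f' x)"
  unfolding hold_def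
proof (intro conjI allI impI)
  show "0 \<le> d + d'" using holdD(1)[OF assms(1)] holdD(1)[OF assms(2)] by simp
  fix x :: "real^3" assume x: "norm x = 1"
  show "\<bar>f x + f' x\<bar> \<le> d + d'" using holdD(2)[OF assms(1) x] holdD(2)[OF assms(2) x] by linarith
  fix y :: "real^3" assume y: "norm y = 1"
  show "\<bar>f x + f' x - (f y + f' y)\<bar> \<le> (d + d') * sqrt (norm (x - y))"
    using holdD(3)[OF assms(1) x y] holdD(3)[OF assms(2) x y] unfolding distrib_right by linarith
qed

lemma hold_zero: "0 \<le> d \<Longrightarrow> hold d (\<lambda>_. 0)"
  by (simp add: hold_def)

lemma hold_cont:
  assumes h: "hold d f"
  shows "continuous_on S2 f"
  unfolding continuous_on_def
proof
  fix x :: "real^3" assume x: "x \<in> S2"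
  have "((\<lambda>y. f y - f x) \<longlongrightarrow> 0) (at x within S2)"
  proof (rule Lim_null_comparison)
    show "\<forall>\<^sub>F y in at x within S2. norm (f y - f x) \<le> d * sqrt (norm (y - x))"
      unfolding eventually_at_filter using holdD(3)[OF h] x by (intro always_eventually) simp
    have "((\<lambda>y. d * sqrt (norm (y - x))) \<longlongrightarrow> d * sqrt (norm (x - x))) (at x within S2)"
      by (intro tendsto_intros)
    then show "((\<lambda>y. d * sqrt (norm (y - x))) \<longlongrightarrow> 0) (at x within S2)" by simp
  qed
  then show "(f \<longlongrightarrow> f x) (at x within S2)" by (simp add: LIM_zero_iff)
qed

lemma hold_gpot:
  assumes g: "wbd p m g"
  shows "hold (8 * m * sing_const) (gpot g)"
  unfolding hold_def
proof (intro conjI allI impI)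
  have m: "0 \<le> m * sing_const" using g sing_const_nonneg by (simp add: wbd_def)
  then show "0 \<le> 8 * m * sing_const" by (simp add: mult.assoc)
  fix x :: "real^3" assume x: "norm x = 1"
  show "\<bar>gpot g x\<bar> \<le> 8 * m * sing_const" using gpot_bound[OF g x] m by linarith
  fix y :: "real^3" assume "norm y = 1"
  then show "\<bar>gpot g x - gpot g y\<bar> \<le> 8 * m * sing_const * sqrt (norm (x - y))" by (rule gpot_holder[OF g x])
qed

lemma gpot_diff:
  assumes "wbd p m g" "wbd p' m' g'" "norm x = 1"
  shows "gpot (\<lambda>y. g y - g' y) x = gpot g x - gpot g' x"
  unfolding gpot_def right_diff_distrib
  using Bochner_Integration.integral_diff[OF greenk_integrable[OF assms(1,3)] greenk_integrable[OF assms(2,3)]] by simp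

text \<open>Up to the factor 2 * pi this is the integral of 1 / (aa s + x \<bullet> \<xi> 1) over
  the sphere. It grows like 2 * ln (1/s) and is the origin of the term s^2 * ln (1/s) in the
  multiplier.\<close>

definition ell :: "real \<Rightarrow> real" where "ell s = ln ((aa s + 1) / (aa s - 1))"

lemma ell_bounds:
  assumes s: "0 < s" "s \<le> 1"
  shows "2 * ln (1/s) \<le> ell s" "ell s \<le> ln 9 + 2 * ln (1/s)" "0 \<le> ell s"
proof -
  note a = aa_facts[OF s]
  have s2: "0 < s\<^sup>2" using s by simp
  have l: "2 * ln (1/s) = ln (1 / s\<^sup>2)" using s by (simp add: ln_div ln_realpow)
  have "1 / s\<^sup>2 \<le> 2 / (s\<^sup>2/2)" using s2 by (simp add: field_simps)
  also have "\<dots> \<le> (aa s + 1) / (aa s - 1)" using a(1,6) by (intro frac_le) auto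
  finally have 1: "1 / s\<^sup>2 \<le> (aa s + 1) / (aa s - 1)" .
  show r: "2 * ln (1/s) \<le> ell s" unfolding l ell_def using 1 s2 a(1) by (subst ln_le_cancel_iff) auto
  have "0 \<le> ln (1/s)" using s by simp
  then show "0 \<le> ell s" using r by linarith
  have "(aa s + 1) / (aa s - 1) \<le> 3 / (s\<^sup>2/3)" using a(1,2,5) s2 by (intro frac_le) auto
  also have "\<dots> = 9 * (1 / s\<^sup>2)" by simp
  finally have 2: "(aa s + 1) / (aa s - 1) \<le> 9 * (1 / s\<^sup>2)" .
  have "ell s \<le> ln (9 * (1 / s\<^sup>2))" unfolding ell_def using 2 s2 a(1) by (subst ln_le_cancel_iff) auto
  also have "\<dots> = ln 9 + ln (1 / s\<^sup>2)" using s2 by (intro ln_mult_pos) auto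
  finally show "ell s \<le> ln 9 + 2 * ln (1/s)" unfolding l .
qed

lemma zonal_inverse:
  assumes c: "0 < c"
  shows "integrable zonal_measure (\<lambda>v. 1 / (c + v))" "(\<integral>v. 1 / (c + v) \<partial>zonal_measure) = 2 * pi * ln ((c + 2) / c)"
    "integrable zonal_measure (\<lambda>v. 1 / (c + v)\<^sup>2)" "(\<integral>v. 1 / (c + v)\<^sup>2 \<partial>zonal_measure) = 2 * pi * (1 / c - 1 / (c + 2))"
proof -
  have c1: "continuous_on {0..2} (\<lambda>v. 1 / (c + v))" "continuous_on {0..2} (\<lambda>v. 1 / (c + v)\<^sup>2)"
    using c by (auto intro!: continuous_intros simp: add_nonneg_eq_0_iff)
  have i1: "((\<lambda>v. 1 / (c + v)) has_integral (ln (c + 2) - ln (c + 0))) {0..2}"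
    unfolding has_real_derivative_iff_has_vector_derivative[symmetric]
    by (intro fundamental_theorem_of_calculus)
       (use c in \<open>auto intro!: derivative_eq_intros simp: has_real_derivative_iff_has_vector_derivative[symmetric]\<close>)
  have i2: "((\<lambda>v. 1 / (c + v)\<^sup>2) has_integral ((- 1 / (c + 2)) - (- 1 / (c + 0)))) {0..2}"
    by (intro fundamental_theorem_of_calculus)
       (use c in \<open>auto intro!: derivative_eq_intros simp: has_real_derivative_iff_has_vector_derivative[symmetric] power2_eq_square\<close>)
  note z1 = zonal_has_integral[OF _ absolutely_integrable_continuous_real[OF c1(1)]]
  note z2 = zonal_has_integral[OF _ absolutely_integrable_continuous_real[OF c1(2)]]
  show "integrable zonal_measure (\<lambda>v. 1 / (c + v))" "integrable zonal_measure (\<lambda>v. 1 / (c + v)\<^sup>2)"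
    by (rule z1(1), simp, rule z2(1), simp)
  show "(\<integral>v. 1 / (c + v) \<partial>zonal_measure) = 2 * pi * ln ((c + 2) / c)"
    using z1(2) integral_unique[OF i1] c by (simp add: ln_div)
  show "(\<integral>v. 1 / (c + v)\<^sup>2 \<partial>zonal_measure) = 2 * pi * (1 / c - 1 / (c + 2))"
    using z2(2) integral_unique[OF i2] by simp
qed

section \<open>The blown-up equation and its error terms\<close>

context tetra begin

lemma bub_T: "symm T \<Longrightarrow> T (\<xi> 1) = \<xi> 1 \<Longrightarrow> T (Th s x) = Th s (T x)" "symm T \<Longrightarrow> T (\<xi> 1) = \<xi> 1 \<Longrightarrow> T (Ph s x) = Ph s (T x)"
  using bub_orth[OF symm_orth, of T "aa s" "- \<xi> 1" x] bub_orth[OF symm_orth, of T "aa s" "\<xi> 1" x]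
    linear_neg[OF orthogonal_transformation_linear[OF symm_orth], of T "\<xi> 1"] by auto

lemma int_inv_t:
  assumes s: "0 < s" "s \<le> 1"
  shows "integrable area (\<lambda>x. 1 / (aa s + x \<bullet> \<xi> 1))" "(\<integral>x. 1 / (aa s + x \<bullet> \<xi> 1) \<partial>area) = 2 * pi * ell s"
    "integrable area (\<lambda>x. 1 / (aa s + x \<bullet> \<xi> 1)\<^sup>2)" "(\<integral>x. 1 / (aa s + x \<bullet> \<xi> 1)\<^sup>2 \<partial>area) = 4 * pi / s\<^sup>2"
proof -
  note a = aa_facts[OF s]
  have n: "norm (- \<xi> 1) = 1" by simp
  have c: "0 < aa s - 1" using a by simp
  have e: "aa s + x \<bullet> \<xi> 1 = (aa s - 1) + (1 - x \<bullet> (- \<xi> 1))" for x by simp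
  note z = integral_zonal[OF n, of "\<lambda>v. 1 / ((aa s - 1) + v)", folded e] integral_zonal[OF n, of "\<lambda>v. 1 / ((aa s - 1) + v)\<^sup>2", folded e]
  show "integrable area (\<lambda>x. 1 / (aa s + x \<bullet> \<xi> 1))" using z(2) zonal_inverse(1)[OF c] by simp
  show "(\<integral>x. 1 / (aa s + x \<bullet> \<xi> 1) \<partial>area) = 2 * pi * ell s"
  proof -
    have e2: "aa s - 1 + 2 = aa s + 1" by simp
    show ?thesis using z(1) zonal_inverse(2)[OF c] unfolding e2 ell_def by simp
  qed
  show "integrable area (\<lambda>x. 1 / (aa s + x \<bullet> \<xi> 1)\<^sup>2)" using z(4) zonal_inverse(3)[OF c] by simp
  have "1 / (aa s - 1) - 1 / (aa s - 1 + 2) = 2 / ((aa s)\<^sup>2 - 1)"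
    using c by (simp add: field_simps power2_eq_square)
  then show "(\<integral>x. 1 / (aa s + x \<bullet> \<xi> 1)\<^sup>2 \<partial>area) = 4 * pi / s\<^sup>2"
    using z(3) zonal_inverse(4)[OF c] unfolding a(3) by simp
qed

text \<open>The effect of the other three bubbles on the first, in its blown-up coordinates: by
  symmetry their corrections are copies of the same function. Each is normalized to vanish at x =
  \<xi> 1, which \<open>Th s\<close> fixes; \<open>phi\<close> subtracts the same constants.\<close>

definition Dop :: "real \<Rightarrow> (real^3 \<Rightarrow> real) \<Rightarrow> real^3 \<Rightarrow> real" where
  "Dop s f x = (\<Sum>k\<in>UNIV-{1}. f (Ph s (refl 1 k (Th s x))) - f (Ph s (\<xi> k)))"

text \<open>The density in blown-up coordinates is \<open>1 + f x + gop s f x\<close>. The summand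
  \<open>f x\<close> goes to the operator, which thereby becomes \<Delta> + 2, and
  \<open>gop\<close> is the remaining right-hand side.\<close>

definition gop :: "real \<Rightarrow> (real^3 \<Rightarrow> real) \<Rightarrow> real^3 \<Rightarrow> real" where
  "gop s f x = Ef (aa s) (Th s x) * exp (f x + Dop s f x) - 1 - f x"

text \<open>The density of the uniform probability measure, seen after blowing up the vertex.\<close>

definition qf :: "real \<Rightarrow> real^3 \<Rightarrow> real" where
  "qf s x = s\<^sup>2 / (4 * pi * (aa s + x \<bullet> \<xi> 1)\<^sup>2)"

text \<open>The coefficient for which \<open>gam s f\<close> is orthogonal to x \<bullet> \<xi> 1.
  The denominator is at most -1/2 for small s, because \<open>qf s\<close> is a probability density
  that concentrates at - \<xi> 1.\<close>

definition mop :: "real \<Rightarrow> (real^3 \<Rightarrow> real) \<Rightarrow> real" where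
  "mop s f = (\<integral>x. (x \<bullet> \<xi> 1) * gop s f x \<partial>area) / (\<integral>x. (x \<bullet> \<xi> 1) * qf s x \<partial>area)"

definition gam :: "real \<Rightarrow> (real^3 \<Rightarrow> real) \<Rightarrow> real^3 \<Rightarrow> real" where
  "gam s f x = gop s f x - mop s f * qf s x"

definition inv1 :: "(real^3 \<Rightarrow> real) \<Rightarrow> bool" where
  "inv1 f \<longleftrightarrow> (\<forall>T x. stab T \<longrightarrow> norm x = 1 \<longrightarrow> f (T x) = f x)"

lemma Dop_diff: "Dop s (\<lambda>x. f x - h x) x = Dop s f x - Dop s h x"
  unfolding Dop_def sum_subtractf[symmetric] by (intro sum.cong refl) simp

lemma refl_norm: "norm (refl k l x) = norm x" by (rule orth_norm[OF refl_orth])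

lemma Ph_norm: "0 < s \<Longrightarrow> s \<le> 1 \<Longrightarrow> norm x = 1 \<Longrightarrow> norm (Ph s x) = 1"
  by (intro bub_norm aa_facts) auto

text \<open>If w = 1 + x \<bullet> \<xi> 1 is below 4 * s^2, the crude bound 2 * d per term is
  absorbed by the weight. Otherwise \<open>bub_dist\<close> shows that the two arguments of
  \<open>f\<close> have squared distance at most 4 * s^4 / w, and Hoelder continuity of exponent 1/2
  turns this into a multiple of s * w powr (-1/4).\<close>

lemma Dop_bound:
  assumes h: "hold d f" and s: "0 < s" "s \<le> 1" and x: "norm x = 1"
  shows "\<bar>Dop s f x\<bar> \<le> 6 * d" "0 < 1 + x \<bullet> \<xi> 1 \<Longrightarrow> \<bar>Dop s f x\<bar> \<le> 18 * d * s * (1 + x \<bullet> \<xi> 1) powr (-5/8)"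
proof -
  note a = aa_facts[OF s] note T = Th_facts[OF s x]
  note d0 = holdD(1)[OF h]
  have nR: "norm (Ph s (refl 1 k (Th s x))) = 1" "norm (Ph s (\<xi> k)) = 1" for k
    by (rule Ph_norm[OF s], simp add: refl_norm T(1), rule Ph_norm[OF s], simp)
  have b1: "\<bar>f (Ph s (refl 1 k (Th s x))) - f (Ph s (\<xi> k))\<bar> \<le> 2 * d" for k
    using holdD(2)[OF h nR(1)[of k]] holdD(2)[OF h nR(2)[of k]] by linarith
  have card: "card (UNIV - {1::4}) = 3" by (simp add: card_Diff_singleton)
  have "\<bar>Dop s f x\<bar> \<le> (\<Sum>k\<in>UNIV-{1::4}. 2 * d)" unfolding Dop_def
    by (rule order_trans[OF sum_abs sum_mono]) (rule b1)
  then show "\<bar>Dop s f x\<bar> \<le> 6 * d" using card by simp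
  assume w: "0 < 1 + x \<bullet> \<xi> 1"
  define w where "w = 1 + x \<bullet> \<xi> 1"
  have w0: "0 < w" "w \<le> 2" using w abs_inner_le_1[OF x nrm[of 1]] by (auto simp: w_def)
  note W = weight_facts[OF w0]
  have b2: "\<bar>f (Ph s (refl 1 k (Th s x))) - f (Ph s (\<xi> k))\<bar> \<le> 6 * d * s * w powr (-5/8)" if k: "k \<in> UNIV - {1}" for k
  proof (cases "w < 4 * s\<^sup>2")
    case True
    have "2 * d * 1 \<le> 2 * d * (3 * s * w powr (-5/8))" using d0 by (intro mult_left_mono W(3)[OF s True]) auto
    then show ?thesis using b1[of k] by simp
  next
    case False
    define A where "A = aa s + x \<bullet> \<xi> 1"
    define Z where "Z = refl 1 k (Th s x)"
    have k1: "k \<noteq> 1" using k by simp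
    have Z: "norm Z = 1" "Z \<bullet> \<xi> 1 = Th s x \<bullet> \<xi> k" "Z \<bullet> \<xi> k = Th s x \<bullet> \<xi> 1"
      using symm_inner[OF refl_symm[of 1 k], of "Th s x" "\<xi> k"] symm_inner[OF refl_symm[of 1 k], of "Th s x" "\<xi> 1"]
      by (simp_all add: Z_def refl_norm T(1) refl_xi)
    have A0: "0 < A" using T(2) by (simp add: A_def)
    define G where "G = (aa s - Th s x \<bullet> \<xi> k) * A"
    define dv where "dv = x \<bullet> \<xi> k + (x \<bullet> \<xi> 1)/3"
    have GE: "G = aa s * (aa s - 1) - (aa s - 1)/3 + 4/3 * (aa s * w) - s * dv"
    proof -
      have "G = aa s * A - (Th s x \<bullet> \<xi> k) * A" by (simp add: G_def algebra_simps)
      also have "(Th s x \<bullet> \<xi> k) * A = s * dv - (aa s * (x \<bullet> \<xi> 1) + 1)/3" unfolding A_def dv_def by (rule T(9)[OF k1])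
      finally show ?thesis unfolding A_def w_def by (simp add: field_simps)
    qed
    \<comment> \<open>Here w \<ge> 4 * s^2 is used. Subtracted from the main term 4/3 * w of
      \<open>G\<close> this leaves w / 2.\<close>
    have sd: "\<bar>s * dv\<bar> \<le> 5/6 * w"
    proof -
      have "(s * dv)\<^sup>2 = s\<^sup>2 * dv\<^sup>2" by (simp add: power_mult_distrib)
      also have "\<dots> \<le> (w/4) * ((8/3) * w)" using False dev_le[OF x k1] w0 unfolding dv_def w_def[symmetric]
        by (intro mult_mono) auto
      also have "\<dots> \<le> (5/6 * w)\<^sup>2" using zero_le_square[of w] by (simp add: power2_eq_square field_simps)
      finally have "\<bar>s * dv\<bar>\<^sup>2 \<le> (5/6 * w)\<^sup>2" by simp
      then show ?thesis by (rule power2_le_imp_le) (use w0 in simp)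
    qed
    have "w * 1 \<le> aa s * w" using a w0 by simp
    moreover have "0 \<le> (aa s - 1/3) * (aa s - 1)" using a by (intro mult_nonneg_nonneg) auto
    then have "0 \<le> aa s * (aa s - 1) - (aa s - 1)/3" by (simp add: algebra_simps)
    moreover have "s * dv \<le> 5/6 * w" using sd by linarith
    ultimately have G: "w / 2 \<le> G" unfolding GE by linarith
    have pos: "0 < aa s - Th s x \<bullet> \<xi> k" by (rule a_minus_pos[OF a(1) nrm T(1)])
    have "(norm (Ph s Z - Ph s (\<xi> k)))\<^sup>2 = jf (aa s) (\<xi> 1) Z * jf (aa s) (\<xi> 1) (\<xi> k) * (norm (Z - \<xi> k))\<^sup>2"
      by (rule bub_dist[OF a(1) nrm Z(1) nrm])
    also have "(norm (Z - \<xi> k))\<^sup>2 = 2 * (s\<^sup>2 * (1 - x \<bullet> \<xi> 1) / (A * (aa s + 1)))"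
      unfolding one_minus_inner[OF Z(1) nrm] Z(3) T(5) A_def ..
    also have "jf (aa s) (\<xi> 1) Z * jf (aa s) (\<xi> 1) (\<xi> k) = (s / (aa s - Th s x \<bullet> \<xi> k)) * (s / (aa s + 1/3))"
      unfolding jf_def a(4) Z(2) using inner_ne[OF k1] by simp
    also have "(s / (aa s - Th s x \<bullet> \<xi> k)) * (s / (aa s + 1/3)) * (2 * (s\<^sup>2 * (1 - x \<bullet> \<xi> 1) / (A * (aa s + 1))))
        = (2 * s^4 * (1 - x \<bullet> \<xi> 1)) / (G * ((aa s + 1/3) * (aa s + 1)))"
      unfolding G_def by (simp add: power2_eq_square power4_eq_xxxx mult_ac)
    also have "\<dots> \<le> (2 * s^4 * 2) / ((w/2) * (1 * 2))"
    proof (intro frac_le)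
      show "2 * s^4 * (1 - x \<bullet> \<xi> 1) \<le> 2 * s^4 * 2" using one_minus_inner_le[OF x nrm] by (intro mult_left_mono) auto
      show "(w/2) * (1 * 2) \<le> G * ((aa s + 1/3) * (aa s + 1))" using G a w0 by (intro mult_mono) auto
    qed (use w0 in auto)
    also have "\<dots> = 4 * s^4 / w" by simp
    finally have n2: "(norm (Ph s Z - Ph s (\<xi> k)))\<^sup>2 \<le> 4 * s^4 / w" .
    have "sqrt (norm (Ph s Z - Ph s (\<xi> k))) = ((norm (Ph s Z - Ph s (\<xi> k)))\<^sup>2) powr (1/4)"
    proof -
      have "sqrt (norm (Ph s Z - Ph s (\<xi> k))) = sqrt (sqrt ((norm (Ph s Z - Ph s (\<xi> k)))\<^sup>2))" by simp
      also have "\<dots> = (((norm (Ph s Z - Ph s (\<xi> k)))\<^sup>2) powr (1/2)) powr (1/2)" by (simp add: powr_half_sqrt)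
      finally show ?thesis unfolding powr_powr by simp
    qed
    also have "\<dots> \<le> (4 * s^4 / w) powr (1/4)" using n2 by (intro powr_mono2) auto
    also have "\<dots> = ((4 * s^4) powr (1/4)) * w powr (-1/4)"
    proof -
      have m: "w powr (-1/4) = 1 / w powr (1/4)" using powr_minus_divide[of w "1/4"] by simp
      show ?thesis unfolding m using w0 s by (simp add: powr_divide)
    qed
    also have "\<dots> \<le> (3 * s) * (2 * w powr (-5/8))"
    proof (rule mult_mono)
      have "(4 * s^4) powr (1/4) \<le> (81 * s^4) powr (1/4)" by (intro powr_mono2) auto
      also have "81 * s^4 = (3 * s) powr 4" using s by (simp add: power_mult_distrib powr_numeral)
      also have "((3 * s) powr 4) powr (1/4) = 3 * s" unfolding powr_powr using s by simp
      finally show "(4 * s^4) powr (1/4) \<le> 3 * s" .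
    qed (use W(2) s in auto)
    finally have "sqrt (norm (Ph s Z - Ph s (\<xi> k))) \<le> 3 * s * (2 * w powr (-5/8))" .
    then have "d * sqrt (norm (Ph s Z - Ph s (\<xi> k))) \<le> d * (3 * s * (2 * w powr (-5/8)))" using d0 by (rule mult_left_mono)
    then show ?thesis using holdD(3)[OF h nR(1)[of k] nR(2)[of k]] unfolding Z_def[symmetric] by simp
  qed
  have "\<bar>Dop s f x\<bar> \<le> (\<Sum>k\<in>UNIV-{1::4}. 6 * d * s * w powr (-5/8))" unfolding Dop_def
    by (rule order_trans[OF sum_abs sum_mono]) (rule b2)
  then show "\<bar>Dop s f x\<bar> \<le> 18 * d * s * (1 + x \<bullet> \<xi> 1) powr (-5/8)" using card unfolding w_def by simp
qed

lemma Th_cont: "0 < s \<Longrightarrow> s \<le> 1 \<Longrightarrow> continuous_on S2 (Th s)"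
  by (intro bub_cont aa_facts) auto

lemma Ph_cont: "0 < s \<Longrightarrow> s \<le> 1 \<Longrightarrow> continuous_on S2 (Ph s)"
  by (intro bub_cont aa_facts) auto

lemma gop_cont:
  assumes f: "continuous_on S2 f" and s: "0 < s" "s \<le> 1"
  shows "continuous_on S2 (gop s f)" "continuous_on S2 (Dop s f)"
proof -
  have r: "continuous_on S2 (refl 1 k)" for k by (rule linear_continuous_on) (simp add: linear_conv_bounded_linear[symmetric] refl_linear)
  have Tn: "Th s ` S2 \<subseteq> S2" using Th_facts(1)[OF s] by auto
  have 1: "continuous_on S2 (\<lambda>x. f (Ph s (refl 1 k (Th s x))))" for k
  proof (rule continuous_on_compose2[OF f])
    show "continuous_on S2 (\<lambda>x. Ph s (refl 1 k (Th s x)))"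
      by (rule continuous_on_compose2[OF Ph_cont[OF s]], rule continuous_on_compose2[OF r Th_cont[OF s] Tn])
         (use Th_facts(1)[OF s] in \<open>auto simp: refl_norm\<close>)
    show "(\<lambda>x. Ph s (refl 1 k (Th s x))) ` S2 \<subseteq> S2"
      using Th_facts(1)[OF s] Ph_norm[OF s] by (auto simp: refl_norm)
  qed
  show D: "continuous_on S2 (Dop s f)" unfolding Dop_def by (intro continuous_intros 1)
  have E: "continuous_on S2 (\<lambda>x. Ef (aa s) (Th s x))"
    by (rule continuous_on_compose2[OF Ef_cont Th_cont[OF s] Tn]) (use aa_facts[OF s] in simp)
  show "continuous_on S2 (gop s f)" unfolding gop_def by (intro continuous_intros E f D)
qed

lemma qf_cont: "0 < s \<Longrightarrow> s \<le> 1 \<Longrightarrow> continuous_on S2 (qf s)"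
proof -
  assume s: "0 < s" "s \<le> 1"
  have "aa s + x \<bullet> \<xi> 1 \<noteq> 0" if "x \<in> S2" for x using Th_facts(2)[OF s, of x] that by simp
  then show ?thesis unfolding qf_def by (intro continuous_intros) auto
qed

lemma wbdI:
  assumes "continuous_on S2 g" "0 \<le> m" "\<And>x. norm x = 1 \<Longrightarrow> 0 < 1 + x \<bullet> \<xi> 1 \<Longrightarrow> \<bar>g x\<bar> \<le> m * (1 + x \<bullet> \<xi> 1) powr (-5/8)"
  shows "wbd (- \<xi> 1) m g"
  unfolding wbd_def using assms borel_measurable_areaI[OF assms(1)] by simp

text \<open>With y = s^2 / (aa s + x \<bullet> \<xi> 1), the distance of \<open>Ef\<close> from 1 is
  at most a multiple of min 1 y, hence of y powr (5/8). This interpolation trades the singularity of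
  y at - \<xi> 1 for the admissible weight and still leaves s powr (5/4), which is o(s).\<close>

lemma E_bound:
  assumes s: "0 < s" "s \<le> 1" and x: "norm x = 1"
  shows "\<bar>Ef (aa s) (Th s x) - 1\<bar> \<le> 179200 * (s\<^sup>2 / (aa s + x \<bullet> \<xi> 1))"
    "0 < 1 + x \<bullet> \<xi> 1 \<Longrightarrow> \<bar>Ef (aa s) (Th s x) - 1\<bar> \<le> 358400 * s powr (5/4) * (1 + x \<bullet> \<xi> 1) powr (-5/8)"
    "\<bar>Ef (aa s) (Th s x) - 1\<bar> \<le> 358400"
proof -
  note a = aa_facts[OF s] note T = Th_facts[OF s x]
  have a1: "1 \<le> aa s" using a by simp
  have e: "\<bar>Ef (aa s) (Th s x) - 1\<bar> \<le> 179200 * (1 - Th s x \<bullet> \<xi> 1)" by (rule Ef_bounds(1)[OF a1 a(2) T(1)])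
  also have "\<dots> \<le> 179200 * (s\<^sup>2 / (aa s + x \<bullet> \<xi> 1))" by (rule mult_left_mono[OF T(6)]) simp
  finally show 1: "\<bar>Ef (aa s) (Th s x) - 1\<bar> \<le> 179200 * (s\<^sup>2 / (aa s + x \<bullet> \<xi> 1))" .
  have "179200 * (1 - Th s x \<bullet> \<xi> 1) \<le> 179200 * 2" by (rule mult_left_mono[OF T(7)]) simp
  then show 2: "\<bar>Ef (aa s) (Th s x) - 1\<bar> \<le> 358400" using e by linarith
  assume w: "0 < 1 + x \<bullet> \<xi> 1"
  define y where "y = s\<^sup>2 / (aa s + x \<bullet> \<xi> 1)"
  have y0: "0 < y" using s T(2) by (simp add: y_def)
  have "\<bar>Ef (aa s) (Th s x) - 1\<bar> \<le> 358400 * y powr (5/8)"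
  proof (cases "y \<le> 1")
    case True
    have "y powr 1 \<le> y powr (5/8)" using True y0 by (intro powr_mono') auto
    then show ?thesis using 1 y0 unfolding y_def[symmetric] by simp
  next
    case False
    have "1 \<le> y powr (5/8)" using False by (intro ge_one_powr_ge_zero) auto
    then show ?thesis using 2 by linarith
  qed
  also have "y powr (5/8) \<le> (s\<^sup>2 / (1 + x \<bullet> \<xi> 1)) powr (5/8)"
    unfolding y_def using T(4) w s by (intro powr_mono2 divide_left_mono) auto
  also have "\<dots> = s powr (5/4) * (1 + x \<bullet> \<xi> 1) powr (-5/8)"
  proof -
    have "(s\<^sup>2) powr (5/8) = s powr (5/4)" using s by (simp add: powr_powr flip: powr_numeral)
    moreover have "(1 + x \<bullet> \<xi> 1) powr (-5/8) = 1 / (1 + x \<bullet> \<xi> 1) powr (5/8)"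
      using powr_minus_divide[of "1 + x \<bullet> \<xi> 1" "5/8"] by simp
    moreover have "(s\<^sup>2 / (1 + x \<bullet> \<xi> 1)) powr (5/8) = (s\<^sup>2) powr (5/8) / (1 + x \<bullet> \<xi> 1) powr (5/8)"
      by (rule powr_divide)
    ultimately show ?thesis by simp
  qed
  finally show "\<bar>Ef (aa s) (Th s x) - 1\<bar> \<le> 358400 * s powr (5/4) * (1 + x \<bullet> \<xi> 1) powr (-5/8)" by simp
qed

text \<open>The power -2 is split as -11/8 - 5/8. The first factor is estimated by aa s + x
  \<bullet> \<xi> 1 \<ge> s^2 / 3 and costs s powr (-11/4); together with s^2 this is s powr (-3/4).
  The constant 3 powr (11/8) is at most 9 and is absorbed by 4 * pi.\<close>

lemma qf_bound:
  assumes s: "0 < s" "s \<le> 1" and x: "norm x = 1"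
  shows "0 \<le> qf s x" "0 < 1 + x \<bullet> \<xi> 1 \<Longrightarrow> qf s x \<le> s powr (-3/4) * (1 + x \<bullet> \<xi> 1) powr (-5/8)"
proof -
  note a = aa_facts[OF s] note T = Th_facts[OF s x]
  define A where "A = aa s + x \<bullet> \<xi> 1"
  have A: "0 < A" "s\<^sup>2/3 \<le> A" "1 + x \<bullet> \<xi> 1 \<le> A" using T(2,3,4) by (auto simp: A_def)
  show "0 \<le> qf s x" by (simp add: qf_def)
  assume w: "0 < 1 + x \<bullet> \<xi> 1"
  have "1 / A\<^sup>2 = A powr (-11/8) * A powr (-5/8)"
  proof -
    have "A powr (-11/8) * A powr (-5/8) = A powr (-2)" by (simp add: powr_add[symmetric])
    moreover have "A powr (-2) = 1 / A\<^sup>2" using powr_minus_divide[of A 2] A by (simp add: powr_numeral)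
    ultimately show ?thesis by simp
  qed
  also have "\<dots> \<le> (s\<^sup>2/3) powr (-11/8) * (1 + x \<bullet> \<xi> 1) powr (-5/8)"
    using A w s by (intro mult_mono powr_mono2') auto
  also have "(s\<^sup>2/3) powr (-11/8) = (s\<^sup>2) powr (-11/8) * 3 powr (11/8)"
  proof -
    have "(3::real) powr (-11/8) = 1 / 3 powr (11/8)" using powr_minus_divide[of "3::real" "11/8"] by simp
    moreover have "(s\<^sup>2/3) powr (-11/8) = (s\<^sup>2) powr (-11/8) / 3 powr (-11/8)" by (rule powr_divide)
    ultimately show ?thesis by simp
  qed
  also have "(s\<^sup>2) powr (-11/8) = s powr (-11/4)" using s by (simp add: powr_powr flip: powr_numeral)
  also have "3 powr (11/8) \<le> (3::real) powr 2" by (intro powr_mono) auto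
  finally have "1 / A\<^sup>2 \<le> s powr (-11/4) * 9 * (1 + x \<bullet> \<xi> 1) powr (-5/8)" by (simp add: mult_left_mono mult_right_mono)
  then have "s\<^sup>2 * (1 / A\<^sup>2) \<le> s\<^sup>2 * (s powr (-11/4) * 9 * (1 + x \<bullet> \<xi> 1) powr (-5/8))" by (intro mult_left_mono) auto
  also have "\<dots> = 9 * (s powr 2 * s powr (-11/4)) * (1 + x \<bullet> \<xi> 1) powr (-5/8)" using s by (simp add: powr_numeral)
  also have "s powr 2 * s powr (-11/4) = s powr (-3/4)" by (simp add: powr_add[symmetric])
  finally have 1: "s\<^sup>2 / A\<^sup>2 \<le> 9 * s powr (-3/4) * (1 + x \<bullet> \<xi> 1) powr (-5/8)" by simp
  have "qf s x = (1 / (4 * pi)) * (s\<^sup>2 / A\<^sup>2)" unfolding qf_def A_def by simp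
  also have "\<dots> \<le> (1 / 9) * (9 * s powr (-3/4) * (1 + x \<bullet> \<xi> 1) powr (-5/8))"
    using 1 pi_gt3 by (intro mult_mono divide_left_mono) auto
  finally show "qf s x \<le> s powr (-3/4) * (1 + x \<bullet> \<xi> 1) powr (-5/8)" by simp
qed

text \<open>Three contributions, each with a factor s: the symmetric factor minus 1 times a
  difference of exponentials, the quadratic remainder of the exponential, and \<open>Dop\<close>.
  The exponents are at most 7 * s, one s from the function and six from \<open>Dop\<close>, which
  explains s \<le> 1/7.\<close>

lemma gop_diff_bound:
  assumes s: "0 < s" "s \<le> 1/7" and f: "hold s f" and h: "hold s h" and d: "hold d (\<lambda>x. f x - h x)"
    and x: "norm x = 1" and w: "0 < 1 + x \<bullet> \<xi> 1"
  shows "\<bar>gop s f x - gop s h x\<bar> \<le> 8000000 * s * d * (1 + x \<bullet> \<xi> 1) powr (-5/8)"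
proof -
  have s1: "s \<le> 1" using s by simp
  define W where "W = (1 + x \<bullet> \<xi> 1) powr (-5/8)"
  have W0: "0 \<le> W" by (simp add: W_def)
  have W1: "1 \<le> 2 * W" unfolding W_def by (rule weight_facts(1)[OF w]) (use abs_inner_le_1[OF x nrm[of 1]] in auto)
  define p where "p = f x + Dop s f x" define q where "q = h x + Dop s h x"
  define E where "E = Ef (aa s) (Th s x)"
  have p: "\<bar>p\<bar> \<le> 7 * s" using holdD(2)[OF f x] Dop_bound(1)[OF f s(1) s1 x] unfolding p_def by linarith
  have q: "\<bar>q\<bar> \<le> 7 * s" using holdD(2)[OF h x] Dop_bound(1)[OF h s(1) s1 x] unfolding q_def by linarith
  have pq: "p - q = (f x - h x) + Dop s (\<lambda>x. f x - h x) x" unfolding p_def q_def Dop_diff by simp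
  have pqb: "\<bar>p - q\<bar> \<le> 7 * d" unfolding pq using holdD(2)[OF d x] Dop_bound(1)[OF d s(1) s1 x] by linarith
  have d0: "0 \<le> d" by (rule holdD(1)[OF d])
  have e: "gop s f x - gop s h x = (E - 1) * (exp p - exp q) + (exp p - exp q - (p - q)) + Dop s (\<lambda>x. f x - h x) x"
    unfolding gop_def p_def[symmetric] q_def[symmetric] E_def[symmetric] using pq by algebra
  have s7: "7 * s \<le> 1" using s by simp
  note ex = exp_diff_bounds[OF p q s7]
  have "s powr (5/4) \<le> s powr 1" using s by (intro powr_mono') auto
  then have s54: "s powr (5/4) \<le> s" using s by simp
  have "\<bar>E - 1\<bar> \<le> 358400 * s powr (5/4) * W" unfolding E_def W_def by (rule E_bound(2)[OF s(1) s1 x w])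
  also have "\<dots> \<le> 358400 * s * W" using s54 W0 by (intro mult_right_mono mult_left_mono) auto
  finally have E1: "\<bar>E - 1\<bar> \<le> 358400 * s * W" .
  have 1: "\<bar>(E - 1) * (exp p - exp q)\<bar> \<le> (358400 * s * W) * (21 * d)"
  proof (rule abs_mult_le[OF E1])
    show "\<bar>exp p - exp q\<bar> \<le> 21 * d" using order_trans[OF ex(2) mult_left_mono[OF pqb, of 3]] by simp
  qed
  have "\<bar>exp p - exp q - (p - q)\<bar> \<le> 2 * (7 * s) * (7 * d)"
    by (rule order_trans[OF ex(1) mult_left_mono[OF pqb]]) (use s in simp)
  also have "\<dots> = 98 * s * d * 1" by simp
  also have "\<dots> \<le> 98 * s * d * (2 * W)" using W1 s d0 by (intro mult_left_mono) auto
  finally have 2: "\<bar>exp p - exp q - (p - q)\<bar> \<le> 196 * (s * d * W)" by simp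
  have 3: "\<bar>Dop s (\<lambda>x. f x - h x) x\<bar> \<le> 18 * (s * d * W)" using Dop_bound(2)[OF d s(1) s1 x w] unfolding W_def by (simp add: mult_ac)
  have nn: "0 \<le> s * d * W" using s d0 W0 by simp
  have "\<bar>gop s f x - gop s h x\<bar> \<le> 7526400 * (s * d * W) + 196 * (s * d * W) + 18 * (s * d * W)"
    unfolding e using 1 2 3 by (simp add: mult_ac)
  also have "\<dots> \<le> 8000000 * (s * d * W)" using nn by linarith
  finally show ?thesis unfolding W_def by (simp add: mult_ac)
qed

end

section \<open>Smallness conditions on the scale\<close>

definition contr_const :: real where "contr_const = 64000000 * (1 + 8 * sing_const) * sing_const"

text \<open>A bound for \<open>Fop\<close> at 0: the weighted bound of \<open>gam_zero_wbd\<close>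
  times the constant 8 * sing_const of \<open>hold_gpot\<close>. Both terms are of order s powr
  (5/4) up to a logarithm, so twice this is at most s for small s.\<close>

definition Bs :: "real \<Rightarrow> real" where
  "Bs s = 8 * (358400 * s powr (5/4) + 2300000 * s\<^sup>2 * ell s * s powr (-3/4)) * sing_const"

text \<open>The conditions serve, in turn, the numerical ranges, the denominator of
  \<open>mop\<close>, the contraction factor 1/2, the invariance of the ball of radius s under the
  iteration, and the dominance of the logarithm in \<open>mu_bounds\<close>.\<close>

definition small :: "real \<Rightarrow> bool" where
  "small s \<longleftrightarrow> 0 < s \<and> s \<le> 1/1000 \<and> s\<^sup>2 * ell s \<le> 1 \<and> contr_const * s powr (1/4) \<le> 1/2 \<and> 2 * Bs s \<le> s
     \<and> 200000000 * (8 * pi) + 64000000 * sing_const < (2 * pi / 200) * ell s"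

lemma smallD:
  assumes "small s"
  shows "0 < s" "s \<le> 1/1000" "s \<le> 1" "s \<le> 1/7" "s\<^sup>2 * ell s \<le> 1" "contr_const * s powr (1/4) \<le> 1/2" "2 * Bs s \<le> s"
    "200000000 * (8 * pi) + 64000000 * sing_const < (2 * pi / 200) * ell s"
  using assms by (auto simp: small_def)

lemma ex_small: "\<exists>s0>0. \<forall>s. 0 < s \<and> s \<le> s0 \<longrightarrow> small s"
proof -
  have "\<forall>\<^sub>F s in at_right (0::real). small s"
  proof -
    have 1: "\<forall>\<^sub>F s in at_right (0::real). 0 < s" by (rule eventually_at_right_less)
    have 2: "\<forall>\<^sub>F s in at_right (0::real). s < 1/1000" by real_asymp
    have 3: "\<forall>\<^sub>F s in at_right (0::real). s\<^sup>2 * (ln 9 + 2 * ln (1/s)) < 1" by real_asymp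
    have "((\<lambda>s::real. s powr (1/4)) \<longlongrightarrow> 0) (at_right 0)" by real_asymp
    then have "((\<lambda>s. contr_const * s powr (1/4)) \<longlongrightarrow> contr_const * 0) (at_right 0)" by (intro tendsto_intros)
    then have 4: "\<forall>\<^sub>F s in at_right 0. contr_const * s powr (1/4) < 1/2" by (rule order_tendstoD) simp
    have "((\<lambda>s::real. 358400 * s powr (1/4) + 2300000 * ((ln 9 + 2 * ln (1/s)) * s powr (1/4))) \<longlongrightarrow> 0) (at_right 0)" by real_asymp
    then have "((\<lambda>s. 16 * sing_const * (358400 * s powr (1/4) + 2300000 * ((ln 9 + 2 * ln (1/s)) * s powr (1/4)))) \<longlongrightarrow> 16 * sing_const * 0) (at_right 0)"
      by (intro tendsto_intros)
    then have 5: "\<forall>\<^sub>F s in at_right 0. 16 * sing_const * (358400 * s powr (1/4) + 2300000 * ((ln 9 + 2 * ln (1/s)) * s powr (1/4))) < 1"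
      by (rule order_tendstoD) simp
    have "filterlim (\<lambda>s::real. 2 * ln (1/s)) at_top (at_right 0)" by real_asymp
    then have 6: "\<forall>\<^sub>F s in at_right 0. (200000000 * (8 * pi) + 64000000 * sing_const) * (100 / pi) + 1 \<le> 2 * ln (1/s)"
      by (simp add: filterlim_at_top)
    show ?thesis using 1 2 3 4 5 6
    proof eventually_elim
      case (elim s)
      then have s1: "s \<le> 1" by simp
      note l = ell_bounds[OF elim(1) s1]
      have "s\<^sup>2 * ell s \<le> s\<^sup>2 * (ln 9 + 2 * ln (1/s))" using l by (intro mult_left_mono) auto
      then have a: "s\<^sup>2 * ell s \<le> 1" using elim(3) by linarith
      have p1: "s powr (5/4) = s * s powr (1/4)"
      proof -
        show ?thesis using powr_mult_base[of s "1/4"] elim(1) by simp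
      qed
      have p2: "s\<^sup>2 * s powr (-3/4) = s * s powr (1/4)"
      proof -
        have "s\<^sup>2 * s powr (-3/4) = s powr 2 * s powr (-3/4)" using elim(1) by (simp add: powr_numeral)
        also have "\<dots> = s powr (5/4)" by (simp add: powr_add[symmetric])
        finally show ?thesis by (simp add: p1)
      qed
      have "2 * Bs s = s * (16 * sing_const * (358400 * s powr (1/4) + 2300000 * (ell s * s powr (1/4))))"
      proof -
        have "2 * Bs s = 16 * sing_const * (358400 * s powr (5/4) + 2300000 * ell s * (s\<^sup>2 * s powr (-3/4)))"
          unfolding Bs_def by (simp add: algebra_simps)
        then show ?thesis unfolding p1 p2 by (simp add: algebra_simps)
      qed
      also have "\<dots> \<le> s * (16 * sing_const * (358400 * s powr (1/4) + 2300000 * ((ln 9 + 2 * ln (1/s)) * s powr (1/4))))"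
        using elim(1) l sing_const_nonneg by (intro mult_left_mono add_mono mult_right_mono) auto
      also have "\<dots> \<le> s * 1" using elim(1,5) by (intro mult_left_mono) auto
      finally have b: "2 * Bs s \<le> s" by simp
      have "(200000000 * (8 * pi) + 64000000 * sing_const) * (100 / pi) < ell s" using elim(6) l(1) by linarith
      then have "(200000000 * (8 * pi) + 64000000 * sing_const) * (100 / pi) * (pi / 100) < ell s * (pi / 100)"
        by (intro mult_strict_right_mono) auto
      then have c: "200000000 * (8 * pi) + 64000000 * sing_const < (2 * pi / 200) * ell s" by (simp add: mult.commute)
      show ?case unfolding small_def using elim a b c by auto
    qed
  qed
  then obtain b where b: "b > 0" "\<And>s. 0 < s \<Longrightarrow> s < b \<Longrightarrow> small s"
    unfolding eventually_at_right_field by auto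
  show ?thesis by (rule exI[of _ "b/2"]) (use b in auto)
qed

section \<open>Weighted bounds for the right-hand side, and the contraction\<close>

context tetra begin

text \<open>The factor 1 + x \<bullet> \<xi> 1 cancels one power of the denominator of
  \<open>qf\<close>, so (1 + x \<bullet> \<xi> 1) * qf s x integrates to at most s^2 * ell s / 2,
  while \<open>qf s\<close> itself integrates to 1.\<close>

lemma qf_integrals:
  assumes s: "0 < s" "s \<le> 1"
  shows "integrable area (qf s)" "(\<integral>x. qf s x \<partial>area) = 1"
    "integrable area (\<lambda>x. (x \<bullet> \<xi> 1) * qf s x)"
    "s\<^sup>2 * ell s \<le> 1 \<Longrightarrow> (\<integral>x. (x \<bullet> \<xi> 1) * qf s x \<partial>area) \<le> - (1/2)"
proof -
  note I = int_inv_t[OF s]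
  have q: "qf s x = s\<^sup>2 / (4 * pi) * (1 / (aa s + x \<bullet> \<xi> 1)\<^sup>2)" for x unfolding qf_def by simp
  show qi: "integrable area (qf s)" by (intro integrable_area_cont qf_cont s)
  show q1: "(\<integral>x. qf s x \<partial>area) = 1"
    unfolding q integral_mult_right_zero I(4) using s by simp
  show ti: "integrable area (\<lambda>x. (x \<bullet> \<xi> 1) * qf s x)"
    by (intro integrable_area_cont continuous_intros qf_cont s)
  assume e: "s\<^sup>2 * ell s \<le> 1"
  have "(\<integral>x. (x \<bullet> \<xi> 1) * qf s x + qf s x \<partial>area) \<le> (\<integral>x. s\<^sup>2 / (4 * pi) * (1 / (aa s + x \<bullet> \<xi> 1)) \<partial>area)"
  proof (rule integral_mono)
    show "integrable area (\<lambda>x. (x \<bullet> \<xi> 1) * qf s x + qf s x)" using ti qi by simp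
    show "integrable area (\<lambda>x. s\<^sup>2 / (4 * pi) * (1 / (aa s + x \<bullet> \<xi> 1)))" by (intro integrable_mult_right I)
    fix x :: "real^3" assume "x \<in> space area"
    then have x: "norm x = 1" by simp
    note T = Th_facts[OF s x]
    have "(x \<bullet> \<xi> 1) * qf s x + qf s x = (1 + x \<bullet> \<xi> 1) * qf s x" by (simp add: algebra_simps)
    also have "\<dots> \<le> (aa s + x \<bullet> \<xi> 1) * qf s x" by (rule mult_right_mono[OF T(4) qf_bound(1)[OF s x]])
    also have "\<dots> = s\<^sup>2 / (4 * pi) * (1 / (aa s + x \<bullet> \<xi> 1))" unfolding q using T(2) by (simp add: power2_eq_square)
    finally show "(x \<bullet> \<xi> 1) * qf s x + qf s x \<le> s\<^sup>2 / (4 * pi) * (1 / (aa s + x \<bullet> \<xi> 1))" .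
  qed
  also have "\<dots> = (s\<^sup>2 * ell s) / 2" unfolding integral_mult_right_zero I(2) by simp
  also have "(\<integral>x. (x \<bullet> \<xi> 1) * qf s x + qf s x \<partial>area) = (\<integral>x. (x \<bullet> \<xi> 1) * qf s x \<partial>area) + 1"
    using ti qi q1 by simp
  finally show "(\<integral>x. (x \<bullet> \<xi> 1) * qf s x \<partial>area) \<le> - (1/2)" using e by linarith
qed

lemma t_meas: "(\<lambda>x. x \<bullet> \<xi> 1) \<in> borel_measurable area" by measurable

lemma mop_abs_le:
  assumes s: "0 < s" "s \<le> 1" "s\<^sup>2 * ell s \<le> 1" and b: "\<bar>c\<bar> \<le> b"
  shows "\<bar>c / (\<integral>x. (x \<bullet> \<xi> 1) * qf s x \<partial>area)\<bar> \<le> 2 * b"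
proof -
  have q: "(\<integral>x. (x \<bullet> \<xi> 1) * qf s x \<partial>area) \<le> - (1/2)" by (rule qf_integrals(4)[OF s])
  have "\<bar>c\<bar> / \<bar>\<integral>x. (x \<bullet> \<xi> 1) * qf s x \<partial>area\<bar> \<le> b / (1/2)"
    using q b by (intro frac_le) auto
  then show ?thesis by (simp add: abs_divide)
qed

lemma gop_integrable: "continuous_on S2 f \<Longrightarrow> 0 < s \<Longrightarrow> s \<le> 1 \<Longrightarrow> integrable area (\<lambda>x. (x \<bullet> \<xi> 1) * gop s f x)"
  by (intro integrable_area_cont continuous_intros gop_cont)

lemma gam_cont: "continuous_on S2 f \<Longrightarrow> 0 < s \<Longrightarrow> s \<le> 1 \<Longrightarrow> continuous_on S2 (gam s f)"
  unfolding gam_def by (intro continuous_intros gop_cont qf_cont)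

lemma gop_zero: "gop s (\<lambda>_. 0) x = Ef (aa s) (Th s x) - 1"
  by (simp add: gop_def Dop_def)

lemma mop_zero:
  assumes s: "0 < s" "s \<le> 1" "s\<^sup>2 * ell s \<le> 1"
  shows "\<bar>\<integral>x. (x \<bullet> \<xi> 1) * gop s (\<lambda>_. 0) x \<partial>area\<bar> \<le> 1150000 * s\<^sup>2 * ell s"
    and "\<bar>mop s (\<lambda>_. 0)\<bar> \<le> 2300000 * s\<^sup>2 * ell s"
proof -
  note I = int_inv_t[OF s(1,2)]
  have gi: "integrable area (\<lambda>x. (x \<bullet> \<xi> 1) * gop s (\<lambda>_. 0) x)" by (intro gop_integrable s) simp
  have "\<bar>\<integral>x. (x \<bullet> \<xi> 1) * gop s (\<lambda>_. 0) x \<partial>area\<bar> \<le> (\<integral>x. \<bar>(x \<bullet> \<xi> 1) * gop s (\<lambda>_. 0) x\<bar> \<partial>area)"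
    by (rule integral_abs_bound)
  also have "\<dots> \<le> (\<integral>x. 179200 * s\<^sup>2 * (1 / (aa s + x \<bullet> \<xi> 1)) \<partial>area)"
  proof (rule integral_mono)
    show "integrable area (\<lambda>x. \<bar>(x \<bullet> \<xi> 1) * gop s (\<lambda>_. 0) x\<bar>)" using gi by (rule integrable_abs)
    show "integrable area (\<lambda>x. 179200 * s\<^sup>2 * (1 / (aa s + x \<bullet> \<xi> 1)))" by (intro integrable_mult_right I)
    fix x :: "real^3" assume "x \<in> space area"
    then have x: "norm x = 1" by simp
    have "\<bar>(x \<bullet> \<xi> 1) * gop s (\<lambda>_. 0) x\<bar> \<le> 1 * (179200 * (s\<^sup>2 / (aa s + x \<bullet> \<xi> 1)))"
      unfolding gop_zero by (rule abs_mult_le[OF abs_inner_le_1[OF x nrm] E_bound(1)[OF s(1,2) x]])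
    then show "\<bar>(x \<bullet> \<xi> 1) * gop s (\<lambda>_. 0) x\<bar> \<le> 179200 * s\<^sup>2 * (1 / (aa s + x \<bullet> \<xi> 1))" by simp
  qed
  also have "\<dots> = 179200 * (2 * pi) * (s\<^sup>2 * ell s)" unfolding integral_mult_right_zero I(2) by simp
  also have "\<dots> \<le> 1150000 * (s\<^sup>2 * ell s)"
    using pi_less_4 ell_bounds(3)[OF s(1,2)] pi_approx by (intro mult_right_mono) auto
  finally show 1: "\<bar>\<integral>x. (x \<bullet> \<xi> 1) * gop s (\<lambda>_. 0) x \<partial>area\<bar> \<le> 1150000 * s\<^sup>2 * ell s" by simp
  show "\<bar>mop s (\<lambda>_. 0)\<bar> \<le> 2300000 * s\<^sup>2 * ell s"
    unfolding mop_def using mop_abs_le[OF s 1] by simp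
qed

lemma gam_zero_wbd:
  assumes s: "0 < s" "s \<le> 1" "s\<^sup>2 * ell s \<le> 1"
  shows "wbd (- \<xi> 1) (358400 * s powr (5/4) + 2300000 * s\<^sup>2 * ell s * s powr (-3/4)) (gam s (\<lambda>_. 0))"
proof (rule wbdI)
  have l0: "0 \<le> ell s" by (rule ell_bounds(3)[OF s(1,2)])
  show "continuous_on S2 (gam s (\<lambda>_. 0))" by (intro gam_cont s) simp
  show "0 \<le> 358400 * s powr (5/4) + 2300000 * s\<^sup>2 * ell s * s powr (-3/4)" using l0 by simp
  fix x assume x: "norm x = 1" and w: "0 < 1 + x \<bullet> \<xi> 1"
  let ?W = "(1 + x \<bullet> \<xi> 1) powr (-5/8)"
  have 1: "\<bar>gop s (\<lambda>_. 0) x\<bar> \<le> 358400 * s powr (5/4) * ?W" unfolding gop_zero by (rule E_bound(2)[OF s(1,2) x w])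
  have "\<bar>qf s x\<bar> \<le> s powr (-3/4) * ?W" using qf_bound[OF s(1,2) x] w by simp
  then have 2: "\<bar>mop s (\<lambda>_. 0) * qf s x\<bar> \<le> (2300000 * s\<^sup>2 * ell s) * (s powr (-3/4) * ?W)" by (rule abs_mult_le[OF mop_zero(2)[OF s]])
  show "\<bar>gam s (\<lambda>_. 0) x\<bar> \<le> (358400 * s powr (5/4) + 2300000 * s\<^sup>2 * ell s * s powr (-3/4)) * ?W"
    unfolding gam_def distrib_right using abs_triangle_ineq4[of "gop s (\<lambda>_. 0) x" "mop s (\<lambda>_. 0) * qf s x"] 1 2
    by (simp only: mult.assoc)
qed

lemma gop_diff_wbd:
  assumes s: "small s" and f: "hold s f" and h: "hold s h" and d: "hold d (\<lambda>x. f x - h x)"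
  shows "wbd (- \<xi> 1) (8000000 * s * d) (\<lambda>x. gop s f x - gop s h x)"
    "\<bar>(\<integral>x. (x \<bullet> \<xi> 1) * gop s f x \<partial>area) - (\<integral>x. (x \<bullet> \<xi> 1) * gop s h x \<partial>area)\<bar> \<le> 32000000 * s * d * sing_const"
proof -
  note S = smallD[OF s]
  have fc: "continuous_on S2 f" "continuous_on S2 h" by (rule hold_cont[OF f], rule hold_cont[OF h])
  show w: "wbd (- \<xi> 1) (8000000 * s * d) (\<lambda>x. gop s f x - gop s h x)"
  proof (rule wbdI)
    show "continuous_on S2 (\<lambda>x. gop s f x - gop s h x)" by (intro continuous_intros gop_cont fc S)
    show "0 \<le> 8000000 * s * d" using S(1) holdD(1)[OF d] by simp
  qed (rule gop_diff_bound[OF S(1,4) f h d])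
  have "(\<integral>x. (x \<bullet> \<xi> 1) * gop s f x \<partial>area) - (\<integral>x. (x \<bullet> \<xi> 1) * gop s h x \<partial>area)
     = (\<integral>x. (x \<bullet> \<xi> 1) * (gop s f x - gop s h x) \<partial>area)"
    unfolding right_diff_distrib
    by (rule Bochner_Integration.integral_diff[symmetric]) (intro gop_integrable fc S)+
  then show "\<bar>(\<integral>x. (x \<bullet> \<xi> 1) * gop s f x \<partial>area) - (\<integral>x. (x \<bullet> \<xi> 1) * gop s h x \<partial>area)\<bar> \<le> 32000000 * s * d * sing_const"
    using wbd_integrable(2)[OF w t_meas abs_inner_le_1[OF _ nrm]] by simp
qed

text \<open>The multipliers differ by O(s * d), and the weighted size s powr (-3/4) of
  \<open>qf\<close> leaves s powr (1/4) of this. It is the weakest gain and fixes the contraction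
  rate.\<close>

lemma gam_diff_wbd:
  assumes s: "small s" and f: "hold s f" and h: "hold s h" and d: "hold d (\<lambda>x. f x - h x)"
  shows "wbd (- \<xi> 1) (8000000 * (1 + 8 * sing_const) * s powr (1/4) * d) (\<lambda>x. gam s f x - gam s h x)"
proof (rule wbdI)
  note S = smallD[OF s]
  have fc: "continuous_on S2 f" "continuous_on S2 h" by (rule hold_cont[OF f], rule hold_cont[OF h])
  have d0: "0 \<le> d" by (rule holdD(1)[OF d])
  show "continuous_on S2 (\<lambda>x. gam s f x - gam s h x)" by (intro continuous_intros gam_cont fc S)
  show "0 \<le> 8000000 * (1 + 8 * sing_const) * s powr (1/4) * d" using sing_const_nonneg d0 by simp
  fix x assume x: "norm x = 1" and w: "0 < 1 + x \<bullet> \<xi> 1"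
  define W where "W = (1 + x \<bullet> \<xi> 1) powr (-5/8)"
  have W0: "0 \<le> W" by (simp add: W_def)
  have 1: "\<bar>gop s f x - gop s h x\<bar> \<le> 8000000 * s * d * W" unfolding W_def by (rule gop_diff_bound[OF S(1,4) f h d x w])
  have m: "\<bar>mop s f - mop s h\<bar> \<le> 2 * (32000000 * s * d * sing_const)"
    unfolding mop_def diff_divide_distrib[symmetric]
    by (rule mop_abs_le[OF S(1,3,5) gop_diff_wbd(2)[OF s f h d]])
  have q: "\<bar>qf s x\<bar> \<le> s powr (-3/4) * W" unfolding W_def using qf_bound[OF S(1,3) x] w by simp
  have 2: "\<bar>(mop s f - mop s h) * qf s x\<bar> \<le> 2 * (32000000 * s * d * sing_const) * (s powr (-3/4) * W)" by (rule abs_mult_le[OF m q])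
  have p: "s * s powr (-3/4) = s powr (1/4)"
  proof -
    show ?thesis using powr_mult_base[of s "-3/4"] S(1) by simp
  qed
  have "s powr 1 \<le> s powr (1/4)" using S(1,3) by (intro powr_mono') auto
  then have p1: "s \<le> s powr (1/4)" using S(1) by simp
  have "8000000 * s * d * W \<le> 8000000 * s powr (1/4) * d * W" using p1 d0 W0 by (intro mult_right_mono mult_left_mono) auto
  moreover have "2 * (32000000 * s * d * sing_const) * (s powr (-3/4) * W) = 64000000 * sing_const * (s * s powr (-3/4)) * d * W" by simp
  moreover have "gam s f x - gam s h x = (gop s f x - gop s h x) - (mop s f - mop s h) * qf s x" unfolding gam_def by algebra
  then have "\<bar>gam s f x - gam s h x\<bar> \<le> \<bar>gop s f x - gop s h x\<bar> + \<bar>(mop s f - mop s h) * qf s x\<bar>" by simp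
  ultimately have "\<bar>gam s f x - gam s h x\<bar> \<le> 8000000 * s powr (1/4) * d * W + 64000000 * sing_const * s powr (1/4) * d * W"
    using 1 2 unfolding p by linarith
  also have "\<dots> = 8000000 * (1 + 8 * sing_const) * s powr (1/4) * d * W" by (simp add: algebra_simps)
  finally show "\<bar>gam s f x - gam s h x\<bar> \<le> 8000000 * (1 + 8 * sing_const) * s powr (1/4) * d * (1 + x \<bullet> \<xi> 1) powr (-5/8)"
    unfolding W_def .
qed

definition Fop :: "real \<Rightarrow> (real^3 \<Rightarrow> real) \<Rightarrow> real^3 \<Rightarrow> real" where "Fop s f = gpot (gam s f)"

lemma gam_wbd:
  assumes s: "small s" and f: "hold s f"
  obtains m where "wbd (- \<xi> 1) m (gam s f)"
proof -
  note S = smallD[OF s]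
  define m0 where "m0 = 358400 * s powr (5/4) + 2300000 * s\<^sup>2 * ell s * s powr (-3/4)"
  define m1 where "m1 = 8000000 * (1 + 8 * sing_const) * s powr (1/4) * s"
  have z: "wbd (- \<xi> 1) m0 (gam s (\<lambda>_. 0))" unfolding m0_def by (rule gam_zero_wbd[OF S(1,3,5)])
  have hz: "hold s (\<lambda>_::real^3. 0)" using S(1) by (intro hold_zero) simp
  have d: "wbd (- \<xi> 1) m1 (\<lambda>x. gam s f x - gam s (\<lambda>_. 0) x)"
    unfolding m1_def by (rule gam_diff_wbd[OF s f hz]) (use f in simp)
  have "wbd (- \<xi> 1) (m0 + m1) (gam s f)"
  proof (rule wbdI)
    show "continuous_on S2 (gam s f)" by (intro gam_cont hold_cont[OF f] S)
    show "0 \<le> m0 + m1" using z d by (simp add: wbd_def)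
    fix x assume x: "norm x = 1" "0 < 1 + x \<bullet> \<xi> 1"
    have "\<bar>gam s (\<lambda>_. 0) x\<bar> \<le> m0 * (1 + x \<bullet> \<xi> 1) powr (-5/8)" using z x by (simp add: wbd_def)
    moreover have "\<bar>gam s f x - gam s (\<lambda>_. 0) x\<bar> \<le> m1 * (1 + x \<bullet> \<xi> 1) powr (-5/8)" using d x by (simp add: wbd_def)
    ultimately show "\<bar>gam s f x\<bar> \<le> (m0 + m1) * (1 + x \<bullet> \<xi> 1) powr (-5/8)" unfolding distrib_right by linarith
  qed
  then show thesis by (rule that)
qed

lemma hold_cong: "hold d f \<Longrightarrow> (\<And>x. norm x = 1 \<Longrightarrow> f x = g x) \<Longrightarrow> hold d g"
  unfolding hold_def by auto

lemma Fop_contraction: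
  assumes s: "small s" and f: "hold s f" and h: "hold s h" and d: "hold d (\<lambda>x. f x - h x)"
  shows "hold (d / 2) (\<lambda>x. Fop s f x - Fop s h x)"
proof -
  note S = smallD[OF s]
  let ?m = "8000000 * (1 + 8 * sing_const) * s powr (1/4) * d"
  obtain mf where mf: "wbd (- \<xi> 1) mf (gam s f)" using gam_wbd[OF s f] by blast
  obtain mh where mh: "wbd (- \<xi> 1) mh (gam s h)" using gam_wbd[OF s h] by blast
  have "hold (8 * ?m * sing_const) (gpot (\<lambda>x. gam s f x - gam s h x))" by (rule hold_gpot[OF gam_diff_wbd[OF s f h d]])
  moreover have e: "8 * ?m * sing_const = contr_const * s powr (1/4) * d" unfolding contr_const_def by (simp add: algebra_simps)
  moreover have "contr_const * s powr (1/4) * d \<le> 1/2 * d" using S(6) holdD(1)[OF d] by (rule mult_right_mono)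
  then have "8 * ?m * sing_const \<le> d / 2" unfolding e by simp
  ultimately have "hold (d / 2) (gpot (\<lambda>x. gam s f x - gam s h x))" using hold_mono by blast
  then show ?thesis unfolding Fop_def by (rule hold_cong) (rule gpot_diff[OF mf mh])
qed

section \<open>Iteration and the fixed point\<close>

lemma Fop_zero: "small s \<Longrightarrow> hold (Bs s) (Fop s (\<lambda>_. 0))"
  unfolding Fop_def Bs_def by (rule hold_gpot[OF gam_zero_wbd]) (use smallD in auto)

text \<open>The iteration is kept explicit because each iterate depends continuously on s and the
  geometric rate is uniform in s, so that continuity passes to the limit in
  \<open>mu_tendsto\<close>.\<close>

primrec chi :: "nat \<Rightarrow> real \<Rightarrow> real^3 \<Rightarrow> real" where
  "chi 0 s = (\<lambda>_. 0)"
| "chi (Suc n) s = Fop s (chi n s)"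

lemma chi_hold:
  assumes s: "small s"
  shows "hold (2 * Bs s) (chi n s)" "hold s (chi n s)"
proof -
  note S = smallD[OF s]
  have B0: "0 \<le> Bs s" by (rule holdD(1)[OF Fop_zero[OF s]])
  have hz: "hold s (\<lambda>_::real^3. 0)" using S(1) by (intro hold_zero) simp
  show 1: "hold (2 * Bs s) (chi n s)"
  proof (induction n)
    case 0 show ?case using B0 by (simp add: hold_zero)
  next
    case (Suc n)
    have "hold s (chi n s)" by (rule hold_mono[OF Suc S(7)])
    then have "hold (2 * Bs s / 2) (\<lambda>x. Fop s (chi n s) x - Fop s (\<lambda>_. 0) x)"
      by (rule Fop_contraction[OF s _ hz]) (use Suc in simp)
    from hold_add[OF this Fop_zero[OF s]] show ?case by simp
  qed
  show "hold s (chi n s)" by (rule hold_mono[OF 1 S(7)])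
qed

lemma chi_step:
  assumes s: "small s"
  shows "hold (Bs s / 2^n) (\<lambda>x. chi (Suc n) s x - chi n s x)"
proof (induction n)
  case 0 show ?case using Fop_zero[OF s] by simp
next
  case (Suc n)
  from Fop_contraction[OF s chi_hold(2)[OF s] chi_hold(2)[OF s] Suc]
  show ?case by (simp add: mult.commute)
qed

lemma chi_tail:
  assumes s: "small s"
  shows "hold (Bs s * (2 / 2^n - 2 / 2^(n + k))) (\<lambda>x. chi (n + k) s x - chi n s x)"
proof (induction k)
  case 0 show ?case by (simp add: hold_zero)
next
  case (Suc k)
  have "Bs s * (2 / 2^n - 2 / 2^(n + k)) + Bs s / 2^(n + k) = Bs s * (2 / 2^n - 2 / 2^(n + Suc k))"
    by (simp add: field_simps)
  then show ?case using hold_add[OF Suc chi_step[OF s, of "n + k"]] by simp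
qed

lemma chi_tail':
  assumes s: "small s"
  shows "hold (2 * Bs s / 2^n) (\<lambda>x. chi (n + k) s x - chi n s x)"
proof (rule hold_mono[OF chi_tail[OF s]])
  have B0: "0 \<le> Bs s" by (rule holdD(1)[OF Fop_zero[OF s]])
  have "Bs s * (2 / 2^n - 2 / 2^(n + k)) \<le> Bs s * (2 / 2^n)" using B0 by (intro mult_left_mono) auto
  then show "Bs s * (2 / 2^n - 2 / 2^(n + k)) \<le> 2 * Bs s / 2^n" by simp
qed

definition chiL :: "real \<Rightarrow> real^3 \<Rightarrow> real" where "chiL s x = lim (\<lambda>n. chi n s x)"

lemma pow2_lim: "(\<lambda>n. c / 2^n) \<longlonglongrightarrow> (0::real)"
proof -
  have "(\<lambda>n. c * (1/2)^n) \<longlonglongrightarrow> c * 0" by (intro tendsto_intros LIMSEQ_realpow_zero) auto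
  then show ?thesis by (simp add: power_divide)
qed

lemma chi_lim:
  assumes s: "small s" and x: "norm x = 1"
  shows "(\<lambda>n. chi n s x) \<longlonglongrightarrow> chiL s x"
proof -
  have "Cauchy (\<lambda>n. chi n s x)"
  proof (rule CauchyI')
    fix e :: real assume e: "0 < e"
    have "\<forall>\<^sub>F n in sequentially. 2 * Bs s / 2^n < e" using pow2_lim[of "2 * Bs s"] e by (rule order_tendstoD)
    then obtain M where M: "\<And>n. n \<ge> M \<Longrightarrow> 2 * Bs s / 2^n < e" by (auto simp: eventually_sequentially)
    show "\<exists>M. \<forall>m\<ge>M. \<forall>n>m. dist (chi m s x) (chi n s x) < e"
    proof (intro exI allI impI)
      fix m n assume mn: "m \<ge> M" "n > m"
      have "\<bar>chi (m + (n - m)) s x - chi m s x\<bar> \<le> 2 * Bs s / 2^m" by (rule holdD(2)[OF chi_tail'[OF s] x])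
      then show "dist (chi m s x) (chi n s x) < e" using M[OF mn(1)] mn(2) by (simp add: dist_real_def abs_minus_commute)
    qed
  qed
  then show ?thesis unfolding chiL_def by (simp add: Cauchy_convergent_iff convergent_LIMSEQ_iff)
qed

lemma hold_limit:
  assumes "\<And>k::nat. hold d (f k)" "\<And>x. norm x = 1 \<Longrightarrow> (\<lambda>k. f k x) \<longlonglongrightarrow> g x"
  shows "hold d g"
  unfolding hold_def
proof (intro conjI allI impI)
  show "0 \<le> d" by (rule holdD(1)[OF assms(1)])
  fix x :: "real^3" assume x: "norm x = 1"
  have "(\<lambda>k. \<bar>f k x\<bar>) \<longlonglongrightarrow> \<bar>g x\<bar>" by (intro tendsto_intros assms x)
  then show "\<bar>g x\<bar> \<le> d" by (rule LIMSEQ_le_const2) (use holdD(2)[OF assms(1) x] in auto)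
  fix y :: "real^3" assume y: "norm y = 1"
  have "(\<lambda>k. \<bar>f k x - f k y\<bar>) \<longlonglongrightarrow> \<bar>g x - g y\<bar>" by (intro tendsto_intros assms x y)
  then show "\<bar>g x - g y\<bar> \<le> d * sqrt (norm (x - y))" by (rule LIMSEQ_le_const2) (use holdD(3)[OF assms(1) x y] in auto)
qed

lemma chiL_hold:
  assumes s: "small s"
  shows "hold (2 * Bs s) (chiL s)" "hold s (chiL s)" "hold (2 * Bs s / 2^n) (\<lambda>x. chiL s x - chi n s x)"
proof -
  show 1: "hold (2 * Bs s) (chiL s)" by (rule hold_limit[OF chi_hold(1)[OF s] chi_lim[OF s]])
  show "hold s (chiL s)" by (rule hold_mono[OF 1 smallD(7)[OF s]])
  show "hold (2 * Bs s / 2^n) (\<lambda>x. chiL s x - chi n s x)"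
  proof (rule hold_limit[OF chi_tail'[OF s]])
    fix x :: "real^3" assume x: "norm x = 1"
    have "(\<lambda>k. chi (k + n) s x) \<longlonglongrightarrow> chiL s x" using chi_lim[OF s x] by (rule LIMSEQ_ignore_initial_segment)
    then show "(\<lambda>k. chi (n + k) s x - chi n s x) \<longlonglongrightarrow> chiL s x - chi n s x" by (intro tendsto_intros) (simp add: add.commute)
  qed
qed

lemma chiL_fixed:
  assumes s: "small s" and x: "norm x = 1"
  shows "Fop s (chiL s) x = chiL s x"
proof -
  have "(\<lambda>n. chi (Suc n) s x) \<longlonglongrightarrow> Fop s (chiL s) x"
  proof (rule LIM_zero_cancel)
    show "(\<lambda>n. chi (Suc n) s x - Fop s (chiL s) x) \<longlonglongrightarrow> 0"
    proof (rule Lim_null_comparison)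
      show "\<forall>\<^sub>F n in sequentially. norm (chi (Suc n) s x - Fop s (chiL s) x) \<le> Bs s / 2^n"
      proof (intro always_eventually allI)
        fix n
        have "\<bar>Fop s (chiL s) x - Fop s (chi n s) x\<bar> \<le> 2 * Bs s / 2^n / 2"
          by (rule holdD(2)[OF Fop_contraction[OF s chiL_hold(2)[OF s] chi_hold(2)[OF s] chiL_hold(3)[OF s]] x])
        then show "norm (chi (Suc n) s x - Fop s (chiL s) x) \<le> Bs s / 2^n" by (simp add: abs_minus_commute)
      qed
    qed (rule pow2_lim)
  qed
  moreover have "(\<lambda>n. chi (Suc n) s x) \<longlonglongrightarrow> chiL s x" using chi_lim[OF s x] by (rule LIMSEQ_Suc)
  ultimately show ?thesis by (rule LIMSEQ_unique)
qed

section \<open>Invariance under the stabilizer and orthogonality to linear functions\<close>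

lemma Dop_inv:
  assumes f: "inv1 f" and T: "stab T" and s: "0 < s" "s \<le> 1" and x: "norm x = 1"
  shows "Dop s f (T x) = Dop s f x"
proof -
  have Ts: "symm T" "T (\<xi> 1) = \<xi> 1" using T by (auto simp: stab_def)
  obtain p where p: "bij p" "\<And>k. T (\<xi> k) = \<xi> (p k)"
    "\<And>j. \<exists>S. stab S \<and> (\<forall>x. refl 1 (p j) (T x) = S (refl 1 j x))" using symm_factor[OF Ts(1)] by metis
  have p1: "p 1 = 1" using p(2)[of 1] Ts(2) inj_xi by metis
  have bij: "bij_betw p (UNIV - {1}) (UNIV - {1})"
    using p(1) p1 by (metis bij_betw_DiffI bij_betw_singletonI subset_UNIV bij_betw_def bij_def inj_on_def singletonD image_insert image_empty)
  have e: "f (Ph s (refl 1 (p j) (Th s (T x)))) = f (Ph s (refl 1 j (Th s x)))" for j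
  proof -
    obtain S where S: "stab S" "\<And>x. refl 1 (p j) (T x) = S (refl 1 j x)" using p(3) by blast
    have S': "symm S" "S (\<xi> 1) = \<xi> 1" using S(1) by (auto simp: stab_def)
    have "refl 1 (p j) (Th s (T x)) = S (refl 1 j (Th s x))" using bub_T(1)[OF Ts] S(2) by metis
    then have "Ph s (refl 1 (p j) (Th s (T x))) = S (Ph s (refl 1 j (Th s x)))" using bub_T(2)[OF S'] by metis
    moreover have "norm (Ph s (refl 1 j (Th s x))) = 1" by (rule Ph_norm[OF s]) (simp add: refl_norm Th_facts(1)[OF s x])
    ultimately show ?thesis using f S(1) by (simp add: inv1_def)
  qed
  have "(\<Sum>k\<in>UNIV-{1}. f (Ph s (refl 1 k (Th s (T x))))) = (\<Sum>j\<in>UNIV-{1}. f (Ph s (refl 1 (p j) (Th s (T x)))))"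
    by (rule sum.reindex_bij_betw[OF bij, symmetric])
  also have "\<dots> = (\<Sum>j\<in>UNIV-{1}. f (Ph s (refl 1 j (Th s x))))" unfolding e ..
  finally show ?thesis unfolding Dop_def sum_subtractf by simp
qed

lemma gam_inv:
  assumes f: "inv1 f" and T: "stab T" and s: "0 < s" "s \<le> 1" and x: "norm x = 1"
  shows "gam s f (T x) = gam s f x"
proof -
  have Ts: "symm T" "T (\<xi> 1) = \<xi> 1" using T by (auto simp: stab_def)
  have t: "T x \<bullet> \<xi> 1 = x \<bullet> \<xi> 1" using symm_inner[OF Ts(1), of x "\<xi> 1"] Ts(2) by simp
  have "Ef (aa s) (Th s (T x)) = Ef (aa s) (Th s x)" unfolding bub_T(1)[OF Ts, symmetric] by (rule Ef_symm[OF Ts(1)])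
  then show ?thesis unfolding gam_def gop_def qf_def t Dop_inv[OF assms] using f T x by (simp add: inv1_def)
qed

lemma chi_inv:
  assumes s: "small s"
  shows "inv1 (chi n s)"
proof (induction n)
  case 0 show ?case by (simp add: inv1_def)
next
  case (Suc n)
  note S = smallD[OF s]
  show ?case unfolding inv1_def
  proof (intro allI impI)
    fix T x assume T: "stab T" and x: "norm (x::real^3) = 1"
    have o: "orthogonal_transformation T" by (rule stab_orth[OF T])
    have m: "(\<lambda>y. greenk (T x) y * gam s (chi n s) y) \<in> borel_measurable area"
      using borel_measurable_areaI[OF gam_cont[OF hold_cont[OF chi_hold(2)[OF s]] S(1,3)]] by simp
    have "(\<integral>y. greenk (T x) y * gam s (chi n s) y \<partial>area) = (\<integral>y. greenk (T x) (T y) * gam s (chi n s) (T y) \<partial>area)"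
      using integral_area_orth[OF o m] by simp
    also have "\<dots> = (\<integral>y. greenk x y * gam s (chi n s) y \<partial>area)"
    proof (rule Bochner_Integration.integral_cong[OF refl])
      fix y assume "y \<in> space area"
      then have y: "norm y = 1" by simp
      show "greenk (T x) (T y) * gam s (chi n s) (T y) = greenk x y * gam s (chi n s) y"
        unfolding gam_inv[OF Suc T S(1,3) y] by (simp add: greenk_def logk_def orth_inner[OF o])
    qed
    finally show "chi (Suc n) s (T x) = chi (Suc n) s x" by (simp add: Fop_def gpot_def)
  qed
qed

lemma chiL_inv:
  assumes s: "small s"
  shows "inv1 (chiL s)"
  unfolding inv1_def chiL_def using chi_inv[OF s] by (simp add: inv1_def)

text \<open>The choice of \<open>mop\<close> kills the moment along \<xi> 1. The reflections
  \<open>refl k l\<close> with k and l different from 1 lie in the stabilizer and make the other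
  three moments equal; as the vertices sum to 0, these vanish too, and \<open>frame\<close> extends
  this to all directions.\<close>

lemma gam_orth:
  assumes s: "small s" and f: "hold s f" "inv1 f"
  shows "(\<integral>y. gam s f y * (q \<bullet> y) \<partial>area) = 0"
proof -
  note S = smallD[OF s]
  note fc = hold_cont[OF f(1)]
  have gi: "integrable area (\<lambda>y. gam s f y * (v \<bullet> y))" for v
    by (intro integrable_area_cont continuous_intros gam_cont fc S)
  define V where "V v = (\<integral>y. gam s f y * (v \<bullet> y) \<partial>area)" for v
  have Vadd: "V (v + w) = V v + V w" for v w unfolding V_def inner_add_left distrib_left using gi by simp
  have Vsc: "V (c *\<^sub>R v) = c * V v" for c v unfolding V_def inner_scaleR_left by (simp add: mult.left_commute)
  have V0: "V 0 = 0" unfolding V_def by simp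
  have V1: "V (\<xi> 1) = 0"
  proof -
    have q: "(\<integral>x. (x \<bullet> \<xi> 1) * qf s x \<partial>area) \<noteq> 0" using qf_integrals(4)[OF S(1,3,5)] by linarith
    have "V (\<xi> 1) = (\<integral>y. (y \<bullet> \<xi> 1) * gop s f y - mop s f * ((y \<bullet> \<xi> 1) * qf s y) \<partial>area)"
      unfolding V_def gam_def by (rule Bochner_Integration.integral_cong) (simp_all add: inner_commute algebra_simps)
    also have "\<dots> = (\<integral>y. (y \<bullet> \<xi> 1) * gop s f y \<partial>area) - mop s f * (\<integral>x. (x \<bullet> \<xi> 1) * qf s x \<partial>area)"
      using gop_integrable[OF fc S(1,3)] qf_integrals(3)[OF S(1,3)] by simp
    also have "\<dots> = 0" unfolding mop_def using q by simp
    finally show ?thesis .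
  qed
  have Vkl: "V (\<xi> k) = V (\<xi> l)" if "k \<noteq> 1" "l \<noteq> 1" for k l
  proof -
    have T: "stab (refl k l)" by (rule refl_stab[OF that])
    note o = refl_orth[of k l]
    have m: "(\<lambda>y. gam s f y * (\<xi> l \<bullet> y)) \<in> borel_measurable area" using gi[of "\<xi> l"] by simp
    have "V (\<xi> l) = (\<integral>y. gam s f (refl k l y) * (\<xi> l \<bullet> refl k l y) \<partial>area)"
      unfolding V_def using integral_area_orth[OF o m] by simp
    also have "\<dots> = V (\<xi> k)" unfolding V_def
    proof (rule Bochner_Integration.integral_cong[OF refl])
      fix y assume "y \<in> space area"
      then have y: "norm y = 1" by simp
      have "\<xi> l \<bullet> refl k l y = \<xi> k \<bullet> y" using orth_inner[OF o, of "\<xi> k" y] by (simp add: refl_xi)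
      then show "gam s f (refl k l y) * (\<xi> l \<bullet> refl k l y) = gam s f y * (\<xi> k \<bullet> y)"
        using gam_inv[OF f(2) T S(1,3) y] by simp
    qed
    finally show ?thesis ..
  qed
  have "V (\<xi> 1) + V (\<xi> 2) + V (\<xi> 3) + V (\<xi> 4) = 0" using arg_cong[OF sum_zero, of V] by (simp only: Vadd V0)
  moreover have "V (\<xi> 3) = V (\<xi> 2)" "V (\<xi> 4) = V (\<xi> 2)" by (rule Vkl; simp)+
  ultimately have V2: "V (\<xi> 2) = 0" "V (\<xi> 3) = 0" "V (\<xi> 4) = 0" using V1 by simp_all
  have "V q = V ((3/4) *\<^sub>R ((q \<bullet> \<xi> 1) *\<^sub>R \<xi> 1 + (q \<bullet> \<xi> 2) *\<^sub>R \<xi> 2 + (q \<bullet> \<xi> 3) *\<^sub>R \<xi> 3 + (q \<bullet> \<xi> 4) *\<^sub>R \<xi> 4))"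
    using frame[of q] by simp
  then have "V q = 0" unfolding Vsc Vadd V1 V2 by simp
  then show ?thesis unfolding V_def .
qed

definition mu :: "real \<Rightarrow> real" where "mu s = mop s (chiL s)"

text \<open>After the blow-up, \<open>1 + Hf s\<close> is half the density, with respect to area, of
  each of the four equal parts of exp (us s); see \<open>integral_exp_us\<close>.\<close>

definition Hf :: "real \<Rightarrow> real^3 \<Rightarrow> real" where
  "Hf s x = Ef (aa s) (Th s x) * exp (chiL s x + Dop s (chiL s) x) - 1"

text \<open>The fixed point equation is inserted in \<open>gpot_equation\<close>. For the mass,
  \<open>gpot_mean\<close> says that chiL s + gam s (chiL s) integrates to 0; since
  \<open>qf s\<close> integrates to 1, what is left is exactly the multiplier.\<close>

theorem chiL_equation:
  assumes s: "small s"
  shows "\<And>x x'. norm x = 1 \<Longrightarrow> norm x' = 1 \<Longrightarrow>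
      chiL s x - chiL s x' = - (1 / (2 * pi)) * (\<integral>z. (logk x z - logk x' z) * (Hf s z - mu s * qf s z) \<partial>area)"
    and "(\<integral>z. Hf s z \<partial>area) = mu s" and "continuous_on S2 (Hf s)"
proof -
  note S = smallD[OF s]
  note cL = chiL_hold(2)[OF s]
  note cc = hold_cont[OF cL]
  obtain m where w: "wbd (- \<xi> 1) m (gam s (chiL s))" using gam_wbd[OF s cL] by blast
  have fx: "gpot (gam s (chiL s)) x = chiL s x" if "norm x = 1" for x using chiL_fixed[OF s that] by (simp add: Fop_def)
  have H: "chiL s z + gam s (chiL s) z = Hf s z - mu s * qf s z" for z unfolding gam_def gop_def Hf_def mu_def by simp
  show "chiL s x - chiL s x' = - (1 / (2 * pi)) * (\<integral>z. (logk x z - logk x' z) * (Hf s z - mu s * qf s z) \<partial>area)"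
    if x: "norm x = 1" "norm x' = 1" for x x'
  proof -
    have "(\<integral>z. (logk x z - logk x' z) * (gpot (gam s (chiL s)) z + gam s (chiL s) z) \<partial>area)
       = (\<integral>z. (logk x z - logk x' z) * (Hf s z - mu s * qf s z) \<partial>area)"
      by (rule Bochner_Integration.integral_cong) (simp_all add: fx H)
    then show ?thesis using gpot_equation(1)[OF w gam_orth[OF s cL chiL_inv[OF s]] x] fx x by simp
  qed
  have He: "Hf s z = gop s (chiL s) z + chiL s z" for z unfolding Hf_def gop_def by simp
  show Hc: "continuous_on S2 (Hf s)" unfolding He by (intro continuous_intros gop_cont cc S)
  have gi: "integrable area (gam s (chiL s))" by (intro integrable_area_cont gam_cont cc S)
  have ci: "integrable area (chiL s)" by (intro integrable_area_cont cc)
  have "(\<integral>z. chiL s z \<partial>area) = (\<integral>z. gpot (gam s (chiL s)) z \<partial>area)"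
    by (rule Bochner_Integration.integral_cong) (simp_all add: fx)
  also have "\<dots> = - (\<integral>y. gam s (chiL s) y \<partial>area)" by (rule gpot_mean(2)[OF w])
  finally have "(\<integral>z. chiL s z + gam s (chiL s) z \<partial>area) = 0" using gi ci by simp
  then have "(\<integral>z. Hf s z - mu s * qf s z \<partial>area) = 0" unfolding H .
  then show "(\<integral>z. Hf s z \<partial>area) = mu s"
    using integrable_area_cont[OF Hc] qf_integrals(1,2)[OF S(1,3)] by simp
qed

end

section \<open>The multiplier\<close>

lemma integral_mult_tendsto:
  fixes w :: "real^3 \<Rightarrow> real" and h :: "nat \<Rightarrow> real^3 \<Rightarrow> real"
  assumes w: "integrable area w" and hc: "\<And>j. continuous_on S2 (h j)" "continuous_on S2 g"
    and b: "\<And>j x. norm x = 1 \<Longrightarrow> \<bar>h j x\<bar> \<le> K" and l: "\<And>x. norm x = 1 \<Longrightarrow> (\<lambda>j. h j x) \<longlonglongrightarrow> g x"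
  shows "(\<lambda>j. \<integral>x. w x * h j x \<partial>area) \<longlonglongrightarrow> (\<integral>x. w x * g x \<partial>area)"
proof (rule integral_dominated_convergence[where w="\<lambda>x. K * \<bar>w x\<bar>"])
  have wm: "w \<in> borel_measurable area" using w by simp
  show "(\<lambda>x. w x * g x) \<in> borel_measurable area" using wm borel_measurable_areaI[OF hc(2)] by simp
  show "(\<lambda>x. w x * h j x) \<in> borel_measurable area" for j using wm borel_measurable_areaI[OF hc(1)] by simp
  show "integrable area (\<lambda>x. K * \<bar>w x\<bar>)" using w by simp
  show "AE x in area. (\<lambda>j. w x * h j x) \<longlonglongrightarrow> w x * g x" by (rule AE_I2) (auto intro!: tendsto_intros l)
  show "AE x in area. norm (w x * h j x) \<le> K * \<bar>w x\<bar>" for j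
  proof (rule AE_I2)
    fix x :: "real^3" assume "x \<in> space area"
    then have "norm x = 1" by simp
    from mult_right_mono[OF b[OF this, of j], of "\<bar>w x\<bar>"] show "norm (w x * h j x) \<le> K * \<bar>w x\<bar>" by (simp add: abs_mult mult.commute)
  qed
qed

lemma bub_tendsto:
  assumes "(\<lambda>j. a j) \<longlonglongrightarrow> b" "x \<longlonglongrightarrow> y" "b - y \<bullet> p \<noteq> 0"
  shows "(\<lambda>j. bub (a j) p (x j)) \<longlonglongrightarrow> bub b p y"
  unfolding bub_def by (intro tendsto_intros assms)

lemma aa_tendsto: "\<sigma> \<longlonglongrightarrow> s \<Longrightarrow> (\<lambda>j. aa (\<sigma> j)) \<longlonglongrightarrow> aa s"
  unfolding aa_def by (intro tendsto_intros)

text \<open>A common Hoelder bound allows evaluation at converging points, as is needed when the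
  maps \<open>Th\<close> and \<open>Ph\<close> move with the scale.\<close>

lemma hold_moving:
  assumes h: "\<And>j. hold 1 (f j)" and l: "\<And>x. norm x = 1 \<Longrightarrow> (\<lambda>j. f j x) \<longlonglongrightarrow> g x"
    and z: "\<And>j. norm (z j) = 1" "norm y = 1" "z \<longlonglongrightarrow> y"
  shows "(\<lambda>j. f j (z j)) \<longlonglongrightarrow> g y"
proof -
  have "(\<lambda>j. f j (z j) - f j y) \<longlonglongrightarrow> 0"
  proof (rule Lim_null_comparison)
    show "\<forall>\<^sub>F j in sequentially. norm (f j (z j) - f j y) \<le> sqrt (norm (z j - y))"
      using holdD(3)[OF h z(1) z(2)] by (intro always_eventually) simp
    have "(\<lambda>j. sqrt (norm (z j - y))) \<longlonglongrightarrow> sqrt (norm (y - y))" by (intro tendsto_intros z)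
    then show "(\<lambda>j. sqrt (norm (z j - y))) \<longlonglongrightarrow> 0" by simp
  qed
  from tendsto_add[OF this l[OF z(2)]] show ?thesis by simp
qed

lemma greenk_int: "norm x = 1 \<Longrightarrow> integrable area (greenk x)"
proof -
  assume x: "norm x = 1"
  have "greenk x = (\<lambda>z. greenk z x)" by (rule ext) (simp add: greenk_def logk_commute inner_commute)
  then show ?thesis using greenk_mean(1)[OF x] by simp
qed

section \<open>Continuity, sign and size of the multiplier\<close>

context tetra begin

lemma Pf_tendsto: "a \<longlonglongrightarrow> b \<Longrightarrow> z \<longlonglongrightarrow> y \<Longrightarrow> (\<lambda>j. Pf (a j) (z j)) \<longlonglongrightarrow> Pf b y"
  unfolding Pf_def prd_def by (intro tendsto_intros)

lemma Ef_tendsto: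
  assumes "a \<longlonglongrightarrow> b" "z \<longlonglongrightarrow> y" "1 \<le> b" "norm y = 1"
  shows "(\<lambda>j. Ef (a j) (z j)) \<longlonglongrightarrow> Ef b y"
proof -
  have "Pf b y \<noteq> 0" using Pf_lower[OF assms(4,3)] by simp
  then show ?thesis unfolding Ef_def by (intro tendsto_divide Pf_tendsto tendsto_const assms)
qed

lemma refl_tendsto: "z \<longlonglongrightarrow> y \<Longrightarrow> (\<lambda>j. refl k l (z j)) \<longlonglongrightarrow> refl k l y"
  unfolding refl_def by (intro tendsto_intros)

lemma gop_abs_le:
  assumes s: "0 < s" "s \<le> 1/7" and f: "hold s f" and x: "norm x = 1"
  shows "\<bar>gop s f x\<bar> \<le> 1200000"
proof -
  have s1: "s \<le> 1" using s by simp
  define p where "p = f x + Dop s f x"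
  have fx: "\<bar>f x\<bar> \<le> s" by (rule holdD(2)[OF f x])
  have "\<bar>p\<bar> \<le> 7 * s" using fx Dop_bound(1)[OF f s(1) s1 x] unfolding p_def by linarith
  then have "exp p \<le> exp 1" using s by simp
  also have "exp 1 \<le> (3::real)" by (rule exp_le)
  finally have e: "\<bar>exp p\<bar> \<le> 3" by simp
  have "\<bar>Ef (aa s) (Th s x)\<bar> \<le> 358401" using E_bound(3)[OF s(1) s1 x] by linarith
  from abs_mult_le[OF this e] have "\<bar>Ef (aa s) (Th s x) * exp p\<bar> \<le> 1075203" by simp
  then show ?thesis unfolding gop_def p_def[symmetric] using fx s by linarith
qed

text \<open>Dominated convergence in each integral. The scales stay above a positive s1, which
  bounds \<open>qf\<close> by 1 / s1^2; the limit is pointwise on the sphere, so it can be fed into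
  the next step of the iteration.\<close>

lemma limit_step:
  assumes s: "small s" "s1 \<le> s" and sj: "\<And>j. small (\<sigma> j)" "\<And>j. s1 \<le> \<sigma> j" and s1: "0 < s1" and l: "\<sigma> \<longlonglongrightarrow> s"
    and h: "\<And>j. hold (\<sigma> j) (f j)" "hold s g" and fl: "\<And>x. norm x = 1 \<Longrightarrow> (\<lambda>j. f j x) \<longlonglongrightarrow> g x"
  shows "(\<lambda>j. mop (\<sigma> j) (f j)) \<longlonglongrightarrow> mop s g" "norm x = 1 \<Longrightarrow> (\<lambda>j. Fop (\<sigma> j) (f j) x) \<longlonglongrightarrow> Fop s g x"
proof -
  note S = smallD[OF s(1)] note Sj = smallD[OF sj(1)]
  have h1: "hold 1 (f j)" for j by (rule hold_mono[OF h(1) Sj(3)])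
  note al = aa_tendsto[OF l]
  have a1: "1 < aa s" by (rule aa_facts(1)[OF S(1,3)])
  have Thl: "(\<lambda>j. Th (\<sigma> j) x) \<longlonglongrightarrow> Th s x" if x: "norm x = 1" for x
  proof (rule bub_tendsto[OF al tendsto_const])
    show "aa s - x \<bullet> (- \<xi> 1) \<noteq> 0" using Th_facts(2)[OF S(1,3) x] by simp
  qed
  have Phl: "(\<lambda>j. Ph (\<sigma> j) (z j)) \<longlonglongrightarrow> Ph s y" if z: "z \<longlonglongrightarrow> y" "norm y = 1" for z y
  proof (rule bub_tendsto[OF al z(1)])
    show "aa s - y \<bullet> \<xi> 1 \<noteq> 0" using a_minus_pos[OF a1 nrm z(2), of 1] by simp
  qed
  have fP: "(\<lambda>j. f j (Ph (\<sigma> j) (z j))) \<longlonglongrightarrow> g (Ph s y)" if z: "z \<longlonglongrightarrow> y" "\<And>j. norm (z j) = 1" "norm y = 1" for z y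
    by (rule hold_moving[OF h1 fl Ph_norm[OF Sj(1,3) z(2)] Ph_norm[OF S(1,3) z(3)] Phl[OF z(1,3)]])
  have Dl: "(\<lambda>j. Dop (\<sigma> j) (f j) x) \<longlonglongrightarrow> Dop s g x" if x: "norm x = 1" for x
    unfolding Dop_def
    by (intro tendsto_sum tendsto_diff fP refl_tendsto Thl x tendsto_const)
       (simp_all add: refl_norm Th_facts(1)[OF Sj(1,3) x] Th_facts(1)[OF S(1,3) x])
  have gl: "(\<lambda>j. gop (\<sigma> j) (f j) x) \<longlonglongrightarrow> gop s g x" if x: "norm x = 1" for x
    unfolding gop_def
    by (intro tendsto_diff tendsto_mult tendsto_exp tendsto_add Ef_tendsto al Thl Dl fl x tendsto_const)
       (use a1 Th_facts(1)[OF S(1,3) x] in simp_all)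
  have ql: "(\<lambda>j. qf (\<sigma> j) x) \<longlonglongrightarrow> qf s x" if x: "norm x = 1" for x
    unfolding qf_def using Th_facts(2)[OF S(1,3) x] by (intro tendsto_intros l al) auto
  have qb: "\<bar>qf (\<sigma> j) x\<bar> \<le> 1 / s1\<^sup>2" if x: "norm x = 1" for x j
  proof -
    note T = Th_facts[OF Sj(1,3)[of j] x]
    have sp: "0 < \<sigma> j" by (rule Sj(1))
    have "((\<sigma> j)\<^sup>2 / 3)\<^sup>2 \<le> (aa (\<sigma> j) + x \<bullet> \<xi> 1)\<^sup>2" by (rule power_mono[OF T(3)]) simp
    then have "4 * pi * (aa (\<sigma> j) + x \<bullet> \<xi> 1)\<^sup>2 \<ge> 9 * ((\<sigma> j)\<^sup>2 / 3)\<^sup>2" using pi_gt3 by (intro mult_mono) auto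
    then have "qf (\<sigma> j) x \<le> (\<sigma> j)\<^sup>2 / (9 * ((\<sigma> j)\<^sup>2 / 3)\<^sup>2)" unfolding qf_def
      using sp T(2) by (intro divide_left_mono) (auto intro!: mult_pos_pos)
    also have "\<dots> = 1 / (\<sigma> j)\<^sup>2" using sp by (simp add: power2_eq_square field_simps)
    also have "\<dots> \<le> 1 / s1\<^sup>2" using s1 sj(2)[of j] by (intro divide_left_mono power_mono) auto
    finally show ?thesis using qf_bound(1)[OF Sj(1,3) x, of j] by simp
  qed
  have gc: "continuous_on S2 (gop (\<sigma> j) (f j))" for j by (intro gop_cont hold_cont[OF h(1)] Sj)
  have gc': "continuous_on S2 (gop s g)" by (intro gop_cont hold_cont[OF h(2)] S)
  have gb: "\<bar>gop (\<sigma> j) (f j) x\<bar> \<le> 1200000" if "norm x = 1" for j x by (rule gop_abs_le[OF Sj(1,4) h(1) that])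
  have qc: "continuous_on S2 (qf (\<sigma> j))" for j by (intro qf_cont Sj)
  have qc': "continuous_on S2 (qf s)" by (intro qf_cont S)
  have ti: "integrable area (\<lambda>x. x \<bullet> \<xi> 1)" by (intro integrable_area_cont continuous_intros)
  have den: "(\<integral>x. (x \<bullet> \<xi> 1) * qf s x \<partial>area) \<noteq> 0" using qf_integrals(4)[OF S(1,3,5)] by simp
  show m: "(\<lambda>j. mop (\<sigma> j) (f j)) \<longlonglongrightarrow> mop s g"
    unfolding mop_def
    by (rule tendsto_divide[OF integral_mult_tendsto[OF ti gc gc' gb gl] integral_mult_tendsto[OF ti qc qc' qb ql] den])
  assume x: "norm x = 1"
  note ki = greenk_int[OF x]
  have sp: "Fop s' f' x = 2 * ((\<integral>y. greenk x y * gop s' f' y \<partial>area) - mop s' f' * (\<integral>y. greenk x y * qf s' y \<partial>area))"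
    if c: "continuous_on S2 (gop s' f')" "continuous_on S2 (qf s')" for s' f'
  proof -
    have i: "integrable area (\<lambda>y. greenk x y * gop s' f' y)" "integrable area (\<lambda>y. greenk x y * qf s' y)"
      by (rule integrable_mult_cont[OF ki c(1)], rule integrable_mult_cont[OF ki c(2)])
    have "(\<integral>y. greenk x y * gam s' f' y \<partial>area) = (\<integral>y. greenk x y * gop s' f' y - mop s' f' * (greenk x y * qf s' y) \<partial>area)"
      unfolding gam_def by (rule Bochner_Integration.integral_cong) (simp_all add: algebra_simps)
    also have "\<dots> = (\<integral>y. greenk x y * gop s' f' y \<partial>area) - mop s' f' * (\<integral>y. greenk x y * qf s' y \<partial>area)"
      using i by simp
    finally show ?thesis by (simp add: Fop_def gpot_def)
  qed
  show "(\<lambda>j. Fop (\<sigma> j) (f j) x) \<longlonglongrightarrow> Fop s g x"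
    unfolding sp[OF gc qc] sp[OF gc' qc']
    by (intro tendsto_mult tendsto_diff tendsto_const m integral_mult_tendsto[OF ki gc gc' gb gl] integral_mult_tendsto[OF ki qc qc' qb ql])
qed

text \<open>At every small scale the n-th iterate is within 1 / 2^n of the fixed point, so the
  pointwise convergence of the iterates, shown by induction, carries over to the fixed points and
  then to \<open>mop\<close>.\<close>

lemma mu_tendsto:
  assumes s: "small s" "s1 \<le> s" and sj: "\<And>j. small (\<sigma> j)" "\<And>j. s1 \<le> \<sigma> j" and s1: "0 < s1" and l: "\<sigma> \<longlonglongrightarrow> s"
  shows "(\<lambda>j. mu (\<sigma> j)) \<longlonglongrightarrow> mu s"
proof -
  have c: "(\<lambda>j. chi n (\<sigma> j) x) \<longlonglongrightarrow> chi n s x" if "norm x = 1" for n x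
    using that
  proof (induction n arbitrary: x)
    case 0 show ?case by simp
  next
    case (Suc n)
    show ?case unfolding chi.simps
      by (rule limit_step(2)[OF s sj s1 l chi_hold(2)[OF sj(1)] chi_hold(2)[OF s(1)] Suc.IH Suc.prems])
  qed
  have b: "\<bar>chiL s x - chi n s x\<bar> \<le> 1 / 2^n" if s: "small s" and x: "norm x = 1" for s x n
  proof -
    have "\<bar>chiL s x - chi n s x\<bar> \<le> 2 * Bs s / 2^n" by (rule holdD(2)[OF chiL_hold(3)[OF s] x])
    also have "\<dots> \<le> 1 / 2^n" using smallD(3,7)[OF s] by (intro divide_right_mono) auto
    finally show ?thesis .
  qed
  have cL: "(\<lambda>j. chiL (\<sigma> j) x) \<longlonglongrightarrow> chiL s x" if x: "norm x = 1" for x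
  proof (rule LIMSEQ_I)
    fix e :: real assume e: "0 < e"
    have "\<forall>\<^sub>F n in sequentially. 1 / 2^n < e/3" using pow2_lim[of 1] e by (intro order_tendstoD(2)) auto
    then obtain n where n: "1 / 2^n < e/3" by (auto simp: eventually_sequentially)
    obtain M where M: "\<And>j. j \<ge> M \<Longrightarrow> norm (chi n (\<sigma> j) x - chi n s x) < e/3" using LIMSEQ_D[OF c[OF x, of n], of "e/3"] e by auto
    show "\<exists>M. \<forall>j\<ge>M. norm (chiL (\<sigma> j) x - chiL s x) < e"
    proof (intro exI allI impI)
      fix j assume "j \<ge> M"
      from M[OF this] b[OF sj(1)[of j] x, of n] b[OF s(1) x, of n] n
      show "norm (chiL (\<sigma> j) x - chiL s x) < e" unfolding real_norm_def by linarith
    qed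
  qed
  show ?thesis unfolding mu_def by (rule limit_step(1)[OF s sj s1 l chiL_hold(2)[OF sj(1)] chiL_hold(2)[OF s(1)] cL])
qed

lemma mu_cont:
  assumes "0 < s1" "\<And>s. s \<in> {s1..s0} \<Longrightarrow> small s"
  shows "continuous_on {s1..s0} mu"
  unfolding continuous_on_sequentially comp_def
  by (intro allI ballI impI, rule mu_tendsto[of _ s1]) (use assms in auto)

text \<open>Three regions. For x \<bullet> \<xi> 1 > -1/2 the quantity y is O(s^2). Otherwise, if Th
  s x is close to the vertex, the growth of \<open>Ef\<close> from its minimum gives at least y /
  200; if it is not, y is bounded below and hence dominated by a multiple of y^2. Only y / 200 has
  an integral that carries a logarithm.\<close>

lemma gop_zero_lower:
  assumes s: "0 < s" "s \<le> 1/1000" and x: "norm x = 1"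
  defines "y \<equiv> s\<^sup>2 / (aa s + x \<bullet> \<xi> 1)"
  shows "y / 200 - 200000000 * s\<^sup>2 - 200000000 * y\<^sup>2 \<le> - ((x \<bullet> \<xi> 1) * gop s (\<lambda>_. 0) x)"
proof -
  have s1: "s \<le> 1" using s by simp
  note a = aa_facts[OF s(1) s1] note T = Th_facts[OF s(1) s1 x]
  define t where "t = x \<bullet> \<xi> 1" define D where "D = Ef (aa s) (Th s x) - 1" define v where "v = 1 - Th s x \<bullet> \<xi> 1"
  have t1: "\<bar>t\<bar> \<le> 1" unfolding t_def by (rule abs_inner_le_1[OF x nrm])
  have a1: "1 \<le> aa s" using a by simp
  have y0: "0 < y" unfolding y_def using s T(2) by simp
  have D1: "\<bar>D\<bar> \<le> 179200 * y" unfolding D_def y_def by (rule E_bound(1)[OF s(1) s1 x])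
  have vy: "v \<le> y" unfolding v_def y_def by (rule T(6))
  have v: "v = y * ((1 - t) / (aa s + 1))" unfolding v_def T(5) y_def t_def by simp
  have "\<bar>t * D\<bar> \<le> 1 * (179200 * y)" by (rule abs_mult_le[OF t1 D1])
  then have tD: "- (179200 * y) \<le> - (t * D)" by linarith
  have y2: "0 \<le> y\<^sup>2" "0 \<le> s\<^sup>2" by simp_all
  have "y / 200 - 200000000 * s\<^sup>2 - 200000000 * y\<^sup>2 \<le> - (t * D)"
  proof (cases "t > - (1/2)")
    case True
    have "y \<le> s\<^sup>2 / (1/2)" unfolding y_def t_def[symmetric] using True a1 s by (intro divide_left_mono) auto
    then have "y \<le> 2 * s\<^sup>2" by simp
    then show ?thesis using tD y2 by linarith
  next
    case False
    show ?thesis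
    proof (cases "v \<le> 1/1000")
      case True
      have "s\<^sup>2 \<le> (1/1000)\<^sup>2" using s by (intro power_mono) auto
      then have "aa s \<le> 1 + 1/1000" using a(6) by (simp add: power2_eq_square)
      from Ef_bounds(2)[OF a1 a(2) T(1) this] True have D2: "v / 50 \<le> D" unfolding v_def D_def by simp
      have "(3/2) / (5/2) \<le> (1 - t) / (aa s + 1)" using False a by (intro frac_le) auto
      then have "y * (3/5) \<le> v" unfolding v using y0 by (intro mult_left_mono) auto
      then have "y / 100 \<le> D" using D2 y0 by linarith
      then have "(1/2) * (y / 100) \<le> (- t) * D" using \<open>\<not> - (1/2) < t\<close> y0 by (intro mult_mono) auto
      then have "y / 200 \<le> - (t * D)" by simp
      then show ?thesis using y2 by linarith
    next
      case False
      then have "1/1000 \<le> y" using vy by linarith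
      then have "(1/1000) * y \<le> y * y" using y0 by (intro mult_right_mono) auto
      then show ?thesis using tD y2 y0 unfolding power2_eq_square by linarith
    qed
  qed
  then show ?thesis unfolding gop_zero t_def D_def by simp
qed

text \<open>Integrating \<open>gop_zero_lower\<close> gives s^2 * ell s * (2 * pi / 200) minus
  O(s^2), since y^2 integrates to 4 * pi * s^2; replacing 0 by the fixed point costs another O(s^2).
  By the last condition in \<open>small\<close> the logarithm wins, so the numerator of
  \<open>mu s\<close> is negative, like its denominator.\<close>

lemma mu_bounds:
  assumes s: "small s"
  shows "0 < mu s" "\<bar>mu s\<bar> \<le> 2 * (1150000 * s\<^sup>2 * ell s + 32000000 * s\<^sup>2 * sing_const)"
proof -
  note S = smallD[OF s] note I = int_inv_t[OF S(1,3)]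
  define N where "N = (\<integral>x. (x \<bullet> \<xi> 1) * gop s (chiL s) x \<partial>area)"
  define N0 where "N0 = (\<integral>x. (x \<bullet> \<xi> 1) * gop s (\<lambda>_. 0) x \<partial>area)"
  have gi: "integrable area (\<lambda>x. (x \<bullet> \<xi> 1) * gop s (\<lambda>_. 0) x)" by (intro gop_integrable S) simp
  define L where "L x = (s\<^sup>2/200) * (1 / (aa s + x \<bullet> \<xi> 1)) - 200000000 * s\<^sup>2 - (200000000 * s^4) * (1 / (aa s + x \<bullet> \<xi> 1)\<^sup>2)" for x
  have Li: "integrable area L" unfolding L_def
    by (intro Bochner_Integration.integrable_diff integrable_mult_right I area.integrable_const)
  have "(\<integral>x. L x \<partial>area) \<le> (\<integral>x. - ((x \<bullet> \<xi> 1) * gop s (\<lambda>_. 0) x) \<partial>area)"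
  proof (rule integral_mono[OF Li])
    show "integrable area (\<lambda>x. - ((x \<bullet> \<xi> 1) * gop s (\<lambda>_. 0) x))" using gi by simp
    fix x :: "real^3" assume "x \<in> space area"
    then have x: "norm x = 1" by simp
    have "L x = (s\<^sup>2 / (aa s + x \<bullet> \<xi> 1)) / 200 - 200000000 * s\<^sup>2 - 200000000 * (s\<^sup>2 / (aa s + x \<bullet> \<xi> 1))\<^sup>2"
    proof -
      have g: "(S/200) * (1/A) - B * S - (B * T) * (1/A\<^sup>2) = (S/A)/200 - B * S - B * (S/A)\<^sup>2" if "T = S\<^sup>2" for A B S T :: real
        using that by (simp add: power_divide)
      have "s^4 = (s\<^sup>2)\<^sup>2" by simp
      then show ?thesis unfolding L_def by (rule g)
    qed
    then show "L x \<le> - ((x \<bullet> \<xi> 1) * gop s (\<lambda>_. 0) x)" using gop_zero_lower[OF S(1,2) x] by simp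
  qed
  also have "(\<integral>x. L x \<partial>area) = (s\<^sup>2/200) * (2 * pi * ell s) - 200000000 * s\<^sup>2 * (4 * pi) - (200000000 * s^4) * (4 * pi / s\<^sup>2)"
  proof -
    have i: "integrable area (\<lambda>x. (s\<^sup>2/200) * (1 / (aa s + x \<bullet> \<xi> 1)))"
      "integrable area (\<lambda>x. (200000000 * s^4) * (1 / (aa s + x \<bullet> \<xi> 1)\<^sup>2))"
      "integrable area (\<lambda>x. 200000000 * s\<^sup>2)"
      by (intro integrable_mult_right I area.integrable_const)+
    show ?thesis unfolding L_def Bochner_Integration.integral_diff[OF Bochner_Integration.integrable_diff[OF i(1,3)] i(2)]
        Bochner_Integration.integral_diff[OF i(1,3)] integral_mult_right_zero I(2,4) by (simp add: measure_area)
  qed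
  also have "(200000000 * s^4) * (4 * pi / s\<^sup>2) = 200000000 * s\<^sup>2 * (4 * pi)" using S(1) by (simp add: power2_eq_square power4_eq_xxxx)
  also have "(\<integral>x. - ((x \<bullet> \<xi> 1) * gop s (\<lambda>_. 0) x) \<partial>area) = - N0" unfolding N0_def by simp
  finally have N0: "N0 \<le> - (s\<^sup>2 * ((2 * pi / 200) * ell s - 200000000 * (8 * pi)))" by (simp add: algebra_simps)
  have hz: "hold s (\<lambda>_::real^3. 0)" using S(1) by (intro hold_zero) simp
  have "\<bar>N - N0\<bar> \<le> 32000000 * s * (2 * Bs s) * sing_const" unfolding N_def N0_def
    by (rule gop_diff_wbd(2)[OF s chiL_hold(2)[OF s] hz]) (use chiL_hold(1)[OF s] in simp)
  also have "\<dots> \<le> 32000000 * s * s * sing_const" using S(1,7) sing_const_nonneg by (intro mult_right_mono mult_left_mono) auto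
  finally have d: "\<bar>N - N0\<bar> \<le> 32000000 * s\<^sup>2 * sing_const" by (simp add: power2_eq_square mult.assoc)
  have sc: "0 \<le> sing_const" by (rule sing_const_nonneg)
  define z where "z = (2 * pi / 200) * ell s - 200000000 * (8 * pi) - 32000000 * sing_const"
  have z: "0 < z" unfolding z_def using S(8) sc by linarith
  have "N \<le> - (s\<^sup>2 * z)" using d N0 unfolding z_def by (simp add: algebra_simps abs_le_iff)
  moreover have "0 < s\<^sup>2 * z" using S(1) z by simp
  ultimately have "N < 0" by linarith
  then show "0 < mu s" unfolding mu_def mop_def N_def[symmetric]
    using qf_integrals(4)[OF S(1,3,5)] by (intro divide_neg_neg) auto
  have "\<bar>N\<bar> \<le> 1150000 * s\<^sup>2 * ell s + 32000000 * s\<^sup>2 * sing_const"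
    using d mop_zero(1)[OF S(1,3,5)] unfolding N0_def[symmetric] by linarith
  then show "\<bar>mu s\<bar> \<le> 2 * (1150000 * s\<^sup>2 * ell s + 32000000 * s\<^sup>2 * sing_const)"
    unfolding mu_def mop_def N_def by (rule mop_abs_le[OF S(1,3,5)])
qed

lemma mu_at_0: "(mu \<longlongrightarrow> 0) (at_right 0)"
proof (rule Lim_null_comparison)
  obtain s0 where s0: "0 < s0" "\<And>s. 0 < s \<Longrightarrow> s \<le> s0 \<Longrightarrow> small s" using ex_small by blast
  show "\<forall>\<^sub>F s in at_right 0. norm (mu s) \<le> 2 * (1150000 * (s\<^sup>2 * (ln 9 + 2 * ln (1/s))) + 32000000 * s\<^sup>2 * sing_const)"
    unfolding eventually_at_right_field
  proof (intro exI[of _ s0] conjI allI impI s0(1))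
    fix s assume "0 < s" "s < s0"
    then have s: "small s" using s0(2) by simp
    note S = smallD[OF s]
    have "s\<^sup>2 * ell s \<le> s\<^sup>2 * (ln 9 + 2 * ln (1/s))" using ell_bounds(2)[OF S(1,3)] by (intro mult_left_mono) auto
    then show "norm (mu s) \<le> 2 * (1150000 * (s\<^sup>2 * (ln 9 + 2 * ln (1/s))) + 32000000 * s\<^sup>2 * sing_const)"
      using mu_bounds(2)[OF s] by simp
  qed
  show "((\<lambda>s::real. 2 * (1150000 * (s\<^sup>2 * (ln 9 + 2 * ln (1/s))) + 32000000 * s\<^sup>2 * sing_const)) \<longlongrightarrow> 0) (at_right 0)"
  proof -
    have "((\<lambda>s::real. s\<^sup>2 * (ln 9 + 2 * ln (1/s))) \<longlongrightarrow> 0) (at_right 0)" "((\<lambda>s::real. s\<^sup>2) \<longlongrightarrow> 0) (at_right 0)" by real_asymp+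
    then have "((\<lambda>s::real. 2 * (1150000 * (s\<^sup>2 * (ln 9 + 2 * ln (1/s))) + 32000000 * s\<^sup>2 * sing_const)) \<longlongrightarrow> 2 * (1150000 * 0 + 32000000 * 0 * sing_const)) (at_right 0)"
      by (intro tendsto_intros)
    then show ?thesis by simp
  qed
qed

end

section \<open>Logarithmic potentials in the plane\<close>

lemma lborel_affine_integral:
  fixes f :: "real^2 \<Rightarrow> real"
  assumes c: "c \<noteq> 0" and f: "f \<in> borel_measurable borel"
  shows "(\<integral>x. f (t + c *\<^sub>R x) \<partial>lborel) = (\<integral>x. f x \<partial>lborel) / c\<^sup>2"
    "integrable lborel (\<lambda>x. f (t + c *\<^sub>R x)) \<longleftrightarrow> integrable lborel f"
proof -
  have e: "(lborel :: (real^2) measure) = density (distr lborel borel (\<lambda>x. t + c *\<^sub>R x)) (\<lambda>_. ennreal (c\<^sup>2))"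
    using lborel_affine[OF c, of t] by simp
  have "(\<integral>x. f x \<partial>lborel) = (\<integral>x. f x \<partial>density (distr lborel borel (\<lambda>x. t + c *\<^sub>R x)) (\<lambda>_. ennreal (c\<^sup>2)))"
    using e by simp
  also have "\<dots> = (\<integral>x. c\<^sup>2 * f (t + c *\<^sub>R x) \<partial>lborel)"
    using f by (subst integral_density) (simp_all add: integral_distr)
  finally show "(\<integral>x. f (t + c *\<^sub>R x) \<partial>lborel) = (\<integral>x. f x \<partial>lborel) / c\<^sup>2" using c by simp
  have "integrable lborel f \<longleftrightarrow> integrable (density (distr lborel borel (\<lambda>x. t + c *\<^sub>R x)) (\<lambda>_. ennreal (c\<^sup>2))) f"
    using e by simp
  also have "\<dots> \<longleftrightarrow> integrable lborel (\<lambda>x. c\<^sup>2 * f (t + c *\<^sub>R x))"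
    using f by (subst integrable_density) (simp_all add: integrable_distr_eq)
  also have "\<dots> \<longleftrightarrow> integrable lborel (\<lambda>x. f (t + c *\<^sub>R x))" using c by simp
  finally show "integrable lborel (\<lambda>x. f (t + c *\<^sub>R x)) \<longleftrightarrow> integrable lborel f" ..
qed

lemma lborel_reflect_integral:
  fixes f :: "real^2 \<Rightarrow> real"
  assumes f: "f \<in> borel_measurable borel"
  shows "(\<integral>x. f (t - x) \<partial>lborel) = (\<integral>x. f x \<partial>lborel)" "integrable lborel (\<lambda>x. f (t - x)) \<longleftrightarrow> integrable lborel f"
  using lborel_affine_integral[OF _ f, of "-1" t] by simp_all

lemma conf_cont: "continuous_on UNIV conf"
  unfolding conf_def by (intro continuous_intros) simp

lemma conf_le: "conf y \<le> 4"
  unfolding conf_def by (simp add: divide_le_eq)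

lemma conf_integrable: "integrable lborel conf" "(\<integral>y. conf y \<partial>lborel) = 4 * pi"
proof -
  have "has_bochner_integral lborel conf (4 * pi)"
    by (rule has_bochner_integral_nn_integral) (use conf_pos nn_integral_conf in \<open>auto intro: less_imp_le\<close>)
  then show "integrable lborel conf" "(\<integral>y. conf y \<partial>lborel) = 4 * pi"
    by (auto simp: has_bochner_integral_iff)
qed

text \<open>Peetre's inequality: 1 + norm z ^ 2 is at most 2 * (1 + norm y ^ 2) * (1 + norm (y - z)
  ^ 2). It provides a common integrable majorant for the translates with y in a bounded set.\<close>

lemma conf_shift: "conf (y - z) \<le> 4 * (1 + (norm y)\<^sup>2)\<^sup>2 * conf z"
proof -
  have "norm z \<le> norm y + norm (y - z)" using norm_triangle_ineq4[of y "y - z"] by simp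
  then have "(norm z)\<^sup>2 \<le> (norm y + norm (y - z))\<^sup>2" by (intro power_mono) auto
  also have "\<dots> \<le> 2 * (norm y)\<^sup>2 + 2 * (norm (y - z))\<^sup>2" using sum_squares_bound[of "norm y" "norm (y - z)"] by (simp add: power2_sum)
  finally have le: "(norm z)\<^sup>2 \<le> 2 * (norm y)\<^sup>2 + 2 * (norm (y - z))\<^sup>2" .
  have g: "1 + n \<le> 2 * (1 + a) * (1 + b)" if "n \<le> 2 * a + 2 * b" "0 \<le> a * b" for a b n :: real
    using that by (simp add: algebra_simps)
  have "1 + (norm z)\<^sup>2 \<le> 2 * (1 + (norm y)\<^sup>2) * (1 + (norm (y - z))\<^sup>2)" by (rule g[OF le]) simp
  then have "(1 + (norm z)\<^sup>2)\<^sup>2 \<le> (2 * (1 + (norm y)\<^sup>2) * (1 + (norm (y - z))\<^sup>2))\<^sup>2" by (intro power_mono) auto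
  also have "\<dots> = 4 * (1 + (norm y)\<^sup>2)\<^sup>2 * (1 + (norm (y - z))\<^sup>2)\<^sup>2" unfolding power_mult_distrib by simp
  finally have 1: "(1 + (norm z)\<^sup>2)\<^sup>2 \<le> 4 * (1 + (norm y)\<^sup>2)\<^sup>2 * (1 + (norm (y - z))\<^sup>2)\<^sup>2" .
  have "4 / B \<le> 4 * C * (4 / A)" if "0 < A" "0 < B" "A \<le> 4 * C * B" for A B C :: real
    using that by (simp add: field_simps)
  from this[OF _ _ 1] show ?thesis unfolding conf_def by (simp add: zero_less_power)
qed

text \<open>A majorant of 1 / norm z near the origin. The exponent -7/8 of the squared norm, rather
  than -1/2, makes its integral the one in \<open>singular_integral\<close>, and [0, 2] is the
  support of \<open>zonal_measure\<close>.\<close>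

definition nearw :: "real^2 \<Rightarrow> real" where
  "nearw z = 2 * ((norm z)\<^sup>2) powr (-7/8) * indicator {0..2} ((norm z)\<^sup>2)"

lemma nearw_nonneg: "0 \<le> nearw z" by (simp add: nearw_def)

lemma nearw_measurable [measurable]: "nearw \<in> borel_measurable borel"
  unfolding nearw_def by measurable

lemma nearw_integrable: "integrable lborel nearw"
proof (rule integrableI_bounded)
  show "nearw \<in> borel_measurable lborel" by simp
  have "(\<integral>\<^sup>+z. ennreal (norm (nearw z)) \<partial>lborel) = (\<integral>\<^sup>+z. (\<lambda>v. ennreal (2 * v powr (-7/8) * indicator {0..2} v)) ((norm (z::real^2))\<^sup>2) \<partial>lborel)"
    by (simp add: nearw_nonneg) (simp add: nearw_def)
  also have "\<dots> = (\<integral>\<^sup>+v. (ennreal pi * indicator {0..} v) * ennreal (2 * v powr (-7/8) * indicator {0..2} v) \<partial>lborel)"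
    by (rule nn_integral_radial_plane) measurable
  also have "\<dots> = (\<integral>\<^sup>+v. (ennreal (2 * pi) * indicator {0..2} v) * ennreal (v powr (-7/8)) \<partial>lborel)"
    by (intro nn_integral_cong) (auto simp: indicator_def ennreal_mult'' ennreal_mult' mult_ac simp flip: ennreal_mult' ennreal_mult'')
  also have "\<dots> = (\<integral>\<^sup>+v. ennreal (norm (v powr (-7/8) :: real)) \<partial>zonal_measure)"
    unfolding zonal_measure_def by (subst nn_integral_density) auto
  also have "\<dots> < \<infinity>" using singular_integral unfolding integrable_iff_bounded by blast
  finally show "(\<integral>\<^sup>+z. ennreal (norm (nearw z)) \<partial>lborel) < \<infinity>" .
qed

lemma inverse_norm_le: "1 / norm z \<le> 1 + nearw z" "norm z \<le> 1 \<Longrightarrow> 1 / norm z \<le> nearw z" for z :: "real^2"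
proof -
  have a: "1 / norm z \<le> nearw z" if "(norm z)\<^sup>2 \<le> 2"
  proof (cases "z = 0")
    case True then show ?thesis by (simp add: nearw_nonneg)
  next
    case False
    define v where "v = (norm z)\<^sup>2"
    have v: "0 < v" "v \<le> 2" using False that by (auto simp: v_def)
    have "v powr (3/8) \<le> 2 powr (3/8)" using v by (intro powr_mono2) auto
    also have "\<dots> \<le> 2 powr 1" by (intro powr_mono) auto
    finally have p: "v powr (3/8) \<le> 2" by simp
    have "1 / norm z = 1 / v powr (1/2)" unfolding v_def by (simp add: powr_half_sqrt)
    also have "\<dots> = v powr (-1/2)" using powr_minus_divide[of v "1/2"] by simp
    also have "\<dots> = v powr (3/8) * v powr (-7/8)" by (simp add: powr_add[symmetric])
    also have "\<dots> \<le> 2 * v powr (-7/8)" using p by (intro mult_right_mono) auto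
    finally show ?thesis using v by (simp add: nearw_def v_def)
  qed
  show "1 / norm z \<le> nearw z" if "norm z \<le> 1"
  proof (rule a)
    show "(norm z)\<^sup>2 \<le> 2" using power_mono[OF that, of 2] by simp
  qed
  show "1 / norm z \<le> 1 + nearw z"
  proof (cases "norm z \<le> 1")
    case True
    have "(norm z)\<^sup>2 \<le> 2" using power_mono[OF True, of 2] by simp
    from a[OF this] show ?thesis by simp
  next
    case False
    then have "1 / norm z \<le> 1" by (subst divide_le_eq_1_pos) auto
    then show ?thesis using nearw_nonneg[of z] by linarith
  qed
qed

lemma dominated_integrable:
  assumes "f \<in> borel_measurable borel" "\<And>z. \<bar>f z\<bar> \<le> C * (conf z + nearw z)"
  shows "integrable lborel f"
proof (rule Bochner_Integration.integrable_bound)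
  show "integrable lborel (\<lambda>z. C * (conf z + nearw z))" using conf_integrable nearw_integrable by simp
  show "AE z in lborel. norm (f z) \<le> norm (C * (conf z + nearw z))"
    using assms(2) by (intro AE_I2) (simp add: order_trans[OF _ abs_ge_self])
qed (use assms in simp)

section \<open>Convolution with kernels of order 1 / norm z\<close>

definition decays :: "real \<Rightarrow> (real^2 \<Rightarrow> real) \<Rightarrow> bool" where
  "decays M F \<longleftrightarrow> continuous_on UNIV F \<and> (\<forall>y. \<bar>F y\<bar> \<le> M * conf y)"

definition conv :: "(real^2 \<Rightarrow> real) \<Rightarrow> (real^2 \<Rightarrow> real) \<Rightarrow> real^2 \<Rightarrow> real" where
  "conv k F y = (\<integral>z. k z * F (y - z) \<partial>lborel)"

lemma decaysD:
  assumes "decays M F"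
  shows "continuous_on UNIV F" "\<And>y. \<bar>F y\<bar> \<le> M * conf y" "F \<in> borel_measurable borel" "0 \<le> M"
proof -
  show c: "continuous_on UNIV F" and b: "\<And>y. \<bar>F y\<bar> \<le> M * conf y" using assms by (auto simp: decays_def)
  show "F \<in> borel_measurable borel" by (rule borel_measurable_continuous_onI[OF c])
  have "0 \<le> M * conf 0" by (rule order_trans[OF abs_ge_zero b])
  then show "0 \<le> M" using conf_pos[of 0] by (simp add: zero_le_mult_iff)
qed

context
  fixes k :: "real^2 \<Rightarrow> real" and c :: real
  assumes km [measurable]: "k \<in> borel_measurable borel" and kb: "\<And>z. \<bar>k z\<bar> \<le> c / norm z" and c0: "0 \<le> c"
begin

lemma conv_pointwise:
  assumes F: "decays M F"
  shows "\<bar>k z * F (y - z)\<bar> \<le> c * M * (conf (y - z) + 4 * nearw z)"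
proof -
  note D = decaysD[OF F]
  have "\<bar>k z\<bar> \<le> c * (1 + nearw z)" using kb[of z] mult_left_mono[OF inverse_norm_le(1)[of z] c0] by simp
  from abs_mult_le[OF this D(2)[of "y - z"]] have "\<bar>k z * F (y - z)\<bar> \<le> c * M * ((1 + nearw z) * conf (y - z))" by (simp add: mult_ac)
  also have "\<dots> \<le> c * M * (conf (y - z) + 4 * nearw z)"
    using mult_left_mono[OF conf_le[of "y - z"] nearw_nonneg[of z]] c0 D(4) by (intro mult_left_mono) (simp_all add: algebra_simps)
  finally show ?thesis .
qed

lemma conv_int:
  assumes F: "decays M F"
  shows "integrable lborel (\<lambda>z. k z * F (y - z))"
    "(\<integral>z. \<bar>k z * F (y - z)\<bar> \<partial>lborel) \<le> c * M * (4 * pi + 4 * (\<integral>z. nearw z \<partial>lborel))"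
    "\<bar>conv k F y\<bar> \<le> c * M * (4 * pi + 4 * (\<integral>z. nearw z \<partial>lborel))"
proof -
  note D = decaysD[OF F]
  have ci: "integrable lborel (\<lambda>z. conf (y - z))" "(\<integral>z. conf (y - z) \<partial>lborel) = 4 * pi"
    using lborel_reflect_integral[OF conf_measurable, of y] conf_integrable by simp_all
  have di: "integrable lborel (\<lambda>z. c * M * (conf (y - z) + 4 * nearw z))" using ci nearw_integrable by simp
  have m: "(\<lambda>z. k z * F (y - z)) \<in> borel_measurable lborel" using D(3) by measurable
  show i: "integrable lborel (\<lambda>z. k z * F (y - z))"
    by (rule Bochner_Integration.integrable_bound[OF di m])
       (use conv_pointwise[OF F, of _ y] in \<open>auto intro!: AE_I2 simp: order_trans[OF _ abs_ge_self]\<close>)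
  have "(\<integral>z. \<bar>k z * F (y - z)\<bar> \<partial>lborel) \<le> (\<integral>z. c * M * (conf (y - z) + 4 * nearw z) \<partial>lborel)"
    by (rule integral_mono[OF integrable_abs[OF i] di]) (rule conv_pointwise[OF F])
  also have "\<dots> = c * M * (4 * pi + 4 * (\<integral>z. nearw z \<partial>lborel))" using ci nearw_integrable by simp
  finally show b: "(\<integral>z. \<bar>k z * F (y - z)\<bar> \<partial>lborel) \<le> c * M * (4 * pi + 4 * (\<integral>z. nearw z \<partial>lborel))" .
  show "\<bar>conv k F y\<bar> \<le> c * M * (4 * pi + 4 * (\<integral>z. nearw z \<partial>lborel))"
    unfolding conv_def by (rule order_trans[OF integral_abs_bound b])
qed

lemma conv_cont:
  assumes F: "decays M F"
  shows "continuous_on UNIV (conv k F)"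
  unfolding continuous_on_sequentially comp_def
proof (intro allI ballI impI)
  note D = decaysD[OF F]
  fix x and y :: "real^2" assume "(\<forall>n. x n \<in> UNIV) \<and> x \<longlonglongrightarrow> y"
  then have l: "x \<longlonglongrightarrow> y" by simp
  then obtain R where R: "\<And>n. norm (x n) \<le> R" using convergent_imp_Bseq[OF convergentI[OF l]] by (auto simp: Bseq_def)
  show "(\<lambda>n. conv k F (x n)) \<longlonglongrightarrow> conv k F y" unfolding conv_def
  proof (rule integral_dominated_convergence[where w="\<lambda>z. c * M * (4 * (1 + R\<^sup>2)\<^sup>2 * conf z + 4 * nearw z)"])
    show "(\<lambda>z. k z * F (y - z)) \<in> borel_measurable lborel" "\<And>n. (\<lambda>z. k z * F (x n - z)) \<in> borel_measurable lborel"
      using D(3) by measurable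
    show "integrable lborel (\<lambda>z. c * M * (4 * (1 + R\<^sup>2)\<^sup>2 * conf z + 4 * nearw z))" using conf_integrable nearw_integrable by simp
    show "AE z in lborel. (\<lambda>n. k z * F (x n - z)) \<longlonglongrightarrow> k z * F (y - z)"
    proof (rule AE_I2)
      fix z
      have "isCont F (y - z)" using D(1) by (simp add: continuous_on_eq_continuous_at)
      then have "(\<lambda>n. F (x n - z)) \<longlonglongrightarrow> F (y - z)" by (rule isCont_tendsto_compose) (intro tendsto_intros l)
      then show "(\<lambda>n. k z * F (x n - z)) \<longlonglongrightarrow> k z * F (y - z)" by (intro tendsto_intros)
    qed
    show "AE z in lborel. norm (k z * F (x n - z)) \<le> c * M * (4 * (1 + R\<^sup>2)\<^sup>2 * conf z + 4 * nearw z)" for n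
    proof (rule AE_I2)
      fix z
      have "(1 + (norm (x n))\<^sup>2)\<^sup>2 \<le> (1 + R\<^sup>2)\<^sup>2" using R[of n] by (intro power_mono add_left_mono) auto
      then have "4 * (1 + (norm (x n))\<^sup>2)\<^sup>2 * conf z \<le> 4 * (1 + R\<^sup>2)\<^sup>2 * conf z"
        using conf_pos[of z] by (intro mult_right_mono mult_left_mono) auto
      then have "conf (x n - z) + 4 * nearw z \<le> 4 * (1 + R\<^sup>2)\<^sup>2 * conf z + 4 * nearw z" using conf_shift[of "x n" z] by linarith
      from mult_left_mono[OF this, of "c * M"] c0 D(4) conv_pointwise[OF F, of z "x n"]
      show "norm (k z * F (x n - z)) \<le> c * M * (4 * (1 + R\<^sup>2)\<^sup>2 * conf z + 4 * nearw z)" by simp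
    qed
  qed
qed

end

text \<open>This avoids differentiation under a singular integral: if the increments of
  \<open>A\<close> are line integrals of a continuous field, that field is its gradient. It serves
  both for potentials and for convolutions.\<close>

lemma has_derivative_of_line_integral:
  fixes A :: "real^'n \<Rightarrow> real" and B :: "real^'n \<Rightarrow> real^'n"
  assumes e: "\<And>h. A (y + h) - A y = (\<integral>t. indicator {0..1} t *\<^sub>R (h \<bullet> B (y + t *\<^sub>R h)) \<partial>lborel)"
    and B: "continuous_on UNIV B"
  shows "(A has_derivative (\<lambda>h. h \<bullet> B y)) (at y)"
  unfolding has_derivative_within_alt
proof (intro conjI allI impI)
  show "bounded_linear (\<lambda>h. h \<bullet> B y)" by (rule bounded_linear_inner_left)
  fix e' :: real assume e0: "0 < e'"
  have "isCont B y" using B by (simp add: continuous_on_eq_continuous_at)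
  then obtain d where d: "d > 0" "\<And>z. norm (z - y) < d \<Longrightarrow> norm (B z - B y) < e'"
    using e0 unfolding continuous_at_eps_delta dist_norm by blast
  show "\<exists>d>0. \<forall>x\<in>UNIV. norm (x - y) < d \<longrightarrow> norm (A x - A y - (x - y) \<bullet> B y) \<le> e' * norm (x - y)"
  proof (intro exI[of _ d] conjI ballI impI d(1))
    fix x assume x: "norm (x - y) < d"
    define h where "h = x - y"
    have ci: "integrable lborel (\<lambda>t. indicator {0..1} t *\<^sub>R g t)" if "continuous_on {0..1::real} g" for g :: "real \<Rightarrow> real"
      using borel_integrable_atLeastAtMost'[OF that] by (simp add: set_integrable_def)
    have Bl: "continuous_on {0..1} (\<lambda>t. B (y + t *\<^sub>R h))" by (rule continuous_on_compose2[OF B]) (auto intro!: continuous_intros)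
    have i1: "integrable lborel (\<lambda>t. indicator {0..1::real} t *\<^sub>R (h \<bullet> B (y + t *\<^sub>R h)))" by (intro ci continuous_intros Bl)
    have i2: "integrable lborel (\<lambda>t. indicator {0..1::real} t *\<^sub>R (h \<bullet> B y))" by (intro ci continuous_intros)
    have i3: "integrable lborel (\<lambda>t. indicator {0..1::real} t *\<^sub>R (e' * norm h))" by (intro ci continuous_intros)
    have u: "(\<integral>t. indicator {0..1::real} t *\<^sub>R v \<partial>lborel) = v" for v :: real by simp
    have "A x - A y - h \<bullet> B y = (\<integral>t. indicator {0..1} t *\<^sub>R (h \<bullet> B (y + t *\<^sub>R h)) \<partial>lborel) - (\<integral>t. indicator {0..1::real} t *\<^sub>R (h \<bullet> B y) \<partial>lborel)"
      using e[of h] u[of "h \<bullet> B y"] by (simp add: h_def)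
    also have "\<dots> = (\<integral>t. indicator {0..1} t *\<^sub>R (h \<bullet> B (y + t *\<^sub>R h)) - indicator {0..1::real} t *\<^sub>R (h \<bullet> B y) \<partial>lborel)"
      by (rule Bochner_Integration.integral_diff[OF i1 i2, symmetric])
    finally have eq: "A x - A y - h \<bullet> B y = (\<integral>t. indicator {0..1} t *\<^sub>R (h \<bullet> B (y + t *\<^sub>R h)) - indicator {0..1::real} t *\<^sub>R (h \<bullet> B y) \<partial>lborel)" .
    have "\<bar>A x - A y - h \<bullet> B y\<bar> \<le> (\<integral>t. \<bar>indicator {0..1} t *\<^sub>R (h \<bullet> B (y + t *\<^sub>R h)) - indicator {0..1::real} t *\<^sub>R (h \<bullet> B y)\<bar> \<partial>lborel)"
      unfolding eq by (rule integral_abs_bound)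
    also have "\<dots> \<le> (\<integral>t. indicator {0..1::real} t *\<^sub>R (e' * norm h) \<partial>lborel)"
    proof (rule integral_mono[OF integrable_abs[OF Bochner_Integration.integrable_diff[OF i1 i2]] i3])
      fix t :: real
      show "\<bar>indicator {0..1} t *\<^sub>R (h \<bullet> B (y + t *\<^sub>R h)) - indicator {0..1::real} t *\<^sub>R (h \<bullet> B y)\<bar> \<le> indicator {0..1::real} t *\<^sub>R (e' * norm h)"
      proof (cases "t \<in> {0..1}")
        case True
        have "norm (t *\<^sub>R h) \<le> 1 * norm h" unfolding norm_scaleR using True by (intro mult_right_mono) auto
        then have "norm (y + t *\<^sub>R h - y) < d" using x by (simp add: h_def)
        from d(2)[OF this] have "norm (B (y + t *\<^sub>R h) - B y) \<le> e'" by simp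
        then have "norm h * norm (B (y + t *\<^sub>R h) - B y) \<le> norm h * e'" by (intro mult_left_mono) auto
        then have "\<bar>h \<bullet> (B (y + t *\<^sub>R h) - B y)\<bar> \<le> e' * norm h"
          using Cauchy_Schwarz_ineq2[of h "B (y + t *\<^sub>R h) - B y"] by (simp add: mult.commute)
        then show ?thesis using True by (simp add: inner_diff_right)
      qed simp
    qed
    also have "\<dots> = e' * norm h" by (rule u)
    finally show "norm (A x - A y - (x - y) \<bullet> B y) \<le> e' * norm (x - y)" by (simp add: h_def)
  qed
qed

lemma unit_interval_swap:
  fixes f :: "real \<Rightarrow> real^2 \<Rightarrow> real"
  assumes m: "(\<lambda>(t, z). f t z) \<in> borel_measurable (lborel \<Otimes>\<^sub>M lborel)"
    and i: "\<And>t. 0 \<le> t \<Longrightarrow> t \<le> 1 \<Longrightarrow> integrable lborel (f t)"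
    and b: "\<And>t. 0 \<le> t \<Longrightarrow> t \<le> 1 \<Longrightarrow> (\<integral>z. \<bar>f t z\<bar> \<partial>lborel) \<le> C"
  shows "(\<integral>z. (\<integral>t. indicator {0..1} t *\<^sub>R f t z \<partial>lborel) \<partial>lborel) = (\<integral>t. indicator {0..1} t *\<^sub>R (\<integral>z. f t z \<partial>lborel) \<partial>lborel)"
proof -
  let ?g = "\<lambda>(t, z). indicator {0..1::real} t *\<^sub>R f t z"
  have gm: "?g \<in> borel_measurable (lborel \<Otimes>\<^sub>M lborel)" using m by (simp add: split_beta')
  have gm2: "(\<lambda>(t, z). \<bar>indicator {0..1::real} t *\<^sub>R f t z\<bar>) \<in> borel_measurable (lborel \<Otimes>\<^sub>M lborel)" using gm by (simp add: split_beta')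
  have C0: "0 \<le> C" using order_trans[OF integral_nonneg_AE b[of 0]] by simp
  have "integrable (lborel \<Otimes>\<^sub>M lborel) ?g"
  proof (rule lborel_pair.Fubini_integrable[OF gm])
    show "AE t in lborel. integrable lborel (\<lambda>z. ?g (t, z))"
    proof (rule AE_I2)
      fix t :: real
      show "integrable lborel (\<lambda>z. ?g (t, z))" by (cases "t \<in> {0..1}") (use i[of t] in simp_all)
    qed
    have "integrable lborel (\<lambda>t. \<integral>z. \<bar>indicator {0..1::real} t *\<^sub>R f t z\<bar> \<partial>lborel)"
    proof (rule Bochner_Integration.integrable_bound)
      show "integrable lborel (\<lambda>t. indicator {0..1::real} t * C)" by simp
      show "(\<lambda>t. \<integral>z. \<bar>indicator {0..1::real} t *\<^sub>R f t z\<bar> \<partial>lborel) \<in> borel_measurable lborel"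
        using gm2 by (intro lborel.borel_measurable_lebesgue_integral) (simp add: split_beta')
      show "AE t in lborel. norm (\<integral>z. \<bar>indicator {0..1::real} t *\<^sub>R f t z\<bar> \<partial>lborel) \<le> norm (indicator {0..1::real} t * C)"
      proof (rule AE_I2)
        fix t :: real
        show "norm (\<integral>z. \<bar>indicator {0..1::real} t *\<^sub>R f t z\<bar> \<partial>lborel) \<le> norm (indicator {0..1::real} t * C)"
          by (cases "t \<in> {0..1}") (use b[of t] C0 in simp_all)
      qed
    qed
    then show "integrable lborel (\<lambda>t. \<integral>z. norm (?g (t, z)) \<partial>lborel)" by simp
  qed
  from lborel_pair.Fubini_integral[OF this] show ?thesis by simp
qed

text \<open>The line through \<open>y\<close> in direction \<open>h\<close> is a hyperplane of the
  plane, hence null. For z off this line, the logarithm of the distance to z is smooth along the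
  whole segment.\<close>

lemma AE_off_line:
  fixes y h :: "real^2"
  assumes h: "h \<noteq> 0"
  shows "AE z in lborel. \<forall>t. y + t *\<^sub>R h - z \<noteq> 0"
proof -
  define a :: "real^2" where "a = vector [- (h$2), h$1]"
  have a0: "a \<noteq> 0" using h by (auto simp: a_def vec_eq_iff forall_2)
  have ah: "a \<bullet> h = 0" by (simp add: a_def inner_vec_def sum_2)
  have n: "negligible {x. a \<bullet> x = a \<bullet> y}" by (rule negligible_hyperplane) (use a0 in simp)
  have "closed {x. a \<bullet> x = a \<bullet> y}" by (rule closed_hyperplane)
  then have "{x. a \<bullet> x = a \<bullet> y} \<in> null_sets lborel"
    using n by (simp add: negligible_iff_null_sets null_sets_completion_iff)
  from AE_not_in[OF this] show ?thesis
  proof eventually_elim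
    case (elim z)
    show ?case
    proof (intro allI notI)
      fix t assume "y + t *\<^sub>R h - z = 0"
      then have "z = y + t *\<^sub>R h" by simp
      then show False using elim ah by (simp add: inner_add_right)
    qed
  qed
qed

section \<open>The gradient of the logarithmic potential\<close>

definition kern :: "2 \<Rightarrow> real^2 \<Rightarrow> real" where "kern i z = z $ i / (norm z)\<^sup>2"

definition gradp :: "(real^2 \<Rightarrow> real) \<Rightarrow> real^2 \<Rightarrow> real^2" where "gradp F y = (\<chi> i. conv (kern i) F y)"

lemma kern_facts: "kern i \<in> borel_measurable borel" "\<bar>kern i z\<bar> \<le> 1 / norm z" "0 \<le> (1::real)"
proof -
  show "kern i \<in> borel_measurable borel" unfolding kern_def by measurable
  have "\<bar>z $ i\<bar> / (norm z)\<^sup>2 \<le> norm z / (norm z)\<^sup>2" by (intro divide_right_mono component_le_norm_cart) auto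
  then show "\<bar>kern i z\<bar> \<le> 1 / norm z" unfolding kern_def by (cases "z = 0") (simp_all add: abs_divide power2_eq_square)
qed simp

lemma gradp_cont: "decays M F \<Longrightarrow> continuous_on UNIV (gradp F)"
  unfolding gradp_def by (intro continuous_on_vec_lambda conv_cont[OF kern_facts])

text \<open>For almost every z the segment from y to y + h avoids z, and the fundamental theorem of
  calculus applies to the logarithm of the squared distance; its derivative involves
  \<open>kern\<close>, the gradient of ln (norm z). Then the two integrations are exchanged.\<close>

lemma log_potential_line:
  assumes F: "decays M F"
  shows "(\<integral>z. F z * (ln ((norm (y + h - z))\<^sup>2) - ln ((norm (y - z))\<^sup>2)) \<partial>lborel)
    = 2 * (\<integral>t. indicator {0..1} t *\<^sub>R (h \<bullet> gradp F (y + t *\<^sub>R h)) \<partial>lborel)"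
proof (cases "h = 0")
  case True then show ?thesis by simp
next
  case h: False
  note D = decaysD[OF F]
  have [measurable]: "F \<in> borel_measurable borel" by (rule D(3))
  define K where "K z = (h \<bullet> z) / (norm z)\<^sup>2" for z :: "real^2"
  have Km [measurable]: "K \<in> borel_measurable borel" unfolding K_def by measurable
  have Kb: "\<bar>K z\<bar> \<le> norm h / norm z" for z
  proof -
    have "\<bar>h \<bullet> z\<bar> / (norm z)\<^sup>2 \<le> (norm h * norm z) / (norm z)\<^sup>2" by (intro divide_right_mono Cauchy_Schwarz_ineq2) auto
    then show ?thesis unfolding K_def by (cases "z = 0") (simp_all add: abs_divide power2_eq_square)
  qed
  note KC = conv_int[OF Km Kb norm_ge_zero F]
  have hV: "h \<bullet> gradp F w = conv K F w" for w
  proof -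
    have "h \<bullet> gradp F w = (\<Sum>i\<in>UNIV. (\<integral>z. h $ i * (kern i z * F (w - z)) \<partial>lborel))"
      by (simp add: inner_vec_def gradp_def conv_def)
    also have "\<dots> = (\<integral>z. (\<Sum>i\<in>UNIV. h $ i * (kern i z * F (w - z))) \<partial>lborel)"
      by (rule Bochner_Integration.integral_sum[symmetric]) (intro integrable_mult_right conv_int[OF kern_facts F])
    also have "(\<lambda>z. \<Sum>i\<in>UNIV. h $ i * (kern i z * F (w - z))) = (\<lambda>z. K z * F (w - z))"
      by (rule ext) (simp add: K_def kern_def inner_vec_def sum_divide_distrib sum_distrib_right mult.assoc)
    finally show ?thesis by (simp add: conv_def)
  qed
  have sub: "(\<integral>z. K (w - z) * F z \<partial>lborel) = conv K F w" "integrable lborel (\<lambda>z. K (w - z) * F z)"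
      "(\<integral>z. \<bar>K (w - z) * F z\<bar> \<partial>lborel) \<le> norm h * M * (4 * pi + 4 * (\<integral>z. nearw z \<partial>lborel))" for w
  proof -
    have m: "(\<lambda>z. K (w - z) * F z) \<in> borel_measurable borel" by measurable
    show "(\<integral>z. K (w - z) * F z \<partial>lborel) = conv K F w" "integrable lborel (\<lambda>z. K (w - z) * F z)"
      using lborel_reflect_integral[OF m, of w] KC(1)[of w] by (simp_all add: conv_def)
    have m': "(\<lambda>z. \<bar>K (w - z) * F z\<bar>) \<in> borel_measurable borel" by measurable
    show "(\<integral>z. \<bar>K (w - z) * F z\<bar> \<partial>lborel) \<le> norm h * M * (4 * pi + 4 * (\<integral>z. nearw z \<partial>lborel))"
      using lborel_reflect_integral(1)[OF m', of w] KC(2)[of w] by simp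
  qed
  define f where "f t z = K (y + t *\<^sub>R h - z) * F z" for t z
  have fm: "(\<lambda>(t, z). f t z) \<in> borel_measurable (lborel \<Otimes>\<^sub>M lborel)"
    unfolding f_def split_beta' by measurable
  have "(\<integral>z. F z * (ln ((norm (y + h - z))\<^sup>2) - ln ((norm (y - z))\<^sup>2)) \<partial>lborel) = (\<integral>z. 2 * (\<integral>t. indicator {0..1} t *\<^sub>R f t z \<partial>lborel) \<partial>lborel)"
  proof (rule integral_cong_AE)
    show "(\<lambda>z. F z * (ln ((norm (y + h - z))\<^sup>2) - ln ((norm (y - z))\<^sup>2))) \<in> borel_measurable lborel" by measurable
    have "(\<lambda>(z, t). indicator {0..1} t *\<^sub>R f t z) \<in> borel_measurable (lborel \<Otimes>\<^sub>M lborel)"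
      unfolding f_def split_beta' by measurable
    then show "(\<lambda>z. 2 * (\<integral>t. indicator {0..1} t *\<^sub>R f t z \<partial>lborel)) \<in> borel_measurable lborel"
      by (intro borel_measurable_times lborel.borel_measurable_lebesgue_integral) auto
    show "AE z in lborel. F z * (ln ((norm (y + h - z))\<^sup>2) - ln ((norm (y - z))\<^sup>2)) = 2 * (\<integral>t. indicator {0..1} t *\<^sub>R f t z \<partial>lborel)"
      using AE_off_line[OF h, of y]
    proof eventually_elim
      case (elim z)
      define \<gamma> where "\<gamma> t = y + t *\<^sub>R h - z" for t
      have n0: "\<gamma> t \<noteq> 0" for t using elim by (simp add: \<gamma>_def)
      have "(\<integral>t. indicator {0..1} t *\<^sub>R f t z \<partial>lborel) = F z * (1/2) * ln (\<gamma> 1 \<bullet> \<gamma> 1) - F z * (1/2) * ln (\<gamma> 0 \<bullet> \<gamma> 0)"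
      proof (rule integral_FTC_atLeastAtMost)
        show "continuous_on {0..1} (\<lambda>t. f t z)" unfolding f_def K_def
          using n0 unfolding \<gamma>_def by (intro continuous_intros) auto
        fix t :: real
        have g': "(\<gamma> has_derivative (\<lambda>x. x *\<^sub>R h)) (at t within {0..1})" unfolding \<gamma>_def
          by (auto intro!: derivative_eq_intros)
        have "((\<lambda>t. \<gamma> t \<bullet> \<gamma> t) has_derivative (\<lambda>x. \<gamma> t \<bullet> (x *\<^sub>R h) + (x *\<^sub>R h) \<bullet> \<gamma> t)) (at t within {0..1})"
          by (rule has_derivative_inner[OF g' g'])
        then have "((\<lambda>t. \<gamma> t \<bullet> \<gamma> t) has_real_derivative 2 * (h \<bullet> \<gamma> t)) (at t within {0..1})"
          unfolding has_field_derivative_def by (rule has_derivative_eq_rhs) (auto simp: inner_commute)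
        then have "((\<lambda>t. F z * (1/2) * ln (\<gamma> t \<bullet> \<gamma> t)) has_real_derivative F z * (1/2) * (1 / (\<gamma> t \<bullet> \<gamma> t) * (2 * (h \<bullet> \<gamma> t)))) (at t within {0..1})"
          using n0[of t] by (auto intro!: derivative_eq_intros simp: field_simps)
        moreover have "F z * (1/2) * (1 / (\<gamma> t \<bullet> \<gamma> t) * (2 * (h \<bullet> \<gamma> t))) = f t z"
          unfolding f_def K_def \<gamma>_def[symmetric] by (simp add: power2_norm_eq_inner)
        ultimately show "((\<lambda>t. F z * (1/2) * ln (\<gamma> t \<bullet> \<gamma> t)) has_vector_derivative f t z) (at t within {0..1})"
          by (simp add: has_real_derivative_iff_has_vector_derivative)
      qed simp
      then show ?case by (simp add: \<gamma>_def power2_norm_eq_inner algebra_simps)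
    qed
  qed
  also have "\<dots> = 2 * (\<integral>z. (\<integral>t. indicator {0..1} t *\<^sub>R f t z \<partial>lborel) \<partial>lborel)" by simp
  also have "(\<integral>z. (\<integral>t. indicator {0..1} t *\<^sub>R f t z \<partial>lborel) \<partial>lborel) = (\<integral>t. indicator {0..1} t *\<^sub>R (\<integral>z. f t z \<partial>lborel) \<partial>lborel)"
    by (rule unit_interval_swap[OF fm]) (unfold f_def, rule sub(2), rule sub(3))
  finally show ?thesis unfolding f_def sub(1) hV .
qed

text \<open>The derivative is moved to the differentiable factor \<open>F\<close>, so the kernel
  keeps its integrable singularity of order 1 / norm z.\<close>

lemma conv_has_derivative:
  assumes km: "k \<in> borel_measurable borel" and kb: "\<And>z. \<bar>k z\<bar> \<le> 1 / norm z"
    and F: "decays M F" and d: "\<And>y. (F has_derivative (\<lambda>h. h \<bullet> G y)) (at y)"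
    and G: "\<And>i. decays M' (\<lambda>y. G y $ i)"
  shows "(conv k F has_derivative (\<lambda>h. h \<bullet> (\<chi> i. conv k (\<lambda>w. G w $ i) y))) (at y)"
proof (rule has_derivative_of_line_integral)
  note [measurable] = km
  have kb1: "\<bar>k z\<bar> \<le> 1 / norm z" for z by (rule kb)
  have one: "0 \<le> (1::real)" by simp
  note CG = conv_int[OF km kb1 one G] note CF = conv_int[OF km kb1 one F]
  have Gc: "continuous_on UNIV (\<lambda>y. G y $ i)" for i by (rule decaysD(1)[OF G])
  have "continuous_on UNIV (\<lambda>y. \<chi> i. G y $ i)" by (intro continuous_on_vec_lambda Gc)
  then have Gc': "continuous_on UNIV G" by simp
  have Gm [measurable]: "G \<in> borel_measurable borel" by (rule borel_measurable_continuous_onI[OF Gc'])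
  show "continuous_on UNIV (\<lambda>y. \<chi> i. conv k (\<lambda>w. G w $ i) y)"
    by (intro continuous_on_vec_lambda conv_cont[OF km kb1 one G])
  fix h
  define f where "f t z = k z * (h \<bullet> G (y + t *\<^sub>R h - z))" for t z
  have fs: "f t z = (\<Sum>i\<in>UNIV. h $ i * (k z * G (y + t *\<^sub>R h - z) $ i))" for t z
    unfolding f_def by (simp add: inner_vec_def sum_distrib_left mult.left_commute)
  have fm: "(\<lambda>(t, z). f t z) \<in> borel_measurable (lborel \<Otimes>\<^sub>M lborel)" unfolding f_def split_beta' by measurable
  define CC where "CC = 1 * M' * (4 * pi + 4 * (\<integral>z. nearw z \<partial>lborel))"
  have fi: "integrable lborel (f t)" for t unfolding fs by (intro Bochner_Integration.integrable_sum integrable_mult_right CG(1))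
  have fint: "(\<integral>z. f t z \<partial>lborel) = h \<bullet> (\<chi> i. conv k (\<lambda>w. G w $ i) (y + t *\<^sub>R h))" for t
  proof -
    have "(\<integral>z. f t z \<partial>lborel) = (\<Sum>i\<in>UNIV. (\<integral>z. h $ i * (k z * G (y + t *\<^sub>R h - z) $ i) \<partial>lborel))"
      unfolding fs by (rule Bochner_Integration.integral_sum) (intro integrable_mult_right CG(1))
    then show ?thesis by (simp add: inner_vec_def conv_def)
  qed
  have fb: "(\<integral>z. \<bar>f t z\<bar> \<partial>lborel) \<le> (\<Sum>i\<in>UNIV. \<bar>h $ i\<bar> * CC)" for t
  proof -
    have "(\<integral>z. \<bar>f t z\<bar> \<partial>lborel) \<le> (\<integral>z. (\<Sum>i\<in>UNIV. \<bar>h $ i\<bar> * \<bar>k z * G (y + t *\<^sub>R h - z) $ i\<bar>) \<partial>lborel)"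
    proof (rule integral_mono[OF integrable_abs[OF fi]])
      show "integrable lborel (\<lambda>z. (\<Sum>i\<in>UNIV. \<bar>h $ i\<bar> * \<bar>k z * G (y + t *\<^sub>R h - z) $ i\<bar>))"
        by (intro Bochner_Integration.integrable_sum integrable_mult_right integrable_abs CG(1))
      fix z show "\<bar>f t z\<bar> \<le> (\<Sum>i\<in>UNIV. \<bar>h $ i\<bar> * \<bar>k z * G (y + t *\<^sub>R h - z) $ i\<bar>)"
        unfolding fs by (rule order_trans[OF sum_abs]) (simp add: abs_mult)
    qed
    also have "\<dots> = (\<Sum>i\<in>UNIV. (\<integral>z. \<bar>h $ i\<bar> * \<bar>k z * G (y + t *\<^sub>R h - z) $ i\<bar> \<partial>lborel))"
      by (rule Bochner_Integration.integral_sum) (intro integrable_mult_right integrable_abs CG(1))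
    also have "\<dots> \<le> (\<Sum>i\<in>UNIV. \<bar>h $ i\<bar> * CC)"
      unfolding integral_mult_right_zero CC_def by (intro sum_mono mult_left_mono CG(2)) auto
    finally show ?thesis .
  qed
  have "conv k F (y + h) - conv k F y = (\<integral>z. k z * F (y + h - z) - k z * F (y - z) \<partial>lborel)"
    unfolding conv_def by (rule Bochner_Integration.integral_diff[symmetric]) (rule CF(1))+
  also have "\<dots> = (\<integral>z. (\<integral>t. indicator {0..1} t *\<^sub>R f t z \<partial>lborel) \<partial>lborel)"
  proof (rule Bochner_Integration.integral_cong[OF refl])
    fix z
    have "(\<integral>t. indicator {0..1} t *\<^sub>R f t z \<partial>lborel) = k z * F (y + 1 *\<^sub>R h - z) - k z * F (y + 0 *\<^sub>R h - z)"
    proof (rule integral_FTC_atLeastAtMost)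
      show "continuous_on {0..1} (\<lambda>t. f t z)" unfolding f_def
        by (intro continuous_intros continuous_on_compose2[OF Gc']) auto
      fix t :: real
      have g': "((\<lambda>t. y + t *\<^sub>R h - z) has_derivative (\<lambda>x. x *\<^sub>R h)) (at t within {0..1})"
        by (auto intro!: derivative_eq_intros)
      have "((\<lambda>t. F (y + t *\<^sub>R h - z)) has_derivative (\<lambda>x. (x *\<^sub>R h) \<bullet> G (y + t *\<^sub>R h - z))) (at t within {0..1})"
        by (rule has_derivative_compose[OF g' d])
      then have "((\<lambda>t. F (y + t *\<^sub>R h - z)) has_real_derivative (h \<bullet> G (y + t *\<^sub>R h - z))) (at t within {0..1})"
        unfolding has_field_derivative_def by (rule has_derivative_eq_rhs) auto
      then have "((\<lambda>t. k z * F (y + t *\<^sub>R h - z)) has_real_derivative f t z) (at t within {0..1})"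
        unfolding f_def by (rule DERIV_cmult)
      then show "((\<lambda>t. k z * F (y + t *\<^sub>R h - z)) has_vector_derivative f t z) (at t within {0..1})"
        by (simp add: has_real_derivative_iff_has_vector_derivative)
    qed simp
    then show "k z * F (y + h - z) - k z * F (y - z) = (\<integral>t. indicator {0..1} t *\<^sub>R f t z \<partial>lborel)" by simp
  qed
  also have "\<dots> = (\<integral>t. indicator {0..1} t *\<^sub>R (\<integral>z. f t z \<partial>lborel) \<partial>lborel)"
    by (rule unit_interval_swap[OF fm fi fb])
  finally show "conv k F (y + h) - conv k F y = (\<integral>t. indicator {0..1} t *\<^sub>R (h \<bullet> (\<chi> i. conv k (\<lambda>w. G w $ i) (y + t *\<^sub>R h))) \<partial>lborel)"
    unfolding fint .
qed

text \<open>The integral of \<open>G z / (norm z)\<^sup>2\<close> is invariant under dilations; its derivative along the dilations is the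
  integral below.\<close>

lemma radial_integral_zero:
  fixes G :: "real^2 \<Rightarrow> real" and D :: "real^2 \<Rightarrow> real^2"
  assumes d: "\<And>z. (G has_derivative (\<lambda>h. h \<bullet> D z)) (at z)" and Dc: "continuous_on UNIV D"
    and b: "\<And>z. \<bar>G z\<bar> \<le> M * conf z" "\<And>z. norm (D z) \<le> M * conf z" and G0: "G 0 = 0"
  shows "integrable lborel (\<lambda>z. (z \<bullet> D z) / (norm z)\<^sup>2)" "(\<integral>z. (z \<bullet> D z) / (norm z)\<^sup>2 \<partial>lborel) = 0"
proof -
  define P where "P z = (z \<bullet> D z) / (norm z)\<^sup>2" for z
  define Q where "Q z = G z / (norm z)\<^sup>2" for z
  have Gc: "continuous_on UNIV G" using d by (intro has_derivative_continuous_on) (auto intro: has_derivative_at_withinI)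
  have [measurable]: "D \<in> borel_measurable borel" "G \<in> borel_measurable borel"
    by (rule borel_measurable_continuous_onI[OF Dc], rule borel_measurable_continuous_onI[OF Gc])
  have [measurable]: "P \<in> borel_measurable borel" "Q \<in> borel_measurable borel" unfolding P_def Q_def by measurable
  have "0 \<le> M * conf 0" by (rule order_trans[OF abs_ge_zero b(1)])
  then have M: "0 \<le> M" using conf_pos[of 0] by (simp add: zero_le_mult_iff)
  have M4: "M * conf z \<le> M * 4" for z using M conf_le by (rule mult_left_mono[rotated])
  have Pi: "integrable lborel P"
  proof (rule dominated_integrable[where C="4 * M"])
    fix z
    have "\<bar>P z\<bar> \<le> norm z * norm (D z) / (norm z)\<^sup>2" unfolding P_def abs_divide
      by (simp add: divide_right_mono Cauchy_Schwarz_ineq2)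
    also have "\<dots> = norm (D z) * (1 / norm z)" by (cases "z = 0") (simp_all add: power2_eq_square)
    also have "\<dots> \<le> (M * conf z) * (1 + nearw z)" by (rule mult_mono[OF b(2) inverse_norm_le(1)]) (use M conf_pos[of z] in auto)
    also have "\<dots> = M * conf z + (M * conf z) * nearw z" by (simp add: algebra_simps)
    also have "\<dots> \<le> 4 * M * (conf z + nearw z)"
      using mult_right_mono[OF M4[of z] nearw_nonneg[of z]] mult_nonneg_nonneg[OF M less_imp_le[OF conf_pos[of z]]]
      by (simp add: algebra_simps)
    finally show "\<bar>P z\<bar> \<le> 4 * M * (conf z + nearw z)" .
  qed simp
  have Qi: "integrable lborel Q"
  proof (rule dominated_integrable[where C="4 * M"])
    fix z
    have cz: "0 \<le> conf z" "0 \<le> nearw z" using conf_pos[of z] nearw_nonneg by auto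
    show "\<bar>Q z\<bar> \<le> 4 * M * (conf z + nearw z)"
    proof (cases "norm z \<le> 1")
      case True
      have "norm (G z - G 0) \<le> (M * 4) * norm (z - 0)"
      proof (rule differentiable_bound[where S=UNIV and f'="\<lambda>x h. h \<bullet> D x"])
        fix x :: "real^2"
        show "onorm (\<lambda>h. h \<bullet> D x) \<le> M * 4"
        proof (rule onorm_bound)
          fix h
          have "\<bar>h \<bullet> D x\<bar> \<le> norm h * norm (D x)" by (rule Cauchy_Schwarz_ineq2)
          also have "\<dots> \<le> norm h * (M * 4)" using order_trans[OF b(2) M4] by (intro mult_left_mono) auto
          finally show "norm (h \<bullet> D x) \<le> M * 4 * norm h" by (simp add: mult.commute)
        qed (use M in simp)
      qed (use d in auto)
      then have "\<bar>Q z\<bar> \<le> (M * 4 * norm z) / (norm z)\<^sup>2" unfolding Q_def abs_divide using G0 by (simp add: divide_right_mono)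
      also have "\<dots> = 4 * M * (1 / norm z)" by (cases "z = 0") (simp_all add: power2_eq_square)
      also have "\<dots> \<le> 4 * M * (conf z + nearw z)" using inverse_norm_le(2)[OF True] cz M by (intro mult_left_mono) auto
      finally show ?thesis .
    next
      case False
      then have "1 \<le> (norm z)\<^sup>2" using one_le_power[of "norm z" 2] by simp
      then have "\<bar>Q z\<bar> \<le> \<bar>G z\<bar> / 1" unfolding Q_def abs_divide by (intro divide_left_mono) auto
      also have "\<dots> \<le> M * conf z" using b(1) by simp
      also have "\<dots> \<le> 4 * M * (conf z + nearw z)"
        using mult_nonneg_nonneg[OF M cz(1)] mult_nonneg_nonneg[OF M cz(2)] by (simp add: algebra_simps)
      finally show ?thesis .
    qed
  qed simp
  have Psc: "(\<integral>z. P (c *\<^sub>R z) \<partial>lborel) = (\<integral>z. P z \<partial>lborel) / c\<^sup>2" "integrable lborel (\<lambda>z. P (c *\<^sub>R z))"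
     "(\<integral>z. \<bar>P (c *\<^sub>R z)\<bar> \<partial>lborel) = (\<integral>z. \<bar>P z\<bar> \<partial>lborel) / c\<^sup>2" if "c \<noteq> 0" for c
    using lborel_affine_integral[OF that, of P 0] lborel_affine_integral(1)[OF that, of "\<lambda>z. \<bar>P z\<bar>" 0] Pi by simp_all
  \<comment> \<open>Away from 0 this is the derivative in t of G at the dilated point (1 + t) z,
    divided by the squared norm of z. Integrated over t it gives 4 * Q (2 z) - Q z, whose integral
    over z is 0 by scaling, whereas the integral of f t is that of P divided by 1 + t. Hence ln 2
    times the integral of P is 0.\<close>
  define f where "f t z = (1 + t) * P ((1 + t) *\<^sub>R z)" for t :: real and z
  have fm: "(\<lambda>(t, z). f t z) \<in> borel_measurable (lborel \<Otimes>\<^sub>M lborel)" unfolding f_def split_beta' by measurable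
  have fi: "integrable lborel (f t)" if "0 \<le> t" for t unfolding f_def using that by (intro integrable_mult_right Psc(2)) simp
  have fint: "(\<integral>z. f t z \<partial>lborel) = (1 / (1 + t)) * (\<integral>z. P z \<partial>lborel)" if "0 \<le> t" for t
  proof -
    have "(\<integral>z. f t z \<partial>lborel) = (1 + t) * ((\<integral>z. P z \<partial>lborel) / (1 + t)\<^sup>2)" unfolding f_def using that Psc(1)[of "1 + t"] by simp
    then show ?thesis using that by (simp add: power2_eq_square)
  qed
  have fb: "(\<integral>z. \<bar>f t z\<bar> \<partial>lborel) \<le> (\<integral>z. \<bar>P z\<bar> \<partial>lborel)" if "0 \<le> t" for t
  proof -
    have "(\<integral>z. \<bar>f t z\<bar> \<partial>lborel) = (1 + t) * ((\<integral>z. \<bar>P z\<bar> \<partial>lborel) / (1 + t)\<^sup>2)"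
      unfolding f_def abs_mult using that Psc(3)[of "1 + t"] by simp
    also have "\<dots> = (\<integral>z. \<bar>P z\<bar> \<partial>lborel) / (1 + t)" using that by (simp add: power2_eq_square)
    also have "\<dots> \<le> (\<integral>z. \<bar>P z\<bar> \<partial>lborel) / 1" using that by (intro divide_left_mono) auto
    finally show ?thesis by simp
  qed
  have pt: "(\<integral>t. indicator {0..1} t *\<^sub>R f t z \<partial>lborel) = 4 * Q (2 *\<^sub>R z) - Q z" for z
  proof (cases "z = 0")
    case True then show ?thesis by (simp add: f_def P_def Q_def)
  next
    case False
    have fz: "f t z = (z \<bullet> D ((1 + t) *\<^sub>R z)) / (norm z)\<^sup>2" if "0 \<le> t" for t
    proof -
      have g: "w * ((w * A) / (w\<^sup>2 * B)) = A / B" if "0 < w" for w A B :: real using that by (simp add: power2_eq_square)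
      show ?thesis unfolding f_def P_def inner_scaleR_left norm_scaleR power_mult_distrib power2_abs by (rule g) (use that in simp)
    qed
    have "(\<integral>t. indicator {0..1} t *\<^sub>R f t z \<partial>lborel) = G ((1 + 1) *\<^sub>R z) / (norm z)\<^sup>2 - G ((1 + 0) *\<^sub>R z) / (norm z)\<^sup>2"
    proof (rule integral_FTC_atLeastAtMost)
      have "continuous_on {0..1} (\<lambda>t. (z \<bullet> D ((1 + t) *\<^sub>R z)) / (norm z)\<^sup>2)"
        using False by (intro continuous_intros continuous_on_compose2[OF Dc]) auto
      then show "continuous_on {0..1} (\<lambda>t. f t z)" by (rule continuous_on_eq) (use fz in auto)
      fix t :: real assume t: "0 \<le> t"
      have g': "((\<lambda>t. (1 + t) *\<^sub>R z) has_derivative (\<lambda>x. x *\<^sub>R z)) (at t within {0..1})" by (auto intro!: derivative_eq_intros)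
      have "((\<lambda>t. G ((1 + t) *\<^sub>R z)) has_derivative (\<lambda>x. (x *\<^sub>R z) \<bullet> D ((1 + t) *\<^sub>R z))) (at t within {0..1})"
        by (rule has_derivative_compose[OF g' d])
      then have "((\<lambda>t. G ((1 + t) *\<^sub>R z)) has_real_derivative (z \<bullet> D ((1 + t) *\<^sub>R z))) (at t within {0..1})"
        unfolding has_field_derivative_def by (rule has_derivative_eq_rhs) auto
      then have "((\<lambda>t. G ((1 + t) *\<^sub>R z) / (norm z)\<^sup>2) has_real_derivative f t z) (at t within {0..1})"
        unfolding fz[OF t] by (rule DERIV_cdivide)
      then show "((\<lambda>t. G ((1 + t) *\<^sub>R z) / (norm z)\<^sup>2) has_vector_derivative f t z) (at t within {0..1})"
        by (simp add: has_real_derivative_iff_has_vector_derivative)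
    qed simp
    then show ?thesis by (simp add: Q_def power_mult_distrib)
  qed
  have "(\<integral>t. indicator {0..1::real} t *\<^sub>R (1 / (1 + t)) \<partial>lborel) = ln (1 + 1) - ln (1 + 0)"
    by (rule integral_FTC_atLeastAtMost)
       (auto intro!: derivative_eq_intros continuous_intros simp: has_real_derivative_iff_has_vector_derivative[symmetric])
  then have l2: "(\<integral>t. indicator {0..1::real} t * (1 / (1 + t)) \<partial>lborel) = ln 2" by simp
  have "(\<integral>z. 4 * Q (2 *\<^sub>R z) - Q z \<partial>lborel) = (\<integral>t. indicator {0..1} t *\<^sub>R (\<integral>z. f t z \<partial>lborel) \<partial>lborel)"
    unfolding pt[symmetric] by (rule unit_interval_swap[OF fm fi fb])
  also have "\<dots> = (\<integral>t. (indicator {0..1} t * (1 / (1 + t))) * (\<integral>z. P z \<partial>lborel) \<partial>lborel)"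
    by (rule Bochner_Integration.integral_cong[OF refl]) (auto simp: indicator_def fint)
  also have "\<dots> = ln 2 * (\<integral>z. P z \<partial>lborel)" using l2 by (simp only: integral_mult_left_zero)
  also have "(\<integral>z. 4 * Q (2 *\<^sub>R z) - Q z \<partial>lborel) = 0"
  proof -
    have "integrable lborel (\<lambda>z. 4 * Q (2 *\<^sub>R z))" "(\<integral>z. 4 * Q (2 *\<^sub>R z) \<partial>lborel) = (\<integral>z. Q z \<partial>lborel)"
      using lborel_affine_integral[of 2 Q 0] Qi by simp_all
    then show ?thesis using Qi by simp
  qed
  finally have "(\<integral>z. P z \<partial>lborel) = 0" by simp
  then show "integrable lborel (\<lambda>z. (z \<bullet> D z) / (norm z)\<^sup>2)" "(\<integral>z. (z \<bullet> D z) / (norm z)\<^sup>2 \<partial>lborel) = 0"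
    using Pi unfolding P_def by simp_all
qed

section \<open>The flux of the gradient kernel, and regularity in the plane\<close>

lemma has_derivative_one_plus_norm_sq: "((\<lambda>y::real^2. 1 + (norm y)\<^sup>2) has_derivative (\<lambda>h. 2 * (h \<bullet> y))) (at y)"
proof -
  have "((\<lambda>y::real^2. 1 + y \<bullet> y) has_derivative (\<lambda>h. y \<bullet> h + h \<bullet> y)) (at y)"
    by (auto intro!: derivative_eq_intros)
  then show ?thesis unfolding power2_norm_eq_inner by (rule has_derivative_eq_rhs) (auto simp: inner_commute)
qed

lemma has_derivative_radial:
  fixes \<psi> :: "real \<Rightarrow> real"
  assumes "(\<psi> has_real_derivative \<psi>') (at (1 + (norm y)\<^sup>2))"
  shows "((\<lambda>y::real^2. \<psi> (1 + (norm y)\<^sup>2)) has_derivative (\<lambda>h. h \<bullet> ((2 * \<psi>') *\<^sub>R y))) (at y)"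
  using has_derivative_compose[OF has_derivative_one_plus_norm_sq assms[unfolded has_field_derivative_def]]
  by (rule has_derivative_eq_rhs) (auto simp: mult_ac)

lemma conf_derivative: "(conf has_derivative (\<lambda>h. h \<bullet> ((- 16 / (1 + (norm y)\<^sup>2)^3) *\<^sub>R y))) (at y)"
proof -
  have g: "((\<lambda>v::real. 4 / v\<^sup>2) has_real_derivative - 8 / w^3) (at w)" if "w \<noteq> 0" for w
    using that by (auto intro!: derivative_eq_intros simp: power2_eq_square power3_eq_cube divide_simps)
  have "((\<lambda>v::real. 4 / v\<^sup>2) has_real_derivative - 8 / (1 + (norm y)\<^sup>2)^3) (at (1 + (norm y)\<^sup>2))" by (rule g) simp
  from has_derivative_radial[OF this] show ?thesis unfolding conf_def by simp
qed

lemma norm_le_one_plus_sq: "norm y \<le> 1 + (norm y)\<^sup>2"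
proof -
  have "2 * norm y \<le> 1 + (norm y)\<^sup>2" using sum_squares_bound[of 1 "norm y"] by simp
  then show ?thesis using norm_ge_zero[of y] by linarith
qed

lemma conf_gradient_le: "norm ((- 16 / (1 + (norm y)\<^sup>2)^3) *\<^sub>R y) \<le> 4 * conf y"
proof -
  define v where "v = 1 + (norm y)\<^sup>2"
  have v: "0 < v" "norm y \<le> v" using norm_le_one_plus_sq by (auto simp: v_def)
  have "norm ((- 16 / v^3) *\<^sub>R y) = 16 / v^3 * norm y" using v by simp
  also have "\<dots> \<le> 16 / v^3 * v" using v by (intro mult_left_mono) auto
  also have "\<dots> = 4 * (4 / v\<^sup>2)" using v by (simp add: power2_eq_square power3_eq_cube)
  finally show ?thesis unfolding v_def conf_def .
qed

lemma radial_integral_cube: "integrable lborel (\<lambda>z::real^2. 4 / (1 + (norm z)\<^sup>2)^3)" "(\<integral>z. 4 / (1 + (norm (z::real^2))\<^sup>2)^3 \<partial>lborel) = 2 * pi"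
proof -
  have "(\<integral>\<^sup>+z. ennreal (4 / (1 + (norm (z::real^2))\<^sup>2)^3) \<partial>lborel) = (\<integral>\<^sup>+v. (ennreal pi * indicator {0..} v) * ennreal (4 / (1 + v)^3) \<partial>lborel)"
    by (rule nn_integral_radial_plane[of "\<lambda>v. ennreal (4 / (1 + v)^3)"]) measurable
  also have "\<dots> = (\<integral>\<^sup>+v. ennreal (4 * pi / (1 + v)^3) * indicator {0..} v \<partial>lborel)"
    by (intro nn_integral_cong) (auto simp: indicator_def mult.commute simp flip: ennreal_mult')
  also have "\<dots> = ennreal (0 - (- 2 * pi / (1 + 0)\<^sup>2))"
  proof (rule nn_integral_FTC_atLeast)
    show "((\<lambda>v::real. - 2 * pi / (1 + v)\<^sup>2) \<longlongrightarrow> 0) at_top" by real_asymp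
    fix v :: real assume "0 \<le> v"
    then show "((\<lambda>v. - 2 * pi / (1 + v)\<^sup>2) has_real_derivative 4 * pi / (1 + v)^3) (at v)"
      by (auto intro!: derivative_eq_intros simp: power2_eq_square power3_eq_cube divide_simps)
  qed auto
  also have "0 - (- 2 * pi / (1 + 0)\<^sup>2) = 2 * pi" by simp
  finally have n: "(\<integral>\<^sup>+z. ennreal (4 / (1 + (norm (z::real^2))\<^sup>2)^3) \<partial>lborel) = ennreal (2 * pi)" .
  have "has_bochner_integral lborel (\<lambda>z::real^2. 4 / (1 + (norm z)\<^sup>2)^3) (2 * pi)"
  proof (rule has_bochner_integral_nn_integral[OF _ _ _ n])
    show "AE z in lborel. 0 \<le> 4 / (1 + (norm (z::real^2))\<^sup>2)^3"
      by (intro AE_I2 divide_nonneg_nonneg zero_le_power add_nonneg_nonneg) auto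
  qed simp_all
  then show "integrable lborel (\<lambda>z::real^2. 4 / (1 + (norm z)\<^sup>2)^3)" "(\<integral>z. 4 / (1 + (norm (z::real^2))\<^sup>2)^3 \<partial>lborel) = 2 * pi"
    by (auto simp: has_bochner_integral_iff)
qed

text \<open>In other words, the field z / norm z ^ 2 has divergence 2 * pi times the Dirac mass at
  0. Subtracting g 0 / 4 times \<open>conf\<close>, whose value at 0 is 4, reduces the claim to
  \<open>radial_integral_zero\<close>, and for \<open>conf\<close> the integral is explicit.\<close>

lemma radial_integral:
  fixes g :: "real^2 \<Rightarrow> real" and D :: "real^2 \<Rightarrow> real^2"
  assumes d: "\<And>z. (g has_derivative (\<lambda>h. h \<bullet> D z)) (at z)" and Dc: "continuous_on UNIV D"
    and b: "\<And>z. \<bar>g z\<bar> \<le> M * conf z" "\<And>z. norm (D z) \<le> M * conf z"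
  shows "(\<integral>z. (z \<bullet> D z) / (norm z)\<^sup>2 \<partial>lborel) = - (2 * pi) * g 0"
proof -
  define E where "E z = (- 16 / (1 + (norm z)\<^sup>2)^3) *\<^sub>R z" for z :: "real^2"
  define c where "c = g 0 / 4"
  have z: "integrable lborel (\<lambda>z. (z \<bullet> (D z - c *\<^sub>R E z)) / (norm z)\<^sup>2)" "(\<integral>z. (z \<bullet> (D z - c *\<^sub>R E z)) / (norm z)\<^sup>2 \<partial>lborel) = 0"
  \<comment> \<open>Both conclusions of \<open>radial_integral_zero\<close> are proved at once, so
    each premise has to be supplied twice.\<close>
  proof (rule_tac [!] radial_integral_zero[where G="\<lambda>z. g z - c * conf z" and M="M + 4 * \<bar>c\<bar>"])
    fix z
    have "((\<lambda>z. g z - c * conf z) has_derivative (\<lambda>h. h \<bullet> D z - c * (h \<bullet> E z))) (at z)"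
      unfolding E_def by (intro has_derivative_diff d has_derivative_mult_right conf_derivative)
    then show "((\<lambda>z. g z - c * conf z) has_derivative (\<lambda>h. h \<bullet> (D z - c *\<^sub>R E z))) (at z)"
      by (simp add: inner_diff_right)
    then show "((\<lambda>z. g z - c * conf z) has_derivative (\<lambda>h. h \<bullet> (D z - c *\<^sub>R E z))) (at z)" .
    have "\<bar>g z - c * conf z\<bar> \<le> M * conf z + \<bar>c\<bar> * conf z" using b(1)[of z] conf_pos[of z] abs_triangle_ineq4[of "g z" "c * conf z"] by (simp add: abs_mult)
    also have "\<dots> \<le> (M + 4 * \<bar>c\<bar>) * conf z" using conf_pos[of z] by (simp add: algebra_simps)
    finally show "\<bar>g z - c * conf z\<bar> \<le> (M + 4 * \<bar>c\<bar>) * conf z" .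
    then show "\<bar>g z - c * conf z\<bar> \<le> (M + 4 * \<bar>c\<bar>) * conf z" .
    have "norm (D z - c *\<^sub>R E z) \<le> norm (D z) + \<bar>c\<bar> * norm (E z)" using norm_triangle_ineq4[of "D z" "c *\<^sub>R E z"] by simp
    also have "\<dots> \<le> M * conf z + \<bar>c\<bar> * (4 * conf z)" using b(2)[of z] conf_gradient_le[of z] unfolding E_def by (intro add_mono mult_left_mono) auto
    finally show "norm (D z - c *\<^sub>R E z) \<le> (M + 4 * \<bar>c\<bar>) * conf z" by (simp add: algebra_simps)
    then show "norm (D z - c *\<^sub>R E z) \<le> (M + 4 * \<bar>c\<bar>) * conf z" .
  next
    show "continuous_on UNIV (\<lambda>z. D z - c *\<^sub>R E z)" unfolding E_def by (intro continuous_intros Dc) auto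
    then show "continuous_on UNIV (\<lambda>z. D z - c *\<^sub>R E z)" .
    show "g 0 - c * conf 0 = 0" by (simp add: c_def conf_def)
    then show "g 0 - c * conf 0 = 0" .
  qed
  have "(\<integral>z. (z \<bullet> D z) / (norm z)\<^sup>2 \<partial>lborel) = (\<integral>z. (z \<bullet> (D z - c *\<^sub>R E z)) / (norm z)\<^sup>2 - (4 * c) * (4 / (1 + (norm z)\<^sup>2)^3) \<partial>lborel)"
  proof (rule integral_cong_AE)
    have [measurable]: "D \<in> borel_measurable borel" by (rule borel_measurable_continuous_onI[OF Dc])
    have [measurable]: "E \<in> borel_measurable borel" unfolding E_def by measurable
    show "(\<lambda>z. (z \<bullet> D z) / (norm z)\<^sup>2) \<in> borel_measurable lborel"
      "(\<lambda>z. (z \<bullet> (D z - c *\<^sub>R E z)) / (norm z)\<^sup>2 - (4 * c) * (4 / (1 + (norm z)\<^sup>2)^3)) \<in> borel_measurable lborel" by measurable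
    have "AE z in lborel. z \<notin> {0::real^2}" by (rule AE_lborel_notin_subsingleton) simp
    then show "AE z in lborel. (z \<bullet> D z) / (norm z)\<^sup>2 = (z \<bullet> (D z - c *\<^sub>R E z)) / (norm z)\<^sup>2 - (4 * c) * (4 / (1 + (norm z)\<^sup>2)^3)"
    proof eventually_elim
      case (elim z)
      then have n: "(norm z)\<^sup>2 \<noteq> 0" by simp
      have "(z \<bullet> (D z - c *\<^sub>R E z)) / (norm z)\<^sup>2 = (z \<bullet> D z) / (norm z)\<^sup>2 - c * ((- 16 / (1 + (norm z)\<^sup>2)^3) * (norm z)\<^sup>2 / (norm z)\<^sup>2)"
        unfolding E_def by (simp add: inner_diff_right inner_add_right add_divide_distrib diff_divide_distrib power2_norm_eq_inner)
      also have "(- 16 / (1 + (norm z)\<^sup>2)^3) * (norm z)\<^sup>2 / (norm z)\<^sup>2 = - 16 / (1 + (norm z)\<^sup>2)^3" using n by simp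
      finally show ?case by simp
    qed
  qed
  also have "\<dots> = 0 - (4 * c) * (2 * pi)"
    unfolding Bochner_Integration.integral_diff[OF z(1) integrable_mult_right[OF radial_integral_cube(1)]] integral_mult_right_zero
      z(2) radial_integral_cube(2) ..
  finally show ?thesis by (simp add: c_def)
qed

lemma pderiv_at_eq: "(f has_derivative (\<lambda>h. h \<bullet> v)) (at y) \<Longrightarrow> pderiv_at i f y = v $ i"
  for f :: "real^'n \<Rightarrow> real"
proof -
  assume "(f has_derivative (\<lambda>h. h \<bullet> v)) (at y)"
  then have "frechet_derivative f (at y) = (\<lambda>h. h \<bullet> v)" by (rule frechet_derivative_at[symmetric])
  then show ?thesis unfolding pderiv_at_def by (simp add: inner_axis')
qed

text \<open>A bootstrap. After subtraction of \<rho> / (4 * pi) * ln (1 + norm y ^ 2),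
  \<open>U\<close> has the increments of a logarithmic potential of \<open>F\<close>, so its
  gradient is a convolution and continuous. Then \<open>F\<close> is differentiable with decaying
  gradient, and differentiating the convolution once more yields continuous second derivatives. The
  Laplacian of ln (1 + norm y ^ 2) is \<open>conf\<close>, which produces the term with
  \<rho>.\<close>

lemma planar_regularity:
  fixes U :: "real^2 \<Rightarrow> real" and \<rho> :: real
  assumes Uc: "continuous_on UNIV U" and Ub: "\<And>y. \<bar>U y\<bar> \<le> B"
  defines "F \<equiv> \<lambda>y. exp (U y) * conf y"
  assumes eq: "\<And>y h. U (y + h) - U y = - (1 / (4 * pi)) * (\<integral>z. F z * (ln ((norm (y + h - z))\<^sup>2) - ln ((norm (y - z))\<^sup>2)) \<partial>lborel)
      + (\<rho> / (4 * pi)) * (ln (1 + (norm (y + h))\<^sup>2) - ln (1 + (norm y)\<^sup>2))"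
  shows "C_class 2 U" "(\<Sum>i\<in>UNIV. pderiv_at i (pderiv_at i U) y) = conf y * (\<rho> / (4 * pi) - exp (U y))"
proof -
  have eU: "\<bar>exp (U y)\<bar> \<le> exp B" for y using Ub[of y] by simp
  have F: "decays (exp B) F" unfolding decays_def F_def
  proof (intro conjI allI)
    show "continuous_on UNIV (\<lambda>y. exp (U y) * conf y)" by (intro continuous_intros Uc conf_cont)
    fix y show "\<bar>exp (U y) * conf y\<bar> \<le> exp B * conf y" using abs_mult_le[OF eU order_refl, of y "conf y"] conf_pos[of y] by simp
  qed
  define D where "D y = (- (1 / (2 * pi))) *\<^sub>R gradp F y + ((\<rho> / (4 * pi)) * (2 / (1 + (norm y)\<^sup>2))) *\<^sub>R y" for y
  have lnd: "((\<lambda>y::real^2. ln (1 + (norm y)\<^sup>2)) has_derivative (\<lambda>h. h \<bullet> ((2 * (1 / (1 + (norm y)\<^sup>2))) *\<^sub>R y))) (at y)" for y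
    by (rule has_derivative_radial, rule derivative_eq_intros) (auto simp: field_simps)
  have dA: "((\<lambda>y. U y - (\<rho> / (4 * pi)) * ln (1 + (norm y)\<^sup>2)) has_derivative (\<lambda>h. h \<bullet> ((- (1 / (2 * pi))) *\<^sub>R gradp F y))) (at y)" for y
  proof (rule has_derivative_of_line_integral)
    show "continuous_on UNIV (\<lambda>y. (- (1 / (2 * pi))) *\<^sub>R gradp F y)" by (intro continuous_intros gradp_cont[OF F])
    fix h
    have "(U (y + h) - (\<rho> / (4 * pi)) * ln (1 + (norm (y + h))\<^sup>2)) - (U y - (\<rho> / (4 * pi)) * ln (1 + (norm y)\<^sup>2))
       = - (1 / (4 * pi)) * (\<integral>z. F z * (ln ((norm (y + h - z))\<^sup>2) - ln ((norm (y - z))\<^sup>2)) \<partial>lborel)"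
      using eq[of y h] by (simp only: algebra_simps)
    also have "\<dots> = - (1 / (2 * pi)) * (\<integral>t. indicator {0..1} t *\<^sub>R (h \<bullet> gradp F (y + t *\<^sub>R h)) \<partial>lborel)"
      unfolding log_potential_line[OF F] by simp
    also have "\<dots> = (\<integral>t. - (1 / (2 * pi)) * (indicator {0..1} t *\<^sub>R (h \<bullet> gradp F (y + t *\<^sub>R h))) \<partial>lborel)"
      by (rule integral_mult_right_zero[symmetric])
    also have "\<dots> = (\<integral>t. indicator {0..1} t *\<^sub>R (h \<bullet> ((- (1 / (2 * pi))) *\<^sub>R gradp F (y + t *\<^sub>R h))) \<partial>lborel)"
      by (rule Bochner_Integration.integral_cong) (simp_all add: mult_ac)
    finally show "(U (y + h) - (\<rho> / (4 * pi)) * ln (1 + (norm (y + h))\<^sup>2)) - (U y - (\<rho> / (4 * pi)) * ln (1 + (norm y)\<^sup>2))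
       = (\<integral>t. indicator {0..1} t *\<^sub>R (h \<bullet> ((- (1 / (2 * pi))) *\<^sub>R gradp F (y + t *\<^sub>R h))) \<partial>lborel)" .
  qed
  have dU: "(U has_derivative (\<lambda>h. h \<bullet> D y)) (at y)" for y
  proof -
    have "((\<lambda>y. (U y - (\<rho> / (4 * pi)) * ln (1 + (norm y)\<^sup>2)) + (\<rho> / (4 * pi)) * ln (1 + (norm y)\<^sup>2)) has_derivative
      (\<lambda>h. h \<bullet> ((- (1 / (2 * pi))) *\<^sub>R gradp F y) + (\<rho> / (4 * pi)) * (h \<bullet> ((2 * (1 / (1 + (norm y)\<^sup>2))) *\<^sub>R y)))) (at y)"
      by (intro has_derivative_add dA has_derivative_mult_right lnd)
    then have "(U has_derivative
      (\<lambda>h. h \<bullet> ((- (1 / (2 * pi))) *\<^sub>R gradp F y) + (\<rho> / (4 * pi)) * (h \<bullet> ((2 * (1 / (1 + (norm y)\<^sup>2))) *\<^sub>R y)))) (at y)"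
      by (simp only: diff_add_cancel)
    then show ?thesis by (rule has_derivative_eq_rhs) (rule ext, simp add: D_def inner_add_right inner_diff_right)
  qed
  have Dc: "continuous_on UNIV D" unfolding D_def by (intro continuous_intros gradp_cont[OF F]) auto
  define G where "G y = F y *\<^sub>R D y + exp (U y) *\<^sub>R ((- 16 / (1 + (norm y)\<^sup>2)^3) *\<^sub>R y)" for y
  have dF: "(F has_derivative (\<lambda>h. h \<bullet> G y)) (at y)" for y
  proof -
    have "((\<lambda>y. exp (U y)) has_derivative (\<lambda>h. exp (U y) * (h \<bullet> D y))) (at y)"
      using has_derivative_compose[OF dU DERIV_exp[unfolded has_field_derivative_def]] .
    from has_derivative_mult[OF this conf_derivative]
    show ?thesis unfolding F_def G_def by (rule has_derivative_eq_rhs) (auto simp: inner_add_right algebra_simps)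
  qed
  define C1 where "C1 = 1 * exp B * (4 * pi + 4 * (\<integral>z. nearw z \<partial>lborel))"
  define C2 where "C2 = (1 / (2 * pi)) * C1 + \<bar>\<rho> / (4 * pi)\<bar> * 2"
  have Db: "\<bar>D y $ i\<bar> \<le> C2" for y i
  proof -
    have 1: "\<bar>conv (kern i) F y\<bar> \<le> C1" unfolding C1_def by (rule conv_int(3)[OF kern_facts F])
    have "\<bar>y $ i\<bar> \<le> 1 + (norm y)\<^sup>2" using component_le_norm_cart[of y i] norm_le_one_plus_sq[of y] by linarith
    then have 2: "\<bar>2 / (1 + (norm y)\<^sup>2) * y $ i\<bar> \<le> 2" using one_plus_norm_sq_pos[of y] by (simp add: abs_mult abs_divide divide_le_eq)
    have "\<bar>(1 / (2 * pi)) * conv (kern i) F y\<bar> \<le> (1 / (2 * pi)) * C1" by (rule abs_mult_le[OF _ 1]) simp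
    moreover have "\<bar>(\<rho> / (4 * pi)) * (2 / (1 + (norm y)\<^sup>2) * y $ i)\<bar> \<le> \<bar>\<rho> / (4 * pi)\<bar> * 2" by (rule abs_mult_le[OF order_refl 2])
    moreover have "D y $ i = (\<rho> / (4 * pi)) * (2 / (1 + (norm y)\<^sup>2) * y $ i) - (1 / (2 * pi)) * conv (kern i) F y"
      by (simp add: D_def gradp_def)
    ultimately show ?thesis unfolding C2_def by linarith
  qed
  define M where "M = exp B * C2 + exp B * 4"
  have Gc: "continuous_on UNIV G" unfolding G_def by (intro continuous_intros decaysD(1)[OF F] Dc Uc) auto
  have Gd: "decays M (\<lambda>y. G y $ i)" for i unfolding decays_def
  proof (intro conjI allI)
    show "continuous_on UNIV (\<lambda>y. G y $ i)" by (intro continuous_intros Gc)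
    fix y
    have 1: "\<bar>F y * D y $ i\<bar> \<le> (exp B * conf y) * C2" by (rule abs_mult_le[OF decaysD(2)[OF F] Db])
    have "\<bar>((- 16 / (1 + (norm y)\<^sup>2)^3) *\<^sub>R y) $ i\<bar> \<le> 4 * conf y" by (rule order_trans[OF component_le_norm_cart conf_gradient_le])
    from abs_mult_le[OF eU this] have 2: "\<bar>exp (U y) * ((- 16 / (1 + (norm y)\<^sup>2)^3) *\<^sub>R y) $ i\<bar> \<le> exp B * (4 * conf y)" .
    have "G y $ i = F y * D y $ i + exp (U y) * ((- 16 / (1 + (norm y)\<^sup>2)^3) *\<^sub>R y) $ i" by (simp add: G_def)
    then have "\<bar>G y $ i\<bar> \<le> (exp B * conf y) * C2 + exp B * (4 * conf y)" using 1 2 by linarith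
    then show "\<bar>G y $ i\<bar> \<le> M * conf y" by (simp add: M_def algebra_simps)
  qed
  define H where "H i y = (- (1 / (2 * pi))) *\<^sub>R (\<chi> j. conv (kern i) (\<lambda>w. G w $ j) y)
      + (\<rho> / (4 * pi)) *\<^sub>R ((2 / (1 + (norm y)\<^sup>2)) *\<^sub>R axis i 1 + (y $ i * (2 * (- 2 / (1 + (norm y)\<^sup>2)\<^sup>2))) *\<^sub>R y)" for i y
  have pU: "pderiv_at i U = (\<lambda>y. D y $ i)" for i by (rule ext) (rule pderiv_at_eq[OF dU])
  have dD: "((\<lambda>y. D y $ i) has_derivative (\<lambda>h. h \<bullet> H i y)) (at y)" for i y
  proof -
    have g: "((\<lambda>v::real. 2 / v) has_real_derivative - 2 / w\<^sup>2) (at w)" if "w \<noteq> 0" for w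
      using that by (auto intro!: derivative_eq_intros simp: power2_eq_square)
    have ps: "((\<lambda>v::real. 2 / v) has_real_derivative - 2 / (1 + (norm y)\<^sup>2)\<^sup>2) (at (1 + (norm y)\<^sup>2))" by (rule g) simp
    have ni: "((\<lambda>y::real^2. y $ i) has_derivative (\<lambda>h. h $ i)) (at y)" by (rule bounded_linear_imp_has_derivative[OF bounded_linear_vec_nth])
    have "((\<lambda>y. (- (1 / (2 * pi))) * conv (kern i) F y + (\<rho> / (4 * pi)) * (2 / (1 + (norm y)\<^sup>2) * y $ i)) has_derivative
      (\<lambda>h. (- (1 / (2 * pi))) * (h \<bullet> (\<chi> j. conv (kern i) (\<lambda>w. G w $ j) y)) +
        (\<rho> / (4 * pi)) * (2 / (1 + (norm y)\<^sup>2) * h $ i + (h \<bullet> ((2 * (- 2 / (1 + (norm y)\<^sup>2)\<^sup>2)) *\<^sub>R y)) * y $ i))) (at y)"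
      by (intro has_derivative_add has_derivative_mult_right conv_has_derivative[OF kern_facts(1,2) F dF Gd]
          has_derivative_mult[OF has_derivative_radial[OF ps] ni])
    moreover have "(\<lambda>y. (- (1 / (2 * pi))) * conv (kern i) F y + (\<rho> / (4 * pi)) * (2 / (1 + (norm y)\<^sup>2) * y $ i)) = (\<lambda>y. D y $ i)"
      by (rule ext) (simp add: D_def gradp_def)
    moreover have "(\<lambda>h. (- (1 / (2 * pi))) * (h \<bullet> (\<chi> j. conv (kern i) (\<lambda>w. G w $ j) y)) +
        (\<rho> / (4 * pi)) * (2 / (1 + (norm y)\<^sup>2) * h $ i + (h \<bullet> ((2 * (- 2 / (1 + (norm y)\<^sup>2)\<^sup>2)) *\<^sub>R y)) * y $ i)) = (\<lambda>h. h \<bullet> H i y)"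
      by (rule ext) (simp add: H_def inner_add_right inner_axis algebra_simps)
    ultimately show ?thesis by simp
  qed
  have ppU: "pderiv_at j (pderiv_at i U) = (\<lambda>y. H i y $ j)" for i j unfolding pU by (rule ext) (rule pderiv_at_eq[OF dD])
  have Hc: "continuous_on UNIV (\<lambda>y. H i y $ j)" for i j
  proof -
    have "continuous_on UNIV (conv (kern i) (\<lambda>w. G w $ j))" by (rule conv_cont[OF kern_facts Gd])
    then show ?thesis unfolding H_def by (simp, intro continuous_intros) auto
  qed
  show "C_class 2 U"
    unfolding numeral_2_eq_2 C_class.simps ppU using Hc dU dD unfolding pU differentiable_def by blast
  \<comment> \<open>The sum is the divergence of the convolution of \<open>F\<close> with the kernel
    field. With F (y - z) as the function of z, \<open>radial_integral\<close> returns the value of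
    \<open>F\<close> at y.\<close>
  have cs: "(\<Sum>i\<in>UNIV. conv (kern i) (\<lambda>w. G w $ i) y) = 2 * pi * F y"
  proof -
    have "(\<Sum>i\<in>UNIV. conv (kern i) (\<lambda>w. G w $ i) y) = (\<integral>z. (\<Sum>i\<in>UNIV. kern i z * G (y - z) $ i) \<partial>lborel)"
      unfolding conv_def by (rule Bochner_Integration.integral_sum[symmetric]) (rule conv_int(1)[OF kern_facts Gd])
    also have "(\<lambda>z. \<Sum>i\<in>UNIV. kern i z * G (y - z) $ i) = (\<lambda>z. - ((z \<bullet> (- G (y - z))) / (norm z)\<^sup>2))"
      by (rule ext) (simp add: kern_def inner_vec_def sum_divide_distrib sum_negf)
    also have "(\<integral>z. - ((z \<bullet> (- G (y - z))) / (norm z)\<^sup>2) \<partial>lborel) = - (- (2 * pi) * F (y - 0))"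
      unfolding Bochner_Integration.integral_minus
    proof (rule arg_cong[where f=uminus], rule radial_integral[where M="2 * (M + exp B) * (4 * (1 + (norm y)\<^sup>2)\<^sup>2)"])
      fix z
      have "((\<lambda>z. y - z) has_derivative (\<lambda>h. - h)) (at z)" by (auto intro!: derivative_eq_intros)
      from has_derivative_compose[OF this dF] show "((\<lambda>z. F (y - z)) has_derivative (\<lambda>h. h \<bullet> (- G (y - z)))) (at z)" by simp
      show "continuous_on UNIV (\<lambda>z. - G (y - z))" by (intro continuous_intros continuous_on_compose2[OF Gc]) auto
      have M0: "0 \<le> M" by (rule decaysD(4)[OF Gd])
      have cc: "(2 * (M + exp B)) * conf (y - z) \<le> (2 * (M + exp B)) * (4 * (1 + (norm y)\<^sup>2)\<^sup>2 * conf z)"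
        by (rule mult_left_mono[OF conf_shift]) (use M0 in simp)
      have cp: "0 < conf (y - z)" by (rule conf_pos)
      have "\<bar>F (y - z)\<bar> \<le> exp B * conf (y - z)" by (rule decaysD(2)[OF F])
      also have "\<dots> \<le> (2 * (M + exp B)) * conf (y - z)" using M0 cp by (intro mult_right_mono) auto
      finally show "\<bar>F (y - z)\<bar> \<le> 2 * (M + exp B) * (4 * (1 + (norm y)\<^sup>2)\<^sup>2) * conf z" using cc by (simp add: mult.assoc)
      have "norm (G (y - z)) \<le> (\<Sum>i\<in>UNIV. \<bar>G (y - z) $ i\<bar>)" by (rule norm_le_l1_cart)
      also have "\<dots> \<le> (\<Sum>i\<in>(UNIV::2 set). M * conf (y - z))" by (intro sum_mono decaysD(2)[OF Gd])
      also have "\<dots> \<le> (2 * (M + exp B)) * conf (y - z)" using cp by (simp add: algebra_simps)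
      finally show "norm (- G (y - z)) \<le> 2 * (M + exp B) * (4 * (1 + (norm y)\<^sup>2)\<^sup>2) * conf z" using cc by (simp add: mult.assoc)
    qed
    finally show ?thesis by simp
  qed
  define v where "v = 1 + (norm y)\<^sup>2"
  have v0: "0 < v" by (simp add: v_def)
  have ys: "y $ 1 * y $ 1 + y $ 2 * y $ 2 = v - 1" using norm_sq_2[of y] by (simp add: v_def power2_eq_square)
  have "(\<Sum>i\<in>UNIV. pderiv_at i (pderiv_at i U) y) = (\<Sum>i\<in>UNIV. H i y $ i)" unfolding ppU ..
  also have "\<dots> = (- (1 / (2 * pi))) * (\<Sum>i\<in>UNIV. conv (kern i) (\<lambda>w. G w $ i) y)
      + (\<rho> / (4 * pi)) * (4 / v - (4 / v\<^sup>2) * (y $ 1 * y $ 1 + y $ 2 * y $ 2))"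
    unfolding H_def v_def[symmetric] by (simp add: sum_2 axis_def algebra_simps)
  also have "4 / v - (4 / v\<^sup>2) * (y $ 1 * y $ 1 + y $ 2 * y $ 2) = conf y"
    unfolding ys conf_def v_def[symmetric] using v0 by (simp add: field_simps power2_eq_square)
  also have "(- (1 / (2 * pi))) * (\<Sum>i\<in>UNIV. conv (kern i) (\<lambda>w. G w $ i) y) = - F y" unfolding cs by simp
  finally show "(\<Sum>i\<in>UNIV. pderiv_at i (pderiv_at i U) y) = conf y * (\<rho> / (4 * pi) - exp (U y))"
    by (simp add: F_def algebra_simps)
qed

section \<open>Regularity on the sphere\<close>

lemma integral_area_plane:
  fixes f :: "real^3 \<Rightarrow> real"
  assumes f: "f \<in> borel_measurable area"
  shows "(\<integral>x. f x \<partial>area) = (\<integral>y. conf y * f (stereo_param 1 y) \<partial>lborel)"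
    "integrable area f \<longleftrightarrow> integrable lborel (\<lambda>y. conf y * f (stereo_param 1 y))"
proof -
  have fm: "f \<in> borel_measurable (restrict_space borel S2)" using f by (simp only: measurable_area_eq)
  have sm: "stereo_param 1 \<in> density lborel (\<lambda>y. ennreal (conf y)) \<rightarrow>\<^sub>M restrict_space borel S2" by simp
  have cm: "(\<lambda>y. f (stereo_param 1 y)) \<in> borel_measurable lborel" using measurable_compose[OF measurable_stereo_1 fm] by simp
  show "(\<integral>x. f x \<partial>area) = (\<integral>y. conf y * f (stereo_param 1 y) \<partial>lborel)"
    unfolding area_measure_eq integral_distr[OF sm fm] using cm less_imp_le[OF conf_pos]
    by (subst integral_density) simp_all
  show "integrable area f \<longleftrightarrow> integrable lborel (\<lambda>y. conf y * f (stereo_param 1 y))"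
    unfolding area_measure_eq integrable_distr_eq[OF sm fm] using cm less_imp_le[OF conf_pos]
    by (subst integrable_density) simp_all
qed

lemma logk_stereo:
  assumes "a \<noteq> z"
  shows "logk (stereo_param 1 a) (stereo_param 1 z) = ln 2 + ln ((norm (a - z))\<^sup>2) - ln (1 + (norm a)\<^sup>2) - ln (1 + (norm z)\<^sup>2)"
proof -
  have n: "norm (stereo_param 1 a) = 1" "norm (stereo_param 1 z) = 1" by simp_all
  have e: "1 - stereo_param 1 a \<bullet> stereo_param 1 z = 2 * (norm (a - z))\<^sup>2 / ((1 + (norm a)\<^sup>2) * (1 + (norm z)\<^sup>2))"
    using one_minus_inner[OF n] norm_stereo_diff[of 1 a z] by simp
  have g: "ln (2 * d / (p * q)) = ln 2 + ln d - ln p - ln q" if "0 < d" "0 < p" "0 < q" for d p q :: real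
    using that by (simp add: ln_div ln_mult_pos)
  show ?thesis unfolding logk_def e by (rule g) (use assms in simp_all)
qed

text \<open>In the chart the kernel splits by \<open>logk_stereo\<close>. The term in the
  integration variable cancels in the difference of two kernels; the terms in y and y + h come out
  of the integral and are multiplied by the total mass \<rho>.\<close>

lemma chart_regularity:
  fixes u :: "real^3 \<Rightarrow> real"
  assumes uc: "continuous_on S2 u"
    and eq: "\<And>x x'. norm x = 1 \<Longrightarrow> norm x' = 1 \<Longrightarrow>
      u x - u x' = - (1 / (4 * pi)) * (\<integral>z. (logk x z - logk x' z) * exp (u z) \<partial>area)"
  defines "\<rho> \<equiv> \<integral>z. exp (u z) \<partial>area"
  shows "C_class 2 (u \<circ> stereo_param 1)"
    "(\<Sum>i\<in>UNIV. pderiv_at i (pderiv_at i (u \<circ> stereo_param 1)) y) = conf y * (\<rho> / (4 * pi) - exp (u (stereo_param 1 y)))"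
proof -
  define U where "U = u \<circ> stereo_param 1"
  define F where "F z = exp (U z) * conf z" for z
  have Uc: "continuous_on UNIV U" unfolding U_def comp_def
    by (rule continuous_on_compose2[OF uc continuous_stereo]) auto
  have "compact (u ` S2)" by (rule compact_continuous_image[OF uc]) simp
  then obtain B where B: "\<And>x. x \<in> u ` S2 \<Longrightarrow> \<bar>x\<bar> \<le> B" using compact_imp_bounded bounded_iff by (metis real_norm_def)
  have Ub: "\<bar>U y\<bar> \<le> B" for y unfolding U_def comp_def by (rule B) simp
  have ec: "continuous_on S2 (\<lambda>z. exp (u z))" by (intro continuous_intros uc)
  have em: "(\<lambda>z. exp (u z)) \<in> borel_measurable area" by (rule borel_measurable_areaI[OF ec])
  have Fi: "integrable lborel F" "(\<integral>z. F z \<partial>lborel) = \<rho>"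
    using integral_area_plane[OF em] integrable_area_cont[OF ec] unfolding F_def U_def comp_def \<rho>_def by (simp_all add: mult.commute)
  have [measurable]: "F \<in> borel_measurable borel" using Fi(1) by simp
  have eqU: "U (y + h) - U y = - (1 / (4 * pi)) * (\<integral>z. exp (U z) * conf z * (ln ((norm (y + h - z))\<^sup>2) - ln ((norm (y - z))\<^sup>2)) \<partial>lborel)
      + (\<rho> / (4 * pi)) * (ln (1 + (norm (y + h))\<^sup>2) - ln (1 + (norm y)\<^sup>2))" for y h
  proof -
    define x x' where "x = stereo_param 1 (y + h)" and "x' = stereo_param 1 y"
    have x: "norm x = 1" "norm x' = 1" unfolding x_def x'_def by simp_all
    define L where "L z = ln ((norm (y + h - z))\<^sup>2) - ln ((norm (y - z))\<^sup>2)" for z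
    define c where "c = ln (1 + (norm (y + h))\<^sup>2) - ln (1 + (norm y)\<^sup>2)"
    have Lm [measurable]: "L \<in> borel_measurable borel" unfolding L_def by measurable
    define g where "g z = (logk x z - logk x' z) * exp (u z)" for z
    have gi: "integrable area g" unfolding g_def
      by (intro integrable_mult_cont ec Bochner_Integration.integrable_diff logk_integrable x)
    then have gm: "g \<in> borel_measurable area" by simp
    define k where "k z = conf z * g (stereo_param 1 z)" for z
    have ki: "integrable lborel k" "(\<integral>z. g z \<partial>area) = (\<integral>z. k z \<partial>lborel)"
      using integral_area_plane[OF gm] gi unfolding k_def by simp_all
    have ae: "AE z in lborel. F z * L z = k z + c * F z"
    proof -
      have "AE z in lborel. z \<notin> {y + h}" by (rule AE_lborel_notin_subsingleton) simp
      moreover have "AE z in lborel. z \<notin> {y}" by (rule AE_lborel_notin_subsingleton) simp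
      ultimately show ?thesis
      proof eventually_elim
        case (elim z)
        then have ne: "y + h \<noteq> z" "y \<noteq> z" by auto
        have lk: "logk x (stereo_param 1 z) - logk x' (stereo_param 1 z) = L z - c"
          unfolding x_def x'_def logk_stereo[OF ne(1)] logk_stereo[OF ne(2)] L_def c_def by simp
        then show ?case unfolding k_def g_def F_def U_def comp_def lk by (simp add: algebra_simps)
      qed
    qed
    have "(\<integral>z. F z * L z \<partial>lborel) = (\<integral>z. k z + c * F z \<partial>lborel)"
    proof (rule integral_cong_AE[OF _ _ ae])
      show "(\<lambda>z. k z + c * F z) \<in> borel_measurable lborel" using ki Fi by simp
      show "(\<lambda>z. F z * L z) \<in> borel_measurable lborel" by measurable
    qed
    also have "\<dots> = (\<integral>z. g z \<partial>area) + c * \<rho>" using ki Fi by simp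
    finally have r: "(\<integral>z. g z \<partial>area) = (\<integral>z. F z * L z \<partial>lborel) - c * \<rho>" by simp
    have "U (y + h) - U y = - (1 / (4 * pi)) * (\<integral>z. g z \<partial>area)"
      using eq[OF x] unfolding U_def comp_def x_def x'_def g_def by simp
    also have "\<dots> = - (1 / (4 * pi)) * (\<integral>z. F z * L z \<partial>lborel) + (\<rho> / (4 * pi)) * c"
      unfolding r by (simp add: algebra_simps)
    finally show ?thesis unfolding L_def c_def F_def .
  qed
  note pr = planar_regularity[OF Uc Ub eqU]
  show "C_class 2 (u \<circ> stereo_param 1)" using pr(1) by (simp only: U_def)
  show "(\<Sum>i\<in>UNIV. pderiv_at i (pderiv_at i (u \<circ> stereo_param 1)) y) = conf y * (\<rho> / (4 * pi) - exp (u (stereo_param 1 y)))"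
    using pr(2)[of y] unfolding U_def by (simp only: comp_def)
qed

text \<open>In dimension two the volume density of a conformal metric times its inverse matrix is
  the identity, so the coordinate formula collapses to the flat Laplacian divided by
  \<open>conf\<close>.\<close>

lemma laplace_beltrami_coord_stereo:
  assumes s: "s\<^sup>2 = 1"
  shows "laplace_beltrami_coord (stereo_param s) u y = (1 / conf y) * (\<Sum>i\<in>UNIV. pderiv_at i (pderiv_at i (u \<circ> stereo_param s)) y)"
proof -
  have vd: "volume_density (stereo_param s) z = conf z" for z unfolding volume_density_stereo[OF s] conf_def ..
  have ent: "conf z * matrix_inv (induced_metric (stereo_param s) z) $ i $ j = (if i = j then 1 else 0)" for z and i j :: 2
  proof -
    define c where "c = conf z"
    have c: "0 < c" unfolding c_def by (rule conf_pos)
    have m: "induced_metric (stereo_param s) z = mat c"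
      by (simp add: vec_eq_iff induced_metric_stereo[OF s] mat_def c_def conf_def)
    have mm: "mat c ** X = (\<chi> i j. c * X $ i $ j)" for X :: "real^2^2"
      by (simp add: vec_eq_iff matrix_matrix_mult_def mat_def if_distrib[where f="\<lambda>x. x * _"] cong: if_cong)
    have mm2: "X ** mat c = (\<chi> i j. c * X $ i $ j)" for X :: "real^2^2"
      by (simp add: vec_eq_iff matrix_matrix_mult_def mat_def if_distrib[where f="\<lambda>x. _ * x"] mult.commute cong: if_cong)
    have "mat c ** mat (1 / c) = (mat 1 :: real^2^2)" "mat (1 / c) ** mat c = (mat 1 :: real^2^2)"
      unfolding mm mm2 using c by (simp_all add: vec_eq_iff mat_def)
    then have "invertible (mat c :: real^2^2)" unfolding invertible_def by blast
    then have "mat c ** matrix_inv (mat c) = (mat 1 :: real^2^2)"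
      unfolding invertible_def matrix_inv_def by (rule someI2_ex) blast
    then have "(mat c ** matrix_inv (mat c)) $ i $ j = (mat 1 :: real^2^2) $ i $ j" by simp
    then show ?thesis unfolding m mm c_def[symmetric] by (simp add: mat_def)
  qed
  have in1: "(\<Sum>j\<in>UNIV. volume_density (stereo_param s) z * matrix_inv (induced_metric (stereo_param s) z) $ i $ j * pderiv_at j (u \<circ> stereo_param s) z)
      = pderiv_at i (u \<circ> stereo_param s) z" for i z
    unfolding vd ent by (simp add: if_distrib[where f="\<lambda>x. x * _"] cong: if_cong)
  show ?thesis unfolding laplace_beltrami_coord_def in1 unfolding vd ..
qed

text \<open>One chart is \<open>chart_regularity\<close>. The reflection \<open>R\<close> in the
  equatorial plane exchanges the two charts and preserves the area and the kernel, so the same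
  result for u composed with \<open>R\<close> covers the other chart.\<close>

theorem mean_field_of_integral_equation:
  fixes u :: "real^3 \<Rightarrow> real"
  assumes uc: "continuous_on S2 u"
    and eq: "\<And>x x'. norm x = 1 \<Longrightarrow> norm x' = 1 \<Longrightarrow>
      u x - u x' = - (1 / (4 * pi)) * (\<integral>z. (logk x z - logk x' z) * exp (u z) \<partial>area)"
    and r: "(\<integral>z. exp (u z) \<partial>area) = \<rho>" "\<rho> \<noteq> 0"
  shows "mean_field_solution \<rho> u"
proof -
  define R :: "real^3 \<Rightarrow> real^3" where "R x = x - (2 * (x \<bullet> axis 3 1)) *\<^sub>R axis 3 1" for x
  have Rl: "linear R" unfolding R_def by (rule linearI) (simp_all add: algebra_simps inner_add_left scaleR_add_left)
  have RR: "R x \<bullet> R y = x \<bullet> y" for x y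
    unfolding R_def by (simp add: inner_diff_left inner_diff_right inner_axis_axis algebra_simps inner_commute)
  have Ro: "orthogonal_transformation R" unfolding orthogonal_transformation_def using Rl RR by blast
  have R3: "R x = x - (2 * x $ 3) *\<^sub>R axis 3 1" for x by (simp add: R_def inner_axis)
  have Rs: "R (stereo_param 1 y) = stereo_param (-1) y" for y
    by (simp add: R3 vec_eq_iff forall_3 stereo_param_nth axis_def field_simps)
  have Rc: "continuous_on S2 R" using Rl by (rule linear_continuous_on_compose[OF continuous_on_id])
  have uRc: "continuous_on S2 (\<lambda>x. u (R x))"
    by (rule continuous_on_compose2[OF uc Rc]) (use orth_S2[OF Ro] in auto)
  have ec: "continuous_on S2 (\<lambda>z. exp (u z))" by (intro continuous_intros uc)
  have em: "(\<lambda>z. exp (u z)) \<in> borel_measurable area" by (rule borel_measurable_areaI[OF ec])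
  have rR: "(\<integral>z. exp (u (R z)) \<partial>area) = \<rho>" using integral_area_orth[OF Ro em] r(1) by simp
  have eqR: "u (R x) - u (R x') = - (1 / (4 * pi)) * (\<integral>z. (logk x z - logk x' z) * exp (u (R z)) \<partial>area)"
    if x: "norm x = 1" "norm x' = 1" for x x'
  proof -
    have n: "norm (R x) = 1" "norm (R x') = 1" using x by (simp_all add: orth_norm[OF Ro])
    have m: "(\<lambda>z. (logk (R x) z - logk (R x') z) * exp (u z)) \<in> borel_measurable area" using em by measurable
    have "(\<integral>z. (logk (R x) z - logk (R x') z) * exp (u z) \<partial>area) = (\<integral>z. (logk (R x) (R z) - logk (R x') (R z)) * exp (u (R z)) \<partial>area)"
      by (rule integral_area_orth[OF Ro m, symmetric])
    then show ?thesis using eq[OF n] by (simp add: logk_def RR)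
  qed
  have main: "C_class 2 (u \<circ> stereo_param s) \<and> (\<forall>y. laplace_beltrami_coord (stereo_param s) u y = \<rho> / (4 * pi) - exp (u (stereo_param s y)))"
    if s: "s = 1 \<or> s = -1" for s
  proof -
    have cp: "conf y \<noteq> 0" for y using conf_pos[of y] by simp
    show ?thesis
    proof (cases "s = 1")
      case True
      have c1: "C_class 2 (u \<circ> stereo_param 1)" by (rule chart_regularity(1)[OF uc eq])
      have c2: "(\<Sum>i\<in>UNIV. pderiv_at i (pderiv_at i (u \<circ> stereo_param 1)) y) = conf y * (\<rho> / (4 * pi) - exp (u (stereo_param 1 y)))" for y
        using chart_regularity(2)[OF uc eq, of y] unfolding r(1) .
      show ?thesis unfolding True
      proof (intro conjI allI)
        show "C_class 2 (u \<circ> stereo_param 1)" by (rule c1)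
        fix y
        have l: "laplace_beltrami_coord (stereo_param 1) u y = (1 / conf y) * (conf y * (\<rho> / (4 * pi) - exp (u (stereo_param 1 y))))"
          using laplace_beltrami_coord_stereo[of 1 u y] unfolding c2 by simp
        then show "laplace_beltrami_coord (stereo_param 1) u y = \<rho> / (4 * pi) - exp (u (stereo_param 1 y))" using cp[of y] by simp
      qed
    next
      case False
      then have s: "s = -1" using s by simp
      have e: "(\<lambda>x. u (R x)) \<circ> stereo_param 1 = u \<circ> stereo_param (-1)" by (rule ext) (simp add: Rs)
      have c1: "C_class 2 (u \<circ> stereo_param (-1))" using chart_regularity(1)[OF uRc eqR] unfolding e .
      have c2: "(\<Sum>i\<in>UNIV. pderiv_at i (pderiv_at i (u \<circ> stereo_param (-1))) y) = conf y * (\<rho> / (4 * pi) - exp (u (stereo_param (-1) y)))" for y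
        using chart_regularity(2)[OF uRc eqR, of y] unfolding e rR Rs .
      show ?thesis unfolding s
      proof (intro conjI allI)
        show "C_class 2 (u \<circ> stereo_param (-1))" by (rule c1)
        fix y
        have l: "laplace_beltrami_coord (stereo_param (-1)) u y = (1 / conf y) * (conf y * (\<rho> / (4 * pi) - exp (u (stereo_param (-1) y))))"
          using laplace_beltrami_coord_stereo[of "-1" u y] unfolding c2 by simp
        then show "laplace_beltrami_coord (stereo_param (-1)) u y = \<rho> / (4 * pi) - exp (u (stereo_param (-1) y))" using cp[of y] by simp
      qed
    qed
  qed
  show ?thesis unfolding mean_field_solution_def r(1)
  proof (intro conjI ballI)
    show "C2_on_sphere u" unfolding C2_on_sphere_def using main by blast
    fix x :: "real^3" assume "x \<in> S2"
    then have x: "norm x = 1" by simp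
    define s :: real where "s = (if x $ 3 \<le> 0 then 1 else -1)"
    have s: "s = 1 \<or> s = -1" "s\<^sup>2 = 1" "s * x $ 3 \<noteq> 1" by (auto simp: s_def)
    have "laplace_beltrami u x = laplace_beltrami_coord (stereo_param s) u (stereo_proj s x)"
      unfolding laplace_beltrami_def s_def Let_def ..
    also have "\<dots> = \<rho> / (4 * pi) - exp (u x)" using main[OF s(1)] stereo_param_proj[OF s(2) x s(3)] by simp
    finally have l: "laplace_beltrami u x = \<rho> / (4 * pi) - exp (u x)" .
    show "laplace_beltrami u x + \<rho> * (exp (u x) / \<rho> - 1 / (4 * pi)) = 0" unfolding l right_diff_distrib using r(2) by simp
  qed
qed

section \<open>The solutions\<close>

context tetra begin

text \<open>One copy of \<open>chiL s\<close> for each bubble. The subtracted constants are those of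
  \<open>Dop\<close>, so that in blown-up coordinates \<open>phi s\<close> becomes the exponent in
  \<open>Hf\<close>.\<close>

definition phi :: "real \<Rightarrow> real^3 \<Rightarrow> real" where
  "phi s x = (\<Sum>k\<in>UNIV. chiL s (Ph s (refl 1 k x))) - (\<Sum>k\<in>UNIV-{1}. chiL s (Ph s (\<xi> k)))"

text \<open>Apart from \<open>phi s\<close>, the logarithm of 2 * s^2 times \<open>Ef\<close> times
  the sum of the 1 / (aa s - x \<bullet> \<xi> k)^2. The polynomial \<open>Pf\<close> in the
  denominator of \<open>Ef\<close> cancels the numerator of that sum, and only the product of the
  four factors remains. The leading 2 gives each bubble the limiting mass 8 * pi.\<close>

definition us :: "real \<Rightarrow> real^3 \<Rightarrow> real" where
  "us s x = ln (2 * s\<^sup>2 * Pf (aa s) (\<xi> 1)) - 2 * (\<Sum>k\<in>UNIV. ln (aa s - x \<bullet> \<xi> k)) + phi s x"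

lemma Ph_Th: "0 < s \<Longrightarrow> s \<le> 1 \<Longrightarrow> norm x = 1 \<Longrightarrow> Ph s (Th s x) = x"
  using bub_inverse[OF aa_facts(1), of s "- \<xi> 1" x] by simp

lemma Th_Ph: "0 < s \<Longrightarrow> s \<le> 1 \<Longrightarrow> norm x = 1 \<Longrightarrow> Th s (Ph s x) = x"
  using bub_inverse[OF aa_facts(1), of s "\<xi> 1" x] by simp

lemma phi_Th:
  assumes s: "0 < s" "s \<le> 1" and x: "norm x = 1"
  shows "phi s (Th s x) = chiL s x + Dop s (chiL s) x"
  unfolding phi_def Dop_def sum_subtractf using Ph_Th[OF s x] by (subst sum.remove[of _ 1]) simp_all

lemma refl_inner: "refl 1 k x \<bullet> \<xi> 1 = x \<bullet> \<xi> k" "refl 1 k x \<bullet> \<xi> k = x \<bullet> \<xi> 1"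
  using symm_inner[OF refl_symm[of 1 k], of x "\<xi> k"] symm_inner[OF refl_symm[of 1 k], of x "\<xi> 1"] by (simp_all add: refl_xi)

text \<open>By \<open>symm_factor\<close> a symmetry permutes the four summands of
  \<open>phi s\<close> up to elements of the stabilizer, under which \<open>chiL s\<close> is
  invariant.\<close>

lemma us_symm:
  assumes s: "small s" and T: "symm T" and x: "norm x = 1"
  shows "us s (T x) = us s x"
proof -
  note S = smallD[OF s]
  obtain p where p: "bij p" "\<And>k. T (\<xi> k) = \<xi> (p k)"
    "\<And>j. \<exists>S. stab S \<and> (\<forall>x. refl 1 (p j) (T x) = S (refl 1 j x))" using symm_factor[OF T] by metis
  have bij: "bij_betw p UNIV UNIV" using p(1) by (simp add: bij_def bij_betw_def)
  have "(\<Sum>k\<in>UNIV. chiL s (Ph s (refl 1 k (T x)))) = (\<Sum>j\<in>UNIV. chiL s (Ph s (refl 1 (p j) (T x))))"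
    by (rule sum.reindex_bij_betw[OF bij, symmetric])
  also have "\<dots> = (\<Sum>j\<in>UNIV. chiL s (Ph s (refl 1 j x)))"
  proof (rule sum.cong[OF HOL.refl])
    fix j
    obtain V where V: "stab V" "\<And>x. refl 1 (p j) (T x) = V (refl 1 j x)" using p(3) by blast
    have V': "symm V" "V (\<xi> 1) = \<xi> 1" using V(1) by (auto simp: stab_def)
    have "Ph s (refl 1 (p j) (T x)) = V (Ph s (refl 1 j x))" unfolding V(2) using bub_T(2)[OF V'] by metis
    moreover have "norm (Ph s (refl 1 j x)) = 1" by (rule Ph_norm[OF S(1,3)]) (simp add: refl_norm x)
    ultimately show "chiL s (Ph s (refl 1 (p j) (T x))) = chiL s (Ph s (refl 1 j x))"
      using chiL_inv[OF s] V(1) by (simp add: inv1_def)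
  qed
  finally have 1: "phi s (T x) = phi s x" unfolding phi_def by simp
  have "(\<Sum>k\<in>UNIV. ln (aa s - T x \<bullet> \<xi> k)) = (\<Sum>j\<in>UNIV. ln (aa s - T x \<bullet> \<xi> (p j)))"
    by (rule sum.reindex_bij_betw[OF bij, symmetric])
  also have "\<dots> = (\<Sum>j\<in>UNIV. ln (aa s - x \<bullet> \<xi> j))" unfolding p(2)[symmetric] symm_inner[OF T] ..
  finally show ?thesis unfolding us_def 1 by simp
qed

lemma refl_cont: "continuous_on A (refl k l)"
  by (rule linear_continuous_on) (simp add: linear_conv_bounded_linear[symmetric] refl_linear)

lemma phi_cont: "small s \<Longrightarrow> continuous_on S2 (phi s)"
proof -
  assume s: "small s"
  note S = smallD[OF s]
  have "continuous_on S2 (\<lambda>x. chiL s (Ph s (refl 1 k x)))" for k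
  proof (rule continuous_on_compose2[OF hold_cont[OF chiL_hold(2)[OF s]]])
    show "continuous_on S2 (\<lambda>x. Ph s (refl 1 k x))"
      by (rule continuous_on_compose2[OF Ph_cont[OF S(1,3)] refl_cont]) (auto simp: refl_norm)
    show "(\<lambda>x. Ph s (refl 1 k x)) ` S2 \<subseteq> S2" using Ph_norm[OF S(1,3)] by (auto simp: refl_norm)
  qed
  then show ?thesis unfolding phi_def by (intro continuous_intros)
qed

lemma us_cont: "small s \<Longrightarrow> continuous_on S2 (us s)"
proof -
  assume s: "small s"
  note S = smallD[OF s]
  have "aa s - x \<bullet> \<xi> k \<noteq> 0" if "x \<in> S2" for x k
    using a_minus_pos[OF aa_facts(1)[OF S(1,3)] nrm[of k], of x] that by simp
  then show ?thesis unfolding us_def by (intro continuous_intros phi_cont s) auto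
qed

lemma exp_us:
  assumes s: "small s" and x: "norm x = 1"
  shows "exp (us s x) = (\<Sum>k\<in>UNIV. 2 * ((jf (aa s) (\<xi> k) x)\<^sup>2 * (Ef (aa s) x * exp (phi s x))))"
proof -
  note S = smallD[OF s] note a = aa_facts[OF S(1,3)]
  define A where "A k = aa s - x \<bullet> \<xi> k" for k
  have A: "0 < A k" for k unfolding A_def by (rule a_minus_pos[OF a(1) nrm x])
  have P0: "0 < Pf (aa s) x" "0 < Pf (aa s) (\<xi> 1)" using Pf_lower[of x "aa s"] Pf_lower[of "\<xi> 1" "aa s"] x a by simp_all
  have P: "Pf (aa s) x = (A 2 * (A 3 * A 4))\<^sup>2 + (A 1 * (A 3 * A 4))\<^sup>2 + (A 1 * (A 2 * A 4))\<^sup>2 + (A 1 * (A 2 * A 3))\<^sup>2"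
    unfolding Pf_def four prd_expl A_def ..
  have e: "exp (us s x) = 2 * s\<^sup>2 * Pf (aa s) (\<xi> 1) / (A 1 * A 2 * A 3 * A 4)\<^sup>2 * exp (phi s x)"
  proof -
    have "exp (us s x) = exp (ln (2 * s\<^sup>2 * Pf (aa s) (\<xi> 1))) / (exp (2 * (ln (A 1) + ln (A 2) + ln (A 3) + ln (A 4)))) * exp (phi s x)"
      unfolding us_def exp_add exp_diff four A_def[symmetric] ..
    also have "exp (ln (2 * s\<^sup>2 * Pf (aa s) (\<xi> 1))) = 2 * s\<^sup>2 * Pf (aa s) (\<xi> 1)" using P0 S(1) by simp
    also have "exp (2 * (ln (A 1) + ln (A 2) + ln (A 3) + ln (A 4))) = (A 1 * A 2 * A 3 * A 4)\<^sup>2"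
      using A by (simp add: exp_double exp_add power_mult_distrib)
    finally show ?thesis .
  qed
  have f: "1 / p\<^sup>2 + 1 / q\<^sup>2 + 1 / r\<^sup>2 + 1 / t\<^sup>2 = ((q * (r * t))\<^sup>2 + (p * (r * t))\<^sup>2 + (p * (q * t))\<^sup>2 + (p * (q * r))\<^sup>2) / (p * q * r * t)\<^sup>2"
    if "0 < p" "0 < q" "0 < r" "0 < t" for p q r t :: real
    using that by (simp add: field_simps power_mult_distrib)
  have "(\<Sum>k\<in>UNIV. 2 * ((jf (aa s) (\<xi> k) x)\<^sup>2 * (Ef (aa s) x * exp (phi s x))))
     = 2 * s\<^sup>2 * (Ef (aa s) x * exp (phi s x)) * (\<Sum>k\<in>UNIV. 1 / (A k)\<^sup>2)"
    unfolding sum_distrib_left jf_def a(4) A_def by (rule sum.cong) (simp_all add: power_divide)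
  also have "(\<Sum>k\<in>UNIV. 1 / (A k)\<^sup>2) = Pf (aa s) x / (A 1 * A 2 * A 3 * A 4)\<^sup>2" unfolding four P by (rule f[OF A A A A])
  also have "2 * s\<^sup>2 * (Ef (aa s) x * exp (phi s x)) * (Pf (aa s) x / (A 1 * A 2 * A 3 * A 4)\<^sup>2) = exp (us s x)"
    unfolding e Ef_def using P0 by simp
  finally show ?thesis ..
qed

text \<open>Each of the four terms of \<open>exp_us\<close> is moved to the first vertex by
  \<open>refl 1 k\<close>; the square of \<open>jf\<close> in it is then the Jacobian of
  \<open>Ph s\<close>, so the change to blown-up coordinates makes no error.\<close>

lemma integral_exp_us:
  assumes s: "small s" and h: "integrable area h"
  shows "(\<integral>x. h x * exp (us s x) \<partial>area) = (\<Sum>k\<in>UNIV. 2 * (\<integral>y. h (refl 1 k (Th s y)) * (1 + Hf s y) \<partial>area))"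
    and "integrable area (\<lambda>y. h (refl 1 k (Th s y)) * (1 + Hf s y))"
proof -
  note S = smallD[OF s] note a = aa_facts[OF S(1,3)]
  define g where "g x = Ef (aa s) x * exp (phi s x)" for x
  have a1: "1 \<le> aa s" using a by simp
  have gc: "continuous_on S2 g" unfolding g_def by (intro continuous_intros Ef_cont a1 phi_cont s)
  have g1: "g (Th s y) = 1 + Hf s y" if "norm y = 1" for y
    unfolding g_def phi_Th[OF S(1,3) that] Hf_def by simp
  have gr: "g (refl 1 k x) = g x" if "norm x = 1" for k x
  proof -
    have "us s (refl 1 k x) = us s x" by (rule us_symm[OF s refl_symm that])
    moreover have "(\<Sum>j\<in>UNIV. ln (aa s - refl 1 k x \<bullet> \<xi> j)) = (\<Sum>j\<in>UNIV. ln (aa s - x \<bullet> \<xi> j))"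
    proof -
      obtain p where p: "bij p" "\<And>j. refl 1 k (\<xi> j) = \<xi> (p j)" using symm_factor[OF refl_symm[of 1 k]] by metis
      have bij: "bij_betw p UNIV UNIV" using p(1) by (simp add: bij_def bij_betw_def)
      have "(\<Sum>j\<in>UNIV. ln (aa s - refl 1 k x \<bullet> \<xi> j)) = (\<Sum>j\<in>UNIV. ln (aa s - refl 1 k x \<bullet> \<xi> (p j)))"
        by (rule sum.reindex_bij_betw[OF bij, symmetric])
      then show ?thesis unfolding p(2)[symmetric] symm_inner[OF refl_symm] .
    qed
    ultimately have "phi s (refl 1 k x) = phi s x" unfolding us_def by simp
    then show ?thesis unfolding g_def Ef_symm[OF refl_symm] by simp
  qed
  have jc: "continuous_on S2 (jf (aa s) (\<xi> k))" for k by (rule jf_cont[OF a(1) nrm])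
  have hi: "integrable area (\<lambda>x. 2 * (h x * ((jf (aa s) (\<xi> k) x)\<^sup>2 * g x)))" for k
    by (intro integrable_mult_right integrable_mult_cont[OF h] continuous_intros jc gc)
  have Tm: "Th s \<in> restrict_space borel S2 \<rightarrow>\<^sub>M restrict_space borel S2"
    by (rule measurable_restrict_space2) (use Th_facts(1)[OF S(1,3)] Th_cont[OF S(1,3)] in \<open>auto intro: measurable_areaI simp: space_restrict_space\<close>)
  have om: "refl 1 k \<in> restrict_space borel S2 \<rightarrow>\<^sub>M restrict_space borel S2" for k by (rule distr_area_orth(2)[OF refl_orth])
  have hm: "h \<in> borel_measurable (restrict_space borel S2)" using h measurable_area_eq by auto
  have gm: "g \<in> borel_measurable (restrict_space borel S2)" by (rule measurable_areaI[OF gc])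
  have fm: "(\<lambda>y. h (refl 1 k (Th s y)) * g (Th s y)) \<in> borel_measurable (restrict_space borel S2)" for k
    by (intro borel_measurable_times measurable_compose[OF Tm gm] measurable_compose[OF measurable_compose[OF Tm om] hm])
  then have fm': "(\<lambda>y. h (refl 1 k (Th s y)) * g (Th s y)) \<in> borel_measurable area" for k unfolding measurable_area_eq .
  note B = integral_bub[OF a(1) nrm[of 1] fm']
  have each: "(\<integral>x. h x * ((jf (aa s) (\<xi> k) x)\<^sup>2 * g x) \<partial>area) = (\<integral>y. h (refl 1 k (Th s y)) * g (Th s y) \<partial>area)"
     "integrable area (\<lambda>y. h (refl 1 k (Th s y)) * g (Th s y))" for k
  proof -
    have i0: "integrable area (\<lambda>x. h x * ((jf (aa s) (\<xi> k) x)\<^sup>2 * g x))" by (intro integrable_mult_cont[OF h] continuous_intros jc gc)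
    then have m0: "(\<lambda>x. h x * ((jf (aa s) (\<xi> k) x)\<^sup>2 * g x)) \<in> borel_measurable area" by simp
    have pt: "h (refl 1 k x) * ((jf (aa s) (\<xi> k) (refl 1 k x))\<^sup>2 * g (refl 1 k x)) = (jf (aa s) (\<xi> 1) x)\<^sup>2 * (h (refl 1 k (Th s (Ph s x))) * g (Th s (Ph s x)))"
      if "x \<in> space area" for x
    proof -
      have x: "norm x = 1" using that by simp
      show ?thesis unfolding gr[OF x] Th_Ph[OF S(1,3) x] by (simp add: jf_def refl_inner)
    qed
    have "(\<integral>x. h x * ((jf (aa s) (\<xi> k) x)\<^sup>2 * g x) \<partial>area) = (\<integral>x. h (refl 1 k x) * ((jf (aa s) (\<xi> k) (refl 1 k x))\<^sup>2 * g (refl 1 k x)) \<partial>area)"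
      by (rule integral_area_orth[OF refl_orth m0, symmetric])
    also have "\<dots> = (\<integral>x. (jf (aa s) (\<xi> 1) x)\<^sup>2 * (h (refl 1 k (Th s (Ph s x))) * g (Th s (Ph s x))) \<partial>area)"
      by (rule Bochner_Integration.integral_cong[OF HOL.refl pt])
    also have "\<dots> = (\<integral>y. h (refl 1 k (Th s y)) * g (Th s y) \<partial>area)" by (rule B(1))
    finally show "(\<integral>x. h x * ((jf (aa s) (\<xi> k) x)\<^sup>2 * g x) \<partial>area) = (\<integral>y. h (refl 1 k (Th s y)) * g (Th s y) \<partial>area)" .
    have d: "distr area (restrict_space borel S2) (refl 1 k) = area" by (rule distr_area_orth(1)[OF refl_orth])
    have om': "refl 1 k \<in> area \<rightarrow>\<^sub>M restrict_space borel S2" unfolding measurable_area_eq by (rule om)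
    have m0': "(\<lambda>x. h x * ((jf (aa s) (\<xi> k) x)\<^sup>2 * g x)) \<in> borel_measurable (restrict_space borel S2)" using m0 unfolding measurable_area_eq .
    have "integrable area (\<lambda>x. h (refl 1 k x) * ((jf (aa s) (\<xi> k) (refl 1 k x))\<^sup>2 * g (refl 1 k x)))"
      using integrable_distr_eq[OF om' m0'] i0 unfolding d by simp
    then have "integrable area (\<lambda>x. (jf (aa s) (\<xi> 1) x)\<^sup>2 * (h (refl 1 k (Th s (Ph s x))) * g (Th s (Ph s x))))"
      using Bochner_Integration.integrable_cong[OF HOL.refl pt, of area "\<lambda>x. x"] by (simp cong: Bochner_Integration.integrable_cong add: pt)
    then show "integrable area (\<lambda>y. h (refl 1 k (Th s y)) * g (Th s y))" using B(2) by blast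
  qed
  have gH: "(\<integral>y. h (refl 1 k (Th s y)) * g (Th s y) \<partial>area) = (\<integral>y. h (refl 1 k (Th s y)) * (1 + Hf s y) \<partial>area)" for k
    by (rule Bochner_Integration.integral_cong) (simp_all add: g1)
  show "integrable area (\<lambda>y. h (refl 1 k (Th s y)) * (1 + Hf s y))"
    using each(2)[of k] by (subst Bochner_Integration.integrable_cong[where g="\<lambda>y. h (refl 1 k (Th s y)) * g (Th s y)"]) (simp_all add: g1)
  have "(\<integral>x. h x * exp (us s x) \<partial>area) = (\<integral>x. (\<Sum>k\<in>UNIV. 2 * (h x * ((jf (aa s) (\<xi> k) x)\<^sup>2 * g x))) \<partial>area)"
  proof (rule Bochner_Integration.integral_cong[OF HOL.refl])
    fix x assume "x \<in> space area"
    then have x: "norm x = 1" by simp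
    show "h x * exp (us s x) = (\<Sum>k\<in>UNIV. 2 * (h x * ((jf (aa s) (\<xi> k) x)\<^sup>2 * g x)))"
      unfolding exp_us[OF s x] g_def[symmetric] sum_distrib_left by (rule sum.cong) simp_all
  qed
  also have "\<dots> = (\<Sum>k\<in>UNIV. \<integral>x. 2 * (h x * ((jf (aa s) (\<xi> k) x)\<^sup>2 * g x)) \<partial>area)"
    by (rule Bochner_Integration.integral_sum) (rule hi)
  also have "\<dots> = (\<Sum>k\<in>UNIV. 2 * (\<integral>y. h (refl 1 k (Th s y)) * (1 + Hf s y) \<partial>area))"
    unfolding integral_mult_right_zero each(1) gH ..
  finally show "(\<integral>x. h x * exp (us s x) \<partial>area) = (\<Sum>k\<in>UNIV. 2 * (\<integral>y. h (refl 1 k (Th s y)) * (1 + Hf s y) \<partial>area))" .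
qed

lemma Hf_integral: "small s \<Longrightarrow> (\<integral>y. 1 + Hf s y \<partial>area) = 4 * pi + mu s"
  using integrable_area_cont[OF chiL_equation(3)] chiL_equation(2) by (simp add: measure_area)

lemma us_mass:
  assumes s: "small s"
  shows "(\<integral>x. exp (us s x) \<partial>area) = 32 * pi + 8 * mu s"
proof -
  have "(\<integral>x. 1 * exp (us s x) \<partial>area) = (\<Sum>k\<in>(UNIV::4 set). 2 * (\<integral>y. 1 * (1 + Hf s y) \<partial>area))"
    by (rule integral_exp_us(1)[OF s area.integrable_const])
  also have "\<dots> = 32 * pi + 8 * mu s" unfolding mult_1 Hf_integral[OF s] by simp
  finally show ?thesis by simp
qed

text \<open>Conformal covariance adds the constant \<open>w\<close> to the difference of kernels,
  which is multiplied by the total mass 4 * pi + mu s. The multiplier term in the equation for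
  \<open>chiL s\<close> contributes - mu s * w, because \<open>qf s\<close> is itself a bubble at -
  \<xi> 1 with an explicit potential. The two terms with the multiplier cancel, which is why it may
  be nonzero.\<close>

lemma bubble_log_difference:
  assumes s: "small s" and X: "norm X = 1" "norm X' = 1"
  shows "(\<integral>y. (logk X (Th s y) - logk X' (Th s y)) * (1 + Hf s y) \<partial>area)
    = 4 * pi * (ln (aa s - X \<bullet> \<xi> 1) - ln (aa s - X' \<bullet> \<xi> 1)) - 2 * pi * (chiL s (Ph s X) - chiL s (Ph s X'))"
proof -
  note S = smallD[OF s] note a = aa_facts[OF S(1,3)]
  define P P' where "P = Ph s X" and "P' = Ph s X'"
  have P: "norm P = 1" "norm P' = 1" unfolding P_def P'_def by (rule Ph_norm[OF S(1,3)], fact)+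
  have mN: "norm (- \<xi> 1) = 1" by simp
  have jP: "aa s + Ph s Z \<bullet> \<xi> 1 = s\<^sup>2 / (aa s - Z \<bullet> \<xi> 1)" "0 < aa s - Z \<bullet> \<xi> 1" if "norm Z = 1" for Z
  proof -
    show p: "0 < aa s - Z \<bullet> \<xi> 1" by (rule a_minus_pos[OF a(1) nrm that])
    have "aa s + (aa s * t - 1) / (aa s - t) = ((aa s)\<^sup>2 - 1) / (aa s - t)" if "0 < aa s - t" for t
      using that by (simp add: field_simps power2_eq_square)
    from this[OF p] show "aa s + Ph s Z \<bullet> \<xi> 1 = s\<^sup>2 / (aa s - Z \<bullet> \<xi> 1)"
      unfolding bub_p[OF a(1) nrm that] a(3) .
  qed
  define w where "w = ln (aa s - X \<bullet> \<xi> 1) - ln (aa s - X' \<bullet> \<xi> 1)"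
  have lnP: "ln (aa s + Ph s Z \<bullet> \<xi> 1) = ln (s\<^sup>2) - ln (aa s - Z \<bullet> \<xi> 1)" if "norm Z = 1" for Z
    unfolding jP(1)[OF that] using S(1) jP(2)[OF that] by (simp add: ln_div)
  have lw: "ln (aa s + P \<bullet> \<xi> 1) - ln (aa s + P' \<bullet> \<xi> 1) = - w" unfolding w_def P_def P'_def lnP[OF X(1)] lnP[OF X(2)] by simp
  have lj: "ln (jf (aa s) (- \<xi> 1) P) - ln (jf (aa s) (- \<xi> 1) P') = w"
  proof -
    have pos: "0 < aa s + P \<bullet> \<xi> 1" "0 < aa s + P' \<bullet> \<xi> 1" using Th_facts(2)[OF S(1,3) P(1)] Th_facts(2)[OF S(1,3) P(2)] .
    have "jf (aa s) (- \<xi> 1) P = s / (aa s + P \<bullet> \<xi> 1)" "jf (aa s) (- \<xi> 1) P' = s / (aa s + P' \<bullet> \<xi> 1)" unfolding jf_def a(4) by simp_all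
    then show ?thesis using lw pos S(1) by (simp add: ln_div)
  qed
  define d where "d y = logk P y - logk P' y" for y
  have di: "integrable area d" unfolding d_def by (intro Bochner_Integration.integrable_diff logk_integrable P)
  have d0: "(\<integral>y. d y \<partial>area) = 0" unfolding d_def using logk_integrable(1)[OF P(1)] logk_integrable(1)[OF P(2)]
    by (simp add: logk_integrable(2)[OF P(1)] logk_integrable(2)[OF P(2)])
  note Hc = chiL_equation(3)[OF s]
  have Hi: "integrable area (Hf s)" by (rule integrable_area_cont[OF Hc])
  have dHi: "integrable area (\<lambda>y. d y * Hf s y)" by (rule integrable_mult_cont[OF di Hc])
  have dqi: "integrable area (\<lambda>y. d y * qf s y)" by (rule integrable_mult_cont[OF di qf_cont[OF S(1,3)]])
  have dq: "(\<integral>y. d y * qf s y \<partial>area) = - w"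
  proof -
    obtain C where C: "\<And>x. norm x = 1 \<Longrightarrow> integrable area (\<lambda>z. (jf (aa s) (- \<xi> 1) z)\<^sup>2 * logk x z)"
      "\<And>x. norm x = 1 \<Longrightarrow> (\<integral>z. (jf (aa s) (- \<xi> 1) z)\<^sup>2 * logk x z \<partial>area) = 4 * pi * ln (aa s - x \<bullet> (- \<xi> 1)) + C"
      using bubble_potential[OF a(1) mN] by blast
    have q: "qf s y = (1 / (4 * pi)) * (jf (aa s) (- \<xi> 1) y)\<^sup>2" for y unfolding qf_def jf_def a(4) by (simp add: power_divide)
    have "(\<integral>y. d y * qf s y \<partial>area) = (\<integral>y. (1 / (4 * pi)) * ((jf (aa s) (- \<xi> 1) y)\<^sup>2 * logk P y - (jf (aa s) (- \<xi> 1) y)\<^sup>2 * logk P' y) \<partial>area)"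
    proof (rule Bochner_Integration.integral_cong[OF HOL.refl])
      have g: "(p - q) * (c * j) = c * (j * p - j * q)" for p q c j :: real by (simp add: algebra_simps)
      show "d y * qf s y = (1 / (4 * pi)) * ((jf (aa s) (- \<xi> 1) y)\<^sup>2 * logk P y - (jf (aa s) (- \<xi> 1) y)\<^sup>2 * logk P' y)" for y
        unfolding q d_def by (rule g)
    qed
    also have "\<dots> = (1 / (4 * pi)) * ((4 * pi * ln (aa s - P \<bullet> (- \<xi> 1)) + C) - (4 * pi * ln (aa s - P' \<bullet> (- \<xi> 1)) + C))"
      unfolding integral_mult_right_zero Bochner_Integration.integral_diff[OF C(1)[OF P(1)] C(1)[OF P(2)]] C(2)[OF P(1)] C(2)[OF P(2)] ..
    also have "\<dots> = ln (aa s + P \<bullet> \<xi> 1) - ln (aa s + P' \<bullet> \<xi> 1)" by (simp add: field_simps)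
    finally show ?thesis unfolding lw .
  qed
  have "(\<integral>z. (logk P z - logk P' z) * (Hf s z - mu s * qf s z) \<partial>area) = (\<integral>y. d y * Hf s y - mu s * (d y * qf s y) \<partial>area)"
    unfolding d_def by (rule Bochner_Integration.integral_cong) (simp_all add: algebra_simps)
  also have "\<dots> = (\<integral>y. d y * Hf s y \<partial>area) - mu s * (- w)" using dHi dqi dq by simp
  finally have "chiL s P - chiL s P' = - (1 / (2 * pi)) * ((\<integral>y. d y * Hf s y \<partial>area) + mu s * w)"
    using chiL_equation(1)[OF s P] by simp
  then have dH: "(\<integral>y. d y * Hf s y \<partial>area) = - 2 * pi * (chiL s P - chiL s P') - mu s * w" by (simp add: field_simps)
  have ae: "AE y in area. (logk X (Th s y) - logk X' (Th s y)) * (1 + Hf s y) = w * (1 + Hf s y) + d y + d y * Hf s y"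
    using AE_area_ne[OF P(1)] AE_area_ne[OF P(2)] AE_space
  proof eventually_elim
    case (elim y)
    then have y: "norm y = 1" "0 < 1 - P \<bullet> y" "0 < 1 - P' \<bullet> y" by (simp_all add: inner_commute)
    have e: "logk X (Th s y) = ln (jf (aa s) (- \<xi> 1) P) + ln (jf (aa s) (- \<xi> 1) y) + logk P y"
      using logk_bub[OF a(1) mN P(1) y(1,2)] Th_Ph[OF S(1,3) X(1)] unfolding P_def by simp
    have e': "logk X' (Th s y) = ln (jf (aa s) (- \<xi> 1) P') + ln (jf (aa s) (- \<xi> 1) y) + logk P' y"
      using logk_bub[OF a(1) mN P(2) y(1,3)] Th_Ph[OF S(1,3) X(2)] unfolding P'_def by simp
    have "logk X (Th s y) - logk X' (Th s y) = w + d y" unfolding e e' d_def lj[symmetric] by simp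
    then show ?case by (simp add: algebra_simps)
  qed
  have Tm: "Th s \<in> area \<rightarrow>\<^sub>M restrict_space borel S2" unfolding measurable_area_eq
    by (rule measurable_restrict_space2) (use Th_facts(1)[OF S(1,3)] Th_cont[OF S(1,3)] in \<open>auto intro: measurable_areaI simp: space_restrict_space\<close>)
  have lm: "logk Z \<in> borel_measurable (restrict_space borel S2)" for Z using logk_measurable[of Z] unfolding measurable_area_eq .
  have ri: "integrable area (\<lambda>y. w * (1 + Hf s y) + d y + d y * Hf s y)"
    by (intro Bochner_Integration.integrable_add integrable_mult_right area.integrable_const Hi di dHi)
  have "(\<integral>y. (logk X (Th s y) - logk X' (Th s y)) * (1 + Hf s y) \<partial>area) = (\<integral>y. w * (1 + Hf s y) + d y + d y * Hf s y \<partial>area)"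
  proof (rule integral_cong_AE[OF _ _ ae])
    show "(\<lambda>y. (logk X (Th s y) - logk X' (Th s y)) * (1 + Hf s y)) \<in> borel_measurable area"
      using Hi by (intro borel_measurable_times borel_measurable_diff borel_measurable_add measurable_compose[OF Tm lm]) auto
    show "(\<lambda>y. w * (1 + Hf s y) + d y + d y * Hf s y) \<in> borel_measurable area" using ri by simp
  qed
  also have "\<dots> = w * (\<integral>y. 1 + Hf s y \<partial>area) + (\<integral>y. d y \<partial>area) + (\<integral>y. d y * Hf s y \<partial>area)"
  proof -
    have i: "integrable area (\<lambda>y. w * (1 + Hf s y))" by (intro Bochner_Integration.integrable_add integrable_mult_right area.integrable_const Hi)
    show ?thesis unfolding Bochner_Integration.integral_add[OF Bochner_Integration.integrable_add[OF i di] dHi]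
        Bochner_Integration.integral_add[OF i di] integral_mult_right_zero ..
  qed
  also have "\<dots> = w * (4 * pi + mu s) + (- 2 * pi * (chiL s P - chiL s P') - mu s * w)" unfolding Hf_integral[OF s] d0 dH by simp
  also have "\<dots> = 4 * pi * w - 2 * pi * (chiL s P - chiL s P')" by (simp add: algebra_simps)
  finally show ?thesis unfolding w_def P_def P'_def .
qed

text \<open>The kernel is rotation invariant, so each part of exp (us s) reduces to
  \<open>bubble_log_difference\<close> at reflected points. The logarithms reassemble the explicit
  part of \<open>us s\<close>, and the values of \<open>chiL s\<close> its correction
  \<open>phi s\<close>.\<close>

lemma us_integral_equation:
  assumes s: "small s" and x: "norm x = 1" "norm x' = 1"
  shows "us s x - us s x' = - (1 / (4 * pi)) * (\<integral>z. (logk x z - logk x' z) * exp (us s z) \<partial>area)"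
proof -
  have li: "integrable area (\<lambda>z. logk x z - logk x' z)" by (intro Bochner_Integration.integrable_diff logk_integrable x)
  have lr: "logk z (refl 1 k y) = logk (refl 1 k z) y" for z y k
    using orth_inner[OF refl_orth[of 1 k], of "refl 1 k z" y] by (simp add: logk_def refl_refl)
  define L where "L k = ln (aa s - x \<bullet> \<xi> k) - ln (aa s - x' \<bullet> \<xi> k)" for k
  define c where "c k = chiL s (Ph s (refl 1 k x)) - chiL s (Ph s (refl 1 k x'))" for k
  have "(\<integral>z. (logk x z - logk x' z) * exp (us s z) \<partial>area)
     = (\<Sum>k\<in>UNIV. 2 * (\<integral>y. (logk (refl 1 k x) (Th s y) - logk (refl 1 k x') (Th s y)) * (1 + Hf s y) \<partial>area))"
    unfolding integral_exp_us(1)[OF s li] lr ..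
  also have "\<dots> = (\<Sum>k\<in>UNIV. 2 * (4 * pi * L k - 2 * pi * c k))"
    by (rule sum.cong[OF HOL.refl], subst bubble_log_difference[OF s]) (simp_all add: refl_norm x refl_inner L_def c_def)
  also have "\<dots> = 8 * pi * (\<Sum>k\<in>UNIV. L k) - 4 * pi * (\<Sum>k\<in>UNIV. c k)"
    by (simp add: four algebra_simps)
  finally have "- (1 / (4 * pi)) * (\<integral>z. (logk x z - logk x' z) * exp (us s z) \<partial>area) = - 2 * (\<Sum>k\<in>UNIV. L k) + (\<Sum>k\<in>UNIV. c k)"
    by (simp add: field_simps)
  also have "\<dots> = us s x - us s x'" unfolding us_def phi_def L_def c_def sum_subtractf by simp
  finally show ?thesis ..
qed

theorem us_solution:
  assumes s: "small s"
  shows "mean_field_solution (32 * pi + 8 * mu s) (us s)"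
proof (rule mean_field_of_integral_equation[OF us_cont[OF s] us_integral_equation[OF s] us_mass[OF s]])
  show "32 * pi + 8 * mu s \<noteq> 0" using mu_bounds(1)[OF s] pi_gt_zero by linarith
qed

end

text \<open>Preimages exist by the intermediate value theorem, and monotonicity of \<open>g\<close>
  is not assumed. They tend to 0 because \<open>g\<close> has a positive minimum on every interval
  [a, b] with a > 0, so smaller values are attained only below a.\<close>

lemma select_preimage:
  fixes g :: "real \<Rightarrow> real"
  assumes b: "0 < b" and c: "\<And>a. 0 < a \<Longrightarrow> continuous_on {a..b} g" and p: "\<And>s. 0 < s \<Longrightarrow> s \<le> b \<Longrightarrow> 0 < g s"
    and l: "(g \<longlongrightarrow> 0) (at_right 0)"
  shows "\<exists>f. (\<forall>e. 0 < e \<longrightarrow> e < g b \<longrightarrow> 0 < f e \<and> f e \<le> b \<and> g (f e) = e) \<and> filterlim f (at_right 0) (at_right 0)"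
proof -
  define f where "f e = (SOME s. 0 < s \<and> s \<le> b \<and> g s = e)" for e
  have f: "0 < f e \<and> f e \<le> b \<and> g (f e) = e" if e: "0 < e" "e < g b" for e
  proof -
    have "\<forall>\<^sub>F s in at_right 0. g s < e" using l e(1) by (rule order_tendstoD)
    then obtain d where d: "d > 0" "\<And>s. 0 < s \<Longrightarrow> s < d \<Longrightarrow> g s < e" unfolding eventually_at_right_field by auto
    define a where "a = min (d/2) b"
    have a: "0 < a" "a \<le> b" "g a < e"
      using d b e unfolding a_def min_def by auto
    obtain s where "a \<le> s" "s \<le> b" "g s = e" using IVT'[of g a e b] a e c[OF a(1)] by auto
    then have "0 < s \<and> s \<le> b \<and> g s = e" using a by auto
    then show ?thesis unfolding f_def by (rule someI)
  qed
  have "filterlim f (at_right 0) (at_right 0)"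
    unfolding filterlim_at
  proof
    show "\<forall>\<^sub>F e in at_right 0. f e \<in> {0<..} \<and> f e \<noteq> 0"
      unfolding eventually_at_right_field using f p[OF b order_refl] by (intro exI[of _ "g b"]) force
    show "(f \<longlongrightarrow> 0) (at_right 0)"
    proof (rule tendstoI)
      fix \<delta> :: real assume \<delta>: "0 < \<delta>"
      define a where "a = min \<delta> b"
      have a: "0 < a" "a \<le> b" "a \<le> \<delta>" using \<delta> b by (auto simp: a_def)
      obtain z where z: "z \<in> {a..b}" "\<And>y. y \<in> {a..b} \<Longrightarrow> g z \<le> g y"
        using continuous_attains_inf[of "{a..b}" g] c[OF a(1)] a(2) by auto
      have gz: "0 < g z" using z(1) a by (intro p) auto
      show "\<forall>\<^sub>F e in at_right 0. dist (f e) 0 < \<delta>"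
        unfolding eventually_at_right_field
      proof (intro exI[of _ "min (g z) (g b)"] conjI allI impI)
        show "0 < min (g z) (g b)" using gz p[OF b order_refl] by simp
        fix e assume e: "0 < e" "e < min (g z) (g b)"
        then have fe: "0 < f e \<and> f e \<le> b \<and> g (f e) = e" by (intro f) auto
        have "f e < a"
        proof (rule ccontr)
          assume "\<not> f e < a"
          then have "g z \<le> g (f e)" using fe by (intro z(2)) auto
          then show False using fe e by simp
        qed
        then show "dist (f e) 0 < \<delta>" using fe a by simp
      qed
    qed
  qed
  then show ?thesis using f by blast
qed

text \<open>The measure is the image of c times the counting measure on the index set, for which the
  integral is a finite sum.\<close>

lemma integral_dirac_sum:
  fixes \<xi> :: "4 \<Rightarrow> real^3" and f :: "real^3 \<Rightarrow> real"
  assumes x: "\<And>j. norm (\<xi> j) = 1" and c: "0 \<le> c" and f: "continuous_on S2 f"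
  shows "(\<integral>x. f x \<partial>dirac_sum c \<xi>) = c * (\<Sum>j\<in>UNIV. f (\<xi> j))"
proof -
  let ?S = "restrict_space borel S2 :: (real^3) measure"
  define M where "M = distr (density (count_space (UNIV :: 4 set)) (\<lambda>_. ennreal c)) ?S \<xi>"
  have xm: "\<xi> \<in> density (count_space (UNIV :: 4 set)) (\<lambda>_. ennreal c) \<rightarrow>\<^sub>M ?S"
    using x by (auto simp: measurable_def space_restrict_space)
  have sp: "space M = space ?S" "sets M = sets ?S" by (simp_all add: M_def)
  have em: "emeasure M A = ennreal c * (\<Sum>j\<in>UNIV. emeasure (return ?S (\<xi> j)) A)" if A: "A \<in> sets ?S" for A
  proof -
    have "emeasure M A = emeasure (density (count_space (UNIV :: 4 set)) (\<lambda>_. ennreal c)) (\<xi> -` A)"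
      unfolding M_def using emeasure_distr[OF xm A] by simp
    also have "\<dots> = (\<integral>\<^sup>+j. ennreal c * indicator (\<xi> -` A) j \<partial>count_space UNIV)" by (rule emeasure_density) simp_all
    also have "\<dots> = (\<Sum>j\<in>UNIV. ennreal c * indicator A (\<xi> j))"
      by (subst nn_integral_count_space_finite) (auto simp: indicator_def intro!: sum.cong)
    finally show ?thesis using A by (simp add: sum_distrib_left)
  qed
  have "dirac_sum c \<xi> = measure_of (space ?S) (sets ?S) (emeasure M)"
    unfolding dirac_sum_def Let_def
  proof (rule measure_of_eq)
    show "sets ?S \<subseteq> Pow (space ?S)" by (rule sets.space_closed)
    fix A assume "A \<in> sigma_sets (space ?S) (sets ?S)"
    then have "A \<in> sets ?S" by (simp only: sets.sigma_sets_eq)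
    then show "ennreal c * (\<Sum>j\<in>UNIV. emeasure (return ?S (\<xi> j)) A) = emeasure M A" using em by simp
  qed
  also have "\<dots> = M" unfolding sp[symmetric] by (rule measure_of_of_measure)
  finally have d: "dirac_sum c \<xi> = M" .
  have fm: "f \<in> borel_measurable ?S" by (rule measurable_areaI[OF f])
  have "(\<integral>x. f x \<partial>M) = (\<integral>j. f (\<xi> j) \<partial>density (count_space (UNIV :: 4 set)) (\<lambda>_. ennreal c))"
    unfolding M_def by (rule integral_distr[OF xm fm])
  also have "\<dots> = (\<integral>j. c *\<^sub>R f (\<xi> j) \<partial>count_space (UNIV :: 4 set))" using c by (intro integral_density) auto
  also have "\<dots> = (\<Sum>j\<in>UNIV. c * f (\<xi> j))" by (subst lebesgue_integral_count_space_finite) simp_all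
  finally show ?thesis unfolding d by (simp add: sum_distrib_left)
qed

section \<open>Behaviour of the solutions as the scale tends to 0\<close>

context tetra begin

lemma phi_bound:
  assumes s: "small s" and x: "norm x = 1"
  shows "\<bar>phi s x\<bar> \<le> 1"
proof -
  note S = smallD[OF s]
  have b: "\<bar>chiL s (Ph s z)\<bar> \<le> s" if "norm z = 1" for z by (rule holdD(2)[OF chiL_hold(2)[OF s] Ph_norm[OF S(1,3) that]])
  have 1: "\<bar>\<Sum>k\<in>UNIV. chiL s (Ph s (refl 1 k x))\<bar> \<le> (\<Sum>k\<in>(UNIV::4 set). s)"
    by (rule order_trans[OF sum_abs sum_mono]) (rule b, simp add: refl_norm x)
  have 2: "\<bar>\<Sum>k\<in>UNIV-{1}. chiL s (Ph s (\<xi> k))\<bar> \<le> (\<Sum>k\<in>UNIV-{1::4}. s)"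
    by (rule order_trans[OF sum_abs sum_mono]) (rule b, simp)
  have "\<bar>phi s x\<bar> \<le> 4 * s + 3 * s" unfolding phi_def using 1 2 by (simp add: card_Diff_singleton)
  then show ?thesis using S(2) by simp
qed

text \<open>The bubble centred at the vertex contributes - 2 * ln (aa s - 1), about - 4 * ln s,
  against 2 * ln s from the leading logarithm. The number 7 is 6 for the logarithms of the three
  distant factors plus 1 for \<open>phi s\<close>.\<close>

lemma us_at_vertex:
  assumes s: "small s"
  shows "ln (s\<^sup>2 / 128) - 2 * ln (s\<^sup>2 / 2) - 7 \<le> us s (\<xi> j)"
proof -
  note S = smallD[OF s] note a = aa_facts[OF S(1,3)]
  have "us s (\<xi> j) = us s (refl 1 j (\<xi> 1))" by (simp add: refl_xi)
  then have j: "us s (\<xi> j) = us s (\<xi> 1)" using us_symm[OF s refl_symm nrm] by simp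
  have P: "1/256 \<le> Pf (aa s) (\<xi> 1)" using Pf_lower[of "\<xi> 1" "aa s"] a by simp
  have "2 * s\<^sup>2 * (1/256) \<le> 2 * s\<^sup>2 * Pf (aa s) (\<xi> 1)" using P by (intro mult_left_mono) auto
  then have 1: "ln (s\<^sup>2 / 128) \<le> ln (2 * s\<^sup>2 * Pf (aa s) (\<xi> 1))" using S(1) by (intro ln_mono) auto
  have 2: "ln (aa s - 1) \<le> ln (s\<^sup>2 / 2)" using a by (intro ln_mono) auto
  have "ln (1 + (aa s - 2/3)) \<le> aa s - 2/3" by (rule ln_add_one_self_le_self) (use a in simp)
  moreover have "1 + (aa s - 2/3) = aa s + 1/3" by simp
  ultimately have 3: "ln (aa s + 1/3) \<le> 1" using a(2) by simp
  have "us s (\<xi> 1) = ln (2 * s\<^sup>2 * Pf (aa s) (\<xi> 1)) - 2 * (ln (aa s - 1) + 3 * ln (aa s + 1/3)) + phi s (\<xi> 1)"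
    unfolding us_def four by (simp add: xi_inner)
  moreover have "p - 2 * q - 7 \<le> A - 2 * (B + 3 * C) + D" if "p \<le> A" "B \<le> q" "C \<le> 1" "\<bar>D\<bar> \<le> 1" for p q A B C D :: real
    using that by (simp add: abs_le_iff)
  ultimately show ?thesis unfolding j using 1 2 3 phi_bound[OF s nrm[of 1]] by simp
qed

text \<open>Since aa s > 1, the four factors are bounded below by their positive values at parameter
  1, so only the logarithm of 200 * s^2 varies with s.\<close>

lemma us_off_vertex:
  assumes s: "small s" and x: "norm x = 1" "x \<notin> range \<xi>"
  shows "us s x \<le> ln (200 * s\<^sup>2) - 2 * (\<Sum>k\<in>UNIV. ln (1 - x \<bullet> \<xi> k)) + 1"
proof -
  note S = smallD[OF s] note a = aa_facts[OF S(1,3)]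
  have P0: "0 < Pf (aa s) (\<xi> 1)" using Pf_lower[of "\<xi> 1" "aa s"] a by simp
  have "2 * s\<^sup>2 * Pf (aa s) (\<xi> 1) \<le> 2 * s\<^sup>2 * 100" using Pf_vertex_bounds[of "aa s"] a by (intro mult_left_mono) auto
  then have 1: "ln (2 * s\<^sup>2 * Pf (aa s) (\<xi> 1)) \<le> ln (200 * s\<^sup>2)" using S(1) P0 by (intro ln_mono) auto
  have "(\<Sum>k\<in>UNIV. ln (1 - x \<bullet> \<xi> k)) \<le> (\<Sum>k\<in>UNIV. ln (aa s - x \<bullet> \<xi> k))"
  proof (rule sum_mono)
    fix k
    have "0 < 1 - x \<bullet> \<xi> k" by (rule one_minus_inner_pos) (use x in auto)
    then show "ln (1 - x \<bullet> \<xi> k) \<le> ln (aa s - x \<bullet> \<xi> k)" using a by (intro ln_mono) auto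
  qed
  then show ?thesis unfolding us_def using 1 phi_bound[OF s x(1)] by linarith
qed

text \<open>The first bound is the majorant for dominated convergence, the second gives pointwise
  convergence to 0 off - \<xi> 1. 600000 exceeds 3 * 179200, and 21 is 3 * 7.\<close>

lemma Hf_bounds:
  assumes s: "small s" and y: "norm y = 1"
  shows "\<bar>1 + Hf s y\<bar> \<le> 1200002" "0 < 1 + y \<bullet> \<xi> 1 \<Longrightarrow> \<bar>Hf s y\<bar> \<le> 600000 * (s\<^sup>2 / (1 + y \<bullet> \<xi> 1)) + 21 * s"
proof -
  note S = smallD[OF s] note h = chiL_hold(2)[OF s]
  have ch: "\<bar>chiL s y\<bar> \<le> s" by (rule holdD(2)[OF h y])
  have "Hf s y = gop s (chiL s) y + chiL s y" unfolding Hf_def gop_def by simp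
  then show "\<bar>1 + Hf s y\<bar> \<le> 1200002" using gop_abs_le[OF S(1,4) h y] ch S(3) by linarith
  assume w: "0 < 1 + y \<bullet> \<xi> 1"
  define p where "p = chiL s y + Dop s (chiL s) y"
  define z where "z = s\<^sup>2 / (1 + y \<bullet> \<xi> 1)"
  have p: "\<bar>p\<bar> \<le> 7 * s" unfolding p_def using ch Dop_bound(1)[OF h S(1,3) y] by linarith
  have "\<bar>exp p - exp 0\<bar> \<le> 3 * \<bar>p - 0\<bar>" by (rule exp_diff_bounds(2)[of p 1]) (use p S(4) in auto)
  then have e: "\<bar>exp p - 1\<bar> \<le> 21 * s" using p by simp
  then have e3: "\<bar>exp p\<bar> \<le> 3" using S(2) by linarith
  have "s\<^sup>2 / (aa s + y \<bullet> \<xi> 1) \<le> z" unfolding z_def using w Th_facts(4)[OF S(1,3) y] by (intro divide_left_mono) auto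
  then have E: "\<bar>Ef (aa s) (Th s y) - 1\<bar> \<le> 179200 * z" using E_bound(1)[OF S(1,3) y] by linarith
  have "Hf s y = (Ef (aa s) (Th s y) - 1) * exp p + (exp p - 1)" unfolding Hf_def p_def[symmetric] by (simp add: algebra_simps)
  then have "\<bar>Hf s y\<bar> \<le> (179200 * z) * 3 + 21 * s" using abs_mult_le[OF E e3] e by linarith
  moreover have "0 \<le> z" unfolding z_def using w by simp
  ultimately show "\<bar>Hf s y\<bar> \<le> 600000 * (s\<^sup>2 / (1 + y \<bullet> \<xi> 1)) + 21 * s" unfolding z_def[symmetric] by linarith
qed

text \<open>In blown-up coordinates \<open>refl 1 k (Th s y)\<close> tends to \<xi> k for every y
  other than - \<xi> 1, while the density \<open>1 + Hf s\<close> tends to 1. Each of the four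
  integrals tends to 4 * pi * f (\<xi> k), and the factor 2 in \<open>integral_exp_us\<close> makes
  this 8 * pi.\<close>

lemma us_concentration:
  assumes f: "continuous_on S2 f"
  shows "((\<lambda>s. \<integral>x. f x * exp (us s x) \<partial>area) \<longlongrightarrow> 8 * pi * (\<Sum>j\<in>UNIV. f (\<xi> j))) (at_right 0)"
proof -
  obtain s0 where s0: "0 < s0" "\<And>s. 0 < s \<Longrightarrow> s \<le> s0 \<Longrightarrow> small s" using ex_small by blast
  have "compact (f ` S2)" by (rule compact_continuous_image[OF f]) simp
  then obtain B where B: "\<And>x. x \<in> f ` S2 \<Longrightarrow> \<bar>x\<bar> \<le> B" using compact_imp_bounded bounded_iff by (metis real_norm_def)
  show ?thesis
  proof (rule tendsto_at_right_sequentially[OF s0(1)])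
    fix S :: "nat \<Rightarrow> real" assume S0: "\<And>n. 0 < S n" "\<And>n. S n < s0" and Sl: "S \<longlonglongrightarrow> 0"
    have sm: "small (S n)" for n using s0(2)[of "S n"] S0[of n] by simp
    note D = smallD[OF sm]
    note fi = integrable_area_cont[OF f]
    have pl: "(\<lambda>n. \<integral>y. f (refl 1 k (Th (S n) y)) * (1 + Hf (S n) y) \<partial>area) \<longlonglongrightarrow> (\<integral>y. f (\<xi> k) \<partial>area)" for k
    proof (rule integral_dominated_convergence[where w="\<lambda>_. B * 1200002"])
      show "(\<lambda>y. f (refl 1 k (Th (S n) y)) * (1 + Hf (S n) y)) \<in> borel_measurable area" for n
        using integral_exp_us(2)[OF sm fi] by simp
      show "AE y in area. norm (f (refl 1 k (Th (S n) y)) * (1 + Hf (S n) y)) \<le> B * 1200002" for n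
      proof (rule AE_I2)
        fix y :: "real^3" assume "y \<in> space area"
        then have y: "norm y = 1" by simp
        have "\<bar>f (refl 1 k (Th (S n) y))\<bar> \<le> B" by (rule B) (simp add: refl_norm Th_facts(1)[OF D(1,3) y])
        from abs_mult_le[OF this Hf_bounds(1)[OF sm y]]
        show "norm (f (refl 1 k (Th (S n) y)) * (1 + Hf (S n) y)) \<le> B * 1200002" by simp
      qed
      have mN: "norm (- \<xi> 1) = 1" by simp
      show "AE y in area. (\<lambda>n. f (refl 1 k (Th (S n) y)) * (1 + Hf (S n) y)) \<longlonglongrightarrow> f (\<xi> k)"
        using AE_area_ne[OF mN] AE_space
      proof eventually_elim
        case (elim y)
        then have y: "norm y = 1" and w: "0 < 1 + y \<bullet> \<xi> 1" by simp_all
        have z: "(\<lambda>n. (S n)\<^sup>2 / (1 + y \<bullet> \<xi> 1)) \<longlonglongrightarrow> 0\<^sup>2 / (1 + y \<bullet> \<xi> 1)" using w by (intro tendsto_intros Sl) auto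
        have "(\<lambda>n. Hf (S n) y) \<longlonglongrightarrow> 0"
        proof (rule Lim_null_comparison)
          show "\<forall>\<^sub>F n in sequentially. norm (Hf (S n) y) \<le> 600000 * ((S n)\<^sup>2 / (1 + y \<bullet> \<xi> 1)) + 21 * S n"
            using Hf_bounds(2)[OF sm y w] by simp
          have "(\<lambda>n. 600000 * ((S n)\<^sup>2 / (1 + y \<bullet> \<xi> 1)) + 21 * S n) \<longlonglongrightarrow> 600000 * (0\<^sup>2 / (1 + y \<bullet> \<xi> 1)) + 21 * 0"
            by (intro tendsto_intros z Sl)
          then show "(\<lambda>n. 600000 * ((S n)\<^sup>2 / (1 + y \<bullet> \<xi> 1)) + 21 * S n) \<longlonglongrightarrow> 0" by simp
        qed
        then have H: "(\<lambda>n. 1 + Hf (S n) y) \<longlonglongrightarrow> 1 + 0" by (intro tendsto_intros)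
        have "(\<lambda>n. Th (S n) y - \<xi> 1) \<longlonglongrightarrow> 0"
        proof (rule Lim_null_comparison)
          show "\<forall>\<^sub>F n in sequentially. norm (Th (S n) y - \<xi> 1) \<le> sqrt (2 * ((S n)\<^sup>2 / (1 + y \<bullet> \<xi> 1)))"
          proof (intro always_eventually allI)
            fix n
            note T = Th_facts[OF D(1,3)[of n] y]
            have "(S n)\<^sup>2 / (aa (S n) + y \<bullet> \<xi> 1) \<le> (S n)\<^sup>2 / (1 + y \<bullet> \<xi> 1)" using w T(4) by (intro divide_left_mono) auto
            then have "(norm (Th (S n) y - \<xi> 1))\<^sup>2 \<le> 2 * ((S n)\<^sup>2 / (1 + y \<bullet> \<xi> 1))"
              unfolding one_minus_inner[OF T(1) nrm] by (rule mult_left_mono[OF order_trans[OF T(6)]]) simp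
            then show "norm (Th (S n) y - \<xi> 1) \<le> sqrt (2 * ((S n)\<^sup>2 / (1 + y \<bullet> \<xi> 1)))" by (rule real_le_rsqrt)
          qed
          have "(\<lambda>n. sqrt (2 * ((S n)\<^sup>2 / (1 + y \<bullet> \<xi> 1)))) \<longlonglongrightarrow> sqrt (2 * (0\<^sup>2 / (1 + y \<bullet> \<xi> 1)))" by (intro tendsto_intros z)
          then show "(\<lambda>n. sqrt (2 * ((S n)\<^sup>2 / (1 + y \<bullet> \<xi> 1)))) \<longlonglongrightarrow> 0" by simp
        qed
        then have "(\<lambda>n. Th (S n) y) \<longlonglongrightarrow> \<xi> 1" by (rule LIM_zero_cancel)
        then have "(\<lambda>n. refl 1 k (Th (S n) y)) \<longlonglongrightarrow> refl 1 k (\<xi> 1)" by (rule refl_tendsto)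
        then have R: "(\<lambda>n. refl 1 k (Th (S n) y)) \<longlonglongrightarrow> \<xi> k" by (simp add: refl_xi)
        have "(\<lambda>n. f (refl 1 k (Th (S n) y))) \<longlonglongrightarrow> f (\<xi> k)"
          by (rule continuous_on_tendsto_compose[OF f R]) (simp_all add: refl_norm Th_facts(1)[OF D(1,3) y])
        from tendsto_mult[OF this H] show ?case by simp
      qed
    qed simp_all
    have "(\<lambda>n. \<Sum>k\<in>UNIV. 2 * (\<integral>y. f (refl 1 k (Th (S n) y)) * (1 + Hf (S n) y) \<partial>area)) \<longlonglongrightarrow> (\<Sum>k\<in>UNIV. 2 * (\<integral>y. f (\<xi> k) \<partial>area))"
      by (intro tendsto_sum tendsto_mult tendsto_const pl)
    also have "(\<Sum>k\<in>UNIV. 2 * (\<integral>y. f (\<xi> k) \<partial>area)) = 8 * pi * (\<Sum>j\<in>UNIV. f (\<xi> j))"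
      by (simp add: measure_area sum_distrib_left mult_ac)
    finally show "(\<lambda>n. \<integral>x. f x * exp (us (S n) x) \<partial>area) \<longlonglongrightarrow> 8 * pi * (\<Sum>j\<in>UNIV. f (\<xi> j))"
      unfolding integral_exp_us(1)[OF sm fi] .
  qed
qed

text \<open>The mass of exp (us s) is exactly 32 * pi + 8 * mu s, so the normalizing quotient in the
  measure is 1.\<close>

lemma mean_field_measure_us:
  assumes s: "small s" and f: "continuous_on S2 f"
  shows "(\<integral>x. f x \<partial>mean_field_measure (32 * pi + 8 * mu s) (us s)) = (\<integral>x. f x * exp (us s x) \<partial>area)"
proof -
  have r: "32 * pi + 8 * mu s \<noteq> 0" using mu_bounds(1)[OF s] pi_gt_zero by linarith
  have e: "mean_field_measure (32 * pi + 8 * mu s) (us s) = density area (\<lambda>x. ennreal (exp (us s x)))"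
    unfolding mean_field_measure_def us_mass[OF s] using r by simp
  have ec: "continuous_on S2 (\<lambda>x. exp (us s x))" by (intro continuous_intros us_cont s)
  have "(\<integral>x. f x \<partial>mean_field_measure (32 * pi + 8 * mu s) (us s)) = (\<integral>x. exp (us s x) *\<^sub>R f x \<partial>area)"
    unfolding e by (rule integral_density[OF borel_measurable_areaI[OF f] borel_measurable_areaI[OF ec]]) simp
  then show ?thesis by (simp add: mult.commute)
qed

end

theorem theorem2p1:
  fixes \<xi> :: "4 \<Rightarrow> real^3"
  assumes "inscribed_regular_tetrahedron \<xi>"
  shows "\<exists>\<epsilon>\<^sub>0>0. \<exists>(lam :: real \<Rightarrow> real) (u :: real \<Rightarrow> real^3 \<Rightarrow> real) (r :: real \<Rightarrow> real).
     (\<forall>\<epsilon>\<in>{0<..<\<epsilon>\<^sub>0}.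
        lam \<epsilon> > 0 \<and>
        mean_field_solution (32 * pi + \<epsilon>) (u \<epsilon>) \<and>
        \<epsilon> = (384 * pi + r \<epsilon>) * (lam \<epsilon>)\<^sup>2 * ln (1 / lam \<epsilon>) \<and>
        (\<forall>T\<in>tetrahedral_group \<xi>. \<forall>y\<in>S2. u \<epsilon> y = u \<epsilon> (T y))) \<and>
     (lam \<longlongrightarrow> 0) (at_right 0) \<and>
     r \<in> o[at_right 0](\<lambda>_. 1) \<and>
     (\<forall>j. filterlim (\<lambda>\<epsilon>. u \<epsilon> (\<xi> j)) at_top (at_right 0)) \<and>
     (\<forall>x\<in>S2 - range \<xi>. filterlim (\<lambda>\<epsilon>. u \<epsilon> x) at_bot (at_right 0)) \<and>
     measures_tendsto (\<lambda>\<epsilon>. mean_field_measure (32 * pi + \<epsilon>) (u \<epsilon>))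
       (dirac_sum (8 * pi) \<xi>) (at_right 0)"
proof -
  interpret tetra \<xi> by unfold_locales (fact assms)
  obtain s0 where s0: "0 < s0" "\<And>s. 0 < s \<Longrightarrow> s \<le> s0 \<Longrightarrow> small s" using ex_small by blast
  have "\<exists>f. (\<forall>e. 0 < e \<longrightarrow> e < 8 * mu s0 \<longrightarrow> 0 < f e \<and> f e \<le> s0 \<and> 8 * mu (f e) = e) \<and> filterlim f (at_right 0) (at_right 0)"
  proof (rule select_preimage[OF s0(1), of "\<lambda>s. 8 * mu s"])
    show "continuous_on {a..s0} (\<lambda>s. 8 * mu s)" if "0 < a" for a
      by (intro continuous_intros mu_cont[OF that] s0(2)) (use that in auto)
    show "0 < 8 * mu s" if "0 < s" "s \<le> s0" for s using mu_bounds(1)[OF s0(2)[OF that]] by simp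
    show "((\<lambda>s. 8 * mu s) \<longlongrightarrow> 0) (at_right 0)" using tendsto_mult[OF tendsto_const[of 8] mu_at_0] by simp
  qed
  then obtain \<sigma> where \<sigma>: "\<And>e. 0 < e \<Longrightarrow> e < 8 * mu s0 \<Longrightarrow> 0 < \<sigma> e \<and> \<sigma> e \<le> s0 \<and> 8 * mu (\<sigma> e) = e"
    and \<sigma>l: "filterlim \<sigma> (at_right 0) (at_right 0)" by metis
  \<comment> \<open>\<open>lam\<close> occurs only in the relation with \<open>\<epsilon>\<close>, so this relation, without a remainder, can define it.\<close>
  have "\<exists>f. (\<forall>e. 0 < e \<longrightarrow> e < 384 * pi * (1/2)\<^sup>2 * ln (1 / (1/2)) \<longrightarrow>
      0 < f e \<and> f e \<le> 1/2 \<and> 384 * pi * (f e)\<^sup>2 * ln (1 / f e) = e) \<and> filterlim f (at_right 0) (at_right (0::real))"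
  proof (rule select_preimage[of "1/2::real" "\<lambda>s. 384 * pi * s\<^sup>2 * ln (1 / s)"])
    show "continuous_on {a..1/2} (\<lambda>s. 384 * pi * s\<^sup>2 * ln (1 / s))" if "0 < a" for a :: real
      using that by (intro continuous_intros) auto
    show "0 < 384 * pi * s\<^sup>2 * ln (1 / s)" if "0 < s" "s \<le> 1/2" for s :: real using that by simp
    show "((\<lambda>s::real. 384 * pi * s\<^sup>2 * ln (1 / s)) \<longlongrightarrow> 0) (at_right 0)" by real_asymp
  qed simp
  then obtain lam where lam: "\<And>e. 0 < e \<Longrightarrow> e < 384 * pi * (1/2)\<^sup>2 * ln (1 / (1/2)) \<Longrightarrow>
        0 < lam e \<and> lam e \<le> 1/2 \<and> 384 * pi * (lam e)\<^sup>2 * ln (1 / lam e) = e"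
    and laml: "filterlim lam (at_right 0) (at_right (0::real))" by metis
  \<comment> \<open>Below e1 both selections, that of the scale and that of \<open>lam\<close>, are
    valid.\<close>
  define e1 where "e1 = min (8 * mu s0) (384 * pi * (1/2)\<^sup>2 * ln (1 / (1/2)))"
  have e1: "0 < e1" unfolding e1_def using mu_bounds(1)[OF s0(2)[OF s0(1) order_refl]] by simp
  have sm: "small (\<sigma> e)" "8 * mu (\<sigma> e) = e" if "0 < e" "e < e1" for e
    using \<sigma>[of e] s0(2)[of "\<sigma> e"] that by (auto simp: e1_def)
  have ev: "\<forall>\<^sub>F e in at_right 0. 0 < e \<and> e < e1" unfolding eventually_at_right_field using e1 by blast
  show ?thesis
  \<comment> \<open>The scale of the bubbles is \<sigma> \<epsilon>, tied to \<epsilon> by 8 * mu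
    (\<sigma> \<epsilon>) = \<epsilon>. As \<open>lam\<close> satisfies its relation with \<epsilon>
    exactly, the remainder is the zero function.\<close>
  proof (rule exI[of _ e1], rule conjI[OF e1], rule exI[of _ lam], rule exI[of _ "\<lambda>e. us (\<sigma> e)"],
      rule exI[of _ "\<lambda>_. 0"], intro conjI ballI allI)
    fix \<epsilon> assume "\<epsilon> \<in> {0<..<e1}"
    then have \<epsilon>: "0 < \<epsilon>" "\<epsilon> < e1" by auto
    note l = lam[of \<epsilon>]
    show "lam \<epsilon> > 0" using l \<epsilon> by (simp add: e1_def)
    show "mean_field_solution (32 * pi + \<epsilon>) (us (\<sigma> \<epsilon>))" using us_solution[OF sm(1)[OF \<epsilon>]] sm(2)[OF \<epsilon>] by simp
    show "\<epsilon> = (384 * pi + 0) * (lam \<epsilon>)\<^sup>2 * ln (1 / lam \<epsilon>)" using l \<epsilon> by (simp add: e1_def)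
    fix T y assume "T \<in> tetrahedral_group \<xi>" "y \<in> S2"
    then show "us (\<sigma> \<epsilon>) y = us (\<sigma> \<epsilon>) (T y)" using us_symm[OF sm(1)[OF \<epsilon>] symm_tetrahedral_group] by simp
  next
    show "(lam \<longlongrightarrow> 0) (at_right 0)" using laml unfolding filterlim_at by simp
    show "(\<lambda>_::real. 0::real) \<in> o[at_right 0](\<lambda>_. 1)" by simp
  next
    fix j
    have "filterlim (\<lambda>s::real. ln (s\<^sup>2 / 128) - 2 * ln (s\<^sup>2 / 2) - 7) at_top (at_right 0)" by real_asymp
    from filterlim_compose[OF this \<sigma>l]
    show "filterlim (\<lambda>\<epsilon>. us (\<sigma> \<epsilon>) (\<xi> j)) at_top (at_right 0)"
      by (rule filterlim_at_top_mono) (use ev us_at_vertex sm in \<open>auto elim!: eventually_mono\<close>)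
  next
    fix x assume "x \<in> S2 - range \<xi>"
    then have x: "norm x = 1" "x \<notin> range \<xi>" by auto
    define C where "C = - 2 * (\<Sum>k\<in>UNIV. ln (1 - x \<bullet> \<xi> k)) + 1"
    have "filterlim (\<lambda>s::real. ln (200 * s\<^sup>2) + C) at_bot (at_right 0)" by real_asymp
    from filterlim_compose[OF this \<sigma>l]
    show "filterlim (\<lambda>\<epsilon>. us (\<sigma> \<epsilon>) x) at_bot (at_right 0)"
    proof (rule filterlim_at_bot_mono)
      have b: "us (\<sigma> e) x \<le> ln (200 * (\<sigma> e)\<^sup>2) + C" if "0 < e" "e < e1" for e
        using us_off_vertex[OF sm(1)[OF that] x] unfolding C_def by simp
      show "\<forall>\<^sub>F \<epsilon> in at_right 0. us (\<sigma> \<epsilon>) x \<le> ln (200 * (\<sigma> \<epsilon>)\<^sup>2) + C"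
        using ev by eventually_elim (use b in blast)
    qed
  next
    show "measures_tendsto (\<lambda>\<epsilon>. mean_field_measure (32 * pi + \<epsilon>) (us (\<sigma> \<epsilon>))) (dirac_sum (8 * pi) \<xi>) (at_right 0)"
      unfolding measures_tendsto_def
    proof (intro allI impI)
      fix f :: "real^3 \<Rightarrow> real" assume f: "continuous_on S2 f"
      have "((\<lambda>\<epsilon>. \<integral>x. f x * exp (us (\<sigma> \<epsilon>) x) \<partial>area) \<longlongrightarrow> 8 * pi * (\<Sum>j\<in>UNIV. f (\<xi> j))) (at_right 0)"
        by (rule filterlim_compose[OF us_concentration[OF f] \<sigma>l])
      moreover have "\<forall>\<^sub>F \<epsilon> in at_right 0. (\<integral>x. f x * exp (us (\<sigma> \<epsilon>) x) \<partial>area) = (\<integral>x. f x \<partial>mean_field_measure (32 * pi + \<epsilon>) (us (\<sigma> \<epsilon>)))"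
        using ev by eventually_elim (use mean_field_measure_us[OF sm(1) f] sm(2) in simp)
      ultimately have "((\<lambda>\<epsilon>. \<integral>x. f x \<partial>mean_field_measure (32 * pi + \<epsilon>) (us (\<sigma> \<epsilon>))) \<longlongrightarrow> 8 * pi * (\<Sum>j\<in>UNIV. f (\<xi> j))) (at_right 0)"
        by (simp add: tendsto_cong)
      moreover have "(\<integral>x. f x \<partial>dirac_sum (8 * pi) \<xi>) = 8 * pi * (\<Sum>j\<in>UNIV. f (\<xi> j))"
        by (rule integral_dirac_sum[OF _ _ f]) simp_all
      ultimately show "((\<lambda>\<epsilon>. \<integral>x. f x \<partial>mean_field_measure (32 * pi + \<epsilon>) (us (\<sigma> \<epsilon>))) \<longlongrightarrow> (\<integral>x. f x \<partial>dirac_sum (8 * pi) \<xi>)) (at_right 0)"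
        by simp
    qed
  qed
qed

end
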